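(* Let $0\le k\le n$, $l\ge0$, $\mathcal U=\mathbb U_{k,l}$, let $\rho$ be a density operator and $O$ a traceless Hermitian operator on $\mathcal H$. Then, with $\gamma=3/4$, $$\bigl|V_*(O,\rho)-\gamma^{kl}V_\triangle(O,\rho)\bigr|\le\frac6d\|O\|_2^2.$$
   Context: Let $n\ge1$, $d=2^n$, $\mathcal H=(\mathbb C^2)^{\otimes n}$ with computational basis $\{|\mathbf b\rangle\}$. For a unitary ensemble $\mathcal U$ with measurement channel $\mathcal M(X)=\mathbb E_{U}\sum_{\mathbf b}\langle\mathbf b|UXU^\dagger|\mathbf b\rangle U^\dagger|\mathbf b\rangle\langle\mathbf b|U$ (for a 2-design, $\mathcal M^{-1}(O)=(d+1)O-\operatorname{tr}(O)\mathbb 1$), define for a density operator $\rho$ and traceless Hermitian $O$: $V_*(O,\rho)=\mathbb E_{U}\bigl(\sum_{\mathbf b}\langle\mathbf b|U\rho U^\dagger|\mathbf b\rangle\langle\mathbf b|U\mathcal M^{-1}(O)U^\dagger|\mathbf b\rangle\bigr)^2-[\operatorname{tr}(O\rho)]^2$. Let $T=\mathrm{diag}(1,e^{i\pi/4})$ and $\hat T_k=I^{\otimes(n-k)}\otimes T^{\otimes k}$. The ensemble $\mathbb U_{k,l}$ is the distribution of $U=C_l\hat T_kC_{l-1}\hat T_k\cdots\hat T_kC_0$, where $C_0,\dots,C_l$ are independent uniformly random elements of the $n$-qubit Clifford group $\mathrm{Cl}_n$ (so $\mathbb U_{k,0}$ and $\mathbb U_{0,l}$ are the uniform Clifford ensemble).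 Let $\overline{\mathcal P}_n=\{I,X,Y,Z\}^{\otimes n}$; for operators $A,B$ let $\Xi_{A,B}(P)=\operatorname{tr}(AP)\operatorname{tr}(BP)$ and $\tilde\Xi_{A,B}(P)=\operatorname{tr}(APBP)$, as vectors in $\mathbb R^{d^2}$ with Euclidean norm and inner product; $V_\triangle(O,\rho)=\frac{d+1}{d(d+2)}\bigl(\|\Xi_{\rho,O}\|_2^2+\tilde\Xi_{\rho,O}\cdot\Xi_{\rho,O}\bigr)$. $\|O\|_2$ is the Hilbert–Schmidt norm. *)

theory Defs
  imports Complex_Main "Jordan_Normal_Form.Matrix"
begin

definition adj :: "complex mat \<Rightarrow> complex mat" where
  "adj A = mat (dim_col A) (dim_row A) (\<lambda>(i,j). cnj (A $$ (j,i)))"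

definition tr :: "complex mat \<Rightarrow> complex" where
  "tr A = (\<Sum>i<dim_row A. A $$ (i,i))"

definition unitary :: "nat \<Rightarrow> complex mat \<Rightarrow> bool" where
  "unitary d U \<longleftrightarrow> U \<in> carrier_mat d d \<and> adj U * U = 1\<^sub>m d \<and> U * adj U = 1\<^sub>m d"

definition hermitian :: "nat \<Rightarrow> complex mat \<Rightarrow> bool" where
  "hermitian d A \<longleftrightarrow> A \<in> carrier_mat d d \<and> adj A = A"

definition density_op :: "nat \<Rightarrow> complex mat \<Rightarrow> bool" where
  "density_op d \<rho> \<longleftrightarrow> hermitian d \<rho> \<and>
     (\<forall>v \<in> carrier_vec d. 0 \<le> Re (\<Sum>i<d. cnj (v $ i) * (\<rho> *\<^sub>v v) $ i)) \<and> tr \<rho> = 1"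

definition hs_norm_sq :: "complex mat \<Rightarrow> real" where
  "hs_norm_sq A = (\<Sum>i<dim_row A. \<Sum>j<dim_col A. (cmod (A $$ (i,j)))\<^sup>2)"

section \<open>Qubits: basis index a < 2^n; tensor factor j (j = 0..n-1, leftmost first)
  corresponds to bit (n-1-j) of a\<close>

definition bit_of :: "nat \<Rightarrow> nat \<Rightarrow> nat" where
  "bit_of i a = (a div 2 ^ i) mod 2"

definition pauli1 :: "nat \<Rightarrow> nat \<Rightarrow> nat \<Rightarrow> complex" where
  "pauli1 p a b =
     (if p = 0 then (if a = b then 1 else 0)
      else if p = 1 then (if a \<noteq> b then 1 else 0)
      else if p = 2 then (if a = 0 \<and> b = 1 then - \<i> else if a = 1 \<and> b = 0 then \<i> else 0)
      else (if a = b then (if a = 0 then 1 else -1) else 0))"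

definition pauli_string :: "nat \<Rightarrow> nat list \<Rightarrow> complex mat" where
  "pauli_string n ps = mat (2^n) (2^n)
     (\<lambda>(a,b). \<Prod>j<n. pauli1 (ps ! j) (bit_of (n - 1 - j) a) (bit_of (n - 1 - j) b))"

definition pauli_idx :: "nat \<Rightarrow> nat list set" where
  "pauli_idx n = {ps. length ps = n \<and> set ps \<subseteq> {0..<4}}"

definition paulis :: "nat \<Rightarrow> complex mat set" where
  "paulis n = pauli_string n ` pauli_idx n"

definition clifford :: "nat \<Rightarrow> complex mat set" where
  "clifford n = {U. unitary (2^n) U \<and>
      (\<forall>P \<in> paulis n. \<exists>Q \<in> paulis n. \<exists>s \<in> {1, -1}. U * P * adj U = s \<cdot>\<^sub>m Q)}"

text \<open>Cliffords up to global phase: the (finite) group on which "uniformly random Clifford" lives.\<close>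
definition phase_rel :: "nat \<Rightarrow> (complex mat \<times> complex mat) set" where
  "phase_rel n = {(U, V). U \<in> clifford n \<and> V \<in> clifford n \<and> (\<exists>c. V = c \<cdot>\<^sub>m U)}"

definition clifford_classes :: "nat \<Rightarrow> complex mat set set" where
  "clifford_classes n = clifford n // phase_rel n"

definition rep :: "complex mat set \<Rightarrow> complex mat" where
  "rep X = (SOME U. U \<in> X)"

text \<open>\<open>T\<^sup>\<otimes>k\<close> acting on the last k tensor factors, i.e. on bits 0..k-1.\<close>
definition T_hat :: "nat \<Rightarrow> nat \<Rightarrow> complex mat" where
  "T_hat n k = mat (2^n) (2^n)
     (\<lambda>(a,b). if a = b then exp (\<i> * of_real (pi / 4) * of_nat (\<Sum>i<k. bit_of i a)) else 0)"

fun circuit :: "complex mat \<Rightarrow> complex mat list \<Rightarrow> complex mat" where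
  "circuit T [] = undefined"
| "circuit T (C # Cs) = foldl (\<lambda>A C'. C' * T * A) C Cs"

definition ens_expect :: "nat \<Rightarrow> nat \<Rightarrow> nat \<Rightarrow> (complex mat \<Rightarrow> real) \<Rightarrow> real" where
  "ens_expect n k l f =
     (\<Sum>cs \<in> {cs. set cs \<subseteq> clifford_classes n \<and> length cs = Suc l}.
         f (circuit (T_hat n k) (map rep cs)))
     / real (card (clifford_classes n)) ^ Suc l"

definition Minv :: "nat \<Rightarrow> complex mat \<Rightarrow> complex mat" where
  "Minv n Ob = of_nat (2^n + 1) \<cdot>\<^sub>m Ob - tr Ob \<cdot>\<^sub>m 1\<^sub>m (2^n)"

definition V_star :: "nat \<Rightarrow> nat \<Rightarrow> nat \<Rightarrow> complex mat \<Rightarrow> complex mat \<Rightarrow> real" where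
  "V_star n k l Ob \<rho> =
     ens_expect n k l (\<lambda>U. (\<Sum>b<2^n. Re ((U * \<rho> * adj U) $$ (b,b))
                                     * Re ((U * Minv n Ob * adj U) $$ (b,b)))\<^sup>2)
     - (Re (tr (Ob * \<rho>)))\<^sup>2"

definition Xi :: "nat \<Rightarrow> complex mat \<Rightarrow> complex mat \<Rightarrow> nat list \<Rightarrow> real" where
  "Xi n A B ps = Re (tr (A * pauli_string n ps) * tr (B * pauli_string n ps))"

definition Xi_tilde :: "nat \<Rightarrow> complex mat \<Rightarrow> complex mat \<Rightarrow> nat list \<Rightarrow> real" where
  "Xi_tilde n A B ps = Re (tr (A * pauli_string n ps * B * pauli_string n ps))"

definition V_tri :: "nat \<Rightarrow> complex mat \<Rightarrow> complex mat \<Rightarrow> real" where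
  "V_tri n Ob \<rho> = (let d = real (2^n) in
     (d + 1) / (d * (d + 2)) *
     ((\<Sum>ps \<in> pauli_idx n. (Xi n \<rho> Ob ps)\<^sup>2)
      + (\<Sum>ps \<in> pauli_idx n. Xi_tilde n \<rho> Ob ps * Xi n \<rho> Ob ps)))"

end

theory Submission imports Defs
begin

text \<open>
Let \<open>m(A, B)\<close> denote the sum of squares and inner product in the definition of \<open>V_tri\<close>, for a state \<open>A\<close> and an observable \<open>B\<close>. The
second moment of the measurement after the last Clifford unitary only involves pairs of commuting Pauli operators, and the Clifford group is
transitive on these; hence it equals \<open>m\<close> at the evolved state and observable times a constant, plus a multiple of \<open>(tr (A B))\<^sup>2\<close>.

The evolution of \<open>m\<close> under one layer \<open>T C\<close> is computed exactly. Expanded in Pauli operators, \<open>m\<close> is a sum over triples \<open>(P, Q, R)\<close> of a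
kernel depending on \<open>T\<close> times a product of four traces. Averaged over \<open>C\<close>, this product depends only on the equalities and commutation
relations within the triple, by transitivity of the Clifford group on triples with the same relations. The kernel may therefore be replaced by
any other one with the same sums over these classes of triples, and the class sums involve \<open>T\<close> only through \<open>g = (3/4) ^ k\<close> and
\<open>h = (1/2) ^ k\<close>. A suitable replacement has a sum that is a combination of traces of products of \<open>A\<close> and \<open>B\<close> and of four
quartic Pauli sums.

The error of one layer, the average of \<open>m\<close> minus \<open>g m\<close>, is affine in \<open>(g, h)\<close>, so its bound by \<open>1 - g\<close> times a unitary invariant needs
checking only at the vertices of a triangle, where it is a polynomial inequality in the dimension \<open>d \<ge> 4\<close>. The errors of the layers
then add up to a geometric sum. For \<open>d = 2\<close> the trivial bounds on \<open>m\<close> suffice.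
\<close>

section \<open>Adjoint and trace\<close>

text \<open>The rates come from a single qubit: \<open>T\<close> fixes I and Z and turns X and Y
  into combinations of both with weights of modulus 1 / sqrt 2. The fourth moment of the Pauli
  coefficients thereby falls to 3/4 of its Clifford value and a sign-weighted one to 1/2, and both
  are multiplicative over tensor factors. The obstacle is that \<open>m\<close> does not evolve by
  itself. Of the eight products of commutation signs of a triple, six are the inversion signs of a
  permutation and lead to traces of reordered products; the other two are not, and they bring in
  quartic Pauli sums besides the two parts of \<open>m\<close>. Those sums are controlled by
  inequalities that rest on positivity of the state. The final estimate must also absorb a term (tr
  (AB))^2 / (d + 2) that the second moment leaves behind; the bound for a layer therefore depends on
  the sign of the error, and the same constant 6 results on both sides. Dimension 2 is exceptional
  because a single qubit has no independent triple of Pauli operators, and the factor d^2 - 4 in the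
  denominators vanishes.\<close>

lemma adj_carrier: "A \<in> carrier_mat r c \<Longrightarrow> adj A \<in> carrier_mat c r"
  by (simp add: adj_def)

lemma adj_index [simp]: "i < dim_col A \<Longrightarrow> j < dim_row A \<Longrightarrow> adj A $$ (i,j) = cnj (A $$ (j,i))"
  by (simp add: adj_def)

lemma adj_dims [simp]: "dim_row (adj A) = dim_col A" "dim_col (adj A) = dim_row A"
  by (simp_all add: adj_def)

lemma adj_adj [simp]: "adj (adj A) = A"
  by (rule eq_matI) auto

lemma adj_mult:
  assumes "A \<in> carrier_mat r m" "B \<in> carrier_mat m c"
  shows "adj (A * B) = adj B * adj A"
  using assms by (intro eq_matI) (auto simp: scalar_prod_def cnj_sum mult.commute intro!: sum.cong)

lemma adj_smult [simp]: "adj (a \<cdot>\<^sub>m A) = cnj a \<cdot>\<^sub>m adj A"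
  by (rule eq_matI) auto

lemma adj_add: "A \<in> carrier_mat r c \<Longrightarrow> B \<in> carrier_mat r c \<Longrightarrow> adj (A + B) = adj A + adj B"
  by (rule eq_matI) auto

lemma adj_one [simp]: "adj (1\<^sub>m m) = 1\<^sub>m m"
  by (rule eq_matI) auto

lemma tr_adj: "A \<in> carrier_mat m m \<Longrightarrow> tr (adj A) = cnj (tr A)"
  by (auto simp: tr_def cnj_sum)

lemma tr_smult [simp]: "A \<in> carrier_mat m m \<Longrightarrow> tr (a \<cdot>\<^sub>m A) = a * tr A"
  by (auto simp: tr_def sum_distrib_left)

lemma tr_add: "A \<in> carrier_mat m m \<Longrightarrow> B \<in> carrier_mat m m \<Longrightarrow> tr (A + B) = tr A + tr B"
  by (auto simp: tr_def sum.distrib)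

lemma tr_one [simp]: "tr (1\<^sub>m m) = of_nat m"
  by (simp add: tr_def)

lemma mat_mult_index:
  "A \<in> carrier_mat r m \<Longrightarrow> B \<in> carrier_mat m c \<Longrightarrow> i < r \<Longrightarrow> j < c \<Longrightarrow>
   (A * B) $$ (i,j) = (\<Sum>k<m. A $$ (i,k) * B $$ (k,j))"
  by (auto simp: scalar_prod_def atLeast0LessThan intro!: sum.cong)

lemma tr_mult:
  "A \<in> carrier_mat m m \<Longrightarrow> B \<in> carrier_mat m m \<Longrightarrow>
   tr (A * B) = (\<Sum>i<m. \<Sum>j<m. A $$ (i,j) * B $$ (j,i))"
  by (auto simp: tr_def mat_mult_index simp del: index_mult_mat(1) intro!: sum.cong)

lemma tr_comm:
  assumes "A \<in> carrier_mat m m" "B \<in> carrier_mat m m"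
  shows "tr (A * B) = tr (B * A)"
  unfolding tr_mult[OF assms] tr_mult[OF assms(2,1)]
  by (subst sum.swap) (simp add: mult.commute)

lemma sum2_product:
  fixes f g :: "nat \<Rightarrow> nat \<Rightarrow> complex"
  shows "(\<Sum>i<m. \<Sum>j<m. f i j) * (\<Sum>k<m. \<Sum>l<m. g k l) =
    (\<Sum>i<m. \<Sum>j<m. \<Sum>k<m. \<Sum>l<m. f i j * g k l)"
  unfolding sum_distrib_right unfolding sum_distrib_left by (rule refl)

lemma sum_rotate:
  "(\<Sum>P\<in>A. \<Sum>Q\<in>B. \<Sum>R\<in>C. f P Q R) = (\<Sum>Q\<in>B. \<Sum>R\<in>C. \<Sum>P\<in>A. f P Q R)"
  by (subst sum.swap) (intro sum.cong refl sum.swap)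

text \<open>The general rules have side conditions with several unknown dimensions. Inside the
  locale they are replaced by versions for square matrices of size \<open>d\<close>, whose side
  conditions are solved by simplification.\<close>

declare assoc_mult_mat [simp del] mult_carrier_mat [simp del]

section \<open>Pauli systems\<close>

text \<open>Only the algebra of Pauli strings is abstracted here; the tensor structure returns when
  \<open>T\<close> and the measurement are evaluated. \<open>S_complete\<close> says that the sum of
  all P tensor P is \<open>d\<close> times the swap operator.\<close>

locale pauli_system =
  fixes d :: nat and S :: "complex mat set"
  assumes finite_S: "finite S"
    and one_S: "1\<^sub>m d \<in> S"
    and S_carrier [simp]: "P \<in> S \<Longrightarrow> P \<in> carrier_mat d d"
    and S_adj [simp]: "P \<in> S \<Longrightarrow> adj P = P"
    and S_sq [simp]: "P \<in> S \<Longrightarrow> P * P = 1\<^sub>m d"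
    and S_mult: "P \<in> S \<Longrightarrow> Q \<in> S \<Longrightarrow> \<exists>R\<in>S. \<exists>c. cmod c = 1 \<and> P * Q = c \<cdot>\<^sub>m R"
    and S_comm: "P \<in> S \<Longrightarrow> Q \<in> S \<Longrightarrow> P * Q = Q * P \<or> P * Q = (-1) \<cdot>\<^sub>m (Q * P)"
    and S_complete: "a < d \<Longrightarrow> b < d \<Longrightarrow> i < d \<Longrightarrow> j < d \<Longrightarrow>
          (\<Sum>P\<in>S. P $$ (a,b) * P $$ (i,j)) = (if a = j \<and> b = i then of_nat d else 0)"
    and S_orth: "P \<in> S \<Longrightarrow> Q \<in> S \<Longrightarrow> P \<noteq> Q \<Longrightarrow> tr (P * Q) = 0"
    and d_pos: "d > 0"
begin

abbreviation M :: "complex mat set" where "M \<equiv> carrier_mat d d"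

text \<open>Keeps the simplifier from rewriting inside the matrices when it discharges carrier conditions.\<close>
lemma mem_weak_cong [cong]: "A = B \<Longrightarrow> x \<in> A \<longleftrightarrow> x \<in> B"
  by simp

lemma mult_M [simp]: "A \<in> M \<Longrightarrow> B \<in> M \<Longrightarrow> A * B \<in> M"
  by (rule mult_carrier_mat)

lemma one_left_M [simp]: "A \<in> M \<Longrightarrow> 1\<^sub>m d * A = A"
  by (rule left_mult_one_mat)

lemma one_right_M [simp]: "A \<in> M \<Longrightarrow> A * 1\<^sub>m d = A"
  by (rule right_mult_one_mat)

lemma one_M [simp]: "1\<^sub>m d \<in> M"
  by simp

lemma adj_M [simp]: "A \<in> M \<Longrightarrow> adj A \<in> M"
  by (rule adj_carrier)

lemma adj_mult_M [simp]: "A \<in> M \<Longrightarrow> B \<in> M \<Longrightarrow> adj (A * B) = adj B * adj A"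
  by (rule adj_mult)

lemma mult_assoc_M [simp]: "A \<in> M \<Longrightarrow> B \<in> M \<Longrightarrow> C \<in> M \<Longrightarrow> (A * B) * C = A * (B * C)"
  by (rule assoc_mult_mat)

lemma smult_left_M [simp]: "A \<in> M \<Longrightarrow> B \<in> M \<Longrightarrow> (c \<cdot>\<^sub>m A) * B = c \<cdot>\<^sub>m (A * B)"
  by (rule mult_smult_assoc_mat)

lemma smult_right_M [simp]: "A \<in> M \<Longrightarrow> B \<in> M \<Longrightarrow> A * (c \<cdot>\<^sub>m B) = c \<cdot>\<^sub>m (A * B)"
  by (rule mult_smult_distrib)

lemma smult_M [simp]: "A \<in> M \<Longrightarrow> c \<cdot>\<^sub>m A \<in> M"
  by simp

lemma smult_smult [simp]: "a \<cdot>\<^sub>m (b \<cdot>\<^sub>m (A :: complex mat)) = (a * b) \<cdot>\<^sub>m A"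
  by (rule eq_matI) auto

lemma smult_one_mat [simp]: "1 \<cdot>\<^sub>m (A :: complex mat) = A"
  by (rule eq_matI) auto

lemma tr_M_smult [simp]: "A \<in> M \<Longrightarrow> tr (c \<cdot>\<^sub>m A) = c * tr A"
  by (rule tr_smult)

lemma tr_cyc: "A \<in> M \<Longrightarrow> B \<in> M \<Longrightarrow> tr (A * B) = tr (B * A)"
  by (rule tr_comm)

lemma S_sq_left [simp]: "P \<in> S \<Longrightarrow> A \<in> M \<Longrightarrow> P * (P * A) = A"
  by (metis S_carrier S_sq mult_assoc_M one_left_M)

text \<open>On \<open>S\<close> this is the symplectic form of the Pauli group modulo phases,
  written multiplicatively. It takes complex values so that it can stand as a factor in the sums
  below.\<close>

definition chi :: "complex mat \<Rightarrow> complex mat \<Rightarrow> complex" where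
  "chi P Q = (if P * Q = Q * P then 1 else -1)"

lemma S_swap: "P \<in> S \<Longrightarrow> Q \<in> S \<Longrightarrow> P * Q = chi P Q \<cdot>\<^sub>m (Q * P)"
  using S_comm[of P Q] by (auto simp: chi_def)

lemma chi_cases: "chi P Q = 1 \<or> chi P Q = -1"
  by (auto simp: chi_def)

lemma chi_sym: "chi P Q = chi Q P"
  by (auto simp: chi_def)

lemma chi_sq [simp]: "chi P Q * chi P Q = 1" "chi P Q * (chi P Q * z) = z"
  using chi_cases[of P Q] by auto

lemma chi_self [simp]: "chi P P = 1"
  by (simp add: chi_def)

lemma chi_one [simp]: "P \<in> S \<Longrightarrow> chi (1\<^sub>m d) P = 1" "P \<in> S \<Longrightarrow> chi P (1\<^sub>m d) = 1"
  by (simp_all add: chi_def)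

lemma S_conj: "P \<in> S \<Longrightarrow> Q \<in> S \<Longrightarrow> P * (Q * P) = chi P Q \<cdot>\<^sub>m Q"
proof -
  assume P: "P \<in> S" and Q: "Q \<in> S"
  have "P * (Q * P) = P * (chi P Q \<cdot>\<^sub>m (P * Q))" using P Q by (simp add: S_swap[of Q P] chi_sym)
  also have "\<dots> = chi P Q \<cdot>\<^sub>m Q" using P Q by simp
  finally show ?thesis .
qed

text \<open>Parseval's identity for the Pauli basis, obtained by contracting the swap operator of
  \<open>S_complete\<close> with the entries of \<open>A\<close> and \<open>B\<close>.\<close>

lemma completeness:
  assumes A: "A \<in> M" and B: "B \<in> M"
  shows "(\<Sum>P\<in>S. tr (A * P) * tr (B * P)) = of_nat d * tr (A * B)"
proof -
  have "(\<Sum>P\<in>S. tr (A * P) * tr (B * P)) =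
     (\<Sum>P\<in>S. \<Sum>i<d. \<Sum>j<d. \<Sum>k<d. \<Sum>l<d. A $$ (i,j) * B $$ (k,l) * (P $$ (j,i) * P $$ (l,k)))"
    using A B by (intro sum.cong refl)
      (simp add: tr_mult[where m=d] sum2_product, simp add: mult_ac)
  also have "\<dots> = (\<Sum>i<d. \<Sum>j<d. \<Sum>k<d. \<Sum>l<d. A $$ (i,j) * B $$ (k,l) * (\<Sum>P\<in>S. P $$ (j,i) * P $$ (l,k)))"
    unfolding sum_distrib_left
    by (subst sum.swap, intro sum.cong refl, subst sum.swap, intro sum.cong refl,
        subst sum.swap, intro sum.cong refl, subst sum.swap, intro sum.cong refl)
  also have "\<dots> = (\<Sum>i<d. \<Sum>j<d. \<Sum>k<d. \<Sum>l<d. if l = i then (if k = j then of_nat d * (A $$ (i,j) * B $$ (j,i)) else 0) else 0)"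
    by (intro sum.cong refl) (auto simp: S_complete)
  also have "\<dots> = of_nat d * tr (A * B)"
    using A B by (simp add: tr_mult[where m=d] sum_distrib_left)
  finally show ?thesis .
qed

text \<open>The other contraction of the swap operator, known as the Pauli twirl: the sum of all
  \<open>P * A * P\<close> is \<open>d * tr A\<close> times the identity.\<close>

lemma completeness_split:
  assumes A: "A \<in> M" and B: "B \<in> M"
  shows "(\<Sum>P\<in>S. tr (P * A * (P * B))) = of_nat d * tr A * tr B"
proof -
  have e: "tr (P * A * (P * B)) = (\<Sum>i<d. \<Sum>j<d. \<Sum>k<d. \<Sum>l<d. A $$ (j,k) * B $$ (l,i) * (P $$ (i,j) * P $$ (k,l)))"
    if "P \<in> S" for P
  proof -
    have "tr (P * A * (P * B)) = (\<Sum>i<d. \<Sum>k<d. (\<Sum>j<d. P $$ (i,j) * A $$ (j,k)) * (\<Sum>l<d. P $$ (k,l) * B $$ (l,i)))"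
      using that A B by (simp add: tr_mult[where m=d] mat_mult_index[where m=d and r=d and c=d] del: mult_assoc_M index_mult_mat(1))
    also have "\<dots> = (\<Sum>i<d. \<Sum>k<d. \<Sum>j<d. \<Sum>l<d. A $$ (j,k) * B $$ (l,i) * (P $$ (i,j) * P $$ (k,l)))"
      by (simp add: sum_product mult.assoc mult.left_commute mult.commute)
    also have "\<dots> = (\<Sum>i<d. \<Sum>j<d. \<Sum>k<d. \<Sum>l<d. A $$ (j,k) * B $$ (l,i) * (P $$ (i,j) * P $$ (k,l)))"
      by (intro sum.cong refl sum.swap)
    finally show ?thesis .
  qed
  have "(\<Sum>P\<in>S. tr (P * A * (P * B))) =
     (\<Sum>P\<in>S. \<Sum>i<d. \<Sum>j<d. \<Sum>k<d. \<Sum>l<d. A $$ (j,k) * B $$ (l,i) * (P $$ (i,j) * P $$ (k,l)))"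
    by (intro sum.cong refl e)
  also have "\<dots> = (\<Sum>i<d. \<Sum>j<d. \<Sum>k<d. \<Sum>l<d. A $$ (j,k) * B $$ (l,i) * (\<Sum>P\<in>S. P $$ (i,j) * P $$ (k,l)))"
    unfolding sum_distrib_left
    by (subst sum.swap, intro sum.cong refl, subst sum.swap, intro sum.cong refl,
        subst sum.swap, intro sum.cong refl, subst sum.swap, intro sum.cong refl)
  also have "\<dots> = (\<Sum>i<d. \<Sum>j<d. \<Sum>k<d. \<Sum>l<d. if l = i then (if k = j then of_nat d * (A $$ (j,j) * B $$ (i,i)) else 0) else 0)"
    by (intro sum.cong refl) (auto simp: S_complete)
  also have "\<dots> = of_nat d * tr A * tr B"
  proof -
    have "of_nat d * tr A * tr B = (\<Sum>j<d. \<Sum>i<d. of_nat d * (A $$ (j,j) * B $$ (i,i)))"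
    proof -
      have "tr A = (\<Sum>j<d. A $$ (j,j))" "tr B = (\<Sum>j<d. B $$ (j,j))" using A B by (auto simp: tr_def)
      then show ?thesis by (simp only: mult.assoc) (simp only: sum_product, simp only: sum_distrib_left)
    qed
    then show ?thesis using sum.swap[of "\<lambda>i j. of_nat d * (A $$ (j,j) * B $$ (i,i))" "{..<d}" "{..<d}"] by simp
  qed
  finally show ?thesis .
qed

lemma card_S: "of_nat (card S) = (of_nat d :: complex) ^ 2"
proof -
  have "(\<Sum>P\<in>S. tr (P * 1\<^sub>m d * (P * 1\<^sub>m d))) = of_nat d * tr (1\<^sub>m d) * tr (1\<^sub>m d)"
    by (rule completeness_split) auto
  moreover have "(\<Sum>P\<in>S. tr (P * 1\<^sub>m d * (P * 1\<^sub>m d))) = of_nat (card S) * of_nat d"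
    by simp
  ultimately show ?thesis using d_pos by (simp add: power2_eq_square)
qed

lemma completeness':
  assumes A: "A \<in> M" and B: "B \<in> M"
  shows "(\<Sum>P\<in>S. tr (P * A) * tr (P * B)) = of_nat d * tr (A * B)"
proof -
  have "(\<Sum>P\<in>S. tr (P * A) * tr (P * B)) = (\<Sum>P\<in>S. tr (A * P) * tr (B * P))"
    using A B by (intro sum.cong refl) (simp add: tr_cyc)
  then show ?thesis using completeness[OF A B] by simp
qed

lemma chi_tr: "P \<in> S \<Longrightarrow> Q \<in> S \<Longrightarrow> X \<in> M \<Longrightarrow> chi P Q * tr (P * (Q * X)) = tr (Q * (P * X))"
proof -
  assume a: "P \<in> S" "Q \<in> S" "X \<in> M"
  have "tr (P * Q * X) = chi P Q * tr (Q * P * X)"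
    using a by (subst S_swap) (auto simp del: mult_assoc_M)
  then show ?thesis using a by simp
qed

text \<open>Conjugation of \<open>A\<close> by \<open>Q\<close> multiplies the Pauli coefficient at
  \<open>P\<close> by \<open>chi Q P\<close>, so this is Parseval's identity for
  \<open>Q * A * Q\<close> and \<open>B\<close>.\<close>

lemma completeness_chi:
  assumes A: "A \<in> M" and B: "B \<in> M" and Q: "Q \<in> S"
  shows "(\<Sum>P\<in>S. chi Q P * (tr (P * A) * tr (P * B))) = of_nat d * tr (Q * (A * (Q * B)))"
proof -
  have "chi Q P * tr (P * A) = tr (P * (Q * (A * Q)))" if P: "P \<in> S" for P
  proof -
    have "tr (P * (Q * (A * Q))) = chi Q P * tr (Q * (P * (A * Q)))"
      using chi_tr[OF Q P, of "A * Q"] A Q by simp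
    also have "tr (Q * (P * (A * Q))) = tr (P * A)"
      using tr_cyc[of "Q" "P * (A * Q)"] A P Q by simp
    finally show ?thesis by simp
  qed
  then have "(\<Sum>P\<in>S. chi Q P * (tr (P * A) * tr (P * B))) = (\<Sum>P\<in>S. tr (P * (Q * (A * Q))) * tr (P * B))"
    by (intro sum.cong refl) (simp add: mult.assoc[symmetric])
  also have "\<dots> = of_nat d * tr (Q * (A * (Q * B)))"
    using completeness'[of "Q * (A * Q)" B] A B Q by simp
  finally show ?thesis .
qed

section \<open>Words in Pauli operators, characters and the symplectic Fourier transform\<close>

primrec word :: "complex mat list \<Rightarrow> complex mat" where
  "word [] = 1\<^sub>m d"
| "word (P # Ps) = P * word Ps"

lemma word_M [simp]: "set Ps \<subseteq> S \<Longrightarrow> word Ps \<in> M"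
  by (induction Ps) (auto cong del: mem_weak_cong)

lemma word_unitary: "set Ps \<subseteq> S \<Longrightarrow> word Ps * adj (word Ps) = 1\<^sub>m d"
proof (induction Ps)
  case (Cons P Ps)
  then have P: "P \<in> S" and W: "word Ps \<in> M" and e: "word Ps * adj (word Ps) = 1\<^sub>m d" by auto
  have "word Ps * (adj (word Ps) * P) = P"
    using mult_assoc_M[of "word Ps" "adj (word Ps)" P] e P W by simp
  then show ?case using P W by simp
qed simp

lemma word_conj: "X \<in> S \<Longrightarrow> set Ps \<subseteq> S \<Longrightarrow> X * (word Ps * X) = (\<Prod>P\<leftarrow>Ps. chi P X) \<cdot>\<^sub>m word Ps"
proof (induction Ps)
  case (Cons P Ps)
  then have P: "P \<in> S" and W: "word Ps \<in> M" by auto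
  have "X * (word (P # Ps) * X) = (X * P * X) * (X * (word Ps * X))"
    using Cons.prems P W by simp
  also have "\<dots> = (chi P X \<cdot>\<^sub>m P) * ((\<Prod>P\<leftarrow>Ps. chi P X) \<cdot>\<^sub>m word Ps)"
    using Cons P W S_conj[of X P] by (simp add: chi_sym)
  finally show ?case using P W by (simp add: mult.commute)
qed simp

text \<open>Orthogonality of characters. Conjugating the word by \<open>X\<close> produces the
  product of signs, and the twirl of the word against its adjoint evaluates the sum. A word is a
  phase times a Pauli operator, so the value is \<open>d ^ 2\<close> or 0 according to whether it is
  a scalar.\<close>

lemma sum_chi_word:
  assumes "set Ps \<subseteq> S"
  shows "(\<Sum>X\<in>S. \<Prod>P\<leftarrow>Ps. chi P X) = of_real ((cmod (tr (word Ps)))\<^sup>2)"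
proof -
  let ?W = "word Ps"
  have W: "?W \<in> M" using assms by simp
  have "tr (X * ?W * (X * adj ?W)) = (\<Prod>P\<leftarrow>Ps. chi P X) * of_nat d" if X: "X \<in> S" for X
  proof -
    have "X * ?W * (X * adj ?W) = (X * (?W * X)) * adj ?W" using X W by simp
    also have "\<dots> = (\<Prod>P\<leftarrow>Ps. chi P X) \<cdot>\<^sub>m (?W * adj ?W)" using X W assms by (simp add: word_conj del: mult_assoc_M)
    finally show ?thesis using assms by (simp add: word_unitary)
  qed
  then have "(\<Sum>X\<in>S. \<Prod>P\<leftarrow>Ps. chi P X) * of_nat d = of_nat d * tr ?W * tr (adj ?W)"
    using completeness_split[OF W adj_M[OF W]] by (simp add: sum_distrib_right)
  then have "(\<Sum>X\<in>S. \<Prod>P\<leftarrow>Ps. chi P X) = tr ?W * cnj (tr ?W)"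
    using d_pos W by (simp add: tr_adj[of _ d] mult.commute mult.left_commute)
  then show ?thesis unfolding complex_norm_square .
qed

lemma tr_S: "P \<in> S \<Longrightarrow> tr P = (if P = 1\<^sub>m d then of_nat d else 0)"
  using S_orth[of P "1\<^sub>m d"] one_S by auto

lemma tr_S2: "P \<in> S \<Longrightarrow> Q \<in> S \<Longrightarrow> tr (P * Q) = (if P = Q then of_nat d else 0)"
  using S_orth[of P Q] by auto

lemma sum_chi: "P \<in> S \<Longrightarrow> (\<Sum>X\<in>S. chi P X) = (if P = 1\<^sub>m d then of_nat d ^ 2 else 0)"
  using sum_chi_word[of "[P]"] by (simp add: tr_S)

lemma sum_chi2: "P \<in> S \<Longrightarrow> Q \<in> S \<Longrightarrow> (\<Sum>X\<in>S. chi P X * chi Q X) = (if P = Q then of_nat d ^ 2 else 0)"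
  using sum_chi_word[of "[P, Q]"] by (simp add: tr_S2)

lemma split_expand:
  assumes A: "A \<in> M" and B: "B \<in> M" and P: "P \<in> S"
  shows "of_nat d * tr (P * (A * (P * B))) = (\<Sum>Q\<in>S. chi P Q * (tr (Q * A) * tr (Q * B)))"
  using completeness_chi[OF A B P] by simp

text \<open>By \<open>split_expand\<close>, \<open>tr (P * A * P * B)\<close> as a function of
  \<open>P\<close> is 1 / d times the symplectic Fourier transform of
  \<open>tr (P * A) * tr (P * B)\<close>. This is Plancherel's identity for that transform.\<close>

lemma fourier_isometry:
  assumes A: "A \<in> M" and B: "B \<in> M" and C: "C \<in> M" and E: "E \<in> M"
  shows "(\<Sum>P\<in>S. tr (P * (A * (P * B))) * tr (P * (C * (P * E)))) =
    (\<Sum>P\<in>S. tr (P * A) * tr (P * B) * (tr (P * C) * tr (P * E)))"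
proof -
  let ?f = "\<lambda>Q. tr (Q * A) * tr (Q * B)" and ?g = "\<lambda>Q. tr (Q * C) * tr (Q * E)"
  have "of_nat d ^ 2 * (\<Sum>P\<in>S. tr (P * (A * (P * B))) * tr (P * (C * (P * E)))) =
    (\<Sum>P\<in>S. (of_nat d * tr (P * (A * (P * B)))) * (of_nat d * tr (P * (C * (P * E)))))"
    by (simp add: sum_distrib_left power2_eq_square mult_ac)
  also have "\<dots> = (\<Sum>P\<in>S. \<Sum>Q\<in>S. \<Sum>R\<in>S. ?f Q * ?g R * (chi Q P * chi R P))"
    by (intro sum.cong refl, subst split_expand[OF A B], assumption, subst split_expand[OF C E], assumption)
      (simp add: sum_product mult_ac chi_sym)
  also have "\<dots> = (\<Sum>Q\<in>S. \<Sum>R\<in>S. ?f Q * ?g R * (\<Sum>P\<in>S. chi Q P * chi R P))"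
    unfolding sum_distrib_left by (rule sum_rotate)
  also have "\<dots> = (\<Sum>Q\<in>S. \<Sum>R\<in>S. if R = Q then of_nat d ^ 2 * (?f Q * ?g Q) else 0)"
    by (intro sum.cong refl) (auto simp: sum_chi2)
  also have "\<dots> = of_nat d ^ 2 * (\<Sum>Q\<in>S. ?f Q * ?g Q)"
    using finite_S by (simp add: sum_distrib_left)
  finally show ?thesis using d_pos by simp
qed

text \<open>In \<open>(P * A * P) * B * (P * C * P) * E\<close> the two conjugated factors are
  expanded in Pauli operators \<open>Q\<close> and \<open>R\<close>. The variable \<open>P\<close>
  is left only in the signs \<open>chi Q P * chi R P\<close>, whose sum forces
  \<open>Q = R\<close>.\<close>

lemma four_cycle_sum:
  assumes A: "A \<in> M" and B: "B \<in> M" and C: "C \<in> M" and E: "E \<in> M"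
  shows "(\<Sum>P\<in>S. tr (P * (A * (P * (B * (P * (C * (P * E)))))))) =
    (\<Sum>P\<in>S. tr (P * A) * tr (P * C) * tr (P * (B * (P * E))))"
proof -
  have e: "of_nat d ^ 2 * tr (P * (A * (P * (B * (P * (C * (P * E))))))) =
    (\<Sum>Q\<in>S. \<Sum>R\<in>S. tr (Q * A) * tr (R * C) * tr (Q * (B * (R * E))) * (chi Q P * chi R P))" if P: "P \<in> S" for P
  proof -
    have "of_nat d * tr (P * (A * (P * (B * (P * (C * (P * E))))))) =
        (\<Sum>Q\<in>S. chi P Q * (tr (Q * A) * tr (Q * (B * (P * (C * (P * E)))))))"
      using split_expand[of A "B * (P * (C * (P * E)))" P] A B C E P by simp
    also have "\<dots> = (\<Sum>Q\<in>S. chi P Q * (tr (Q * A) * tr (P * (C * (P * (E * (Q * B)))))))"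
    proof (intro sum.cong refl arg_cong2[where f="(*)"])
      fix Q assume "Q \<in> S"
      then show "tr (Q * (B * (P * (C * (P * E))))) = tr (P * (C * (P * (E * (Q * B)))))"
        using A B C E P tr_cyc[of "Q * B" "P * (C * (P * E))"] by simp
    qed
    finally have "of_nat d ^ 2 * tr (P * (A * (P * (B * (P * (C * (P * E))))))) =
       (\<Sum>Q\<in>S. chi P Q * (tr (Q * A) * (of_nat d * tr (P * (C * (P * (E * (Q * B))))))))"
      by (simp add: power2_eq_square mult.assoc sum_distrib_left mult.left_commute)
    also have "\<dots> = (\<Sum>Q\<in>S. chi P Q * (tr (Q * A) * (\<Sum>R\<in>S. chi P R * (tr (R * C) * tr (R * (E * (Q * B)))))))"
      using A B C E P by (intro sum.cong refl) (subst split_expand, auto)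
    also have "\<dots> = (\<Sum>Q\<in>S. chi P Q * (tr (Q * A) * (\<Sum>R\<in>S. chi P R * (tr (R * C) * tr (Q * (B * (R * E)))))))"
    proof (intro sum.cong refl arg_cong2[where f="(*)"])
      fix Q R assume "Q \<in> S" "R \<in> S"
      then show "tr (R * (E * (Q * B))) = tr (Q * (B * (R * E)))"
        using B E tr_cyc[of "R * E" "Q * B"] by simp
    qed
    finally show ?thesis by (simp add: sum_distrib_left mult_ac chi_sym)
  qed
  let ?h = "\<lambda>Q R. tr (Q * A) * tr (R * C) * tr (Q * (B * (R * E)))"
  have "of_nat d ^ 2 * (\<Sum>P\<in>S. tr (P * (A * (P * (B * (P * (C * (P * E)))))))) =
    (\<Sum>P\<in>S. \<Sum>Q\<in>S. \<Sum>R\<in>S. ?h Q R * (chi Q P * chi R P))"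
    unfolding sum_distrib_left by (intro sum.cong refl e)
  also have "\<dots> = (\<Sum>Q\<in>S. \<Sum>R\<in>S. ?h Q R * (\<Sum>P\<in>S. chi Q P * chi R P))"
    unfolding sum_distrib_left by (rule sum_rotate)
  also have "\<dots> = (\<Sum>Q\<in>S. \<Sum>R\<in>S. if R = Q then of_nat d ^ 2 * ?h Q Q else 0)"
    by (intro sum.cong refl) (auto simp: sum_chi2)
  also have "\<dots> = of_nat d ^ 2 * (\<Sum>Q\<in>S. ?h Q Q)"
    using finite_S by (simp add: sum_distrib_left)
  finally show ?thesis using d_pos by simp
qed

text \<open>The Pauli expansion of \<open>A\<close>, namely that the sum of
  \<open>tr (R * A)\<close> times \<open>R\<close> is \<open>d\<close> times \<open>A\<close>, used
  in the interior of a longer product.\<close>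

lemma sum_insert:
  assumes "A \<in> M" "X \<in> M" "Y \<in> M"
  shows "(\<Sum>R\<in>S. tr (R * A) * tr (X * (R * Y))) = of_nat d * tr (X * (A * Y))"
proof -
  have "(\<Sum>R\<in>S. tr (R * A) * tr (X * (R * Y))) = (\<Sum>R\<in>S. tr (R * A) * tr (R * (Y * X)))"
    using assms tr_cyc[of X] by (intro sum.cong refl) simp
  also have "\<dots> = of_nat d * tr (A * (Y * X))"
    using assms by (subst completeness') auto
  also have "tr (A * (Y * X)) = tr (X * (A * Y))"
    using assms tr_cyc[of X "A * Y"] by simp
  finally show ?thesis .
qed

lemma sum_insert_chi:
  assumes "A \<in> M" "X \<in> M" "Y \<in> M" "P \<in> S"
  shows "(\<Sum>R\<in>S. chi P R * (tr (R * A) * tr (X * (R * Y)))) = of_nat d * tr (X * (P * (A * (P * Y))))"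
proof -
  have "(\<Sum>R\<in>S. chi P R * (tr (R * A) * tr (X * (R * Y)))) = (\<Sum>R\<in>S. chi P R * (tr (R * A) * tr (R * (Y * X))))"
    using assms tr_cyc[of X] by (intro sum.cong refl) simp
  also have "\<dots> = of_nat d * tr (P * (A * (P * (Y * X))))"
    using assms by (subst completeness_chi) auto
  also have "tr (P * (A * (P * (Y * X)))) = tr (X * (P * (A * (P * Y))))"
    using assms tr_cyc[of X "P * (A * (P * Y))"] by simp
  finally show ?thesis .
qed

lemma chi_tr': "P \<in> S \<Longrightarrow> Q \<in> S \<Longrightarrow> X \<in> M \<Longrightarrow> Y \<in> M \<Longrightarrow>
    chi P Q * tr (Y * (P * (Q * X))) = tr (Y * (Q * (P * X)))"
proof -
  assume a: "P \<in> S" "Q \<in> S" "X \<in> M" "Y \<in> M"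
  have "tr (Y * (P * (Q * X))) = tr (P * (Q * (X * Y)))" "tr (Y * (Q * (P * X))) = tr (Q * (P * (X * Y)))"
    using a tr_cyc[of Y "P * (Q * X)"] tr_cyc[of Y "Q * (P * X)"] by simp_all
  with chi_tr[of P Q "X * Y"] a show ?thesis by simp
qed

section \<open>Sums over triples of Pauli operators\<close>

text \<open>The product of traces is unchanged when \<open>P\<close>, \<open>Q\<close> or \<open>R\<close> changes its sign, so Clifford conjugation,
  which permutes the Pauli operators only up to signs, permutes its values.\<close>
definition Gam :: "complex mat \<Rightarrow> complex mat \<Rightarrow> complex mat \<Rightarrow> complex mat \<Rightarrow>
    complex mat \<Rightarrow> complex mat \<Rightarrow> complex mat \<Rightarrow> complex" where
  "Gam A B C E P Q R = tr (P * A) * (tr (Q * B) * (tr (R * C) * tr (P * (Q * (R * E)))))"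

abbreviation sum3 :: "(complex mat \<Rightarrow> complex mat \<Rightarrow> complex mat \<Rightarrow> complex) \<Rightarrow> complex" where
  "sum3 f \<equiv> (\<Sum>P\<in>S. \<Sum>Q\<in>S. \<Sum>R\<in>S. f P Q R)"

lemma sum3_swap12: "sum3 f = sum3 (\<lambda>P Q R. f Q P R)"
  by (rule sum.swap)

lemma sum3_swap23: "sum3 f = sum3 (\<lambda>P Q R. f P R Q)"
  by (intro sum.cong refl sum.swap)

lemma sum3_Gam:
  assumes [simp]: "A \<in> M" "B \<in> M" "C \<in> M" "E \<in> M"
  shows "sum3 (Gam A B C E) = of_nat d ^ 3 * tr (A * (B * (C * E)))"
proof -
  have "(\<Sum>R\<in>S. Gam A B C E P Q R) = of_nat d * (tr (P * A) * (tr (Q * B) * tr (P * (Q * (C * E)))))"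
    if [simp]: "P \<in> S" "Q \<in> S" for P Q
  proof -
    have "(\<Sum>R\<in>S. Gam A B C E P Q R) = tr (P * A) * (tr (Q * B) * (\<Sum>R\<in>S. tr (R * C) * tr ((P * Q) * (R * E))))"
      by (simp add: Gam_def sum_distrib_left mult_ac)
    then show ?thesis by (subst (asm) sum_insert) (simp_all add: mult_ac)
  qed
  then have "sum3 (Gam A B C E) = (\<Sum>P\<in>S. of_nat d * (tr (P * A) * (\<Sum>Q\<in>S. tr (Q * B) * tr (P * (Q * (C * E))))))"
    by (simp add: sum_distrib_left)
  also have "\<dots> = (\<Sum>P\<in>S. of_nat d * (tr (P * A) * (of_nat d * tr (P * (B * (C * E))))))"
    by (intro sum.cong refl) (subst sum_insert, auto)
  also have "\<dots> = of_nat d ^ 2 * (\<Sum>P\<in>S. tr (P * A) * tr (P * (B * (C * E))))"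
    by (simp add: sum_distrib_left power2_eq_square mult_ac)
  also have "\<dots> = of_nat d ^ 3 * tr (A * (B * (C * E)))"
    by (subst completeness') (auto simp: power2_eq_square power3_eq_cube)
  finally show ?thesis .
qed

context
  fixes A B C E assumes A [simp]: "A \<in> M" and B [simp]: "B \<in> M" and C [simp]: "C \<in> M" and E [simp]: "E \<in> M"
begin

text \<open>The sign exchanges two neighbours in the word \<open>P * Q * R\<close>. Together with
  \<open>Gam_z\<close> this generates all permutations of the three factors, so a product of signs
  over the inversions of a permutation yields the trace of a reordered product.\<close>

lemma Gam_x: "P \<in> S \<Longrightarrow> Q \<in> S \<Longrightarrow> R \<in> S \<Longrightarrow> chi P Q * Gam A B C E P Q R = Gam B A C E Q P R"
  using chi_tr[of P Q "R * E"] by (simp add: Gam_def mult_ac)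

lemma Gam_z: "P \<in> S \<Longrightarrow> Q \<in> S \<Longrightarrow> R \<in> S \<Longrightarrow> chi Q R * Gam A B C E P Q R = Gam A C B E P R Q"
  using chi_tr'[of Q R E P] by (simp add: Gam_def mult_ac)

end

context
  fixes A B C E assumes A [simp]: "A \<in> M" and B [simp]: "B \<in> M" and C [simp]: "C \<in> M" and E [simp]: "E \<in> M"
begin

lemma sum3_x: "sum3 (\<lambda>P Q R. chi P Q * Gam A B C E P Q R) = of_nat d ^ 3 * tr (B * (A * (C * E)))"
proof -
  have "sum3 (\<lambda>P Q R. chi P Q * Gam A B C E P Q R) = sum3 (\<lambda>P Q R. Gam B A C E Q P R)"
    by (intro sum.cong refl) (simp add: Gam_x)
  also have "\<dots> = sum3 (Gam B A C E)" by (rule sum3_swap12)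
  finally show ?thesis by (simp add: sum3_Gam)
qed

lemma sum3_z: "sum3 (\<lambda>P Q R. chi Q R * Gam A B C E P Q R) = of_nat d ^ 3 * tr (A * (C * (B * E)))"
proof -
  have "sum3 (\<lambda>P Q R. chi Q R * Gam A B C E P Q R) = sum3 (\<lambda>P Q R. Gam A C B E P R Q)"
    by (intro sum.cong refl) (simp add: Gam_z)
  also have "\<dots> = sum3 (Gam A C B E)" by (rule sum3_swap23)
  finally show ?thesis by (simp add: sum3_Gam)
qed

end

context
  fixes A B C E assumes A [simp]: "A \<in> M" and B [simp]: "B \<in> M" and C [simp]: "C \<in> M" and E [simp]: "E \<in> M"
begin

lemma sum3_xy: "sum3 (\<lambda>P Q R. chi P Q * (chi P R * Gam A B C E P Q R)) = of_nat d ^ 3 * tr (B * (C * (A * E)))"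
proof -
  have "sum3 (\<lambda>P Q R. chi P Q * (chi P R * Gam A B C E P Q R)) = sum3 (\<lambda>P Q R. chi P R * Gam B A C E Q P R)"
    by (intro sum.cong refl) (simp add: Gam_x mult.left_commute[of "chi _ _" "chi _ _"])
  also have "\<dots> = sum3 (\<lambda>P Q R. chi Q R * Gam B A C E P Q R)" by (rule sum3_swap12)
  finally show ?thesis by (simp add: sum3_z)
qed

lemma sum3_yz: "sum3 (\<lambda>P Q R. chi P R * (chi Q R * Gam A B C E P Q R)) = of_nat d ^ 3 * tr (C * (A * (B * E)))"
proof -
  have "sum3 (\<lambda>P Q R. chi P R * (chi Q R * Gam A B C E P Q R)) = sum3 (\<lambda>P Q R. chi P R * Gam A C B E P R Q)"
    by (intro sum.cong refl) (simp add: Gam_z)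
  also have "\<dots> = sum3 (\<lambda>P Q R. chi P Q * Gam A C B E P Q R)" by (rule sum3_swap23)
  finally show ?thesis by (simp add: sum3_x)
qed

end

context
  fixes A B C E assumes A [simp]: "A \<in> M" and B [simp]: "B \<in> M" and C [simp]: "C \<in> M" and E [simp]: "E \<in> M"
begin

lemma sum3_xyz: "sum3 (\<lambda>P Q R. chi P Q * (chi P R * (chi Q R * Gam A B C E P Q R))) = of_nat d ^ 3 * tr (C * (B * (A * E)))"
proof -
  have "sum3 (\<lambda>P Q R. chi P Q * (chi P R * (chi Q R * Gam A B C E P Q R))) = sum3 (\<lambda>P Q R. chi P R * (chi P Q * Gam A C B E P R Q))"
    by (intro sum.cong refl) (simp add: Gam_z mult_ac)
  also have "\<dots> = sum3 (\<lambda>P Q R. chi P Q * (chi P R * Gam A C B E P Q R))" by (rule sum3_swap23)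
  finally show ?thesis by (simp add: sum3_xy)
qed

text \<open>The pair of outer factors alone is not the inversion set of a permutation, since
  \<open>R\<close> cannot get past \<open>P\<close> without meeting \<open>Q\<close>. The sum over
  \<open>R\<close> therefore inserts \<open>P * C * P\<close> instead, and a quartic Pauli sum
  remains in place of a trace.\<close>

lemma sum3_y: "sum3 (\<lambda>P Q R. chi P R * Gam A B C E P Q R) =
    of_nat d ^ 2 * (\<Sum>P\<in>S. tr (P * A) * tr (P * (B * (P * (C * (P * E))))))"
proof -
  have "(\<Sum>R\<in>S. chi P R * Gam A B C E P Q R) =
      of_nat d * (tr (P * A) * (tr (Q * B) * tr (P * (Q * (P * (C * (P * E)))))))"
    if [simp]: "P \<in> S" "Q \<in> S" for P Q
  proof -
    have "(\<Sum>R\<in>S. chi P R * Gam A B C E P Q R) =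
       tr (P * A) * (tr (Q * B) * (\<Sum>R\<in>S. chi P R * (tr (R * C) * tr ((P * Q) * (R * E)))))"
      by (simp add: Gam_def sum_distrib_left mult_ac)
    then show ?thesis by (subst (asm) sum_insert_chi) (simp_all add: mult_ac)
  qed
  then have "sum3 (\<lambda>P Q R. chi P R * Gam A B C E P Q R) =
      (\<Sum>P\<in>S. of_nat d * (tr (P * A) * (\<Sum>Q\<in>S. tr (Q * B) * tr (P * (Q * (P * (C * (P * E))))))))"
    by (simp add: sum_distrib_left)
  also have "\<dots> = (\<Sum>P\<in>S. of_nat d * (tr (P * A) * (of_nat d * tr (P * (B * (P * (C * (P * E))))))))"
    by (intro sum.cong refl) (subst sum_insert, auto)
  finally show ?thesis by (simp add: sum_distrib_left power2_eq_square mult_ac)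
qed

text \<open>The complementary exception to the permutation rule. Both signs involve
  \<open>Q\<close>, so this variable is summed first; a quartic sum with the roles shifted
  remains.\<close>

lemma sum3_xz: "sum3 (\<lambda>P Q R. chi P Q * (chi Q R * Gam A B C E P Q R)) =
    of_nat d ^ 2 * (\<Sum>R\<in>S. tr (R * C) * tr (R * (A * (R * (E * (R * B))))))"
proof -
  have "(\<Sum>Q\<in>S. chi P Q * (chi Q R * Gam A B C E P Q R)) =
      of_nat d * (tr (R * C) * (tr (P * A) * tr (P * (R * (E * (R * (B * R)))))))"
    if [simp]: "P \<in> S" "R \<in> S" for P R
  proof -
    have "chi P Q * (chi Q R * tr (P * (Q * (R * E)))) = chi R Q * tr (Q * (P * (R * E)))" if [simp]: "Q \<in> S" for Q
      using chi_tr[of P Q "R * E"] by (simp add: chi_sym mult_ac)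
    then have "(\<Sum>Q\<in>S. chi P Q * (chi Q R * Gam A B C E P Q R)) =
       tr (R * C) * (tr (P * A) * (\<Sum>Q\<in>S. chi R Q * (tr (Q * B) * tr (Q * (P * (R * E))))))"
      unfolding sum_distrib_left by (intro sum.cong refl) (simp add: Gam_def mult_ac)
    also have "\<dots> = tr (R * C) * (tr (P * A) * (of_nat d * tr (R * (B * (R * (P * (R * E)))))))"
      by (subst completeness_chi) auto
    also have "tr (R * (B * (R * (P * (R * E))))) = tr (P * (R * (E * (R * (B * R)))))"
      using tr_cyc[of "R * (B * R)" "P * (R * E)"] by simp
    finally show ?thesis by (simp add: mult_ac)
  qed
  note inner = this
  have "sum3 (\<lambda>P Q R. chi P Q * (chi Q R * Gam A B C E P Q R)) =
      (\<Sum>R\<in>S. \<Sum>P\<in>S. \<Sum>Q\<in>S. chi P Q * (chi Q R * Gam A B C E P Q R))"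
    by (subst sum_rotate[symmetric]) (rule refl)
  also have "\<dots> = (\<Sum>R\<in>S. of_nat d * (tr (R * C) * (\<Sum>P\<in>S. tr (P * A) * tr (P * (R * (E * (R * (B * R))))))))"
    by (simp add: inner sum_distrib_left)
  also have "\<dots> = (\<Sum>R\<in>S. of_nat d * (tr (R * C) * (of_nat d * tr (A * (R * (E * (R * (B * R))))))))"
    by (intro sum.cong refl) (subst completeness', auto)
  also have "\<dots> = (\<Sum>R\<in>S. of_nat d * (tr (R * C) * (of_nat d * tr (R * (A * (R * (E * (R * B))))))))"
  proof (intro sum.cong refl arg_cong2[where f="(*)"])
    fix R assume [simp]: "R \<in> S"
    show "tr (A * (R * (E * (R * (B * R))))) = tr (R * (A * (R * (E * (R * B)))))"
      using tr_cyc[of R "A * (R * (E * (R * B)))"] by simp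
  qed
  finally show ?thesis by (simp add: sum_distrib_left power2_eq_square mult_ac)
qed

lemma sum2_PQ: "(\<Sum>P\<in>S. \<Sum>R\<in>S. Gam A B C E P P R) = of_nat d ^ 2 * (tr (A * B) * tr (C * E))"
proof -
  have "(\<Sum>P\<in>S. \<Sum>R\<in>S. Gam A B C E P P R) = (\<Sum>P\<in>S. tr (P * A) * tr (P * B)) * (\<Sum>R\<in>S. tr (R * C) * tr (R * E))"
    unfolding sum_product by (intro sum.cong refl) (simp add: Gam_def mult_ac)
  then show ?thesis by (simp add: completeness' power2_eq_square mult_ac)
qed

lemma sum2_PQ_chi: "(\<Sum>P\<in>S. \<Sum>R\<in>S. chi P R * Gam A B C E P P R) =
    of_nat d * (\<Sum>P\<in>S. tr (P * A) * tr (P * B) * tr (P * (C * (P * E))))"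
proof -
  have "(\<Sum>P\<in>S. \<Sum>R\<in>S. chi P R * Gam A B C E P P R) =
      (\<Sum>P\<in>S. tr (P * A) * tr (P * B) * (\<Sum>R\<in>S. chi P R * (tr (R * C) * tr (R * E))))"
    unfolding sum_distrib_left by (intro sum.cong refl) (simp add: Gam_def mult_ac)
  then show ?thesis by (simp add: completeness_chi sum_distrib_left mult_ac)
qed

lemma sum2_QR: "(\<Sum>P\<in>S. \<Sum>Q\<in>S. Gam A B C E P Q Q) = of_nat d ^ 2 * (tr (A * E) * tr (B * C))"
proof -
  have "(\<Sum>P\<in>S. \<Sum>Q\<in>S. Gam A B C E P Q Q) = (\<Sum>P\<in>S. tr (P * A) * tr (P * E)) * (\<Sum>R\<in>S. tr (R * B) * tr (R * C))"
    unfolding sum_product by (intro sum.cong refl) (simp add: Gam_def mult_ac)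
  then show ?thesis by (simp add: completeness' power2_eq_square mult_ac)
qed

lemma sum2_QR_chi: "(\<Sum>P\<in>S. \<Sum>Q\<in>S. chi P Q * Gam A B C E P Q Q) =
    of_nat d * (\<Sum>Q\<in>S. tr (Q * B) * tr (Q * C) * tr (Q * (A * (Q * E))))"
proof -
  have "(\<Sum>P\<in>S. \<Sum>Q\<in>S. chi P Q * Gam A B C E P Q Q) =
      (\<Sum>Q\<in>S. tr (Q * B) * tr (Q * C) * (\<Sum>P\<in>S. chi Q P * (tr (P * A) * tr (P * E))))"
    unfolding sum_distrib_left by (subst sum.swap, intro sum.cong refl) (simp add: Gam_def mult_ac chi_sym)
  then show ?thesis by (simp add: completeness_chi sum_distrib_left mult_ac)
qed

text \<open>For equal outer factors the word is \<open>P * Q * P * E\<close>, in which the sign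
  \<open>chi P Q\<close> is already hidden. Hence the unsigned sum is quartic and the signed one a
  product of traces, opposite to the coincidences of neighbours.\<close>

lemma sum2_PR: "(\<Sum>P\<in>S. \<Sum>Q\<in>S. Gam A B C E P Q P) =
    of_nat d * (\<Sum>P\<in>S. tr (P * A) * tr (P * C) * tr (P * (B * (P * E))))"
proof -
  have "(\<Sum>P\<in>S. \<Sum>Q\<in>S. Gam A B C E P Q P) =
      (\<Sum>P\<in>S. tr (P * A) * tr (P * C) * (\<Sum>Q\<in>S. tr (Q * B) * tr (P * (Q * (P * E)))))"
    unfolding sum_distrib_left by (intro sum.cong refl) (simp add: Gam_def mult_ac)
  also have "\<dots> = (\<Sum>P\<in>S. tr (P * A) * tr (P * C) * (of_nat d * tr (P * (B * (P * E)))))"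
    by (intro sum.cong refl) (subst sum_insert, auto)
  finally show ?thesis by (simp add: sum_distrib_left mult_ac)
qed

lemma sum2_PR_chi: "(\<Sum>P\<in>S. \<Sum>Q\<in>S. chi P Q * Gam A B C E P Q P) = of_nat d ^ 2 * (tr (A * C) * tr (B * E))"
proof -
  have e: "chi P Q * tr (P * (Q * (P * E))) = tr (Q * E)" if "P \<in> S" "Q \<in> S" for P Q
    using that chi_tr[of P Q "P * E"] by simp
  have "(\<Sum>P\<in>S. \<Sum>Q\<in>S. chi P Q * Gam A B C E P Q P) = (\<Sum>P\<in>S. \<Sum>Q\<in>S. tr (P * A) * (tr (Q * B) * (tr (P * C) * tr (Q * E))))"
    by (intro sum.cong refl) (simp add: Gam_def e[symmetric])
  also have "\<dots> = (\<Sum>P\<in>S. tr (P * A) * tr (P * C)) * (\<Sum>R\<in>S. tr (R * B) * tr (R * E))"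
    unfolding sum_product by (intro sum.cong refl) (simp add: mult_ac)
  finally show ?thesis by (simp add: completeness' power2_eq_square mult_ac)
qed

lemma sum1_PPP: "(\<Sum>P\<in>S. Gam A B C E P P P) = (\<Sum>P\<in>S. tr (P * A) * tr (P * B) * (tr (P * C) * tr (P * E)))"
  by (intro sum.cong refl) (simp add: Gam_def mult_ac)

lemma sum2_P1: "(\<Sum>Q\<in>S. \<Sum>R\<in>S. Gam A B C E (1\<^sub>m d) Q R) = of_nat d ^ 2 * (tr A * tr (B * (C * E)))"
proof -
  have "(\<Sum>R\<in>S. Gam A B C E (1\<^sub>m d) Q R) = tr A * (tr (Q * B) * (of_nat d * tr (Q * (C * E))))" if [simp]: "Q \<in> S" for Q
    by (subst sum_insert[symmetric]) (auto simp: Gam_def sum_distrib_left)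
  then have "(\<Sum>Q\<in>S. \<Sum>R\<in>S. Gam A B C E (1\<^sub>m d) Q R) = of_nat d * (tr A * (\<Sum>Q\<in>S. tr (Q * B) * tr (Q * (C * E))))"
    by (simp add: sum_distrib_left mult_ac)
  then show ?thesis by (simp add: completeness' power2_eq_square mult_ac)
qed

lemma sum2_R1: "(\<Sum>P\<in>S. \<Sum>Q\<in>S. Gam A B C E P Q (1\<^sub>m d)) = of_nat d ^ 2 * (tr C * tr (A * (B * E)))"
proof -
  have "(\<Sum>Q\<in>S. Gam A B C E P Q (1\<^sub>m d)) = tr C * (tr (P * A) * (of_nat d * tr (P * (B * E))))" if [simp]: "P \<in> S" for P
    by (subst sum_insert[symmetric]) (auto simp: Gam_def sum_distrib_left mult_ac)
  then have "(\<Sum>P\<in>S. \<Sum>Q\<in>S. Gam A B C E P Q (1\<^sub>m d)) = of_nat d * (tr C * (\<Sum>P\<in>S. tr (P * A) * tr (P * (B * E))))"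
    by (simp add: sum_distrib_left mult_ac)
  then show ?thesis by (simp add: completeness' power2_eq_square mult_ac)
qed

lemma sum1_P1R1: "(\<Sum>Q\<in>S. Gam A B C E (1\<^sub>m d) Q (1\<^sub>m d)) = of_nat d * (tr A * tr C * tr (B * E))"
proof -
  have "(\<Sum>Q\<in>S. Gam A B C E (1\<^sub>m d) Q (1\<^sub>m d)) = tr A * tr C * (\<Sum>Q\<in>S. tr (Q * B) * tr (Q * E))"
    unfolding sum_distrib_left by (intro sum.cong refl) (simp add: Gam_def mult_ac)
  then show ?thesis by (simp add: completeness' mult_ac)
qed

end

context
  fixes A B C E assumes A [simp]: "A \<in> M" and B [simp]: "B \<in> M" and C [simp]: "C \<in> M" and E [simp]: "E \<in> M"
begin

lemma sum2_P1_chi: "(\<Sum>Q\<in>S. \<Sum>R\<in>S. chi Q R * Gam A B C E (1\<^sub>m d) Q R) = of_nat d ^ 2 * (tr A * tr (C * (B * E)))"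
proof -
  have "(\<Sum>Q\<in>S. \<Sum>R\<in>S. chi Q R * Gam A B C E (1\<^sub>m d) Q R) = (\<Sum>Q\<in>S. \<Sum>R\<in>S. Gam A C B E (1\<^sub>m d) R Q)"
    by (intro sum.cong refl) (simp add: Gam_z one_S)
  then show ?thesis by (subst (asm) sum.swap) (simp add: sum2_P1)
qed

lemma sum2_R1_chi: "(\<Sum>P\<in>S. \<Sum>Q\<in>S. chi P Q * Gam A B C E P Q (1\<^sub>m d)) = of_nat d ^ 2 * (tr C * tr (B * (A * E)))"
proof -
  have "(\<Sum>P\<in>S. \<Sum>Q\<in>S. chi P Q * Gam A B C E P Q (1\<^sub>m d)) = (\<Sum>P\<in>S. \<Sum>Q\<in>S. Gam B A C E Q P (1\<^sub>m d))"
    by (intro sum.cong refl) (simp add: Gam_x one_S)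
  then show ?thesis by (subst (asm) sum.swap) (simp add: sum2_R1)
qed

end

section \<open>The kernel of a traceless involution and its sums\<close>

lemma sum3_sum: "sum3 (\<lambda>P Q R. \<Sum>X\<in>S. f X P Q R) = (\<Sum>X\<in>S. sum3 (f X))"
proof -
  have "sum3 (\<lambda>P Q R. \<Sum>X\<in>S. f X P Q R) = (\<Sum>P\<in>S. \<Sum>Q\<in>S. \<Sum>X\<in>S. \<Sum>R\<in>S. f X P Q R)"
    by (intro sum.cong refl sum.swap)
  also have "\<dots> = (\<Sum>P\<in>S. \<Sum>X\<in>S. \<Sum>Q\<in>S. \<Sum>R\<in>S. f X P Q R)"
    by (intro sum.cong refl sum.swap)
  also have "\<dots> = (\<Sum>X\<in>S. sum3 (f X))"
    by (rule sum.swap)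
  finally show ?thesis .
qed

lemma sum2_sum: "(\<Sum>P\<in>S. \<Sum>Q\<in>S. \<Sum>X\<in>S. f X P Q) = (\<Sum>X\<in>S. \<Sum>P\<in>S. \<Sum>Q\<in>S. f X P Q)"
  by (rule sum_rotate[symmetric])

text \<open>Twice \<open>d\<close> times the 4-linear form \<open>\<prod>\<^sub>i tr (W A\<^sub>i) + (tr (W A\<^sub>1 W A\<^sub>2) tr (W A\<^sub>3) tr (W A\<^sub>4) + tr (W A\<^sub>2 W A\<^sub>3) tr (W A\<^sub>1) tr (W A\<^sub>4)) / 2\<close>
  at \<open>(P, Q, R, PQR)\<close>; the symmetrization in the second term makes the class sums below symmetric.\<close>
definition kap :: "complex mat \<Rightarrow> complex mat \<Rightarrow> complex mat \<Rightarrow> complex mat \<Rightarrow> complex" where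
  "kap W P Q R = 2 * of_nat d * Gam W W W W P Q R +
     (\<Sum>X\<in>S. Gam (W * X) (W * X) W W P Q R + Gam W (W * X) (W * X) W P Q R)"

text \<open>Fourth-order Pauli sums of \<open>W\<close>; \<open>q4\<close> is the fourth moment of
  its Pauli coefficients, the quantity behind stabilizer entropies. All sums of \<open>kap\<close>
  against products of signs are affine in \<open>q4\<close>, \<open>q2\<close> and
  \<open>q3\<close>, so these are all that a layer contributes.\<close>

definition q4 :: "complex mat \<Rightarrow> complex" where
  "q4 W = (\<Sum>P\<in>S. tr (P * W) ^ 4)"
definition q2 :: "complex mat \<Rightarrow> complex" where
  "q2 W = (\<Sum>P\<in>S. tr (P * W) ^ 2 * tr (P * (W * (P * W))))"
definition q3 :: "complex mat \<Rightarrow> complex" where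
  "q3 W = (\<Sum>P\<in>S. tr (P * W) * tr (P * (W * (P * (W * (P * W))))))"

text \<open>The intended \<open>W\<close> is \<open>adj T * (V * T)\<close> with a Pauli operator
  \<open>V\<close> other than the identity.\<close>

context
  fixes W assumes W [simp]: "W \<in> M" and W2: "W * W = 1\<^sub>m d" and W0: "tr W = 0"
begin

lemma W_cancel [simp]: "A \<in> M \<Longrightarrow> W * (W * A) = A"
  using mult_assoc_M[of W W A] W2 by simp

lemmas W_simps [simp] = W2 W0

lemma S_comp1: "X \<in> S \<Longrightarrow> tr (W * (X * W)) = tr X"
  using tr_cyc[of W "X * W"] by simp

lemma sum_trX [simp]: "(\<Sum>X\<in>S. tr X * tr X) = of_nat d ^ 2"
proof -
  have "(\<Sum>X\<in>S. tr X * tr X) = (\<Sum>X\<in>S. if X = 1\<^sub>m d then of_nat d ^ 2 else 0)"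
    by (intro sum.cong refl) (simp add: tr_S power2_eq_square)
  then show ?thesis using one_S finite_S by simp
qed

lemma sum_XWXW [simp]:
  "(\<Sum>X\<in>S. tr (X * (W * (X * W)))) = 0"
  "(\<Sum>X\<in>S. tr (W * (X * (W * X)))) = 0"
proof -
  show a: "(\<Sum>X\<in>S. tr (X * (W * (X * W)))) = 0"
    using completeness_split[of W W] by simp
  have "(\<Sum>X\<in>S. tr (W * (X * (W * X)))) = (\<Sum>X\<in>S. tr (X * (W * (X * W))))"
  proof (intro sum.cong refl)
    fix X assume "X \<in> S"
    then show "tr (W * (X * (W * X))) = tr (X * (W * (X * W)))"
      using tr_cyc[of W "X * (W * X)"] by simp
  qed
  with a show "(\<Sum>X\<in>S. tr (W * (X * (W * X)))) = 0" by simp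
qed

lemma kap_split: "c * kap W P Q R = 2 * of_nat d * (c * Gam W W W W P Q R) +
    ((\<Sum>X\<in>S. c * Gam (W * X) (W * X) W W P Q R) + (\<Sum>X\<in>S. c * Gam W (W * X) (W * X) W P Q R))"
  by (simp add: kap_def distrib_left sum.distrib sum_distrib_left)

lemma sum3_kap:
  "sum3 (\<lambda>P Q R. c P Q R * kap W P Q R) =
     2 * of_nat d * sum3 (\<lambda>P Q R. c P Q R * Gam W W W W P Q R) +
     ((\<Sum>X\<in>S. sum3 (\<lambda>P Q R. c P Q R * Gam (W * X) (W * X) W W P Q R)) +
      (\<Sum>X\<in>S. sum3 (\<lambda>P Q R. c P Q R * Gam W (W * X) (W * X) W P Q R)))"
  unfolding kap_split sum.distrib
  by (subst (1 2) sum3_sum) (simp only: sum_distrib_left)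

lemma sum2_kap:
  "(\<Sum>P\<in>S. \<Sum>Q\<in>S. c P Q * kap W (u P Q) (v P Q) (w P Q)) =
     2 * of_nat d * (\<Sum>P\<in>S. \<Sum>Q\<in>S. c P Q * Gam W W W W (u P Q) (v P Q) (w P Q)) +
     ((\<Sum>X\<in>S. \<Sum>P\<in>S. \<Sum>Q\<in>S. c P Q * Gam (W * X) (W * X) W W (u P Q) (v P Q) (w P Q)) +
      (\<Sum>X\<in>S. \<Sum>P\<in>S. \<Sum>Q\<in>S. c P Q * Gam W (W * X) (W * X) W (u P Q) (v P Q) (w P Q)))"
  unfolding kap_split sum.distrib
  by (subst (1 2) sum2_sum) (simp only: sum_distrib_left)

text \<open>In this and the next lemmas the two sums over \<open>X\<close> each become a sum of
  traces of one fixed word. Either \<open>W\<close> separates the two occurrences of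
  \<open>X\<close>, and the twirl gives 0 because \<open>tr W = 0\<close>, or they cancel and each
  of the \<open>d ^ 2\<close> operators contributes \<open>tr 1 = d\<close>. The latter case
  produces the extra \<open>d ^ 6\<close> in four of the sums.\<close>

lemma kap_1: "sum3 (\<lambda>P Q R. kap W P Q R) = 2 * of_nat d ^ 5"
  unfolding sum3_kap[of "\<lambda>P Q R. 1", unfolded mult.assoc mult_1]
  by (simp add: sum3_Gam, (simp add: sum_distrib_left[symmetric] card_S power_numeral_reduce)?)

lemma kap_xyz: "sum3 (\<lambda>P Q R. chi P Q * (chi P R * (chi Q R * kap W P Q R))) = 2 * of_nat d ^ 5"
  unfolding sum3_kap[of "\<lambda>P Q R. chi P Q * (chi P R * chi Q R)", unfolded mult.assoc mult_1]
  by (simp add: sum3_xyz, (simp add: sum_distrib_left[symmetric] card_S power_numeral_reduce)?)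

lemma kap_x: "sum3 (\<lambda>P Q R. chi P Q * kap W P Q R) = 2 * of_nat d ^ 5 + of_nat d ^ 6"
  unfolding sum3_kap[of "\<lambda>P Q R. chi P Q", unfolded mult.assoc mult_1]
  by (simp add: sum3_x, (simp add: sum_distrib_left[symmetric] card_S power_numeral_reduce)?)

lemma kap_z: "sum3 (\<lambda>P Q R. chi Q R * kap W P Q R) = 2 * of_nat d ^ 5 + of_nat d ^ 6"
  unfolding sum3_kap[of "\<lambda>P Q R. chi Q R", unfolded mult.assoc mult_1]
  by (simp add: sum3_z, (simp add: sum_distrib_left[symmetric] card_S power_numeral_reduce)?)

lemma kap_xy: "sum3 (\<lambda>P Q R. chi P Q * (chi P R * kap W P Q R)) = 2 * of_nat d ^ 5 + of_nat d ^ 6"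
  unfolding sum3_kap[of "\<lambda>P Q R. chi P Q * chi P R", unfolded mult.assoc mult_1]
  by (simp add: sum3_xy, (simp add: sum_distrib_left[symmetric] card_S power_numeral_reduce)?)

lemma kap_yz: "sum3 (\<lambda>P Q R. chi P R * (chi Q R * kap W P Q R)) = 2 * of_nat d ^ 5 + of_nat d ^ 6"
  unfolding sum3_kap[of "\<lambda>P Q R. chi P R * chi Q R", unfolded mult.assoc mult_1]
  by (simp add: sum3_yz, (simp add: sum_distrib_left[symmetric] card_S power_numeral_reduce)?)

lemma rot_WX: "A \<in> M \<Longrightarrow> P \<in> S \<Longrightarrow> X \<in> S \<Longrightarrow> tr (P * (W * (X * A))) = tr (X * (A * (P * W)))"
  using tr_cyc[of "P * W" "X * A"] by simp

lemma rot_WX': "P \<in> S \<Longrightarrow> X \<in> S \<Longrightarrow> tr (P * (W * X)) = tr (X * (P * W))"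
  using tr_cyc[of "P * W" "X"] by simp

text \<open>Summing over \<open>X\<close> first merges the two traces into one alternating product
  with four factors \<open>P\<close> and four factors \<open>W\<close>, which
  \<open>four_cycle_sum\<close> turns into \<open>q2\<close>.\<close>

lemma sumX_a:
  "(\<Sum>X\<in>S. \<Sum>P\<in>S. tr (P * (W * X)) * tr (P * (W * (X * (P * (W * (P * W))))))) = of_nat d * q2 W"
proof -
  have "(\<Sum>X\<in>S. \<Sum>P\<in>S. tr (P * (W * X)) * tr (P * (W * (X * (P * (W * (P * W))))))) =
      (\<Sum>P\<in>S. \<Sum>X\<in>S. tr (X * (P * W)) * tr (X * (P * (W * (P * (W * (P * W)))))))"
    by (subst sum.swap, intro sum.cong refl) (simp add: rot_WX rot_WX')
  also have "\<dots> = (\<Sum>P\<in>S. of_nat d * tr (P * (W * (P * (W * (P * (W * (P * W))))))))"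
    by (intro sum.cong refl) (subst completeness', auto)
  also have "\<dots> = of_nat d * q2 W"
    unfolding sum_distrib_left[symmetric] by (subst four_cycle_sum) (auto simp: q2_def power2_eq_square)
  finally show ?thesis .
qed

lemma sumX_a':
  "(\<Sum>X\<in>S. \<Sum>P\<in>S. tr (P * (W * X)) * tr (P * (W * (P * (W * (P * (W * X))))))) = of_nat d * q2 W"
proof -
  have e: "tr (P * (W * (P * (W * (P * (W * X)))))) = tr (X * (P * (W * (P * (W * (P * W))))))" if "P \<in> S" "X \<in> S" for P X
    using that tr_cyc[of "P * (W * (P * (W * (P * W))))" X] by simp
  have "(\<Sum>X\<in>S. \<Sum>P\<in>S. tr (P * (W * X)) * tr (P * (W * (P * (W * (P * (W * X))))))) =
      (\<Sum>P\<in>S. \<Sum>X\<in>S. tr (X * (P * W)) * tr (X * (P * (W * (P * (W * (P * W)))))))"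
    by (subst sum.swap, intro sum.cong refl) (simp add: e rot_WX')
  also have "\<dots> = (\<Sum>P\<in>S. of_nat d * tr (P * (W * (P * (W * (P * (W * (P * W))))))))"
    by (intro sum.cong refl) (subst completeness', auto)
  also have "\<dots> = of_nat d * q2 W"
    unfolding sum_distrib_left[symmetric] by (subst four_cycle_sum) (auto simp: q2_def power2_eq_square)
  finally show ?thesis .
qed

lemma sumX_b:
  "(\<Sum>X\<in>S. \<Sum>P\<in>S. tr (P * W) * tr (P * (W * (X * (P * (W * (X * (P * W)))))))) = of_nat d * q2 W"
proof -
  have "(\<Sum>X\<in>S. \<Sum>P\<in>S. tr (P * W) * tr (P * (W * (X * (P * (W * (X * (P * W)))))))) =
      (\<Sum>P\<in>S. tr (P * W) * (\<Sum>X\<in>S. tr (X * (P * W) * (X * (P * (W * (P * W)))))))"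
    unfolding sum_distrib_left by (subst sum.swap, intro sum.cong refl) (simp add: rot_WX)
  also have "\<dots> = (\<Sum>P\<in>S. tr (P * W) * (of_nat d * tr (P * W) * tr (P * (W * (P * W)))))"
    by (intro sum.cong refl) (subst completeness_split, auto)
  finally show ?thesis by (simp add: q2_def sum_distrib_left power2_eq_square mult_ac)
qed

lemma sumX_b':
  "(\<Sum>X\<in>S. \<Sum>P\<in>S. tr (P * W) * tr (P * (W * (X * (P * (W * (P * (W * X)))))))) = of_nat d * q2 W"
proof -
  have e: "tr (P * (W * (X * (P * (W * (P * (W * X))))))) = tr (X * (P * (W * (P * W))) * (X * (P * W)))" if "P \<in> S" "X \<in> S" for P X
    using that tr_cyc[of "P * W" "X * (P * (W * (P * (W * X))))"] by simp
  have "(\<Sum>X\<in>S. \<Sum>P\<in>S. tr (P * W) * tr (P * (W * (X * (P * (W * (P * (W * X)))))))) =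
      (\<Sum>P\<in>S. tr (P * W) * (\<Sum>X\<in>S. tr (X * (P * (W * (P * W))) * (X * (P * W)))))"
    unfolding sum_distrib_left by (subst sum.swap, intro sum.cong refl) (simp only: e)
  also have "\<dots> = (\<Sum>P\<in>S. tr (P * W) * (of_nat d * tr (P * (W * (P * W))) * tr (P * W)))"
    by (intro sum.cong refl) (subst completeness_split, auto)
  finally show ?thesis by (simp add: q2_def sum_distrib_left power2_eq_square mult_ac)
qed

lemma sumX_c: "(\<Sum>X\<in>S. \<Sum>P\<in>S. tr (P * (W * X)) * (tr (P * W) * tr (P * (W * (X * (P * W)))))) = of_nat d * q3 W"
proof -
  have "(\<Sum>X\<in>S. \<Sum>P\<in>S. tr (P * (W * X)) * (tr (P * W) * tr (P * (W * (X * (P * W)))))) =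
      (\<Sum>P\<in>S. tr (P * W) * (\<Sum>X\<in>S. tr (X * (P * W)) * tr (X * (P * (W * (P * W))))))"
    unfolding sum_distrib_left by (subst sum.swap, intro sum.cong refl) (simp add: rot_WX rot_WX')
  also have "\<dots> = (\<Sum>P\<in>S. tr (P * W) * (of_nat d * tr (P * (W * (P * (W * (P * W)))))))"
    by (intro sum.cong refl) (subst completeness', auto)
  finally show ?thesis by (simp add: q3_def sum_distrib_left mult_ac)
qed

lemma sumX_d: "A \<in> S \<rightarrow> UNIV \<Longrightarrow> (\<Sum>X\<in>S. \<Sum>P\<in>S. tr (P * (W * X)) * (tr (P * (W * X)) * A P)) = of_nat d * (\<Sum>P\<in>S. tr (P * (W * (P * W))) * A P)"
proof -
  have "(\<Sum>X\<in>S. \<Sum>P\<in>S. tr (P * (W * X)) * (tr (P * (W * X)) * A P)) =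
      (\<Sum>P\<in>S. A P * (\<Sum>X\<in>S. tr (X * (P * W)) * tr (X * (P * W))))"
    unfolding sum_distrib_left by (subst sum.swap, intro sum.cong refl) (simp add: rot_WX')
  also have "\<dots> = (\<Sum>P\<in>S. A P * (of_nat d * tr (P * (W * (P * W)))))"
    by (intro sum.cong refl) (subst completeness', auto)
  finally show ?thesis by (simp add: sum_distrib_left mult_ac)
qed

lemma sum_split_sq: "(\<Sum>P\<in>S. tr (P * (W * (P * W))) * tr (P * (W * (P * W)))) = q4 W"
  using fourier_isometry[of W W W W] by (simp add: q4_def power4_eq_xxxx mult.assoc)

lemma kap_y: "sum3 (\<lambda>P Q R. chi P R * kap W P Q R) = 2 * of_nat d ^ 3 * (q2 W + q3 W)"
  unfolding sum3_kap[of "\<lambda>P Q R. chi P R", unfolded mult.assoc mult_1]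
  by (simp add: sum3_y sum_distrib_left[symmetric] sumX_a sumX_b q3_def[symmetric])
     (simp add: algebra_simps power2_eq_square power3_eq_cube)

lemma kap_xz: "sum3 (\<lambda>P Q R. chi P Q * (chi Q R * kap W P Q R)) = 2 * of_nat d ^ 3 * (q2 W + q3 W)"
  unfolding sum3_kap[of "\<lambda>P Q R. chi P Q * chi Q R", unfolded mult.assoc mult_1]
  by (simp add: sum3_xz, simp add: sum_distrib_left[symmetric] sumX_a' sumX_b' q3_def[symmetric])
     (simp add: algebra_simps power2_eq_square power3_eq_cube)

lemma kap_PQ: "(\<Sum>P\<in>S. \<Sum>R\<in>S. kap W P P R) = 2 * of_nat d ^ 5 + of_nat d ^ 4"
  unfolding sum2_kap[of "\<lambda>P R. 1" "\<lambda>P R. P" "\<lambda>P R. P" "\<lambda>P R. R", unfolded mult_1]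
  by (simp add: sum2_PQ S_comp1, (simp add: sum_distrib_left[symmetric] sum_distrib_right[symmetric] card_S power_numeral_reduce)?)

lemma kap_QR: "(\<Sum>P\<in>S. \<Sum>Q\<in>S. kap W P Q Q) = 2 * of_nat d ^ 5 + of_nat d ^ 4"
  unfolding sum2_kap[of "\<lambda>P Q. 1" "\<lambda>P Q. P" "\<lambda>P Q. Q" "\<lambda>P Q. Q", unfolded mult_1]
  by (simp add: sum2_QR S_comp1, (simp add: sum_distrib_left[symmetric] sum_distrib_right[symmetric] card_S power_numeral_reduce)?)

lemma kap_PR_chi: "(\<Sum>P\<in>S. \<Sum>Q\<in>S. chi P Q * kap W P Q P) = 2 * of_nat d ^ 5 + 2 * of_nat d ^ 4"
  unfolding sum2_kap[of "\<lambda>P Q. chi P Q" "\<lambda>P Q. P" "\<lambda>P Q. Q" "\<lambda>P Q. P", unfolded mult_1]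
  by (simp add: sum2_PR_chi S_comp1, (simp add: sum_distrib_left[symmetric] sum_distrib_right[symmetric] card_S power_numeral_reduce)?)

lemma kap_PQ_chi: "(\<Sum>P\<in>S. \<Sum>R\<in>S. chi P R * kap W P P R) = of_nat d ^ 2 * (2 * q2 W + q4 W + q3 W)"
  unfolding sum2_kap[of "\<lambda>P R. chi P R" "\<lambda>P R. P" "\<lambda>P R. P" "\<lambda>P R. R"]
  by (simp add: sum2_PQ_chi sum_distrib_left[symmetric])
     (simp add: mult.assoc mult.left_commute[of "tr (_ * W)" "tr (_ * (W * _))"] sumX_c sumX_d sum_split_sq,
      simp add: q2_def algebra_simps power2_eq_square)

lemma kap_QR_chi: "(\<Sum>P\<in>S. \<Sum>Q\<in>S. chi P Q * kap W P Q Q) = of_nat d ^ 2 * (2 * q2 W + q4 W + q3 W)"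
  unfolding sum2_kap[of "\<lambda>P Q. chi P Q" "\<lambda>P Q. P" "\<lambda>P Q. Q" "\<lambda>P Q. Q"]
  by (simp add: sum2_QR_chi sum_distrib_left[symmetric])
     (simp add: mult.assoc mult.left_commute[of "tr (_ * W)" "tr (_ * (W * _))"] sumX_c sumX_d sum_split_sq,
      simp add: q2_def algebra_simps power2_eq_square)

lemma kap_PR: "(\<Sum>P\<in>S. \<Sum>Q\<in>S. kap W P Q P) = 2 * of_nat d ^ 2 * (q2 W + q3 W)"
  unfolding sum2_kap[of "\<lambda>P Q. 1" "\<lambda>P Q. P" "\<lambda>P Q. Q" "\<lambda>P Q. P", unfolded mult_1]
  by (simp add: sum2_PR sum_distrib_left[symmetric])
     (simp add: mult.assoc mult.left_commute[of "tr (_ * W)" "tr (_ * (W * _))"] sumX_c,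
      simp add: q2_def algebra_simps power2_eq_square)

lemma kap_PPP: "(\<Sum>P\<in>S. kap W P P P) = 2 * of_nat d * (q4 W + q2 W)"
proof -
  have "(\<Sum>P\<in>S. kap W P P P) = 2 * of_nat d * (\<Sum>P\<in>S. Gam W W W W P P P) +
     ((\<Sum>X\<in>S. \<Sum>P\<in>S. Gam (W * X) (W * X) W W P P P) + (\<Sum>X\<in>S. \<Sum>P\<in>S. Gam W (W * X) (W * X) W P P P))"
    unfolding kap_def sum.distrib sum_distrib_left[symmetric] by (subst (1 2) sum.swap) (rule refl)
  also have "(\<Sum>P\<in>S. Gam W W W W P P P) = q4 W"
    by (simp add: sum1_PPP q4_def power4_eq_xxxx mult.assoc)
  also have "(\<Sum>X\<in>S. \<Sum>P\<in>S. Gam (W * X) (W * X) W W P P P) = of_nat d * q2 W"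
    by (simp add: sum1_PPP mult.assoc sumX_d) (simp add: q2_def power2_eq_square mult_ac)
  also have "(\<Sum>X\<in>S. \<Sum>P\<in>S. Gam W (W * X) (W * X) W P P P) = of_nat d * q2 W"
    by (simp add: sum1_PPP mult.assoc mult.left_commute[of "tr (_ * W)" "tr (_ * (W * _))"] sumX_d)
       (simp add: q2_def power2_eq_square mult_ac)
  finally show ?thesis by (simp add: algebra_simps)
qed

text \<open>This is the form in which the kernel arises when the 4-linear form is expanded. The
  definition as a sum of \<open>Gam\<close> is the form in which its sums against signs can be
  evaluated.\<close>

lemma kap_eq:
  assumes [simp]: "P \<in> S" "Q \<in> S" "R \<in> S"
  shows "kap W P Q R = of_nat d * tr (P * (Q * (R * W))) *
    (2 * tr (P * W) * tr (Q * W) * tr (R * W) + tr (P * (W * (Q * W))) * tr (R * W) + tr (Q * (W * (R * W))) * tr (P * W))"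
proof -
  have e: "(\<Sum>X\<in>S. tr (A * (W * X)) * tr (B * (W * X))) = of_nat d * tr (A * (W * (B * W)))"
    if "A \<in> S" "B \<in> S" for A B
    using that by (simp add: rot_WX' completeness')
  have "(\<Sum>X\<in>S. Gam (W * X) (W * X) W W P Q R) = tr (R * W) * tr (P * (Q * (R * W))) * (\<Sum>X\<in>S. tr (P * (W * X)) * tr (Q * (W * X)))"
    unfolding sum_distrib_left by (intro sum.cong refl) (simp add: Gam_def mult_ac)
  moreover have "(\<Sum>X\<in>S. Gam W (W * X) (W * X) W P Q R) = tr (P * W) * tr (P * (Q * (R * W))) * (\<Sum>X\<in>S. tr (Q * (W * X)) * tr (R * (W * X)))"
    unfolding sum_distrib_left by (intro sum.cong refl) (simp add: Gam_def mult_ac)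
  ultimately show ?thesis by (simp add: kap_def sum.distrib e Gam_def algebra_simps)
qed

text \<open>In \<open>kap_eq\<close> every term then contains a factor \<open>tr W\<close> or
  \<open>tr Q\<close>. In the last case \<open>P * (Q * R)\<close> is a scalar, so the common factor
  \<open>tr (P * (Q * (R * W)))\<close> is a multiple of \<open>tr W\<close>.\<close>

lemma kap_vanish:
  assumes P [simp]: "P \<in> S" and Q [simp]: "Q \<in> S" and R [simp]: "R \<in> S" and Q1: "Q \<noteq> 1\<^sub>m d"
    and h: "P = 1\<^sub>m d \<or> R = 1\<^sub>m d \<or> tr (P * (Q * R)) \<noteq> 0"
  shows "kap W P Q R = 0"
proof -
  have trQ: "tr Q = 0" using Q1 by (simp add: tr_S)
  consider "P = 1\<^sub>m d" | "R = 1\<^sub>m d" | "tr (P * (Q * R)) \<noteq> 0" using h by blast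
  then show ?thesis
  proof cases
    case 1
    then show ?thesis unfolding kap_eq[OF P Q R] by (simp add: S_comp1 trQ)
  next
    case 2
    then show ?thesis unfolding kap_eq[OF P Q R] by (simp add: trQ)
  next
    case 3
    obtain X c where X: "X \<in> S" "Q * R = c \<cdot>\<^sub>m X" using S_mult[OF Q R] by blast
    have "tr (P * (Q * R)) = c * tr (P * X)" using X by simp
    with 3 X have "P = X" by (auto simp: tr_S2 split: if_splits)
    have "P * (Q * (R * W)) = P * ((Q * R) * W)" by simp
    also have "\<dots> = c \<cdot>\<^sub>m W" unfolding X(2) using \<open>P = X\<close> X(1) by simp
    finally show ?thesis unfolding kap_eq[OF P Q R] by simp
  qed
qed

text \<open>The exceptional slice on which the kernel survives outside \<open>supp\<close>. It will
  be cut off in \<open>kap1\<close>, and the sums over it must be subtracted.\<close>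

lemma kap_Q1: "P \<in> S \<Longrightarrow> R \<in> S \<Longrightarrow> kap W P (1\<^sub>m d) R =
    (if P = 1\<^sub>m d then of_nat d ^ 2 * (tr (R * W) * tr (R * W)) else 0) + (if R = 1\<^sub>m d then of_nat d ^ 2 * (tr (P * W) * tr (P * W)) else 0)"
  by (subst kap_eq) (auto simp: one_S tr_S S_comp1 power2_eq_square algebra_simps)

lemma sum_kap_Q1:
  assumes "\<And>R. R \<in> S \<Longrightarrow> c (1\<^sub>m d) R = 1" "\<And>P. P \<in> S \<Longrightarrow> c P (1\<^sub>m d) = 1"
  shows "(\<Sum>P\<in>S. \<Sum>R\<in>S. c P R * kap W P (1\<^sub>m d) R) = 2 * of_nat d ^ 4"
proof -
  have "c P R * kap W P (1\<^sub>m d) R = (if P = 1\<^sub>m d then of_nat d ^ 2 * (tr (R * W) * tr (R * W)) else 0) +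
       (if R = 1\<^sub>m d then of_nat d ^ 2 * (tr (P * W) * tr (P * W)) else 0)" if "P \<in> S" "R \<in> S" for P R
    using that assms by (auto simp: kap_Q1)
  then have "(\<Sum>P\<in>S. \<Sum>R\<in>S. c P R * kap W P (1\<^sub>m d) R) =
      (\<Sum>P\<in>S. if P = 1\<^sub>m d then (\<Sum>R\<in>S. of_nat d ^ 2 * (tr (R * W) * tr (R * W))) else 0) +
      (\<Sum>P\<in>S. \<Sum>R\<in>S. if R = 1\<^sub>m d then of_nat d ^ 2 * (tr (P * W) * tr (P * W)) else 0)"
    by (simp add: sum.distrib) (intro sum.cong refl, simp)
  also have "\<dots> = 2 * of_nat d ^ 4"
    using finite_S one_S by (simp add: sum_distrib_left[symmetric] completeness' power_numeral_reduce)
  finally show ?thesis .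
qed

lemma sum_kap_PQ1: "(\<Sum>R\<in>S. kap W (1\<^sub>m d) (1\<^sub>m d) R) = of_nat d ^ 4"
proof -
  have "(\<Sum>R\<in>S. kap W (1\<^sub>m d) (1\<^sub>m d) R) = (\<Sum>R\<in>S. of_nat d ^ 2 * (tr (R * W) * tr (R * W)))"
    by (intro sum.cong refl) (auto simp: kap_Q1 one_S)
  then show ?thesis by (simp add: sum_distrib_left[symmetric] completeness' power_numeral_reduce)
qed

lemma sum_kap_QR1: "(\<Sum>P\<in>S. kap W P (1\<^sub>m d) (1\<^sub>m d)) = of_nat d ^ 4"
proof -
  have "(\<Sum>P\<in>S. kap W P (1\<^sub>m d) (1\<^sub>m d)) = (\<Sum>R\<in>S. of_nat d ^ 2 * (tr (R * W) * tr (R * W)))"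
    by (intro sum.cong refl) (auto simp: kap_Q1 one_S)
  then show ?thesis by (simp add: sum_distrib_left[symmetric] completeness' power_numeral_reduce)
qed

lemma kap_P1P: "P \<in> S \<Longrightarrow> kap W P (1\<^sub>m d) P = 0"
  by (simp add: kap_Q1)

end

section \<open>Classes of Pauli triples\<close>

definition supp :: "complex mat \<Rightarrow> complex mat \<Rightarrow> complex mat \<Rightarrow> bool" where
  "supp P Q R \<longleftrightarrow> P \<noteq> 1\<^sub>m d \<and> Q \<noteq> 1\<^sub>m d \<and> R \<noteq> 1\<^sub>m d \<and> tr (P * (Q * R)) = 0"

text \<open>Linear independence over the field with two elements, when products modulo phases are
  read as sums.\<close>

definition ind :: "complex mat \<Rightarrow> complex mat \<Rightarrow> complex mat \<Rightarrow> bool" where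
  "ind P Q R \<longleftrightarrow> supp P Q R \<and> P \<noteq> Q \<and> Q \<noteq> R \<and> P \<noteq> R"

definition isum :: "(complex mat \<Rightarrow> complex mat \<Rightarrow> complex mat \<Rightarrow> complex) \<Rightarrow> complex" where
  "isum f = sum3 (\<lambda>P Q R. if ind P Q R then f P Q R else 0)"

definition psum :: "(complex mat \<Rightarrow> complex mat \<Rightarrow> complex) \<Rightarrow> complex" where
  "psum f = (\<Sum>P\<in>S. \<Sum>Q\<in>S. if P \<noteq> 1\<^sub>m d \<and> Q \<noteq> 1\<^sub>m d \<and> P \<noteq> Q then f P Q else 0)"

definition usum :: "(complex mat \<Rightarrow> complex) \<Rightarrow> complex" where
  "usum f = (\<Sum>P\<in>S. if P \<noteq> 1\<^sub>m d then f P else 0)"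

lemma isum_add: "isum (\<lambda>P Q R. f P Q R + g P Q R) = isum f + isum g"
  unfolding isum_def sum.distrib[symmetric] by (intro sum.cong refl) auto

lemma isum_cmult: "isum (\<lambda>P Q R. c * f P Q R) = c * isum f"
  unfolding isum_def sum_distrib_left by (intro sum.cong refl) auto

lemma isum_cong: "(\<And>P Q R. P \<in> S \<Longrightarrow> Q \<in> S \<Longrightarrow> R \<in> S \<Longrightarrow> ind P Q R \<Longrightarrow> f P Q R = g P Q R) \<Longrightarrow> isum f = isum g"
  unfolding isum_def by (intro sum.cong refl) auto

lemma psum_add: "psum (\<lambda>P Q. f P Q + g P Q) = psum f + psum g"
  unfolding psum_def sum.distrib[symmetric] by (intro sum.cong refl) auto

lemma psum_cmult: "psum (\<lambda>P Q. c * f P Q) = c * psum f"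
  unfolding psum_def sum_distrib_left by (intro sum.cong refl) auto

lemma psum_cong: "(\<And>P Q. P \<in> S \<Longrightarrow> Q \<in> S \<Longrightarrow> P \<noteq> 1\<^sub>m d \<Longrightarrow> Q \<noteq> 1\<^sub>m d \<Longrightarrow> P \<noteq> Q \<Longrightarrow> f P Q = g P Q) \<Longrightarrow> psum f = psum g"
  unfolding psum_def by (intro sum.cong refl) auto

lemma usum_cong: "(\<And>P. P \<in> S \<Longrightarrow> P \<noteq> 1\<^sub>m d \<Longrightarrow> f P = g P) \<Longrightarrow> usum f = usum g"
  unfolding usum_def by (intro sum.cong refl) auto

lemma usum_cmult: "usum (\<lambda>P. c * f P) = c * usum f"
  unfolding usum_def sum_distrib_left by (intro sum.cong refl) auto

lemma usum_1: "usum (\<lambda>P. 1) = of_nat d ^ 2 - 1"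
proof -
  have "usum (\<lambda>P. 1) = (\<Sum>P\<in>S. 1 - (if P = 1\<^sub>m d then 1 else 0))"
    unfolding usum_def by (intro sum.cong refl) auto
  then show ?thesis using finite_S one_S card_S by (simp add: sum_subtractf)
qed

lemma psum_1: "psum (\<lambda>P Q. 1) = (of_nat d ^ 2 - 1) * (of_nat d ^ 2 - 2)"
proof -
  have "(\<Sum>Q\<in>S. if P \<noteq> 1\<^sub>m d \<and> Q \<noteq> 1\<^sub>m d \<and> P \<noteq> Q then 1 else 0) = (if P \<noteq> 1\<^sub>m d then of_nat d ^ 2 - 2 else (0::complex))"
    if P: "P \<in> S" for P
  proof (cases "P = 1\<^sub>m d")
    case False
    have "(\<Sum>Q\<in>S. if P \<noteq> 1\<^sub>m d \<and> Q \<noteq> 1\<^sub>m d \<and> P \<noteq> Q then 1 else 0) =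
       (\<Sum>Q\<in>S. 1 - (if Q = 1\<^sub>m d then 1 else 0) - (if Q = P then 1 else (0::complex)))"
      by (intro sum.cong refl) (use False in auto)
    then show ?thesis using False finite_S one_S P card_S by (simp add: sum_subtractf)
  qed simp
  then have "psum (\<lambda>P Q. 1) = (of_nat d ^ 2 - 2) * usum (\<lambda>P. 1)"
    unfolding psum_def usum_def sum_distrib_left by (intro sum.cong refl) auto
  then show ?thesis by (simp add: usum_1)
qed

lemma psum_chi: "psum (\<lambda>P Q. chi P Q) = - 2 * (of_nat d ^ 2 - 1)"
proof -
  have "(\<Sum>Q\<in>S. if P \<noteq> 1\<^sub>m d \<and> Q \<noteq> 1\<^sub>m d \<and> P \<noteq> Q then chi P Q else 0) = (if P \<noteq> 1\<^sub>m d then - 2 else (0::complex))"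
    if P: "P \<in> S" for P
  proof (cases "P = 1\<^sub>m d")
    case False
    have "(\<Sum>Q\<in>S. if P \<noteq> 1\<^sub>m d \<and> Q \<noteq> 1\<^sub>m d \<and> P \<noteq> Q then chi P Q else 0) =
       (\<Sum>Q\<in>S. chi P Q - (if Q = 1\<^sub>m d then 1 else 0) - (if Q = P then 1 else (0::complex)))"
      by (intro sum.cong refl) (use False P in auto)
    then show ?thesis using False finite_S one_S P by (simp add: sum_subtractf sum_chi)
  qed simp
  then have "psum (\<lambda>P Q. chi P Q) = - 2 * usum (\<lambda>P. 1)"
    unfolding psum_def usum_def sum_distrib_left by (intro sum.cong refl) auto
  then show ?thesis by (simp add: usum_1)
qed

lemma chi_smult: "P \<in> S \<Longrightarrow> X \<in> S \<Longrightarrow> Q \<in> S \<Longrightarrow> R \<in> S \<Longrightarrow> P * Q = c \<cdot>\<^sub>m R \<Longrightarrow> c \<noteq> 0 \<Longrightarrow> chi R X = chi P X * chi Q X"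
proof -
  assume a: "P \<in> S" "X \<in> S" "Q \<in> S" "R \<in> S" "P * Q = c \<cdot>\<^sub>m R" "c \<noteq> 0"
  have "X * ((P * Q) * X) = (chi P X * chi Q X * c) \<cdot>\<^sub>m R"
    using word_conj[of X "[P, Q]"] a by simp
  moreover have "X * ((P * Q) * X) = (chi R X * c) \<cdot>\<^sub>m R"
    unfolding a(5) using S_conj[of X R] a by (simp add: chi_sym mult.commute)
  ultimately have "(chi P X * chi Q X * c) \<cdot>\<^sub>m R = (chi R X * c) \<cdot>\<^sub>m R" by simp
  then have "tr (R * ((chi P X * chi Q X * c) \<cdot>\<^sub>m R)) = tr (R * ((chi R X * c) \<cdot>\<^sub>m R))" by simp
  then show ?thesis using a d_pos by simp
qed

text \<open>\<open>T\<close> is the product of \<open>P\<close> and \<open>Q\<close> up to a phase.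
  It inherits the product of their signs, and it is the only operator that completes
  \<open>P * Q\<close> to a scalar.\<close>

lemma third:
  assumes P: "P \<in> S" and Q: "Q \<in> S" and "P \<noteq> 1\<^sub>m d" "Q \<noteq> 1\<^sub>m d" "P \<noteq> Q"
  obtains T where "T \<in> S" "T \<noteq> 1\<^sub>m d" "T \<noteq> P" "T \<noteq> Q" "chi P T = chi P Q" "chi Q T = chi P Q"
    "\<And>R. R \<in> S \<Longrightarrow> tr (P * (Q * R)) = 0 \<longleftrightarrow> R \<noteq> T"
proof -
  obtain T c where T: "T \<in> S" "cmod c = 1" "P * Q = c \<cdot>\<^sub>m T" using S_mult[OF P Q] by blast
  then have c: "c \<noteq> 0" by auto
  have t: "tr (P * (Q * R)) = c * tr (T * R)" if "R \<in> S" for R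
  proof -
    have "P * (Q * R) = (P * Q) * R" using P Q that by (simp only: mult_assoc_M S_carrier)
    also have "\<dots> = c \<cdot>\<^sub>m (T * R)" unfolding T(3) using T(1) that by (simp only: smult_left_M S_carrier)
    finally have "tr (P * (Q * R)) = tr (c \<cdot>\<^sub>m (T * R))" by (rule arg_cong)
    then show ?thesis using tr_M_smult[OF mult_M[OF S_carrier[OF T(1)] S_carrier[OF that]], of c] by (rule trans)
  qed
  have iff: "tr (P * (Q * R)) = 0 \<longleftrightarrow> R \<noteq> T" if "R \<in> S" for R
    unfolding t[OF that] tr_S2[OF T(1) that] using c d_pos by auto
  have "tr (P * (Q * 1\<^sub>m d)) = 0" using P Q assms(5) by (simp add: tr_S2)
  then have T1: "T \<noteq> 1\<^sub>m d" using iff[OF one_S] by blast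
  have "tr (P * (Q * P)) = 0"
    by (metis tr_cyc[of P "Q * P"] P Q assms(4) tr_S S_carrier mult_M mult_assoc_M S_sq one_right_M)
  then have TP: "T \<noteq> P" using iff[OF P] by blast
  have "tr (P * (Q * Q)) = 0" using P Q assms(3) by (simp add: tr_S)
  then have TQ: "T \<noteq> Q" using iff[OF Q] by blast
  have cP: "chi P T = chi P Q" using chi_smult[OF P P Q T(1) T(3) c] chi_sym[of T P] chi_sym[of Q P] by simp
  have cQ: "chi Q T = chi P Q" using chi_smult[OF P Q Q T(1) T(3) c] chi_sym[of T Q] by simp
  show ?thesis by (rule that[OF T(1) T1 TP TQ cP cQ iff])
qed

text \<open>Only the identity, \<open>P\<close>, \<open>Q\<close> and their product \<open>T\<close>
  are excluded for \<open>R\<close>. The unrestricted sum of a nontrivial character vanishes, so the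
  value is minus the contribution of these four.\<close>

lemma ind_R_sum:
  assumes P: "P \<in> S" and Q: "Q \<in> S" and ne: "P \<noteq> 1\<^sub>m d" "Q \<noteq> 1\<^sub>m d" "P \<noteq> Q"
  shows "(\<Sum>R\<in>S. if ind P Q R then 1 else 0) = (of_nat d ^ 2 - 4 :: complex)"
    "(\<Sum>R\<in>S. if ind P Q R then chi P R else 0) = - 2 * (1 + chi P Q)"
    "(\<Sum>R\<in>S. if ind P Q R then chi Q R else 0) = - 2 * (1 + chi P Q)"
    "(\<Sum>R\<in>S. if ind P Q R then chi P R * chi Q R else 0) = - 2 * (1 + chi P Q)"
proof -
  obtain T where T: "T \<in> S" "T \<noteq> 1\<^sub>m d" "T \<noteq> P" "T \<noteq> Q" "chi P T = chi P Q" "chi Q T = chi P Q"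
    "\<And>R. R \<in> S \<Longrightarrow> tr (P * (Q * R)) = 0 \<longleftrightarrow> R \<noteq> T" by (rule third[OF assms]) blast
  have "(\<Sum>R\<in>S. if ind P Q R then h R else 0) = (\<Sum>R\<in>S. h R) - h (1\<^sub>m d) - h P - h Q - h T" for h :: "complex mat \<Rightarrow> complex"
  proof -
    have "(\<Sum>R\<in>S. if ind P Q R then h R else 0) = (\<Sum>R\<in>S. h R - (if R = 1\<^sub>m d then h R else 0) - (if R = P then h R else 0)
        - (if R = Q then h R else 0) - (if R = T then h R else 0))"
    proof (intro sum.cong refl)
      fix R assume R: "R \<in> S"
      have iff: "ind P Q R \<longleftrightarrow> R \<noteq> 1\<^sub>m d \<and> R \<noteq> P \<and> R \<noteq> Q \<and> R \<noteq> T"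
        unfolding ind_def supp_def T(7)[OF R] using ne by auto
      show "(if ind P Q R then h R else 0) = h R - (if R = 1\<^sub>m d then h R else 0) - (if R = P then h R else 0)
        - (if R = Q then h R else 0) - (if R = T then h R else 0)"
        unfolding iff using ne T(2-4) by (simp split: if_split)
    qed
    then show ?thesis using P Q T(1) one_S finite_S by (simp add: sum_subtractf)
  qed
  note e = this
  have s: "chi Q P = chi P Q" by (rule chi_sym)
  show "(\<Sum>R\<in>S. if ind P Q R then 1 else 0) = (of_nat d ^ 2 - 4 :: complex)"
    unfolding e using card_S by simp
  show "(\<Sum>R\<in>S. if ind P Q R then chi P R else 0) = - 2 * (1 + chi P Q)"
    unfolding e using P Q ne T by (simp add: sum_chi)
  show "(\<Sum>R\<in>S. if ind P Q R then chi Q R else 0) = - 2 * (1 + chi P Q)"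
    unfolding e using P Q ne T s by (simp add: sum_chi)
  show "(\<Sum>R\<in>S. if ind P Q R then chi P R * chi Q R else 0) = - 2 * (1 + chi P Q)"
    unfolding e using P Q ne T s by (simp add: sum_chi2)
qed

lemma isum_pair:
  "isum (\<lambda>P Q R. a P Q * f P Q R) = psum (\<lambda>P Q. a P Q * (\<Sum>R\<in>S. if ind P Q R then f P Q R else 0))"
  unfolding isum_def psum_def
proof (intro sum.cong refl)
  fix P Q
  show "(\<Sum>R\<in>S. if ind P Q R then a P Q * f P Q R else 0) = (if P \<noteq> 1\<^sub>m d \<and> Q \<noteq> 1\<^sub>m d \<and> P \<noteq> Q then
          a P Q * (\<Sum>R\<in>S. if ind P Q R then f P Q R else 0) else 0)"
  proof (cases "P \<noteq> 1\<^sub>m d \<and> Q \<noteq> 1\<^sub>m d \<and> P \<noteq> Q")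
    case True
    then show ?thesis by (simp add: sum_distrib_left) (intro sum.cong refl, auto)
  next
    case False
    then have "\<not> ind P Q R" for R by (auto simp: ind_def supp_def)
    with False show ?thesis by auto
  qed
qed

text \<open>\<open>N1\<close> counts the independent triples, and \<open>N0\<close> is the sum over
  them of a product of signs; by \<open>isum_chars\<close> it is the same for all seven nontrivial
  products.\<close>

definition N1 :: complex where "N1 = (of_nat d ^ 2 - 1) * (of_nat d ^ 2 - 2) * (of_nat d ^ 2 - 4)"
definition N0 :: complex where "N0 = - 2 * (of_nat d ^ 2 - 1) * (of_nat d ^ 2 - 4)"

lemma isum_chars:
  "isum (\<lambda>P Q R. 1) = N1"
  "isum (\<lambda>P Q R. chi P Q) = N0"
  "isum (\<lambda>P Q R. chi P R) = N0"
  "isum (\<lambda>P Q R. chi Q R) = N0"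
  "isum (\<lambda>P Q R. chi P Q * chi P R) = N0"
  "isum (\<lambda>P Q R. chi P R * chi Q R) = N0"
  "isum (\<lambda>P Q R. chi P Q * chi Q R) = N0"
  "isum (\<lambda>P Q R. chi P Q * (chi P R * chi Q R)) = N0"
proof -
  have a: "isum (\<lambda>P Q R. a P Q * f P Q R) = psum (\<lambda>P Q. - 2 * a P Q - 2 * (a P Q * chi P Q))"
    if "\<And>P Q. P \<in> S \<Longrightarrow> Q \<in> S \<Longrightarrow> P \<noteq> 1\<^sub>m d \<Longrightarrow> Q \<noteq> 1\<^sub>m d \<Longrightarrow> P \<noteq> Q \<Longrightarrow> (\<Sum>R\<in>S. if ind P Q R then f P Q R else 0) = - 2 * (1 + chi P Q)"
    for a f
    unfolding isum_pair by (rule psum_cong) (simp add: that algebra_simps)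
  have b: "psum (\<lambda>P Q. - 2 * a P Q - 2 * (a P Q * chi P Q)) = - 2 * psum a - 2 * psum (\<lambda>P Q. a P Q * chi P Q)" for a
    using psum_add[of "\<lambda>P Q. - 2 * a P Q" "\<lambda>P Q. - 2 * (a P Q * chi P Q)"] by (simp add: psum_cmult[of "-2", simplified])
  have n: "- 2 * ((of_nat d ^ 2 - 1) * (of_nat d ^ 2 - 2)) - 2 * (- 2 * (of_nat d ^ 2 - 1)) = N0"
    "- 2 * (- 2 * (of_nat d ^ 2 - 1)) - 2 * ((of_nat d ^ 2 - 1) * (of_nat d ^ 2 - 2)) = N0"
    by (simp_all add: N0_def algebra_simps)
  have c1: "isum f = N0" and cx: "isum (\<lambda>P Q R. chi P Q * f P Q R) = N0"
    if "\<And>P Q. P \<in> S \<Longrightarrow> Q \<in> S \<Longrightarrow> P \<noteq> 1\<^sub>m d \<Longrightarrow> Q \<noteq> 1\<^sub>m d \<Longrightarrow> P \<noteq> Q \<Longrightarrow> (\<Sum>R\<in>S. if ind P Q R then f P Q R else 0) = - 2 * (1 + chi P Q)"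
    for f
    using a[where a="\<lambda>P Q. 1", OF that] a[where a=chi, OF that] b[of "\<lambda>P Q. 1"] b[of chi] n
    by (simp_all add: psum_1 psum_chi)
  have m: "isum (\<lambda>P Q R. a P Q) = (of_nat d ^ 2 - 4) * psum a" for a
    using isum_pair[of a "\<lambda>P Q R. 1"] psum_cmult[of "of_nat d ^ 2 - 4" a]
      psum_cong[of "\<lambda>P Q. a P Q * (\<Sum>R\<in>S. if ind P Q R then 1 else 0)" "\<lambda>P Q. (of_nat d ^ 2 - 4) * a P Q"]
    by (simp add: ind_R_sum(1) mult.commute)
  show "isum (\<lambda>P Q R. 1) = N1" using m[of "\<lambda>P Q. 1"] by (simp add: psum_1 N1_def mult_ac)
  show "isum (\<lambda>P Q R. chi P Q) = N0" using m[of chi] by (simp add: psum_chi N0_def mult_ac)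
  show "isum (\<lambda>P Q R. chi P R) = N0" "isum (\<lambda>P Q R. chi P Q * chi P R) = N0"
    using c1[of "\<lambda>P Q R. chi P R"] cx[of "\<lambda>P Q R. chi P R"] by (simp_all add: ind_R_sum)
  show "isum (\<lambda>P Q R. chi Q R) = N0" "isum (\<lambda>P Q R. chi P Q * chi Q R) = N0"
    using c1[of "\<lambda>P Q R. chi Q R"] cx[of "\<lambda>P Q R. chi Q R"] by (simp_all add: ind_R_sum)
  show "isum (\<lambda>P Q R. chi P R * chi Q R) = N0" "isum (\<lambda>P Q R. chi P Q * (chi P R * chi Q R)) = N0"
    using c1[of "\<lambda>P Q R. chi P R * chi Q R"] cx[of "\<lambda>P Q R. chi P R * chi Q R"] by (simp_all add: ind_R_sum)
qed

text \<open>For \<open>P = Q \<noteq> R\<close> etc. the condition \<open>tr (PQR) = 0\<close> holds automatically when \<open>P\<close>, \<open>Q\<close>, \<open>R\<close> are not the identity.\<close>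
lemma supp_sum:
  assumes v: "\<And>P Q R. P \<in> S \<Longrightarrow> Q \<in> S \<Longrightarrow> R \<in> S \<Longrightarrow> \<not> supp P Q R \<Longrightarrow> f P Q R = 0"
  shows "sum3 f = isum f + psum (\<lambda>P R. f P P R) + psum (\<lambda>P Q. f P Q Q) + psum (\<lambda>P Q. f P Q P) + usum (\<lambda>P. f P P P)"
proof -
  have e: "f P Q R = (if ind P Q R then f P Q R else 0) + (if Q = P then (if P \<noteq> 1\<^sub>m d \<and> R \<noteq> 1\<^sub>m d \<and> P \<noteq> R then f P P R else 0) else 0)
     + (if R = Q then (if P \<noteq> 1\<^sub>m d \<and> Q \<noteq> 1\<^sub>m d \<and> P \<noteq> Q then f P Q Q else 0) else 0)
     + (if R = P then (if P \<noteq> 1\<^sub>m d \<and> Q \<noteq> 1\<^sub>m d \<and> P \<noteq> Q then f P Q P else 0) else 0)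
     + (if Q = P then (if R = P then (if P \<noteq> 1\<^sub>m d then f P P P else 0) else 0) else 0)"
    if "P \<in> S" "Q \<in> S" "R \<in> S" for P Q R
  proof -
    have z: "f (1\<^sub>m d) Q R = 0" "f P (1\<^sub>m d) R = 0" "f P Q (1\<^sub>m d) = 0" if "P \<in> S" "Q \<in> S" "R \<in> S" for P Q R
      using v that one_S by (auto simp: supp_def)
    have i: "\<not> ind P P R" "\<not> ind P Q Q" "\<not> ind P Q P" for P Q R by (auto simp: ind_def)
    consider "P = Q" "Q = R" | "P = Q" "Q \<noteq> R" | "Q = R" "P \<noteq> Q" | "P = R" "P \<noteq> Q" | "P \<noteq> Q" "Q \<noteq> R" "P \<noteq> R" by blast
    then show ?thesis
    proof cases
      case 5
      then show ?thesis using v[OF that] by (simp add: ind_def)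
    qed (use that in \<open>simp_all add: i z one_S\<close>)
  qed
  have "sum3 f = sum3 (\<lambda>P Q R. (if ind P Q R then f P Q R else 0) + (if Q = P then (if P \<noteq> 1\<^sub>m d \<and> R \<noteq> 1\<^sub>m d \<and> P \<noteq> R then f P P R else 0) else 0)
     + (if R = Q then (if P \<noteq> 1\<^sub>m d \<and> Q \<noteq> 1\<^sub>m d \<and> P \<noteq> Q then f P Q Q else 0) else 0)
     + (if R = P then (if P \<noteq> 1\<^sub>m d \<and> Q \<noteq> 1\<^sub>m d \<and> P \<noteq> Q then f P Q P else 0) else 0)
     + (if Q = P then (if R = P then (if P \<noteq> 1\<^sub>m d then f P P P else 0) else 0) else 0))"
    by (intro sum.cong refl e)
  moreover have "sum3 (\<lambda>P Q R. if Q = P then h P R else 0) = (\<Sum>P\<in>S. \<Sum>R\<in>S. h P R)" for h :: "complex mat \<Rightarrow> complex mat \<Rightarrow> complex"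
  proof -
    have "sum3 (\<lambda>P Q R. if Q = P then h P R else 0) = (\<Sum>P\<in>S. \<Sum>Q\<in>S. if Q = P then (\<Sum>R\<in>S. h P R) else 0)"
      by (intro sum.cong refl) auto
    then show ?thesis using finite_S by simp
  qed
  ultimately show ?thesis
    unfolding sum.distrib isum_def psum_def usum_def using finite_S by simp
qed

text \<open>Inclusion and exclusion over the coincidences. A triple coincidence is counted once in
  the full sum and removed three times, which explains the factor 2.\<close>

lemma isum_reduce:
  assumes v: "\<And>P Q R. P \<in> S \<Longrightarrow> Q \<in> S \<Longrightarrow> R \<in> S \<Longrightarrow> \<not> supp P Q R \<Longrightarrow> f P Q R = 0"
  shows "isum f = sum3 f - (\<Sum>P\<in>S. \<Sum>R\<in>S. f P P R) - (\<Sum>P\<in>S. \<Sum>Q\<in>S. f P Q Q) - (\<Sum>P\<in>S. \<Sum>Q\<in>S. f P Q P) + 2 * (\<Sum>P\<in>S. f P P P)"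
    "psum (\<lambda>P R. f P P R) = (\<Sum>P\<in>S. \<Sum>R\<in>S. f P P R) - (\<Sum>P\<in>S. f P P P)"
    "psum (\<lambda>P Q. f P Q Q) = (\<Sum>P\<in>S. \<Sum>Q\<in>S. f P Q Q) - (\<Sum>P\<in>S. f P P P)"
    "psum (\<lambda>P Q. f P Q P) = (\<Sum>P\<in>S. \<Sum>Q\<in>S. f P Q P) - (\<Sum>P\<in>S. f P P P)"
    "usum (\<lambda>P. f P P P) = (\<Sum>P\<in>S. f P P P)"
proof -
  have z: "f (1\<^sub>m d) Q R = 0" "f P (1\<^sub>m d) R = 0" "f P Q (1\<^sub>m d) = 0" if "P \<in> S" "Q \<in> S" "R \<in> S" for P Q R
    using v that one_S by (auto simp: supp_def)
  show u: "usum (\<lambda>P. f P P P) = (\<Sum>P\<in>S. f P P P)"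
    unfolding usum_def by (intro sum.cong refl) (auto simp: z one_S)
  have p: "psum h = (\<Sum>P\<in>S. \<Sum>Q\<in>S. h P Q) - (\<Sum>P\<in>S. h P P)"
    if "\<And>P. P \<in> S \<Longrightarrow> h P (1\<^sub>m d) = 0" "\<And>P. P \<in> S \<Longrightarrow> h (1\<^sub>m d) P = 0" for h
  proof -
    have "psum h = (\<Sum>P\<in>S. \<Sum>Q\<in>S. h P Q - (if Q = P then h P P else 0))"
      unfolding psum_def by (intro sum.cong refl) (use that in auto)
    then show ?thesis using finite_S by (simp add: sum_subtractf)
  qed
  show p1: "psum (\<lambda>P R. f P P R) = (\<Sum>P\<in>S. \<Sum>R\<in>S. f P P R) - (\<Sum>P\<in>S. f P P P)"
    by (rule p) (auto simp: z one_S)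
  show p2: "psum (\<lambda>P Q. f P Q Q) = (\<Sum>P\<in>S. \<Sum>Q\<in>S. f P Q Q) - (\<Sum>P\<in>S. f P P P)"
    by (rule p) (auto simp: z one_S)
  show p3: "psum (\<lambda>P Q. f P Q P) = (\<Sum>P\<in>S. \<Sum>Q\<in>S. f P Q P) - (\<Sum>P\<in>S. f P P P)"
    by (rule p) (auto simp: z one_S)
  show "isum f = sum3 f - (\<Sum>P\<in>S. \<Sum>R\<in>S. f P P R) - (\<Sum>P\<in>S. \<Sum>Q\<in>S. f P Q Q) - (\<Sum>P\<in>S. \<Sum>Q\<in>S. f P Q P) + 2 * (\<Sum>P\<in>S. f P P P)"
    using supp_sum[of f, OF v] u p1 p2 p3 by simp
qed

end

lemma sign_function1:
  fixes \<Gamma> :: "complex \<Rightarrow> complex"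
  shows "\<exists>a b. \<forall>x\<in>{1,-1}. \<Gamma> x = a + b * x"
  by (rule exI[of _ "(\<Gamma> 1 + \<Gamma> (-1)) / 2"], rule exI[of _ "(\<Gamma> 1 - \<Gamma> (-1)) / 2"]) (simp add: field_simps)

text \<open>A function on signs is affine in each argument separately. The eight coefficients
  correspond to the eight characters against which sums will be compared.\<close>

lemma sign_function3:
  fixes \<Gamma> :: "complex \<Rightarrow> complex \<Rightarrow> complex \<Rightarrow> complex"
  shows "\<exists>a0 a1 a2 a3 a4 a5 a6 a7. \<forall>x\<in>{1,-1}. \<forall>y\<in>{1,-1}. \<forall>z\<in>{1,-1}.
    \<Gamma> x y z = a0 + a1 * x + a2 * y + a3 * z + a4 * (x * y) + a5 * (y * z) + a6 * (x * z) + a7 * (x * (y * z))"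
proof -
  have "\<forall>x y. \<exists>a b. \<forall>z\<in>{1,-1}. \<Gamma> x y z = a + b * z" by (intro allI sign_function1)
  then obtain a b where z: "\<And>x y z. z \<in> {1,-1} \<Longrightarrow> \<Gamma> x y z = a x y + b x y * z" by metis
  have "\<forall>x. \<exists>c e. \<forall>y\<in>{1,-1}. a x y = c + e * y" by (intro allI sign_function1)
  then obtain a0 a1 where a: "\<And>x y. y \<in> {1,-1} \<Longrightarrow> a x y = a0 x + a1 x * y" by metis
  have "\<forall>x. \<exists>c e. \<forall>y\<in>{1,-1}. b x y = c + e * y" by (intro allI sign_function1)
  then obtain b0 b1 where b: "\<And>x y. y \<in> {1,-1} \<Longrightarrow> b x y = b0 x + b1 x * y" by metis
  obtain p0 q0 where 1: "\<And>x. x \<in> {1,-1} \<Longrightarrow> a0 x = p0 + q0 * x" using sign_function1[of a0] by metis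
  obtain p1 q1 where 2: "\<And>x. x \<in> {1,-1} \<Longrightarrow> a1 x = p1 + q1 * x" using sign_function1[of a1] by metis
  obtain p2 q2 where 3: "\<And>x. x \<in> {1,-1} \<Longrightarrow> b0 x = p2 + q2 * x" using sign_function1[of b0] by metis
  obtain p3 q3 where 4: "\<And>x. x \<in> {1,-1} \<Longrightarrow> b1 x = p3 + q3 * x" using sign_function1[of b1] by metis
  have "\<Gamma> x y z = p0 + q0 * x + p1 * y + p2 * z + q1 * (x * y) + p3 * (y * z) + q2 * (x * z) + q3 * (x * (y * z))"
    if "x \<in> {1,-1}" "y \<in> {1,-1}" "z \<in> {1,-1}" for x y z
    unfolding z[OF that(3)] a[OF that(2)] b[OF that(2)] 1[OF that(1)] 2[OF that(1)] 3[OF that(1)] 4[OF that(1)]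
    by (simp only: algebra_simps)
  then show ?thesis by blast
qed

section \<open>Class functions and the replacement of kernels\<close>

context pauli_system
begin

lemma chi_in: "chi P Q \<in> {1, -1}"
  using chi_cases by auto

text \<open>The conditions describe functions constant on the Clifford orbits in
  \<open>supp\<close>, expressed by equality patterns and commutation signs. Values outside
  \<open>supp\<close> are left free.\<close>

definition class_fun :: "(complex mat \<Rightarrow> complex mat \<Rightarrow> complex mat \<Rightarrow> complex) \<Rightarrow> bool" where
  "class_fun g \<longleftrightarrow>
     (\<exists>\<Gamma>. \<forall>P\<in>S. \<forall>Q\<in>S. \<forall>R\<in>S. ind P Q R \<longrightarrow> g P Q R = \<Gamma> (chi P Q) (chi P R) (chi Q R)) \<and>
     (\<exists>\<Gamma>. \<forall>P\<in>S. \<forall>Q\<in>S. P \<noteq> 1\<^sub>m d \<longrightarrow> Q \<noteq> 1\<^sub>m d \<longrightarrow> P \<noteq> Q \<longrightarrow> g P P Q = \<Gamma> (chi P Q)) \<and>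
     (\<exists>\<Gamma>. \<forall>P\<in>S. \<forall>Q\<in>S. P \<noteq> 1\<^sub>m d \<longrightarrow> Q \<noteq> 1\<^sub>m d \<longrightarrow> P \<noteq> Q \<longrightarrow> g P Q Q = \<Gamma> (chi P Q)) \<and>
     (\<exists>\<Gamma>. \<forall>P\<in>S. \<forall>Q\<in>S. P \<noteq> 1\<^sub>m d \<longrightarrow> Q \<noteq> 1\<^sub>m d \<longrightarrow> P \<noteq> Q \<longrightarrow> g P Q P = \<Gamma> (chi P Q)) \<and>
     (\<exists>c. \<forall>P\<in>S. P \<noteq> 1\<^sub>m d \<longrightarrow> g P P P = c)"

text \<open>Sums against characters are compared instead of sums over classes. For each equality
  pattern the two determine each other by Fourier inversion on signs, and the character sums are the
  ones that reordering of words makes accessible.\<close>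

definition same_stats where
  "same_stats f h \<longleftrightarrow>
     isum f = isum h \<and>
     isum (\<lambda>P Q R. chi P Q * f P Q R) = isum (\<lambda>P Q R. chi P Q * h P Q R) \<and>
     isum (\<lambda>P Q R. chi P R * f P Q R) = isum (\<lambda>P Q R. chi P R * h P Q R) \<and>
     isum (\<lambda>P Q R. chi Q R * f P Q R) = isum (\<lambda>P Q R. chi Q R * h P Q R) \<and>
     isum (\<lambda>P Q R. chi P Q * (chi P R * f P Q R)) = isum (\<lambda>P Q R. chi P Q * (chi P R * h P Q R)) \<and>
     isum (\<lambda>P Q R. chi P R * (chi Q R * f P Q R)) = isum (\<lambda>P Q R. chi P R * (chi Q R * h P Q R)) \<and>
     isum (\<lambda>P Q R. chi P Q * (chi Q R * f P Q R)) = isum (\<lambda>P Q R. chi P Q * (chi Q R * h P Q R)) \<and>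
     isum (\<lambda>P Q R. chi P Q * (chi P R * (chi Q R * f P Q R))) = isum (\<lambda>P Q R. chi P Q * (chi P R * (chi Q R * h P Q R))) \<and>
     psum (\<lambda>P R. f P P R) = psum (\<lambda>P R. h P P R) \<and>
     psum (\<lambda>P R. chi P R * f P P R) = psum (\<lambda>P R. chi P R * h P P R) \<and>
     psum (\<lambda>P Q. f P Q Q) = psum (\<lambda>P Q. h P Q Q) \<and>
     psum (\<lambda>P Q. chi P Q * f P Q Q) = psum (\<lambda>P Q. chi P Q * h P Q Q) \<and>
     psum (\<lambda>P Q. f P Q P) = psum (\<lambda>P Q. h P Q P) \<and>
     psum (\<lambda>P Q. chi P Q * f P Q P) = psum (\<lambda>P Q. chi P Q * h P Q P) \<and>
     usum (\<lambda>P. f P P P) = usum (\<lambda>P. h P P P)"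

lemma psum_pairing:
  assumes "\<And>P Q. P \<in> S \<Longrightarrow> Q \<in> S \<Longrightarrow> P \<noteq> 1\<^sub>m d \<Longrightarrow> Q \<noteq> 1\<^sub>m d \<Longrightarrow> P \<noteq> Q \<Longrightarrow> g P Q = \<Gamma> (chi P Q)"
    and "psum f = psum h" "psum (\<lambda>P Q. chi P Q * f P Q) = psum (\<lambda>P Q. chi P Q * h P Q)"
  shows "psum (\<lambda>P Q. f P Q * g P Q) = psum (\<lambda>P Q. h P Q * g P Q)"
proof -
  obtain a b where ab: "\<And>x. x \<in> {1,-1} \<Longrightarrow> \<Gamma> x = a + b * x" using sign_function1[of \<Gamma>] by blast
  have "psum (\<lambda>P Q. k P Q * g P Q) = a * psum k + b * psum (\<lambda>P Q. chi P Q * k P Q)" for k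
    unfolding psum_cmult[symmetric] psum_add[symmetric]
    by (rule psum_cong) (simp add: assms(1) ab[OF chi_in] algebra_simps)
  then show ?thesis using assms by simp
qed

text \<open>On each equality pattern \<open>g\<close> is a linear combination of sign characters, so
  the pairing depends on \<open>f\<close> only through the sums listed in
  \<open>same_stats\<close>.\<close>

lemma class_pairing:
  assumes g: "class_fun g" and st: "same_stats f h"
    and f: "\<And>P Q R. P \<in> S \<Longrightarrow> Q \<in> S \<Longrightarrow> R \<in> S \<Longrightarrow> \<not> supp P Q R \<Longrightarrow> f P Q R = 0"
    and h: "\<And>P Q R. P \<in> S \<Longrightarrow> Q \<in> S \<Longrightarrow> R \<in> S \<Longrightarrow> \<not> supp P Q R \<Longrightarrow> h P Q R = 0"
  shows "sum3 (\<lambda>P Q R. f P Q R * g P Q R) = sum3 (\<lambda>P Q R. h P Q R * g P Q R)"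
proof -
  note g' = g[unfolded class_fun_def]
  from g'[THEN conjunct1] obtain \<Gamma> where
    G: "\<forall>P\<in>S. \<forall>Q\<in>S. \<forall>R\<in>S. ind P Q R \<longrightarrow> g P Q R = \<Gamma> (chi P Q) (chi P R) (chi Q R)" ..
  obtain a0 a1 a2 a3 a4 a5 a6 a7 where a: "\<And>x y z. x \<in> {1,-1} \<Longrightarrow> y \<in> {1,-1} \<Longrightarrow> z \<in> {1,-1} \<Longrightarrow>
    \<Gamma> x y z = a0 + a1 * x + a2 * y + a3 * z + a4 * (x * y) + a5 * (y * z) + a6 * (x * z) + a7 * (x * (y * z))"
    using sign_function3[of \<Gamma>] by blast
  have gi: "g P Q R = a0 + a1 * chi P Q + a2 * chi P R + a3 * chi Q R + a4 * (chi P Q * chi P R) + a5 * (chi P R * chi Q R) +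
      a6 * (chi P Q * chi Q R) + a7 * (chi P Q * (chi P R * chi Q R))"
    if "P \<in> S" "Q \<in> S" "R \<in> S" "ind P Q R" for P Q R
    using G that a[OF chi_in chi_in chi_in] by simp
  have "isum (\<lambda>P Q R. k P Q R * g P Q R) = a0 * isum k + a1 * isum (\<lambda>P Q R. chi P Q * k P Q R) +
     a2 * isum (\<lambda>P Q R. chi P R * k P Q R) + a3 * isum (\<lambda>P Q R. chi Q R * k P Q R) +
     a4 * isum (\<lambda>P Q R. chi P Q * (chi P R * k P Q R)) + a5 * isum (\<lambda>P Q R. chi P R * (chi Q R * k P Q R)) +
     a6 * isum (\<lambda>P Q R. chi P Q * (chi Q R * k P Q R)) + a7 * isum (\<lambda>P Q R. chi P Q * (chi P R * (chi Q R * k P Q R)))" for k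
    unfolding isum_cmult[symmetric] isum_add[symmetric]
    by (rule isum_cong) (simp only: gi, simp only: algebra_simps)
  then have 1: "isum (\<lambda>P Q R. f P Q R * g P Q R) = isum (\<lambda>P Q R. h P Q R * g P Q R)"
    using st unfolding same_stats_def by simp
  from g'[THEN conjunct2, THEN conjunct1] obtain \<Gamma>2 where
    G2: "\<forall>P\<in>S. \<forall>Q\<in>S. P \<noteq> 1\<^sub>m d \<longrightarrow> Q \<noteq> 1\<^sub>m d \<longrightarrow> P \<noteq> Q \<longrightarrow> g P P Q = \<Gamma>2 (chi P Q)" ..
  from g'[THEN conjunct2, THEN conjunct2, THEN conjunct1] obtain \<Gamma>3 where
    G3: "\<forall>P\<in>S. \<forall>Q\<in>S. P \<noteq> 1\<^sub>m d \<longrightarrow> Q \<noteq> 1\<^sub>m d \<longrightarrow> P \<noteq> Q \<longrightarrow> g P Q Q = \<Gamma>3 (chi P Q)" ..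
  from g'[THEN conjunct2, THEN conjunct2, THEN conjunct2, THEN conjunct1] obtain \<Gamma>4 where
    G4: "\<forall>P\<in>S. \<forall>Q\<in>S. P \<noteq> 1\<^sub>m d \<longrightarrow> Q \<noteq> 1\<^sub>m d \<longrightarrow> P \<noteq> Q \<longrightarrow> g P Q P = \<Gamma>4 (chi P Q)" ..
  from g'[THEN conjunct2, THEN conjunct2, THEN conjunct2, THEN conjunct2] obtain c where
    c: "\<forall>P\<in>S. P \<noteq> 1\<^sub>m d \<longrightarrow> g P P P = c" ..
  note st' = st[unfolded same_stats_def]
  have s2: "psum (\<lambda>P R. f P P R) = psum (\<lambda>P R. h P P R)" "psum (\<lambda>P R. chi P R * f P P R) = psum (\<lambda>P R. chi P R * h P P R)"
    and s3: "psum (\<lambda>P Q. f P Q Q) = psum (\<lambda>P Q. h P Q Q)" "psum (\<lambda>P Q. chi P Q * f P Q Q) = psum (\<lambda>P Q. chi P Q * h P Q Q)"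
    and s4: "psum (\<lambda>P Q. f P Q P) = psum (\<lambda>P Q. h P Q P)" "psum (\<lambda>P Q. chi P Q * f P Q P) = psum (\<lambda>P Q. chi P Q * h P Q P)"
    using st' by simp_all
  have 2: "psum (\<lambda>P Q. f P P Q * g P P Q) = psum (\<lambda>P Q. h P P Q * g P P Q)"
    by (rule psum_pairing[OF _ s2, of _ \<Gamma>2]) (use G2 in simp)
  have 3: "psum (\<lambda>P Q. f P Q Q * g P Q Q) = psum (\<lambda>P Q. h P Q Q * g P Q Q)"
    by (rule psum_pairing[OF _ s3, of _ \<Gamma>3]) (use G3 in simp)
  have 4: "psum (\<lambda>P Q. f P Q P * g P Q P) = psum (\<lambda>P Q. h P Q P * g P Q P)"
    by (rule psum_pairing[OF _ s4, of _ \<Gamma>4]) (use G4 in simp)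
  have "usum (\<lambda>P. k P P P * g P P P) = c * usum (\<lambda>P. k P P P)" for k
    unfolding usum_cmult[symmetric] by (rule usum_cong) (use c in \<open>simp add: mult.commute\<close>)
  then have 5: "usum (\<lambda>P. f P P P * g P P P) = usum (\<lambda>P. h P P P * g P P P)"
    using st unfolding same_stats_def by simp
  have "sum3 (\<lambda>P Q R. k P Q R * g P Q R) = isum (\<lambda>P Q R. k P Q R * g P Q R) + psum (\<lambda>P R. k P P R * g P P R) +
     psum (\<lambda>P Q. k P Q Q * g P Q Q) + psum (\<lambda>P Q. k P Q P * g P Q P) + usum (\<lambda>P. k P P P * g P P P)"
    if "\<And>P Q R. P \<in> S \<Longrightarrow> Q \<in> S \<Longrightarrow> R \<in> S \<Longrightarrow> \<not> supp P Q R \<Longrightarrow> k P Q R = 0" for k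
    by (rule supp_sum) (simp add: that)
  from this[of f, OF f] this[of h, OF h] show ?thesis using 1 2 3 4 5 by simp
qed

context
  fixes c1 c2 c3 al be ga de ep ze et :: complex
begin

text \<open>A function of the equality pattern and the commutation signs of a triple whose sum against \<open>Gam\<close> is an explicit combination of traces.
  It replaces the kernel of a layer, which has no such structure.\<close>
definition lam :: "complex mat \<Rightarrow> complex mat \<Rightarrow> complex mat \<Rightarrow> complex" where
  "lam P Q R =
     c1 * (1 + chi P Q * (chi P R * chi Q R)) + c2 * (chi P Q + chi Q R + chi P Q * chi P R + chi P R * chi Q R)
     + c3 * (chi P R + chi P Q * chi Q R)
     + (if P = Q then al + be * chi P R else 0) + (if Q = R then al + be * chi P Q else 0)
     + (if P = R then ga + de * chi P Q else 0) + (if P = Q \<and> Q = R then ep else 0)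
     + (if P = 1\<^sub>m d then ze * (1 + chi Q R) else 0) + (if R = 1\<^sub>m d then ze * (1 + chi P Q) else 0)
     + (if P = 1\<^sub>m d \<and> R = 1\<^sub>m d then et else 0)"

definition lam' where "lam' P Q R = (if supp P Q R then lam P Q R else 0)"

lemma isum8:
  "isum (\<lambda>P Q R. a0 + a1 * chi P Q + a2 * chi P R + a3 * chi Q R + a4 * (chi P Q * chi P R) +
      a5 * (chi P R * chi Q R) + a6 * (chi P Q * chi Q R) + a7 * (chi P Q * (chi P R * chi Q R))) =
   a0 * N1 + (a1 + a2 + a3 + a4 + a5 + a6 + a7) * N0"
proof -
  have "isum (\<lambda>P Q R. a0) = a0 * N1" using isum_cmult[of a0 "\<lambda>P Q R. 1"] isum_chars(1) by simp
  then show ?thesis unfolding isum_add isum_cmult isum_chars by (simp add: algebra_simps)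
qed

lemma lam_ind: "ind P Q R \<Longrightarrow> lam' P Q R = c1 + c2 * chi P Q + c3 * chi P R + c2 * chi Q R + c2 * (chi P Q * chi P R) +
      c2 * (chi P R * chi Q R) + c3 * (chi P Q * chi Q R) + c1 * (chi P Q * (chi P R * chi Q R))"
  by (auto simp: lam_def lam'_def ind_def supp_def algebra_simps)

text \<open>Multiplication by a product of signs permutes the eight characters and with them the
  coefficients of \<open>lam\<close>. The coefficient that lands on the trivial character meets
  \<open>N1\<close>, every other one \<open>N0\<close>.\<close>

lemma lam_isum:
  "isum lam' = c1 * N1 + (c1 + 4 * c2 + 2 * c3) * N0"
  "isum (\<lambda>P Q R. chi P Q * (chi P R * (chi Q R * lam' P Q R))) = c1 * N1 + (c1 + 4 * c2 + 2 * c3) * N0"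
  "isum (\<lambda>P Q R. chi P Q * lam' P Q R) = c2 * N1 + (2 * c1 + 3 * c2 + 2 * c3) * N0"
  "isum (\<lambda>P Q R. chi Q R * lam' P Q R) = c2 * N1 + (2 * c1 + 3 * c2 + 2 * c3) * N0"
  "isum (\<lambda>P Q R. chi P Q * (chi P R * lam' P Q R)) = c2 * N1 + (2 * c1 + 3 * c2 + 2 * c3) * N0"
  "isum (\<lambda>P Q R. chi P R * (chi Q R * lam' P Q R)) = c2 * N1 + (2 * c1 + 3 * c2 + 2 * c3) * N0"
  "isum (\<lambda>P Q R. chi P R * lam' P Q R) = c3 * N1 + (2 * c1 + 4 * c2 + c3) * N0"
  "isum (\<lambda>P Q R. chi P Q * (chi Q R * lam' P Q R)) = c3 * N1 + (2 * c1 + 4 * c2 + c3) * N0"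
proof -
  have *: "isum f = a0 * N1 + (a1 + a2 + a3 + a4 + a5 + a6 + a7) * N0"
    if "\<And>P Q R. ind P Q R \<Longrightarrow> f P Q R = a0 + a1 * chi P Q + a2 * chi P R + a3 * chi Q R + a4 * (chi P Q * chi P R) +
      a5 * (chi P R * chi Q R) + a6 * (chi P Q * chi Q R) + a7 * (chi P Q * (chi P R * chi Q R))" for f a0 a1 a2 a3 a4 a5 a6 a7
    using isum8[of a0 a1 a2 a3 a4 a5 a6 a7] isum_cong[of f, OF that] by simp
  show "isum lam' = c1 * N1 + (c1 + 4 * c2 + 2 * c3) * N0"
    by (rule trans[OF *[of _ c1 c2 c3 c2 c2 c2 c3 c1]]) (simp_all add: lam_ind algebra_simps)
  show "isum (\<lambda>P Q R. chi P Q * (chi P R * (chi Q R * lam' P Q R))) = c1 * N1 + (c1 + 4 * c2 + 2 * c3) * N0"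
    by (rule trans[OF *[of _ c1 c2 c3 c2 c2 c2 c3 c1]]) (simp_all add: lam_ind algebra_simps)
  show "isum (\<lambda>P Q R. chi P Q * lam' P Q R) = c2 * N1 + (2 * c1 + 3 * c2 + 2 * c3) * N0"
    by (rule trans[OF *[of _ c2 c1 c2 c3 c3 c1 c2 c2]]) (simp_all add: lam_ind algebra_simps)
  show "isum (\<lambda>P Q R. chi Q R * lam' P Q R) = c2 * N1 + (2 * c1 + 3 * c2 + 2 * c3) * N0"
    by (rule trans[OF *[of _ c2 c3 c2 c1 c1 c3 c2 c2]]) (simp_all add: lam_ind algebra_simps)
  show "isum (\<lambda>P Q R. chi P Q * (chi P R * lam' P Q R)) = c2 * N1 + (2 * c1 + 3 * c2 + 2 * c3) * N0"
    by (rule trans[OF *[of _ c2 c3 c2 c1 c1 c3 c2 c2]]) (simp_all add: lam_ind algebra_simps)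
  show "isum (\<lambda>P Q R. chi P R * (chi Q R * lam' P Q R)) = c2 * N1 + (2 * c1 + 3 * c2 + 2 * c3) * N0"
    by (rule trans[OF *[of _ c2 c1 c2 c3 c3 c1 c2 c2]]) (simp_all add: lam_ind algebra_simps)
  show "isum (\<lambda>P Q R. chi P R * lam' P Q R) = c3 * N1 + (2 * c1 + 4 * c2 + c3) * N0"
    by (rule trans[OF *[of _ c3 c2 c1 c2 c2 c2 c1 c3]]) (simp_all add: lam_ind algebra_simps)
  show "isum (\<lambda>P Q R. chi P Q * (chi Q R * lam' P Q R)) = c3 * N1 + (2 * c1 + 4 * c2 + c3) * N0"
    by (rule trans[OF *[of _ c3 c2 c1 c2 c2 c2 c1 c3]]) (simp_all add: lam_ind algebra_simps)
qed

lemma lam_pairs: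
  assumes "P \<in> S" "Q \<in> S" "P \<noteq> 1\<^sub>m d" "Q \<noteq> 1\<^sub>m d" "P \<noteq> Q"
  shows "lam' P P Q = (2 * c1 + 2 * c2 + al) + (2 * c2 + 2 * c3 + be) * chi P Q"
    "lam' P Q Q = (2 * c1 + 2 * c2 + al) + (2 * c2 + 2 * c3 + be) * chi P Q"
    "lam' P Q P = (2 * c1 + 2 * c3 + ga) + (4 * c2 + de) * chi P Q"
proof -
  have t: "tr (P * (Q * P)) = 0" unfolding S_conj[OF assms(1,2)] tr_M_smult[OF S_carrier[OF assms(2)]] tr_S[OF assms(2)] using assms(4) by simp
  have sp: "supp P P Q" "supp P Q Q" "supp P Q P"
    unfolding supp_def S_sq_left[OF assms(1) S_carrier[OF assms(2)]] S_sq[OF assms(2)] one_right_M[OF S_carrier[OF assms(1)]]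
      tr_S[OF assms(1)] tr_S[OF assms(2)] t using assms(3-5) by simp_all
  have "lam' P P Q = c1 * (1 + chi P Q * chi P Q) + c2 * (1 + chi P Q + chi P Q + chi P Q * chi P Q) + c3 * (chi P Q + chi P Q) + (al + be * chi P Q)"
    using assms(3-5) sp(1) by (simp only: lam'_def lam_def chi_self) simp
  then show "lam' P P Q = (2 * c1 + 2 * c2 + al) + (2 * c2 + 2 * c3 + be) * chi P Q"
    by (simp only: chi_sq) (simp add: distrib_left distrib_right algebra_simps)
  have "lam' P Q Q = c1 * (1 + chi P Q * chi P Q) + c2 * (1 + chi P Q + chi P Q + chi P Q * chi P Q) + c3 * (chi P Q + chi P Q) + (al + be * chi P Q)"
    using assms(3-5) sp(2) by (simp only: lam'_def lam_def chi_self) simp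
  then show "lam' P Q Q = (2 * c1 + 2 * c2 + al) + (2 * c2 + 2 * c3 + be) * chi P Q"
    by (simp only: chi_sq) (simp add: distrib_left distrib_right algebra_simps)
  have "lam' P Q P = c1 * (1 + chi P Q * chi P Q) + c2 * (chi P Q + chi P Q + chi P Q + chi P Q) + c3 * (1 + chi P Q * chi P Q) + (ga + de * chi P Q)"
    using assms(3-5) sp(3) by (simp only: lam'_def lam_def chi_self chi_sym[of Q P]) simp
  then show "lam' P Q P = (2 * c1 + 2 * c3 + ga) + (4 * c2 + de) * chi P Q"
    by (simp only: chi_sq) (simp add: distrib_left distrib_right algebra_simps)
qed

lemma psum_affine:
  assumes "\<And>P Q. P \<in> S \<Longrightarrow> Q \<in> S \<Longrightarrow> P \<noteq> 1\<^sub>m d \<Longrightarrow> Q \<noteq> 1\<^sub>m d \<Longrightarrow> P \<noteq> Q \<Longrightarrow> f P Q = a + b * chi P Q"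
  shows "psum f = (of_nat d ^ 2 - 1) * ((of_nat d ^ 2 - 2) * a - 2 * b)"
    "psum (\<lambda>P Q. chi P Q * f P Q) = (of_nat d ^ 2 - 1) * ((of_nat d ^ 2 - 2) * b - 2 * a)"
proof -
  have *: "psum (\<lambda>P Q. a + b * chi P Q) = (of_nat d ^ 2 - 1) * ((of_nat d ^ 2 - 2) * a - 2 * b)" for a b
    using psum_add[of "\<lambda>P Q. a * 1" "\<lambda>P Q. b * chi P Q"] unfolding psum_cmult psum_1 psum_chi
    by (simp add: algebra_simps)
  show "psum f = (of_nat d ^ 2 - 1) * ((of_nat d ^ 2 - 2) * a - 2 * b)"
    using *[of a b] psum_cong[of f, OF assms] by simp
  have "psum (\<lambda>P Q. chi P Q * f P Q) = psum (\<lambda>P Q. b + a * chi P Q)"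
    by (rule psum_cong) (simp add: assms algebra_simps)
  then show "psum (\<lambda>P Q. chi P Q * f P Q) = (of_nat d ^ 2 - 1) * ((of_nat d ^ 2 - 2) * b - 2 * a)"
    using * by simp
qed

lemma lam_usum: "usum (\<lambda>P. lam' P P P) = (of_nat d ^ 2 - 1) * (2 * c1 + 4 * c2 + 2 * c3 + 2 * (al + be) + ga + de + ep)"
proof -
  have "usum (\<lambda>P. lam' P P P) = usum (\<lambda>P. (2 * c1 + 4 * c2 + 2 * c3 + 2 * (al + be) + ga + de + ep) * 1)"
    by (rule usum_cong) (auto simp: lam'_def lam_def supp_def tr_S algebra_simps)
  then show ?thesis unfolding usum_cmult usum_1 by (simp add: mult.commute)
qed

text \<open>Only the unrestricted sum of \<open>lam\<close> against \<open>Gam\<close> is a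
  combination of known sums, so the difference between \<open>lam\<close> and \<open>lam'\<close>
  must be invisible. At \<open>Q = 1\<close> and at scalar \<open>P * Q * R\<close> the averaged
  product vanishes; at the remaining points outside \<open>supp\<close>, where \<open>P\<close> or
  \<open>R\<close> is the identity, the coefficients \<open>ze\<close> and \<open>et\<close> make
  \<open>lam\<close> vanish.\<close>

lemma lam_vanish:
  assumes E1: "c1 + 2 * c2 + c3 + ze = 0" and E2: "2 * c1 + 4 * c2 + 2 * c3 + ga + de + 4 * ze + et = 0"
    and P: "P \<in> S" and Q: "Q \<in> S" and R: "R \<in> S" and ns: "\<not> supp P Q R" "Q \<noteq> 1\<^sub>m d" "tr (P * (Q * R)) = 0"
  shows "lam P Q R = 0"
proof -
  have s: "chi Q P = chi P Q" by (rule chi_sym)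
  consider "P = 1\<^sub>m d" "R = 1\<^sub>m d" | "P = 1\<^sub>m d" "R \<noteq> 1\<^sub>m d" | "P \<noteq> 1\<^sub>m d" "R = 1\<^sub>m d" using ns by (auto simp: supp_def)
  then show ?thesis
  proof cases
    case 1
    then have "lam P Q R = 2 * c1 + 4 * c2 + 2 * c3 + ga + de + 4 * ze + et"
      using Q ns(2) by (simp add: lam_def)
    then show ?thesis using E2 by simp
  next
    case 2
    then have "Q \<noteq> R" using ns Q R d_pos by (auto simp: tr_S2)
    then have "lam P Q R = (c1 + 2 * c2 + c3 + ze) * (1 + chi Q R)"
      using 2 Q R ns(2) by (simp add: lam_def algebra_simps)
    then show ?thesis using E1 by simp
  next
    case 3
    then have "P \<noteq> Q" using ns P Q d_pos by (auto simp: tr_S2)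
    then have "lam P Q R = (c1 + 2 * c2 + c3 + ze) * (1 + chi P Q)"
      using 3 P Q ns(2) by (simp add: lam_def algebra_simps)
    then show ?thesis using E1 by simp
  qed
qed

lemma dual_sum:
  assumes g: "class_fun g" and st: "same_stats k lam'"
    and k: "\<And>P Q R. P \<in> S \<Longrightarrow> Q \<in> S \<Longrightarrow> R \<in> S \<Longrightarrow> \<not> supp P Q R \<Longrightarrow> k P Q R = 0"
    and g0: "\<And>P Q R. P \<in> S \<Longrightarrow> Q \<in> S \<Longrightarrow> R \<in> S \<Longrightarrow> Q = 1\<^sub>m d \<or> tr (P * (Q * R)) \<noteq> 0 \<Longrightarrow> g P Q R = 0"
    and E1: "c1 + 2 * c2 + c3 + ze = 0" and E2: "2 * c1 + 4 * c2 + 2 * c3 + ga + de + 4 * ze + et = 0"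
  shows "sum3 (\<lambda>P Q R. k P Q R * g P Q R) = sum3 (\<lambda>P Q R. lam P Q R * g P Q R)"
proof -
  have "sum3 (\<lambda>P Q R. k P Q R * g P Q R) = sum3 (\<lambda>P Q R. lam' P Q R * g P Q R)"
    by (rule class_pairing[OF g st k]) (simp_all add: lam'_def)
  also have "\<dots> = sum3 (\<lambda>P Q R. lam P Q R * g P Q R)"
  proof (intro sum.cong refl)
    fix P Q R assume a: "P \<in> S" "Q \<in> S" "R \<in> S"
    show "lam' P Q R * g P Q R = lam P Q R * g P Q R"
    proof (cases "supp P Q R \<or> g P Q R = 0")
      case False
      then have "lam P Q R = 0" using lam_vanish[OF E1 E2 a] g0[OF a] by blast
      with False show ?thesis by (simp add: lam'_def)
    qed (auto simp: lam'_def)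
  qed
  finally show ?thesis .
qed

end

section \<open>Clifford conjugation\<close>

definition Cl :: "complex mat set" where
  "Cl = {U. unitary d U \<and> (\<forall>P\<in>S. \<exists>Q\<in>S. \<exists>s\<in>{1,-1}. U * P * adj U = s \<cdot>\<^sub>m Q)}"

definition cj :: "complex mat \<Rightarrow> complex mat \<Rightarrow> complex mat" where
  "cj U A = U * (A * adj U)"

definition maps_to :: "complex mat \<Rightarrow> complex mat \<Rightarrow> complex mat \<Rightarrow> bool" where
  "maps_to U P Q \<longleftrightarrow> (\<exists>s\<in>{1,-1}. cj U P = s \<cdot>\<^sub>m Q)"

lemma add_left_M: "A \<in> M \<Longrightarrow> B \<in> M \<Longrightarrow> C \<in> M \<Longrightarrow> (A + B) * C = A * C + B * C"
  by (rule add_mult_distrib_mat)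

lemma add_right_M: "A \<in> M \<Longrightarrow> B \<in> M \<Longrightarrow> C \<in> M \<Longrightarrow> C * (A + B) = C * A + C * B"
  by (rule mult_add_distrib_mat)

lemma Cl_M [simp]: "U \<in> Cl \<Longrightarrow> U \<in> M"
  unfolding Cl_def unitary_def by (elim CollectE conjE)

lemma Cl_unitary: "U \<in> Cl \<Longrightarrow> adj U * U = 1\<^sub>m d" "U \<in> Cl \<Longrightarrow> U * adj U = 1\<^sub>m d"
  unfolding Cl_def unitary_def by blast+

lemma Cl_cancel: "U \<in> Cl \<Longrightarrow> A \<in> M \<Longrightarrow> adj U * (U * A) = A" "U \<in> Cl \<Longrightarrow> A \<in> M \<Longrightarrow> U * (adj U * A) = A"
  using mult_assoc_M[of "adj U" U A] mult_assoc_M[of U "adj U" A] by (simp_all add: Cl_unitary)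

lemma cj_M [simp]: "U \<in> M \<Longrightarrow> A \<in> M \<Longrightarrow> cj U A \<in> M"
  unfolding cj_def by simp

lemma CL_I:
  assumes "U \<in> M" "adj U * U = 1\<^sub>m d" "U * adj U = 1\<^sub>m d" "\<And>P. P \<in> S \<Longrightarrow> \<exists>Q\<in>S. maps_to U P Q"
  shows "U \<in> Cl"
  using assms unfolding Cl_def unitary_def maps_to_def cj_def by simp

lemma Cl_maps: "U \<in> Cl \<Longrightarrow> P \<in> S \<Longrightarrow> \<exists>Q\<in>S. maps_to U P Q"
  unfolding Cl_def unitary_def maps_to_def cj_def by auto

lemma cj_mult: "U \<in> M \<Longrightarrow> V \<in> M \<Longrightarrow> A \<in> M \<Longrightarrow> cj (U * V) A = cj U (cj V A)"
  by (simp add: cj_def)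

lemma cj_smult: "U \<in> M \<Longrightarrow> A \<in> M \<Longrightarrow> cj U (c \<cdot>\<^sub>m A) = c \<cdot>\<^sub>m cj U A"
  by (simp add: cj_def)

lemma cj_phase: "U \<in> M \<Longrightarrow> A \<in> M \<Longrightarrow> cmod c = 1 \<Longrightarrow> cj (c \<cdot>\<^sub>m U) A = cj U A"
proof -
  assume a: "U \<in> M" "A \<in> M" "cmod c = 1"
  have "cnj c * c = 1" using complex_norm_square[of c] a(3) by (simp add: mult.commute)
  then show ?thesis using a by (simp add: cj_def)
qed

lemma cj_prod: "U \<in> Cl \<Longrightarrow> A \<in> M \<Longrightarrow> B \<in> M \<Longrightarrow> cj U (A * B) = cj U A * cj U B"
  by (simp add: cj_def Cl_cancel)

lemma cj_tr: "U \<in> Cl \<Longrightarrow> A \<in> M \<Longrightarrow> tr (cj U A) = tr A"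
proof -
  assume a: "U \<in> Cl" "A \<in> M"
  have "tr (U * (A * adj U)) = tr ((A * adj U) * U)" by (rule tr_cyc) (use a in simp_all)
  also have "(A * adj U) * U = A * (adj U * U)" by (rule mult_assoc_M) (use a in simp_all)
  finally show ?thesis unfolding cj_def Cl_unitary(1)[OF a(1)] one_right_M[OF a(2)] .
qed

lemma cj_one: "A \<in> M \<Longrightarrow> cj (1\<^sub>m d) A = A"
  by (simp add: cj_def)

lemma maps_to_mult: "U \<in> M \<Longrightarrow> V \<in> M \<Longrightarrow> P \<in> M \<Longrightarrow> Q \<in> M \<Longrightarrow> maps_to V P Q \<Longrightarrow> maps_to U Q R \<Longrightarrow> maps_to (U * V) P R"
  unfolding maps_to_def by (auto simp: cj_mult cj_smult)

lemma Cl_mult: "U \<in> Cl \<Longrightarrow> V \<in> Cl \<Longrightarrow> U * V \<in> Cl"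
proof (rule CL_I)
  assume a: "U \<in> Cl" "V \<in> Cl"
  show "U * V \<in> M" using a by simp
  show "adj (U * V) * (U * V) = 1\<^sub>m d" using a by (simp add: Cl_cancel Cl_unitary)
  show "U * V * adj (U * V) = 1\<^sub>m d" using a by (simp add: Cl_cancel Cl_unitary)
  fix P assume P: "P \<in> S"
  obtain Q where Q: "Q \<in> S" "maps_to V P Q" using Cl_maps[OF a(2) P] by blast
  obtain R where R: "R \<in> S" "maps_to U Q R" using Cl_maps[OF a(1) Q(1)] by blast
  show "\<exists>R\<in>S. maps_to (U * V) P R" using maps_to_mult[OF _ _ _ _ Q(2) R(2)] a P Q(1) R(1) by auto
qed

lemma S_eq_of_sign: "P \<in> S \<Longrightarrow> Q \<in> S \<Longrightarrow> c \<noteq> 0 \<Longrightarrow> b \<cdot>\<^sub>m P = c \<cdot>\<^sub>m Q \<Longrightarrow> P = Q"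
proof (rule ccontr)
  assume a: "P \<in> S" "Q \<in> S" "c \<noteq> 0" "b \<cdot>\<^sub>m P = c \<cdot>\<^sub>m Q" "P \<noteq> Q"
  have "tr ((b \<cdot>\<^sub>m P) * Q) = b * tr (P * Q)" using a(1,2) by simp
  moreover have "tr ((c \<cdot>\<^sub>m Q) * Q) = c * of_nat d" using a(2) by simp
  ultimately show False using a(3-5) S_orth[OF a(1,2,5)] d_pos by simp
qed

lemma maps_to_cj: "U \<in> Cl \<Longrightarrow> P \<in> M \<Longrightarrow> Q \<in> M \<Longrightarrow> maps_to U P Q \<Longrightarrow> maps_to (adj U) Q P"
proof -
  assume a: "U \<in> Cl" "P \<in> M" "Q \<in> M" "maps_to U P Q"
  obtain s where s: "s \<in> {1,-1}" "cj U P = s \<cdot>\<^sub>m Q" using a(4) unfolding maps_to_def by blast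
  have "Q = s \<cdot>\<^sub>m cj U P" using s by auto
  then have "cj (adj U) Q = s \<cdot>\<^sub>m (adj U * (U * (P * (adj U * U))))" using a by (simp add: cj_def)
  also have "\<dots> = s \<cdot>\<^sub>m P" using a by (simp add: Cl_cancel Cl_unitary)
  finally show ?thesis using s(1) unfolding maps_to_def by blast
qed

lemma maps_to_unique: "P \<in> S \<Longrightarrow> Q \<in> S \<Longrightarrow> maps_to U R P \<Longrightarrow> maps_to U R Q \<Longrightarrow> P = Q"
  unfolding maps_to_def using S_eq_of_sign[of P Q] by (metis insertE singletonD zero_neq_one neg_equal_0_iff_equal)

definition act :: "complex mat \<Rightarrow> complex mat \<Rightarrow> complex mat" where
  "act U P = (SOME Q. Q \<in> S \<and> maps_to U P Q)"

lemma act: "U \<in> Cl \<Longrightarrow> P \<in> S \<Longrightarrow> act U P \<in> S" "U \<in> Cl \<Longrightarrow> P \<in> S \<Longrightarrow> maps_to U P (act U P)"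
  using someI_ex[OF Cl_maps[of U P, unfolded Bex_def]] unfolding act_def by auto

lemma act_bij: assumes U: "U \<in> Cl" shows "bij_betw (act U) S S"
proof -
  have "inj_on (act U) S"
  proof (rule inj_onI)
    fix P Q assume a: "P \<in> S" "Q \<in> S" "act U P = act U Q"
    have "maps_to (adj U) (act U P) P" "maps_to (adj U) (act U P) Q"
      using maps_to_cj[OF U _ _ act(2)[OF U]] a act(1)[OF U] S_carrier by metis+
    then show "P = Q" using maps_to_unique a by blast
  qed
  moreover have "act U ` S \<subseteq> S" using act[OF U] by auto
  ultimately show ?thesis using finite_S by (simp add: bij_betw_def endo_inj_surj)
qed

lemma one_Cl: "1\<^sub>m d \<in> Cl"
proof (rule CL_I)
  fix P assume "P \<in> S"
  then have "cj (1\<^sub>m d) P = 1 \<cdot>\<^sub>m P" by (simp add: cj_one)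
  then show "\<exists>Q\<in>S. maps_to (1\<^sub>m d) P Q" unfolding maps_to_def using \<open>P \<in> S\<close> by blast
qed simp_all

lemma S_Cl: "X \<in> S \<Longrightarrow> X \<in> Cl"
proof (rule CL_I)
  fix P assume a: "X \<in> S" "P \<in> S"
  have "cj X P = chi X P \<cdot>\<^sub>m P" using a S_conj[of X P] by (simp add: cj_def)
  then show "\<exists>Q\<in>S. maps_to X P Q" unfolding maps_to_def using chi_in a by blast
qed simp_all

text \<open>The unitary is (1 + ab) / sqrt 2, where \<open>a * b\<close> is antihermitian with
  square -1. It commutes with \<open>X\<close> if \<open>X\<close> has equal signs with
  \<open>a\<close> and \<open>b\<close>, and otherwise turns \<open>X\<close> into
  \<open>a * b * X\<close>. On the symplectic space this is the transvection along the product of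
  \<open>a\<close> and \<open>b\<close>.\<close>

lemma transvection:
  assumes a: "a \<in> S" and b: "b \<in> S" and ab: "chi a b = -1"
  shows "\<exists>U\<in>Cl. (\<forall>X\<in>S. chi a X = chi b X \<longrightarrow> maps_to U X X) \<and> maps_to U a b"
proof -
  define K where "K = a * b"
  define r :: complex where "r = of_real (1 / sqrt 2)"
  define U where "U = r \<cdot>\<^sub>m (1\<^sub>m d + K)"
  have rr: "r * r = 1 / 2" "cnj r = r" by (simp_all add: r_def flip: of_real_mult)
  have K [simp]: "K \<in> M" unfolding K_def using a b by simp
  have dK: "dim_row K = d" "dim_col K = d" using carrier_matD[OF K] by simp_all
  have ba: "b * a = (-1) \<cdot>\<^sub>m K" using S_swap[OF b a] ab chi_sym[of a b] unfolding K_def by simp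
  have adjK: "adj K = (-1) \<cdot>\<^sub>m K" using ba a b by (simp add: K_def)
  have KK: "K * K = (-1) \<cdot>\<^sub>m 1\<^sub>m d"
  proof -
    have "K * K = a * ((b * a) * b)" using a b by (simp add: K_def)
    also have "\<dots> = (-1) \<cdot>\<^sub>m (a * (K * b))" unfolding ba using a b by simp
    also have "a * (K * b) = 1\<^sub>m d" using a b by (simp add: K_def)
    finally show ?thesis .
  qed
  have U [simp]: "U \<in> M" unfolding U_def by simp
  have adjU: "adj U = r \<cdot>\<^sub>m (1\<^sub>m d + (-1) \<cdot>\<^sub>m K)"
    by (simp add: U_def rr adj_add[of _ d d] adjK)
  have mm: "(1\<^sub>m d + A) * (1\<^sub>m d + B) = 1\<^sub>m d + A + B + A * B" if "A \<in> M" "B \<in> M" for A B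
  proof -
    have "(1\<^sub>m d + A) * (1\<^sub>m d + B) = (1\<^sub>m d + A) * 1\<^sub>m d + (1\<^sub>m d + A) * B"
      using that by (intro mult_add_distrib_mat) auto
    also have "(1\<^sub>m d + A) * B = 1\<^sub>m d * B + A * B" using that by (intro add_mult_distrib_mat) auto
    finally show ?thesis using that by (simp add: assoc_add_mat[of _ d d])
  qed
  have e1: "1\<^sub>m d + K + (-1) \<cdot>\<^sub>m K + K * ((-1) \<cdot>\<^sub>m K) = 2 \<cdot>\<^sub>m 1\<^sub>m d"
    "1\<^sub>m d + (-1) \<cdot>\<^sub>m K + K + ((-1) \<cdot>\<^sub>m K) * K = 2 \<cdot>\<^sub>m 1\<^sub>m d"
    by (auto simp: KK dK intro!: eq_matI)
  have UU: "U * adj U = 1\<^sub>m d" "adj U * U = 1\<^sub>m d"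
  proof -
    have m: "(r \<cdot>\<^sub>m A) * (r \<cdot>\<^sub>m B) = (1/2) \<cdot>\<^sub>m (A * B)" if "A \<in> M" "B \<in> M" for A B
    proof -
      have "(r \<cdot>\<^sub>m A) * (r \<cdot>\<^sub>m B) = (r * r) \<cdot>\<^sub>m (A * B)" using that by simp
      then show ?thesis unfolding rr(1) .
    qed
    have k: "1\<^sub>m d + K \<in> M" "1\<^sub>m d + (-1) \<cdot>\<^sub>m K \<in> M" "(-1) \<cdot>\<^sub>m K \<in> M" using K by simp_all
    have h: "(1/2) \<cdot>\<^sub>m (2 \<cdot>\<^sub>m 1\<^sub>m d) = (1\<^sub>m d :: complex mat)" by simp
    show "U * adj U = 1\<^sub>m d" unfolding adjU unfolding U_def m[OF k(1,2)] mm[OF K k(3)] e1 h ..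
    show "adj U * U = 1\<^sub>m d" unfolding adjU unfolding U_def m[OF k(2,1)] mm[OF k(3) K] e1 h ..
  qed
  have U2: "U * U = K"
  proof -
    have e3: "1\<^sub>m d + K + K + K * K = 2 \<cdot>\<^sub>m K" by (auto simp: KK dK intro!: eq_matI)
    have uu: "U * U = (r * r) \<cdot>\<^sub>m ((1\<^sub>m d + K) * (1\<^sub>m d + K))"
    proof -
      have k: "1\<^sub>m d + K \<in> M" "r \<cdot>\<^sub>m (1\<^sub>m d + K) \<in> M" using K by simp_all
      show ?thesis unfolding U_def smult_left_M[OF k] smult_right_M[OF k(1) k(1)] smult_smult ..
    qed
    have h: "(1/2) \<cdot>\<^sub>m (2 \<cdot>\<^sub>m K) = K" unfolding smult_smult by simp
    show ?thesis unfolding uu rr(1) mm[OF K K] e3 h ..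
  qed
  have KX: "K * X = (chi a X * chi b X) \<cdot>\<^sub>m (X * K)" if X: "X \<in> S" for X
  proof -
    have "K * X = a * (b * X)" using a b X by (simp add: K_def)
    also have "\<dots> = chi b X \<cdot>\<^sub>m ((a * X) * b)" unfolding S_swap[OF b X] using a b X by simp
    also have "(a * X) * b = chi a X \<cdot>\<^sub>m (X * K)" unfolding S_swap[OF a X] using a b X by (simp add: K_def)
    finally show ?thesis by (simp add: mult.commute)
  qed
  have com: "cj U X = X" if X: "X \<in> S" and "chi a X = chi b X" for X
  proof -
    have "K * X = X * K" using KX[OF X] that by simp
    then have "U * X = X * U" unfolding U_def using X K
      by (simp add: add_left_M add_right_M)
    then have "U * X * adj U = X * (U * adj U)" using X by simp
    then show ?thesis using X by (simp add: cj_def UU)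
  qed
  have acom: "cj U X = K * X" if X: "X \<in> S" and ne: "chi a X \<noteq> chi b X" for X
  proof -
    have "chi a X * chi b X = -1" using ne chi_cases[of a X] chi_cases[of b X] by auto
    then have k: "X * K = (-1) \<cdot>\<^sub>m (K * X)" using KX[OF X] X by simp
    have "X * adj U = U * X" unfolding adjU unfolding U_def using X K k
      by (simp add: add_left_M add_right_M)
    then have "cj U X = (U * U) * X" using X by (simp add: cj_def)
    then show ?thesis using U2 by simp
  qed
  have maps: "\<exists>Q\<in>S. maps_to U X Q" if X: "X \<in> S" for X
  proof (cases "chi a X = chi b X")
    case True
    then have "cj U X = 1 \<cdot>\<^sub>m X" using com[OF X] by simp
    then show ?thesis using X unfolding maps_to_def by blast
  next
    case False
    obtain Q c where Q: "Q \<in> S" "K = c \<cdot>\<^sub>m Q" "cmod c = 1" using S_mult[OF a b] unfolding K_def by blast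
    obtain R e where R: "R \<in> S" "Q * X = e \<cdot>\<^sub>m R" "cmod e = 1" using S_mult[OF Q(1) X] by blast
    have 1: "cj U X = (c * e) \<cdot>\<^sub>m R" using acom[OF X False] Q R X by simp
    \<comment> \<open>The phase \<open>c * e\<close> is real because the conjugate of
      \<open>X\<close> is Hermitian, and it has modulus one, so it is a sign.\<close>
    have "adj (cj U X) = cj U X" using X by (simp add: cj_def)
    then have "cnj (c * e) \<cdot>\<^sub>m R = (c * e) \<cdot>\<^sub>m R" using 1 R by simp
    then have "tr ((cnj (c * e) \<cdot>\<^sub>m R) * R) = tr (((c * e) \<cdot>\<^sub>m R) * R)" by simp
    then have "cnj (c * e) = c * e" using R(1) d_pos by simp
    moreover have "(c * e) * cnj (c * e) = 1" using complex_norm_square[of "c * e"] Q(3) R(3) by (simp add: norm_mult)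
    ultimately have "(c * e)\<^sup>2 = 1" by (simp add: power2_eq_square)
    then have "c * e \<in> {1,-1}" by (simp add: power2_eq_1_iff)
    then show ?thesis using 1 R(1) unfolding maps_to_def by blast
  qed
  have "U \<in> Cl" by (rule CL_I) (simp_all add: UU maps)
  moreover have "cj U a = (-1) \<cdot>\<^sub>m b"
  proof -
    have "cj U a = K * a" using acom[OF a] ab chi_sym[of a b] by simp
    also have "\<dots> = a * (b * a)" using a b by (simp add: K_def)
    finally show ?thesis unfolding ba using a b by (simp add: K_def)
  qed
  ultimately show ?thesis using com unfolding maps_to_def by (intro bexI[of _ U]) auto
qed

section \<open>Witt extension and transitivity of the Clifford group\<close>

lemma word_trace_sign:
  assumes "set ws \<subseteq> S" "X \<in> S" "tr (word ws) \<noteq> 0"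
  shows "(\<Prod>P\<leftarrow>ws. chi P X) = 1"
proof -
  have "tr (X * (word ws * X)) = tr ((word ws * X) * X)" by (rule tr_cyc) (use assms in simp_all)
  also have "(word ws * X) * X = word ws" using assms by simp
  finally have "tr (X * (word ws * X)) = tr (word ws)" .
  moreover have "tr (X * (word ws * X)) = (\<Prod>P\<leftarrow>ws. chi P X) * tr (word ws)"
    using assms by (simp add: word_conj)
  ultimately show ?thesis using assms(3) by simp
qed

text \<open>A counting argument: the indicator of the required operators is expanded into characters
  and summed. Words that contain exactly one of \<open>P\<close> and \<open>P'\<close> have trace 0
  by independence. All other words contribute a nonnegative square, and the empty word contributes
  \<open>d ^ 2\<close>, so the sum cannot be 0.\<close>

lemma connecting:
  assumes S: "L1 \<in> S" "L2 \<in> S" "P \<in> S" "P' \<in> S"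
    and c: "chi P L1 = chi P' L1" "chi P L2 = chi P' L2" "chi P P' = 1"
    and i: "tr P = 0" "tr (P * L1) = 0" "tr (P * L2) = 0" "tr (P * (L1 * L2)) = 0"
    and i': "tr P' = 0" "tr (P' * L1) = 0" "tr (P' * L2) = 0" "tr (P' * (L1 * L2)) = 0"
  shows "\<exists>R\<in>S. chi R L1 = chi P L1 \<and> chi R L2 = chi P L2 \<and> chi P R = -1 \<and> chi P' R = -1"
proof (rule ccontr)
  assume no: "\<not> ?thesis"
  define u1 u2 where "u1 = chi P L1" and "u2 = chi P L2"
  \<comment> \<open>Each of the four factors is 0 or 2, so this is 16 times the indicator of the
    required operators.\<close>
  let ?f = "\<lambda>X. (1 + u1 * chi L1 X) * (1 + u2 * chi L2 X) * ((1 - chi P X) * (1 - chi P' X))"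
  have z: "?f X = 0" if "X \<in> S" for X
  proof -
    have "chi X L1 \<noteq> u1 \<or> chi X L2 \<noteq> u2 \<or> chi P X \<noteq> -1 \<or> chi P' X \<noteq> -1" using no that u1_def u2_def by auto
    then have "u1 * chi L1 X = -1 \<or> u2 * chi L2 X = -1 \<or> chi P X = 1 \<or> chi P' X = 1"
      using chi_cases[of L1 X] chi_cases[of L2 X] chi_cases[of P X] chi_cases[of P' X] chi_cases[of P L1] chi_cases[of P L2]
      unfolding u1_def u2_def chi_sym[of X] by auto
    then show ?thesis by auto
  qed
  define T where "T ws = (\<Sum>X\<in>S. \<Prod>P\<leftarrow>ws. chi P X)" for ws
  have T: "T ws = of_real ((cmod (tr (word ws)))\<^sup>2)" if "set ws \<subseteq> S" for ws
    unfolding T_def using sum_chi_word[OF that] .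
  have F: "(\<Sum>X\<in>S. ?f X) = T [] + u1 * T [L1] + u2 * T [L2] + u1 * u2 * T [L1, L2]
     - (T [P] + u1 * T [P, L1] + u2 * T [P, L2] + u1 * u2 * T [P, L1, L2])
     - (T [P'] + u1 * T [P', L1] + u2 * T [P', L2] + u1 * u2 * T [P', L1, L2])
     + (T [P, P'] + u1 * T [P, P', L1] + u2 * T [P, P', L2] + u1 * u2 * T [P, P', L1, L2])"
    unfolding T_def sum_distrib_left sum.distrib[symmetric] sum_subtractf[symmetric]
    by (intro sum.cong refl) (simp add: algebra_simps)
  have T0: "T ws = 0" if "set ws \<subseteq> S" "tr (word ws) = 0" for ws
    using T[OF that(1)] that(2) by simp
  have w: "word [Q] = Q" "word [Q, L] = Q * L" "word [Q, L, L'] = Q * (L * L')"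
    if "Q \<in> S" "L \<in> S" "L' \<in> S" for Q L L'
    using that by simp_all
  have n: "T [Q] = 0" "T [Q, L1] = 0" "T [Q, L2] = 0" "T [Q, L1, L2] = 0"
    if Q: "Q \<in> S" and "tr Q = 0" "tr (Q * L1) = 0" "tr (Q * L2) = 0" "tr (Q * (L1 * L2)) = 0" for Q
  proof -
    have s: "set [Q] \<subseteq> S" "set [Q, L1] \<subseteq> S" "set [Q, L2] \<subseteq> S" "set [Q, L1, L2] \<subseteq> S" using Q S by simp_all
    show "T [Q] = 0" by (rule T0[OF s(1)], unfold w(1)[OF Q Q Q], fact)
    show "T [Q, L1] = 0" by (rule T0[OF s(2)], unfold w(2)[OF Q S(1) Q], fact)
    show "T [Q, L2] = 0" by (rule T0[OF s(3)], unfold w(2)[OF Q S(2) Q], fact)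
    show "T [Q, L1, L2] = 0" by (rule T0[OF s(4)], unfold w(3)[OF Q S(1) S(2)], fact)
  qed
  have t: "x * T ws = T ws" if "set ws \<subseteq> S" "(\<Prod>Q\<leftarrow>ws. chi Q P) = x" for ws x
  proof (cases "tr (word ws) = 0")
    case True
    then show ?thesis using T0[OF that(1)] by simp
  next
    case False
    then show ?thesis using word_trace_sign[OF that(1) S(3)] that(2) by simp
  qed
  \<comment> \<open>The prefactors are the signs of the words against \<open>P\<close>, where
    \<open>chi P P\<close> and \<open>chi P' P\<close> are 1. If the trace of the word is not 0,
    \<open>word_trace_sign\<close> makes the prefactor 1; otherwise both sides vanish.\<close>
  have E: "u1 * T [L1] = T [L1]" "u2 * T [L2] = T [L2]" "u1 * u2 * T [L1, L2] = T [L1, L2]"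
    "u1 * T [P, P', L1] = T [P, P', L1]" "u2 * T [P, P', L2] = T [P, P', L2]"
    "u1 * u2 * T [P, P', L1, L2] = T [P, P', L1, L2]"
    using S c by (intro t; simp add: u1_def u2_def chi_sym[of _ P])+
  have "(\<Sum>X\<in>S. ?f X) = 0" by (rule sum.neutral) (use z in blast)
  then have "T [] + T [L1] + T [L2] + T [L1, L2] + (T [P, P'] + T [P, P', L1] + T [P, P', L2] + T [P, P', L1, L2]) = 0"
    unfolding F E n[OF S(3) i] n[OF S(4) i'] by (simp only: mult_zero_right add_0 diff_0_right)
  then have "of_real ((cmod (tr (word [])))\<^sup>2 + (cmod (tr (word [L1])))\<^sup>2 + (cmod (tr (word [L2])))\<^sup>2 + (cmod (tr (word [L1, L2])))\<^sup>2 +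
    ((cmod (tr (word [P, P'])))\<^sup>2 + (cmod (tr (word [P, P', L1])))\<^sup>2 + (cmod (tr (word [P, P', L2])))\<^sup>2 + (cmod (tr (word [P, P', L1, L2])))\<^sup>2)) = (0::complex)"
    using S by (simp only: T of_real_add list.set insert_subset empty_subsetI simp_thms)
  then have "(cmod (tr (word [])))\<^sup>2 + (cmod (tr (word [L1])))\<^sup>2 + (cmod (tr (word [L2])))\<^sup>2 + (cmod (tr (word [L1, L2])))\<^sup>2 +
    ((cmod (tr (word [P, P'])))\<^sup>2 + (cmod (tr (word [P, P', L1])))\<^sup>2 + (cmod (tr (word [P, P', L2])))\<^sup>2 + (cmod (tr (word [P, P', L1, L2])))\<^sup>2) = 0"
    by (simp only: of_real_eq_0_iff)
  moreover have "(cmod (tr (word [])))\<^sup>2 > 0" using d_pos by simp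
  moreover have "\<And>x. 0 \<le> (cmod x)\<^sup>2" by simp
  ultimately show False by (smt (verit))
qed

text \<open>The inductive step of Witt's theorem. An anticommuting pair is joined by one
  transvection, a commuting pair by two that pass through the operator from
  \<open>connecting\<close>. They fix \<open>L1\<close> and \<open>L2\<close> because each of these
  has equal signs with both ends of every transvection.\<close>

lemma witt_step:
  assumes S: "L1 \<in> S" "L2 \<in> S" "P \<in> S" "P' \<in> S"
    and c: "chi P L1 = chi P' L1" "chi P L2 = chi P' L2"
    and i: "tr P = 0" "tr (P * L1) = 0" "tr (P * L2) = 0" "tr (P * (L1 * L2)) = 0"
    and i': "tr P' = 0" "tr (P' * L1) = 0" "tr (P' * L2) = 0" "tr (P' * (L1 * L2)) = 0"
  shows "\<exists>U\<in>Cl. maps_to U L1 L1 \<and> maps_to U L2 L2 \<and> maps_to U P P'"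
proof (cases "chi P P' = 1")
  case False
  then have "chi P P' = -1" using chi_cases by auto
  from transvection[OF S(3,4) this] show ?thesis using S c by blast
next
  case True
  obtain R where R: "R \<in> S" "chi R L1 = chi P L1" "chi R L2 = chi P L2" "chi P R = -1" "chi P' R = -1"
    using connecting[OF S c True i i'] by blast
  obtain U where U: "U \<in> Cl" "maps_to U L1 L1" "maps_to U L2 L2" "maps_to U P R"
    using transvection[OF S(3) R(1) R(4)] S R(2,3) by (metis (no_types))
  have "chi R P' = -1" using R(5) chi_sym by metis
  then obtain V where V: "V \<in> Cl" "maps_to V L1 L1" "maps_to V L2 L2" "maps_to V R P'"
    using transvection[OF R(1) S(4)] S R(2,3) c by (metis (no_types))
  have "maps_to (V * U) L1 L1" "maps_to (V * U) L2 L2" "maps_to (V * U) P P'"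
    using maps_to_mult[of V U] U V S R(1) by (meson Cl_M S_carrier)+
  then show ?thesis using Cl_mult[OF V(1) U(1)] by blast
qed

lemma maps_toE:
  assumes "maps_to U P Q" "Q \<in> M"
  obtains s where "s \<in> {1,-1}" "cj U P = s \<cdot>\<^sub>m Q" "Q = s \<cdot>\<^sub>m cj U P"
proof -
  obtain s where s: "s \<in> {1,-1}" "cj U P = s \<cdot>\<^sub>m Q" using assms(1) unfolding maps_to_def by blast
  have "s * s = 1" using s(1) by auto
  then have "s \<cdot>\<^sub>m cj U P = Q" unfolding s(2) smult_smult by simp
  then show ?thesis using that[OF s] by simp
qed

lemma tr_maps1:
  assumes U: "U \<in> Cl" and P: "P \<in> S" "P' \<in> S" "maps_to U P P'"
  shows "\<exists>s\<in>{1,-1}. cj U P = s \<cdot>\<^sub>m P' \<and> (\<forall>A\<in>M. tr (P' * cj U A) = s * tr (P * A))"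
proof -
  obtain s where s: "s \<in> {1,-1}" "cj U P = s \<cdot>\<^sub>m P'" "P' = s \<cdot>\<^sub>m cj U P" using maps_toE[OF P(3) S_carrier[OF P(2)]] .
  have "tr (P' * cj U A) = s * tr (P * A)" if A: "A \<in> M" for A
  proof -
    have m: "cj U P \<in> M" "cj U A \<in> M" using U P A by simp_all
    have "tr (P' * cj U A) = tr ((s \<cdot>\<^sub>m cj U P) * cj U A)" using s(3) by simp
    also have "\<dots> = s * tr (cj U P * cj U A)" unfolding smult_left_M[OF m] tr_M_smult[OF mult_M[OF m]] ..
    also have "cj U P * cj U A = cj U (P * A)" using cj_prod[OF U S_carrier[OF P(1)] A] ..
    finally show ?thesis unfolding cj_tr[OF U mult_M[OF S_carrier[OF P(1)] A]] .
  qed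
  then show ?thesis using s by blast
qed

lemma mult_maps:
  assumes U: "U \<in> Cl" and P: "P \<in> S" "P' \<in> S" "cj U P = s \<cdot>\<^sub>m P'" "s \<in> {1,-1}" and A: "A \<in> M"
  shows "P' * cj U A = s \<cdot>\<^sub>m cj U (P * A)"
proof -
  have m: "P' \<in> M" "cj U A \<in> M" using P U A by simp_all
  have "s * s = 1" using P(4) by auto
  then have "P' * cj U A = s \<cdot>\<^sub>m ((s \<cdot>\<^sub>m P') * cj U A)" unfolding smult_left_M[OF m] smult_smult by simp
  then show ?thesis unfolding P(3)[symmetric] cj_prod[OF U S_carrier[OF P(1)] A] .
qed

lemma tr_maps3:
  assumes U: "U \<in> Cl" and P: "P \<in> S" "P' \<in> S" "cj U P = s \<cdot>\<^sub>m P'" "s \<in> {1,-1}"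
    and Q: "Q \<in> S" "Q' \<in> S" "cj U Q = t \<cdot>\<^sub>m Q'" "t \<in> {1,-1}"
    and R: "R \<in> S" "R' \<in> S" "cj U R = u \<cdot>\<^sub>m R'" "u \<in> {1,-1}" and A: "A \<in> M"
  shows "tr (P' * (Q' * (R' * cj U A))) = s * t * u * tr (P * (Q * (R * A)))"
proof -
  have m: "R * A \<in> M" "Q * (R * A) \<in> M" "P * (Q * (R * A)) \<in> M" using P Q R A by simp_all
  have c: "cj U (R * A) \<in> M" "cj U (Q * (R * A)) \<in> M" "cj U (P * (Q * (R * A))) \<in> M" using m U by simp_all
  show ?thesis
    unfolding mult_maps[OF U R A] smult_right_M[OF S_carrier[OF Q(2)] c(1)] mult_maps[OF U Q m(1)] smult_smult
      smult_right_M[OF S_carrier[OF P(2)] c(2)] mult_maps[OF U P m(2)] tr_M_smult[OF c(3)] cj_tr[OF U m(3)]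
    by simp
qed

lemma Gam_cj:
  assumes U: "U \<in> Cl" and P: "P \<in> S" "P' \<in> S" "maps_to U P P'"
    and Q: "Q \<in> S" "Q' \<in> S" "maps_to U Q Q'"
    and R: "R \<in> S" "R' \<in> S" "maps_to U R R'" and A: "A \<in> M" "B \<in> M" "C \<in> M" "E \<in> M"
  shows "Gam (cj U A) (cj U B) (cj U C) (cj U E) P' Q' R' = Gam A B C E P Q R"
proof -
  obtain s where s: "s \<in> {1,-1}" "cj U P = s \<cdot>\<^sub>m P'" "\<forall>A\<in>M. tr (P' * cj U A) = s * tr (P * A)" using tr_maps1[OF U P] by blast
  obtain t where t: "t \<in> {1,-1}" "cj U Q = t \<cdot>\<^sub>m Q'" "\<forall>A\<in>M. tr (Q' * cj U A) = t * tr (Q * A)" using tr_maps1[OF U Q] by blast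
  obtain u where u: "u \<in> {1,-1}" "cj U R = u \<cdot>\<^sub>m R'" "\<forall>A\<in>M. tr (R' * cj U A) = u * tr (R * A)" using tr_maps1[OF U R] by blast
  have e: "tr (P' * (Q' * (R' * cj U E))) = s * t * u * tr (P * (Q * (R * E)))"
    by (rule tr_maps3[OF U P(1,2) s(2,1) Q(1,2) t(2,1) R(1,2) u(2,1) A(4)])
  have 1: "tr (P' * cj U A) = s * tr (P * A)" "tr (Q' * cj U B) = t * tr (Q * B)" "tr (R' * cj U C) = u * tr (R * C)"
    using s(3) t(3) u(3) A by blast+
  have "(s * s) * (t * t) * (u * u) = 1" using s(1) t(1) u(1) by auto
  then show ?thesis unfolding Gam_def e 1 by (simp add: mult_ac)
qed

lemma chi_trace: "P \<in> S \<Longrightarrow> Q \<in> S \<Longrightarrow> tr (P * (Q * (P * Q))) = chi P Q * of_nat d"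
proof -
  assume a: "P \<in> S" "Q \<in> S"
  have "P * (Q * (P * Q)) = (P * (Q * P)) * Q" using a by simp
  also have "\<dots> = chi P Q \<cdot>\<^sub>m 1\<^sub>m d" unfolding S_conj[OF a] using a by simp
  finally have "tr (P * (Q * (P * Q))) = tr (chi P Q \<cdot>\<^sub>m 1\<^sub>m d)" by (rule arg_cong)
  then show ?thesis unfolding tr_M_smult[OF one_M] tr_one .
qed

lemma chi_maps:
  assumes U: "U \<in> Cl" and P: "P \<in> S" "P' \<in> S" "maps_to U P P'" and Q: "Q \<in> S" "Q' \<in> S" "maps_to U Q Q'"
  shows "chi P' Q' = chi P Q"
proof -
  obtain s where s: "s \<in> {1,-1}" "cj U P = s \<cdot>\<^sub>m P'" using P(3) unfolding maps_to_def by blast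
  obtain t where t: "t \<in> {1,-1}" "cj U Q = t \<cdot>\<^sub>m Q'" using Q(3) unfolding maps_to_def by blast
  have e: "t \<cdot>\<^sub>m cj U Q = Q'" unfolding t(2) using t(1) by auto
  have m: "cj U Q \<in> M" "P' * cj U Q \<in> M" "Q' * (P' * cj U Q) \<in> M" "P' * (Q' * (P' * cj U Q)) \<in> M"
    using P Q U by simp_all
  have "tr (P' * (Q' * (P' * Q'))) = tr (P' * (Q' * (P' * (t \<cdot>\<^sub>m cj U Q))))" unfolding e ..
  also have "\<dots> = t * tr (P' * (Q' * (P' * cj U Q)))"
    unfolding smult_right_M[OF S_carrier[OF P(2)] m(1)] smult_right_M[OF S_carrier[OF Q(2)] m(2)]
      smult_right_M[OF S_carrier[OF P(2)] m(3)] tr_M_smult[OF m(4)] ..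
  also have "\<dots> = t * (s * t * s * tr (P * (Q * (P * Q))))"
    unfolding tr_maps3[OF U P(1,2) s(2,1) Q(1,2) t(2,1) P(1,2) s(2,1) S_carrier[OF Q(1)]] ..
  also have "\<dots> = tr (P * (Q * (P * Q)))" using s(1) t(1) by auto
  finally show ?thesis unfolding chi_trace[OF P(2) Q(2)] chi_trace[OF P(1) Q(1)] using d_pos by simp
qed

lemma maps_to_eq_iff:
  assumes U: "U \<in> Cl" and P: "P \<in> S" "P' \<in> S" "maps_to U P P'" and Q: "Q \<in> S" "Q' \<in> S" "maps_to U Q Q'"
  shows "P' = Q' \<longleftrightarrow> P = Q"
proof
  assume "P = Q"
  then obtain s t where "s \<in> {1,-1}" "cj U P = s \<cdot>\<^sub>m P'" "t \<in> {1,-1}" "cj U P = t \<cdot>\<^sub>m Q'"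
    using P(3) Q(3) unfolding maps_to_def by blast
  then have "s \<cdot>\<^sub>m P' = t \<cdot>\<^sub>m Q'" "t \<noteq> 0" by auto
  then show "P' = Q'" using S_eq_of_sign[OF P(2) Q(2)] by blast
next
  assume e: "P' = Q'"
  have "maps_to (adj U) P' P" "maps_to (adj U) P' Q"
    using maps_to_cj[OF U S_carrier[OF P(1)] S_carrier[OF P(2)] P(3)] maps_to_cj[OF U S_carrier[OF Q(1)] S_carrier[OF Q(2)] Q(3)] e by simp_all
  then show "P = Q" using maps_to_unique[OF P(1) Q(1)] by blast
qed

lemma maps_to_one: "U \<in> Cl \<Longrightarrow> maps_to U (1\<^sub>m d) (1\<^sub>m d)"
proof -
  assume U: "U \<in> Cl"
  have "cj U (1\<^sub>m d) = 1 \<cdot>\<^sub>m 1\<^sub>m d" unfolding cj_def using U by (simp add: Cl_unitary)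
  then show ?thesis unfolding maps_to_def by blast
qed

lemma maps_to_one_iff: "U \<in> Cl \<Longrightarrow> P \<in> S \<Longrightarrow> P' \<in> S \<Longrightarrow> maps_to U P P' \<Longrightarrow> P' = 1\<^sub>m d \<longleftrightarrow> P = 1\<^sub>m d"
  using maps_to_eq_iff[of U P P' "1\<^sub>m d" "1\<^sub>m d"] one_S maps_to_one by blast

lemma tr3_maps_iff:
  assumes U: "U \<in> Cl" and P: "P \<in> S" "P' \<in> S" "maps_to U P P'" and Q: "Q \<in> S" "Q' \<in> S" "maps_to U Q Q'"
    and R: "R \<in> S" "R' \<in> S" "maps_to U R R'"
  shows "tr (P' * (Q' * R')) = 0 \<longleftrightarrow> tr (P * (Q * R)) = 0"
proof -
  obtain s where s: "s \<in> {1,-1}" "cj U P = s \<cdot>\<^sub>m P'" using P(3) unfolding maps_to_def by blast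
  obtain t where t: "t \<in> {1,-1}" "cj U Q = t \<cdot>\<^sub>m Q'" using Q(3) unfolding maps_to_def by blast
  obtain u where u: "u \<in> {1,-1}" "cj U R = u \<cdot>\<^sub>m R'" using R(3) unfolding maps_to_def by blast
  have o: "cj U (1\<^sub>m d) = 1\<^sub>m d" unfolding cj_def using U by (simp add: Cl_unitary)
  have "tr (P' * (Q' * (R' * cj U (1\<^sub>m d)))) = s * t * u * tr (P * (Q * (R * 1\<^sub>m d)))"
    by (rule tr_maps3[OF U P(1,2) s(2,1) Q(1,2) t(2,1) R(1,2) u(2,1) one_M])
  then have "tr (P' * (Q' * R')) = s * t * u * tr (P * (Q * R))"
    unfolding o one_right_M[OF S_carrier[OF R(1)]] one_right_M[OF S_carrier[OF R(2)]] .
  then show ?thesis using s(1) t(1) u(1) by auto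
qed

lemma ind_maps:
  assumes U: "U \<in> Cl" and P: "P \<in> S" "P' \<in> S" "maps_to U P P'" and Q: "Q \<in> S" "Q' \<in> S" "maps_to U Q Q'"
    and R: "R \<in> S" "R' \<in> S" "maps_to U R R'"
  shows "ind P' Q' R' \<longleftrightarrow> ind P Q R"
  unfolding ind_def supp_def maps_to_one_iff[OF U P] maps_to_one_iff[OF U Q] maps_to_one_iff[OF U R]
    maps_to_eq_iff[OF U P Q] maps_to_eq_iff[OF U Q R] maps_to_eq_iff[OF U P R] tr3_maps_iff[OF U P Q R] ..

lemma tr_S_0: "P \<in> S \<Longrightarrow> P \<noteq> 1\<^sub>m d \<Longrightarrow> tr P = 0"
  by (simp add: tr_S)

lemma transitive1:
  assumes "P \<in> S" "P' \<in> S" "P \<noteq> 1\<^sub>m d" "P' \<noteq> 1\<^sub>m d"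
  shows "\<exists>U\<in>Cl. maps_to U P P'"
proof -
  have "\<exists>U\<in>Cl. maps_to U (1\<^sub>m d) (1\<^sub>m d) \<and> maps_to U (1\<^sub>m d) (1\<^sub>m d) \<and> maps_to U P P'"
    by (rule witt_step) (use assms one_S tr_S_0[OF assms(1,3)] tr_S_0[OF assms(2,4)] in simp_all)
  then show ?thesis by blast
qed

lemma transitive2:
  assumes P: "P \<in> S" "P' \<in> S" "P \<noteq> 1\<^sub>m d" "P' \<noteq> 1\<^sub>m d" and Q: "Q \<in> S" "Q' \<in> S" "Q \<noteq> 1\<^sub>m d" "Q' \<noteq> 1\<^sub>m d"
    and ne: "P \<noteq> Q" "P' \<noteq> Q'" and c: "chi P Q = chi P' Q'"
  shows "\<exists>U\<in>Cl. maps_to U P P' \<and> maps_to U Q Q'"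
proof -
  obtain U where U: "U \<in> Cl" "maps_to U P P'" using transitive1[OF P] by blast
  obtain Q1 where Q1: "Q1 \<in> S" "maps_to U Q Q1" using Cl_maps[OF U(1) Q(1)] by blast
  have n: "Q1 \<noteq> 1\<^sub>m d" "Q1 \<noteq> P'"
    using maps_to_one_iff[OF U(1) Q(1) Q1] Q(3) maps_to_eq_iff[OF U(1) Q(1) Q1 P(1,2) U(2)] ne(1) by blast+
  have ch: "chi Q1 P' = chi Q' P'"
    using chi_maps[OF U(1) Q(1) Q1 P(1,2) U(2)] c chi_sym[of Q P] chi_sym[of Q' P'] by simp
  have t: "tr (Q1 * P') = 0" "tr (Q' * P') = 0" using S_orth Q1(1) Q(2) P(2) n(2) ne(2) by blast+
  \<comment> \<open>Both fixed operators of \<open>witt_step\<close> are taken to be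
    \<open>P'\<close>. Their product is the identity, so the fourth trace condition repeats the
    first.\<close>
  have "\<exists>V\<in>Cl. maps_to V P' P' \<and> maps_to V P' P' \<and> maps_to V Q1 Q'"
    by (rule witt_step[OF P(2) P(2) Q1(1) Q(2) ch ch tr_S_0[OF Q1(1) n(1)] t(1) t(1) _ tr_S_0[OF Q(2,4)] t(2) t(2)])
      (use tr_S_0[OF Q1(1) n(1)] tr_S_0[OF Q(2,4)] P(2) Q1(1) Q(2) in simp_all)
  then obtain V where V: "V \<in> Cl" "maps_to V P' P'" "maps_to V Q1 Q'" by blast
  have "maps_to (V * U) P P'" "maps_to (V * U) Q Q'"
    by (rule maps_to_mult[OF Cl_M[OF V(1)] Cl_M[OF U(1)] S_carrier[OF P(1)] S_carrier[OF P(2)] U(2) V(2)],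
        rule maps_to_mult[OF Cl_M[OF V(1)] Cl_M[OF U(1)] S_carrier[OF Q(1)] S_carrier[OF Q1(1)] Q1(2) V(3)])
  then show ?thesis using Cl_mult[OF V(1) U(1)] by blast
qed

lemma tr3_cyc: "P \<in> M \<Longrightarrow> Q \<in> M \<Longrightarrow> R \<in> M \<Longrightarrow> tr (R * (P * Q)) = tr (P * (Q * R))"
proof -
  assume a: "P \<in> M" "Q \<in> M" "R \<in> M"
  have "tr (R * (P * Q)) = tr ((P * Q) * R)" by (rule tr_cyc) (use a in simp_all)
  then show ?thesis unfolding mult_assoc_M[OF a] .
qed

lemma transitive3:
  assumes P: "P \<in> S" "P' \<in> S" and Q: "Q \<in> S" "Q' \<in> S" and R: "R \<in> S" "R' \<in> S"
    and i: "ind P Q R" and i': "ind P' Q' R'"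
    and c: "chi P Q = chi P' Q'" "chi P R = chi P' R'" "chi Q R = chi Q' R'"
  shows "\<exists>U\<in>Cl. maps_to U P P' \<and> maps_to U Q Q' \<and> maps_to U R R'"
proof -
  obtain U where U: "U \<in> Cl" "maps_to U P P'" "maps_to U Q Q'"
    using transitive2[OF P _ _ Q _ _ _ _ c(1)] i i' unfolding ind_def supp_def by blast
  obtain R1 where R1: "R1 \<in> S" "maps_to U R R1" using Cl_maps[OF U(1) R(1)] by blast
  have i1: "ind P' Q' R1" using ind_maps[OF U(1) P U(2) Q U(3) R(1) R1] i by blast
  have ch: "chi R1 P' = chi R' P'" "chi R1 Q' = chi R' Q'"
    using chi_maps[OF U(1) P U(2) R(1) R1] chi_maps[OF U(1) Q U(3) R(1) R1] c chi_sym[of R1] chi_sym[of R'] by simp_all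
  have t: "tr X = 0" "tr (X * P') = 0" "tr (X * Q') = 0" "tr (X * (P' * Q')) = 0" if "X \<in> S" "ind P' Q' X" for X
  proof -
    have n: "X \<noteq> 1\<^sub>m d" "X \<noteq> P'" "X \<noteq> Q'" "tr (P' * (Q' * X)) = 0" using that(2) unfolding ind_def supp_def by blast+
    show "tr X = 0" by (rule tr_S_0[OF that(1) n(1)])
    show "tr (X * P') = 0" by (rule S_orth[OF that(1) P(2) n(2)])
    show "tr (X * Q') = 0" by (rule S_orth[OF that(1) Q(2) n(3)])
    show "tr (X * (P' * Q')) = 0" using n(4) tr3_cyc[OF S_carrier[OF P(2)] S_carrier[OF Q(2)] S_carrier[OF that(1)]] by simp
  qed
  obtain V where V: "V \<in> Cl" "maps_to V P' P'" "maps_to V Q' Q'" "maps_to V R1 R'"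
    using witt_step[OF P(2) Q(2) R1(1) R(2) ch t[OF R1(1) i1] t[OF R(2) i']] by blast
  have "maps_to (V * U) P P'" "maps_to (V * U) Q Q'" "maps_to (V * U) R R'"
    by (rule maps_to_mult[OF Cl_M[OF V(1)] Cl_M[OF U(1)] S_carrier[OF P(1)] S_carrier[OF P(2)] U(2) V(2)],
        rule maps_to_mult[OF Cl_M[OF V(1)] Cl_M[OF U(1)] S_carrier[OF Q(1)] S_carrier[OF Q(2)] U(3) V(3)],
        rule maps_to_mult[OF Cl_M[OF V(1)] Cl_M[OF U(1)] S_carrier[OF R(1)] S_carrier[OF R1(1)] R1(2) V(4)])
  then show ?thesis using Cl_mult[OF V(1) U(1)] by blast
qed

definition Cl_invariant where
  "Cl_invariant g \<longleftrightarrow> (\<forall>U\<in>Cl. \<forall>P\<in>S. \<forall>P'\<in>S. \<forall>Q\<in>S. \<forall>Q'\<in>S. \<forall>R\<in>S. \<forall>R'\<in>S.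
     maps_to U P P' \<longrightarrow> maps_to U Q Q' \<longrightarrow> maps_to U R R' \<longrightarrow> g P' Q' R' = (g P Q R :: complex))"

lemma factor_through:
  assumes "\<And>x y. p x \<Longrightarrow> p y \<Longrightarrow> k x = k y \<Longrightarrow> f x = f y"
  shows "\<exists>\<Gamma>. \<forall>x. p x \<longrightarrow> f x = \<Gamma> (k x)"
proof (rule exI[of _ "\<lambda>v. f (SOME x. p x \<and> k x = v)"], intro allI impI)
  fix x assume "p x"
  then have "p (SOME y. p y \<and> k y = k x) \<and> k (SOME y. p y \<and> k y = k x) = k x" 
    using someI[of "\<lambda>y. p y \<and> k y = k x" x] by blast
  then show "f x = f (SOME y. p y \<and> k y = k x)" using assms \<open>p x\<close> by metis
qed

lemma factor_pair:
  assumes "\<And>P Q P' Q'. P \<in> S \<Longrightarrow> Q \<in> S \<Longrightarrow> P \<noteq> 1\<^sub>m d \<Longrightarrow> Q \<noteq> 1\<^sub>m d \<Longrightarrow> P \<noteq> Q \<Longrightarrow>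
      P' \<in> S \<Longrightarrow> Q' \<in> S \<Longrightarrow> P' \<noteq> 1\<^sub>m d \<Longrightarrow> Q' \<noteq> 1\<^sub>m d \<Longrightarrow> P' \<noteq> Q' \<Longrightarrow> chi P Q = chi P' Q' \<Longrightarrow> f P Q = f P' Q'"
  shows "\<exists>\<Gamma>. \<forall>P\<in>S. \<forall>Q\<in>S. P \<noteq> 1\<^sub>m d \<longrightarrow> Q \<noteq> 1\<^sub>m d \<longrightarrow> P \<noteq> Q \<longrightarrow> f P Q = \<Gamma> (chi P Q)"
proof -
  have "\<exists>\<Gamma>. \<forall>x. (case x of (P, Q) \<Rightarrow> P \<in> S \<and> Q \<in> S \<and> P \<noteq> 1\<^sub>m d \<and> Q \<noteq> 1\<^sub>m d \<and> P \<noteq> Q) \<longrightarrow>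
      (case x of (P, Q) \<Rightarrow> f P Q) = \<Gamma> (case x of (P, Q) \<Rightarrow> chi P Q)"
    by (rule factor_through) (clarsimp, rule assms, assumption+)
  then obtain \<Gamma> where "\<forall>P Q. P \<in> S \<and> Q \<in> S \<and> P \<noteq> 1\<^sub>m d \<and> Q \<noteq> 1\<^sub>m d \<and> P \<noteq> Q \<longrightarrow> f P Q = \<Gamma> (chi P Q)"
    by auto
  then show ?thesis by (intro exI[of _ \<Gamma>]) blast
qed

text \<open>Transitivity on each equality pattern shows that the commutation signs separate the
  orbits, so an invariant function factors through them.\<close>

lemma class_fun_of_invariant:
  assumes g: "Cl_invariant g"
  shows "class_fun g"
proof -
  have inv: "g P' Q' R' = g P Q R" if "U \<in> Cl" "P \<in> S" "P' \<in> S" "Q \<in> S" "Q' \<in> S" "R \<in> S" "R' \<in> S"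
    "maps_to U P P'" "maps_to U Q Q'" "maps_to U R R'" for U P P' Q Q' R R'
    using g that unfolding Cl_invariant_def by blast
  have pr: "\<exists>U\<in>Cl. maps_to U P P' \<and> maps_to U Q Q'" if "P \<in> S" "Q \<in> S" "P \<noteq> 1\<^sub>m d" "Q \<noteq> 1\<^sub>m d" "P \<noteq> Q"
      "P' \<in> S" "Q' \<in> S" "P' \<noteq> 1\<^sub>m d" "Q' \<noteq> 1\<^sub>m d" "P' \<noteq> Q'" "chi P Q = chi P' Q'" for P Q P' Q'
    using transitive2 that by blast
  have "\<exists>\<Gamma>. \<forall>x. (case x of (P, Q, R) \<Rightarrow> P \<in> S \<and> Q \<in> S \<and> R \<in> S \<and> ind P Q R) \<longrightarrow>
      (case x of (P, Q, R) \<Rightarrow> g P Q R) = \<Gamma> (case x of (P, Q, R) \<Rightarrow> (chi P Q, chi P R, chi Q R))"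
  proof (rule factor_through, clarsimp)
    fix P Q R P' Q' R' assume a: "P \<in> S" "Q \<in> S" "R \<in> S" "P' \<in> S" "Q' \<in> S" "R' \<in> S" "ind P Q R" "ind P' Q' R'"
      "chi P Q = chi P' Q'" "chi P R = chi P' R'" "chi Q R = chi Q' R'"
    obtain U where "U \<in> Cl" "maps_to U P P'" "maps_to U Q Q'" "maps_to U R R'"
      using transitive3[OF a(1,4,2,5,3,6,7,8,9,10,11)] by blast
    then show "g P Q R = g P' Q' R'" using inv[OF _ a(1,4,2,5,3,6)] by simp
  qed
  then obtain \<Gamma> where "\<forall>P Q R. P \<in> S \<and> Q \<in> S \<and> R \<in> S \<and> ind P Q R \<longrightarrow> g P Q R = \<Gamma> (chi P Q, chi P R, chi Q R)"
    by (auto simp: split_paired_all)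
  then have 1: "\<exists>\<Gamma>. \<forall>P\<in>S. \<forall>Q\<in>S. \<forall>R\<in>S. ind P Q R \<longrightarrow> g P Q R = \<Gamma> (chi P Q) (chi P R) (chi Q R)"
    by (intro exI[of _ "\<lambda>x y z. \<Gamma> (x, y, z)"]) blast
  have 2: "\<exists>\<Gamma>. \<forall>P\<in>S. \<forall>Q\<in>S. P \<noteq> 1\<^sub>m d \<longrightarrow> Q \<noteq> 1\<^sub>m d \<longrightarrow> P \<noteq> Q \<longrightarrow> g P P Q = \<Gamma> (chi P Q)"
    by (rule factor_pair, frule (10) pr, elim bexE conjE, rule sym, rule inv)
  have 3: "\<exists>\<Gamma>. \<forall>P\<in>S. \<forall>Q\<in>S. P \<noteq> 1\<^sub>m d \<longrightarrow> Q \<noteq> 1\<^sub>m d \<longrightarrow> P \<noteq> Q \<longrightarrow> g P Q Q = \<Gamma> (chi P Q)"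
    by (rule factor_pair, frule (10) pr, elim bexE conjE, rule sym, rule inv)
  have 4: "\<exists>\<Gamma>. \<forall>P\<in>S. \<forall>Q\<in>S. P \<noteq> 1\<^sub>m d \<longrightarrow> Q \<noteq> 1\<^sub>m d \<longrightarrow> P \<noteq> Q \<longrightarrow> g P Q P = \<Gamma> (chi P Q)"
    by (rule factor_pair, frule (10) pr, elim bexE conjE, rule sym, rule inv)
  have 5: "\<exists>c. \<forall>P\<in>S. P \<noteq> 1\<^sub>m d \<longrightarrow> g P P P = c"
  proof -
    have "\<exists>\<Gamma>. \<forall>P. (P \<in> S \<and> P \<noteq> 1\<^sub>m d) \<longrightarrow> g P P P = \<Gamma> ()"
    proof (rule factor_through)
      fix P P' assume a: "P \<in> S \<and> P \<noteq> 1\<^sub>m d" "P' \<in> S \<and> P' \<noteq> 1\<^sub>m d"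
      then obtain U where "U \<in> Cl" "maps_to U P P'" using transitive1 by blast
      then show "g P P P = g P' P' P'" using inv[of U P P' P P' P P'] a by simp
    qed
    then show ?thesis by blast
  qed
  show ?thesis unfolding class_fun_def using 1 2 3 4 5 by blast
qed

lemma lam_maps:
  assumes U: "U \<in> Cl" and P: "P \<in> S" "P' \<in> S" "maps_to U P P'" and Q: "Q \<in> S" "Q' \<in> S" "maps_to U Q Q'"
    and R: "R \<in> S" "R' \<in> S" "maps_to U R R'"
  shows "lam c1 c2 c3 al be ga de ep ze et P' Q' R' = lam c1 c2 c3 al be ga de ep ze et P Q R"
  unfolding lam_def maps_to_one_iff[OF U P] maps_to_one_iff[OF U Q] maps_to_one_iff[OF U R]
    maps_to_eq_iff[OF U P Q] maps_to_eq_iff[OF U Q R] maps_to_eq_iff[OF U P R]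
    chi_maps[OF U P Q] chi_maps[OF U Q R] chi_maps[OF U P R] ..

lemma sum3_act:
  assumes U: "U \<in> Cl"
  shows "sum3 (\<lambda>P Q R. f (act U P) (act U Q) (act U R)) = sum3 f"
proof -
  have b: "(\<Sum>P\<in>S. h (act U P)) = (\<Sum>P\<in>S. h P)" for h :: "complex mat \<Rightarrow> complex"
    by (rule sum.reindex_bij_betw[OF act_bij[OF U]])
  have "sum3 (\<lambda>P Q R. f (act U P) (act U Q) (act U R)) = (\<Sum>P\<in>S. \<Sum>Q\<in>S. \<Sum>R\<in>S. f (act U P) (act U Q) R)"
    by (intro sum.cong refl b)
  also have "\<dots> = (\<Sum>P\<in>S. \<Sum>Q\<in>S. \<Sum>R\<in>S. f (act U P) Q R)"
    by (rule sum.cong[OF refl], rule b)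
  also have "\<dots> = sum3 f" by (rule b)
  finally show ?thesis .
qed

text \<open>\<open>lam\<close> depends only on data preserved by Clifford conjugation, so
  relabelling the summation variables by \<open>act U\<close> absorbs the conjugation of the
  arguments of \<open>Gam\<close>.\<close>

lemma sum3_lam_Gam:
  assumes U: "U \<in> Cl" and A: "A \<in> M" "B \<in> M" "C \<in> M" "E \<in> M"
  shows "sum3 (\<lambda>P Q R. lam c1 c2 c3 al be ga de ep ze et P Q R * Gam (cj U A) (cj U B) (cj U C) (cj U E) R Q P) =
    sum3 (\<lambda>P Q R. lam c1 c2 c3 al be ga de ep ze et P Q R * Gam A B C E R Q P)"
proof -
  have "sum3 (\<lambda>P Q R. lam c1 c2 c3 al be ga de ep ze et P Q R * Gam (cj U A) (cj U B) (cj U C) (cj U E) R Q P) =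
    sum3 (\<lambda>P Q R. lam c1 c2 c3 al be ga de ep ze et (act U P) (act U Q) (act U R) *
        Gam (cj U A) (cj U B) (cj U C) (cj U E) (act U R) (act U Q) (act U P))"
    by (rule sum3_act[OF U, symmetric])
  also have "\<dots> = sum3 (\<lambda>P Q R. lam c1 c2 c3 al be ga de ep ze et P Q R * Gam A B C E R Q P)"
  proof (intro sum.cong refl)
    fix P Q R assume a: "P \<in> S" "Q \<in> S" "R \<in> S"
    note p = a(1) act[OF U a(1)] and q = a(2) act[OF U a(2)] and r = a(3) act[OF U a(3)]
    show "lam c1 c2 c3 al be ga de ep ze et (act U P) (act U Q) (act U R) *
        Gam (cj U A) (cj U B) (cj U C) (cj U E) (act U R) (act U Q) (act U P) =
        lam c1 c2 c3 al be ga de ep ze et P Q R * Gam A B C E R Q P"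
      unfolding lam_maps[OF U p q r] Gam_cj[OF U r q p A] ..
  qed
  finally show ?thesis .
qed

text \<open>Cutting off \<open>Q = 1\<close> puts the support of the kernel inside
  \<open>supp\<close>. In the pairing below nothing is lost, since the averaged product vanishes
  there for traceless \<open>B\<close>.\<close>

definition kap1 where "kap1 W P Q R = (if Q = 1\<^sub>m d then 0 else kap W P Q R)"

context
  fixes W assumes W [simp]: "W \<in> M" and W2: "W * W = 1\<^sub>m d" and W0: "tr W = 0"
begin

lemma kap1_supp: "P \<in> S \<Longrightarrow> Q \<in> S \<Longrightarrow> R \<in> S \<Longrightarrow> \<not> supp P Q R \<Longrightarrow> kap1 W P Q R = 0"
proof -
  assume a: "P \<in> S" "Q \<in> S" "R \<in> S" "\<not> supp P Q R"
  show ?thesis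
  proof (cases "Q = 1\<^sub>m d")
    case False
    then have "P = 1\<^sub>m d \<or> R = 1\<^sub>m d \<or> tr (P * (Q * R)) \<noteq> 0" using a(4) unfolding supp_def by blast
    then show ?thesis unfolding kap1_def kap_vanish[OF W W2 W0 a(1-3) False \<open>_ \<or> _\<close>] by simp
  qed (simp add: kap1_def)
qed

text \<open>The subtracted number is the total weight of \<open>kap\<close> on the slice
  \<open>Q = 1\<close>. The conditions on \<open>c\<close> hold for every product of signs because
  the identity commutes with everything.\<close>

lemma sum3_kap1:
  assumes "\<And>R. R \<in> S \<Longrightarrow> c (1\<^sub>m d) (1\<^sub>m d) R = 1" "\<And>P. P \<in> S \<Longrightarrow> c P (1\<^sub>m d) (1\<^sub>m d) = 1"
  shows "sum3 (\<lambda>P Q R. c P Q R * kap1 W P Q R) = sum3 (\<lambda>P Q R. c P Q R * kap W P Q R) - 2 * of_nat d ^ 4"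
proof -
  have "sum3 (\<lambda>P Q R. c P Q R * kap1 W P Q R) =
     (\<Sum>P\<in>S. \<Sum>Q\<in>S. (\<Sum>R\<in>S. c P Q R * kap W P Q R) - (if Q = 1\<^sub>m d then (\<Sum>R\<in>S. c P Q R * kap W P Q R) else 0))"
    by (intro sum.cong refl) (simp add: kap1_def)
  also have "\<dots> = sum3 (\<lambda>P Q R. c P Q R * kap W P Q R) - (\<Sum>P\<in>S. \<Sum>R\<in>S. c P (1\<^sub>m d) R * kap W P (1\<^sub>m d) R)"
    using finite_S one_S by (simp add: sum_subtractf)
  also have "(\<Sum>P\<in>S. \<Sum>R\<in>S. c P (1\<^sub>m d) R * kap W P (1\<^sub>m d) R) = 2 * of_nat d ^ 4"
    by (rule sum_kap_Q1[OF W W2 W0]) (use assms in auto)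
  finally show ?thesis .
qed

lemma kap1_PQ: "(\<Sum>P\<in>S. \<Sum>R\<in>S. c P R * kap1 W P P R) = (\<Sum>P\<in>S. \<Sum>R\<in>S. c P R * kap W P P R) - of_nat d ^ 4"
  if "\<And>R. R \<in> S \<Longrightarrow> c (1\<^sub>m d) R = 1"
proof -
  have "(\<Sum>P\<in>S. \<Sum>R\<in>S. c P R * kap1 W P P R) =
     (\<Sum>P\<in>S. (\<Sum>R\<in>S. c P R * kap W P P R) - (if P = 1\<^sub>m d then (\<Sum>R\<in>S. c P R * kap W P P R) else 0))"
    by (intro sum.cong refl) (simp add: kap1_def)
  also have "\<dots> = (\<Sum>P\<in>S. \<Sum>R\<in>S. c P R * kap W P P R) - (\<Sum>R\<in>S. c (1\<^sub>m d) R * kap W (1\<^sub>m d) (1\<^sub>m d) R)"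
    using finite_S one_S by (simp add: sum_subtractf)
  also have "(\<Sum>R\<in>S. c (1\<^sub>m d) R * kap W (1\<^sub>m d) (1\<^sub>m d) R) = of_nat d ^ 4"
    using that sum_kap_PQ1[OF W W2 W0] by simp
  finally show ?thesis .
qed

lemma kap1_QR: "(\<Sum>P\<in>S. \<Sum>Q\<in>S. c P Q * kap1 W P Q Q) = (\<Sum>P\<in>S. \<Sum>Q\<in>S. c P Q * kap W P Q Q) - of_nat d ^ 4"
  if "\<And>P. P \<in> S \<Longrightarrow> c P (1\<^sub>m d) = 1"
proof -
  have "(\<Sum>P\<in>S. \<Sum>Q\<in>S. c P Q * kap1 W P Q Q) =
     (\<Sum>P\<in>S. \<Sum>Q\<in>S. c P Q * kap W P Q Q - (if Q = 1\<^sub>m d then c P Q * kap W P Q Q else 0))"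
    by (intro sum.cong refl) (simp add: kap1_def)
  also have "\<dots> = (\<Sum>P\<in>S. \<Sum>Q\<in>S. c P Q * kap W P Q Q) - (\<Sum>P\<in>S. c P (1\<^sub>m d) * kap W P (1\<^sub>m d) (1\<^sub>m d))"
    using finite_S one_S by (simp add: sum_subtractf)
  also have "(\<Sum>P\<in>S. c P (1\<^sub>m d) * kap W P (1\<^sub>m d) (1\<^sub>m d)) = of_nat d ^ 4"
    using that sum_kap_QR1[OF W W2 W0] by simp
  finally show ?thesis .
qed

lemma kap1_PR: "(\<Sum>P\<in>S. \<Sum>Q\<in>S. c P Q * kap1 W P Q P) = (\<Sum>P\<in>S. \<Sum>Q\<in>S. c P Q * kap W P Q P)"
  by (intro sum.cong refl) (auto simp: kap1_def kap_P1P[OF W W2 W0])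

lemma kap1_PPP: "(\<Sum>P\<in>S. kap1 W P P P) = (\<Sum>P\<in>S. kap W P P P)"
  by (intro sum.cong refl) (auto simp: kap1_def kap_Q1[OF W W2 W0] one_S W0)

lemmas kaps = kap_1[OF W W2 W0] kap_x[OF W W2 W0] kap_y[OF W W2 W0] kap_z[OF W W2 W0] kap_xy[OF W W2 W0] kap_yz[OF W W2 W0]
  kap_xz[OF W W2 W0] kap_xyz[OF W W2 W0] kap_PQ[OF W W2 W0] kap_PQ_chi[OF W W2 W0] kap_QR[OF W W2 W0] kap_QR_chi[OF W W2 W0]
  kap_PR[OF W W2 W0] kap_PR_chi[OF W W2 W0] kap_PPP[OF W W2 W0]

lemma kap1_sums:
  "sum3 (kap1 W) = 2 * of_nat d ^ 5 - 2 * of_nat d ^ 4"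
  "(\<Sum>P\<in>S. \<Sum>R\<in>S. kap1 W P P R) = 2 * of_nat d ^ 5"
  "(\<Sum>P\<in>S. \<Sum>R\<in>S. chi P R * kap1 W P P R) = of_nat d ^ 2 * (2 * q2 W + q4 W + q3 W) - of_nat d ^ 4"
  "(\<Sum>P\<in>S. \<Sum>Q\<in>S. kap1 W P Q Q) = 2 * of_nat d ^ 5"
  "(\<Sum>P\<in>S. \<Sum>Q\<in>S. chi P Q * kap1 W P Q Q) = of_nat d ^ 2 * (2 * q2 W + q4 W + q3 W) - of_nat d ^ 4"
  "(\<Sum>P\<in>S. \<Sum>Q\<in>S. kap1 W P Q P) = 2 * of_nat d ^ 2 * (q2 W + q3 W)"
  "(\<Sum>P\<in>S. \<Sum>Q\<in>S. chi P Q * kap1 W P Q P) = 2 * of_nat d ^ 5 + 2 * of_nat d ^ 4"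
  "(\<Sum>P\<in>S. kap1 W P P P) = 2 * of_nat d * (q4 W + q2 W)"
  using sum3_kap1[of "\<lambda>P Q R. 1"] kap1_PQ[of "\<lambda>P R. 1"] kap1_PQ[of chi] kap1_QR[of "\<lambda>P R. 1"] kap1_QR[of chi]
    kap1_PR[of "\<lambda>P R. 1"] kap1_PR[of chi] kap1_PPP
  by (simp_all add: kaps)

lemma kap1_sums3:
  "sum3 (\<lambda>P Q R. chi P Q * kap1 W P Q R) = 2 * of_nat d ^ 5 + of_nat d ^ 6 - 2 * of_nat d ^ 4"
  "sum3 (\<lambda>P Q R. chi Q R * kap1 W P Q R) = 2 * of_nat d ^ 5 + of_nat d ^ 6 - 2 * of_nat d ^ 4"
  "sum3 (\<lambda>P Q R. chi P R * kap1 W P Q R) = 2 * of_nat d ^ 3 * (q2 W + q3 W) - 2 * of_nat d ^ 4"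
  "sum3 (\<lambda>P Q R. chi P Q * (chi P R * kap1 W P Q R)) = 2 * of_nat d ^ 5 + of_nat d ^ 6 - 2 * of_nat d ^ 4"
  "sum3 (\<lambda>P Q R. chi P R * (chi Q R * kap1 W P Q R)) = 2 * of_nat d ^ 5 + of_nat d ^ 6 - 2 * of_nat d ^ 4"
  "sum3 (\<lambda>P Q R. chi P Q * (chi Q R * kap1 W P Q R)) = 2 * of_nat d ^ 3 * (q2 W + q3 W) - 2 * of_nat d ^ 4"
  "sum3 (\<lambda>P Q R. chi P Q * (chi P R * (chi Q R * kap1 W P Q R))) = 2 * of_nat d ^ 5 - 2 * of_nat d ^ 4"
proof -
  show "sum3 (\<lambda>P Q R. chi P Q * kap1 W P Q R) = 2 * of_nat d ^ 5 + of_nat d ^ 6 - 2 * of_nat d ^ 4"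
    using sum3_kap1[of "\<lambda>P Q R. chi P Q"] one_S unfolding kaps by simp
  show "sum3 (\<lambda>P Q R. chi Q R * kap1 W P Q R) = 2 * of_nat d ^ 5 + of_nat d ^ 6 - 2 * of_nat d ^ 4"
    using sum3_kap1[of "\<lambda>P Q R. chi Q R"] one_S unfolding kaps by simp
  show "sum3 (\<lambda>P Q R. chi P R * kap1 W P Q R) = 2 * of_nat d ^ 3 * (q2 W + q3 W) - 2 * of_nat d ^ 4"
    using sum3_kap1[of "\<lambda>P Q R. chi P R"] one_S unfolding kaps by simp
  show "sum3 (\<lambda>P Q R. chi P Q * (chi P R * kap1 W P Q R)) = 2 * of_nat d ^ 5 + of_nat d ^ 6 - 2 * of_nat d ^ 4"
    using sum3_kap1[of "\<lambda>P Q R. chi P Q * chi P R"] one_S unfolding mult.assoc kaps by simp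
  show "sum3 (\<lambda>P Q R. chi P R * (chi Q R * kap1 W P Q R)) = 2 * of_nat d ^ 5 + of_nat d ^ 6 - 2 * of_nat d ^ 4"
    using sum3_kap1[of "\<lambda>P Q R. chi P R * chi Q R"] one_S unfolding mult.assoc kaps by simp
  show "sum3 (\<lambda>P Q R. chi P Q * (chi Q R * kap1 W P Q R)) = 2 * of_nat d ^ 3 * (q2 W + q3 W) - 2 * of_nat d ^ 4"
    using sum3_kap1[of "\<lambda>P Q R. chi P Q * chi Q R"] one_S unfolding mult.assoc kaps by simp
  show "sum3 (\<lambda>P Q R. chi P Q * (chi P R * (chi Q R * kap1 W P Q R))) = 2 * of_nat d ^ 5 - 2 * of_nat d ^ 4"
    using sum3_kap1[of "\<lambda>P Q R. chi P Q * (chi P R * chi Q R)"] one_S unfolding mult.assoc kaps by simp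
qed

text \<open>\<open>isum_reduce\<close> applied to a signed kernel. On a coincidence some of the
  signs become 1 or cancel in pairs, which decides whether the plain or the signed pair sum is
  subtracted.\<close>

lemma kap1_isum:
  defines "cc \<equiv> 4 * of_nat d * (q4 W + q2 W)"
    and "p1 \<equiv> of_nat d ^ 2 * (2 * q2 W + q4 W + q3 W) - of_nat d ^ 4" and "r0 \<equiv> 2 * of_nat d ^ 2 * (q2 W + q3 W)"
  shows "isum (kap1 W) = cc - 2 * of_nat d ^ 5 - 2 * of_nat d ^ 4 - r0"
    "isum (\<lambda>P Q R. chi P Q * (chi P R * (chi Q R * kap1 W P Q R))) = cc - 2 * of_nat d ^ 5 - 2 * of_nat d ^ 4 - r0"
    "isum (\<lambda>P Q R. chi P Q * kap1 W P Q R) = cc + of_nat d ^ 6 - 2 * of_nat d ^ 5 - 4 * of_nat d ^ 4 - p1"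
    "isum (\<lambda>P Q R. chi Q R * kap1 W P Q R) = cc + of_nat d ^ 6 - 2 * of_nat d ^ 5 - 4 * of_nat d ^ 4 - p1"
    "isum (\<lambda>P Q R. chi P Q * (chi P R * kap1 W P Q R)) = cc + of_nat d ^ 6 - 2 * of_nat d ^ 5 - 4 * of_nat d ^ 4 - p1"
    "isum (\<lambda>P Q R. chi P R * (chi Q R * kap1 W P Q R)) = cc + of_nat d ^ 6 - 2 * of_nat d ^ 5 - 4 * of_nat d ^ 4 - p1"
    "isum (\<lambda>P Q R. chi P R * kap1 W P Q R) = cc + of_nat d * r0 - 2 * of_nat d ^ 4 - 2 * p1 - r0"
    "isum (\<lambda>P Q R. chi P Q * (chi Q R * kap1 W P Q R)) = cc + of_nat d * r0 - 2 * of_nat d ^ 4 - 2 * p1 - r0"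
proof -
  have s: "(\<Sum>P\<in>S. \<Sum>Q\<in>S. chi Q P * kap1 W P Q P) = (\<Sum>P\<in>S. \<Sum>Q\<in>S. chi P Q * kap1 W P Q P)"
    by (simp only: chi_sym)
  show "isum (kap1 W) = cc - 2 * of_nat d ^ 5 - 2 * of_nat d ^ 4 - r0"
    using isum_reduce(1)[of "kap1 W", OF kap1_supp] unfolding kap1_sums cc_def r0_def by simp
  show "isum (\<lambda>P Q R. chi P Q * (chi P R * (chi Q R * kap1 W P Q R))) = cc - 2 * of_nat d ^ 5 - 2 * of_nat d ^ 4 - r0"
    using isum_reduce(1)[of "\<lambda>P Q R. chi P Q * (chi P R * (chi Q R * kap1 W P Q R))"] kap1_supp
    by (simp add: kap1_sums kap1_sums3 chi_sym[of _ "_"] cc_def r0_def)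
  show "isum (\<lambda>P Q R. chi P Q * kap1 W P Q R) = cc + of_nat d ^ 6 - 2 * of_nat d ^ 5 - 4 * of_nat d ^ 4 - p1"
    using isum_reduce(1)[of "\<lambda>P Q R. chi P Q * kap1 W P Q R"] kap1_supp
    by (simp add: kap1_sums kap1_sums3 cc_def p1_def)
  show "isum (\<lambda>P Q R. chi Q R * kap1 W P Q R) = cc + of_nat d ^ 6 - 2 * of_nat d ^ 5 - 4 * of_nat d ^ 4 - p1"
    using isum_reduce(1)[of "\<lambda>P Q R. chi Q R * kap1 W P Q R"] kap1_supp
    by (simp add: kap1_sums kap1_sums3 s cc_def p1_def)
  show "isum (\<lambda>P Q R. chi P Q * (chi P R * kap1 W P Q R)) = cc + of_nat d ^ 6 - 2 * of_nat d ^ 5 - 4 * of_nat d ^ 4 - p1"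
    using isum_reduce(1)[of "\<lambda>P Q R. chi P Q * (chi P R * kap1 W P Q R)"] kap1_supp
    by (simp add: kap1_sums kap1_sums3 cc_def p1_def)
  show "isum (\<lambda>P Q R. chi P R * (chi Q R * kap1 W P Q R)) = cc + of_nat d ^ 6 - 2 * of_nat d ^ 5 - 4 * of_nat d ^ 4 - p1"
    using isum_reduce(1)[of "\<lambda>P Q R. chi P R * (chi Q R * kap1 W P Q R)"] kap1_supp
    by (simp add: kap1_sums kap1_sums3 s cc_def p1_def)
  show "isum (\<lambda>P Q R. chi P R * kap1 W P Q R) = cc + of_nat d * r0 - 2 * of_nat d ^ 4 - 2 * p1 - r0"
    using isum_reduce(1)[of "\<lambda>P Q R. chi P R * kap1 W P Q R"] kap1_supp
    by (simp add: kap1_sums kap1_sums3 cc_def p1_def r0_def power_numeral_reduce)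
  show "isum (\<lambda>P Q R. chi P Q * (chi Q R * kap1 W P Q R)) = cc + of_nat d * r0 - 2 * of_nat d ^ 4 - 2 * p1 - r0"
  proof -
    have s': "chi P Q * (chi Q P * z) = z" for P Q z using chi_sym[of P Q] by simp
    show ?thesis using isum_reduce(1)[of "\<lambda>P Q R. chi P Q * (chi Q R * kap1 W P Q R)"] kap1_supp
      by (simp add: kap1_sums kap1_sums3 s' cc_def p1_def r0_def power_numeral_reduce)
  qed
qed

lemma kap1_psum:
  "psum (\<lambda>P R. kap1 W P P R) = 2 * of_nat d ^ 5 - 2 * of_nat d * (q4 W + q2 W)"
  "psum (\<lambda>P R. chi P R * kap1 W P P R) = of_nat d ^ 2 * (2 * q2 W + q4 W + q3 W) - of_nat d ^ 4 - 2 * of_nat d * (q4 W + q2 W)"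
  "psum (\<lambda>P Q. kap1 W P Q Q) = 2 * of_nat d ^ 5 - 2 * of_nat d * (q4 W + q2 W)"
  "psum (\<lambda>P Q. chi P Q * kap1 W P Q Q) = of_nat d ^ 2 * (2 * q2 W + q4 W + q3 W) - of_nat d ^ 4 - 2 * of_nat d * (q4 W + q2 W)"
  "psum (\<lambda>P Q. kap1 W P Q P) = 2 * of_nat d ^ 2 * (q2 W + q3 W) - 2 * of_nat d * (q4 W + q2 W)"
  "psum (\<lambda>P Q. chi P Q * kap1 W P Q P) = 2 * of_nat d ^ 5 + 2 * of_nat d ^ 4 - 2 * of_nat d * (q4 W + q2 W)"
  "usum (\<lambda>P. kap1 W P P P) = 2 * of_nat d * (q4 W + q2 W)"
proof -
  note r = isum_reduce(2-5)[of "kap1 W", OF kap1_supp]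
  show "psum (\<lambda>P R. kap1 W P P R) = 2 * of_nat d ^ 5 - 2 * of_nat d * (q4 W + q2 W)"
    "psum (\<lambda>P Q. kap1 W P Q Q) = 2 * of_nat d ^ 5 - 2 * of_nat d * (q4 W + q2 W)"
    "psum (\<lambda>P Q. kap1 W P Q P) = 2 * of_nat d ^ 2 * (q2 W + q3 W) - 2 * of_nat d * (q4 W + q2 W)"
    "usum (\<lambda>P. kap1 W P P P) = 2 * of_nat d * (q4 W + q2 W)"
    using r unfolding kap1_sums by simp_all
  show "psum (\<lambda>P R. chi P R * kap1 W P P R) = of_nat d ^ 2 * (2 * q2 W + q4 W + q3 W) - of_nat d ^ 4 - 2 * of_nat d * (q4 W + q2 W)"
    "psum (\<lambda>P Q. chi P Q * kap1 W P Q Q) = of_nat d ^ 2 * (2 * q2 W + q4 W + q3 W) - of_nat d ^ 4 - 2 * of_nat d * (q4 W + q2 W)"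
    "psum (\<lambda>P Q. chi P Q * kap1 W P Q P) = 2 * of_nat d ^ 5 + 2 * of_nat d ^ 4 - 2 * of_nat d * (q4 W + q2 W)"
    using isum_reduce(2)[of "\<lambda>P Q R. chi P R * kap1 W P Q R"] isum_reduce(3)[of "\<lambda>P Q R. chi P Q * kap1 W P Q R"]
      isum_reduce(4)[of "\<lambda>P Q R. chi P Q * kap1 W P Q R"] kap1_supp
    by (simp_all add: kap1_sums)
qed

end

end

section \<open>Clifford averages\<close>

text \<open>\<open>G\<close> stands for a choice of representatives modulo phase. It need not be
  closed under products, so invariance of the uniform distribution is expressed by a permutation of
  \<open>G\<close> that agrees with left multiplication up to phases.\<close>

locale clifford_sample = pauli_system +
  fixes G :: "complex mat set"
  assumes finite_G: "finite G" and G_ne: "G \<noteq> {}" and G_Cl: "G \<subseteq> Cl"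
    and shift: "K \<in> Cl \<Longrightarrow> \<exists>\<pi>. bij_betw \<pi> G G \<and> (\<forall>U\<in>G. \<exists>c. cmod c = 1 \<and> K * U = c \<cdot>\<^sub>m \<pi> U)"
begin

definition avg :: "(complex mat \<Rightarrow> complex) \<Rightarrow> complex" where
  "avg f = (\<Sum>U\<in>G. f U) / of_nat (card G)"

lemma card_G: "of_nat (card G) \<noteq> (0 :: complex)"
  using finite_G G_ne by simp

lemma avg_cong: "(\<And>U. U \<in> Cl \<Longrightarrow> f U = g U) \<Longrightarrow> avg f = avg g"
  unfolding avg_def using G_Cl by (intro arg_cong2[where f="(/)"] sum.cong refl) auto

lemma avg_cmult: "avg (\<lambda>U. c * f U) = c * avg f"
  by (simp add: avg_def sum_distrib_left)

lemma avg_sum: "avg (\<lambda>U. \<Sum>i\<in>I. f i U) = (\<Sum>i\<in>I. avg (f i))"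
  unfolding avg_def by (subst sum.swap) (simp add: sum_divide_distrib)

lemma avg_const: "avg (\<lambda>U. c) = c"
  using card_G by (simp add: avg_def)

lemma avg_shift:
  assumes K: "K \<in> Cl" and f: "\<And>U c. U \<in> Cl \<Longrightarrow> cmod c = 1 \<Longrightarrow> f (c \<cdot>\<^sub>m U) = f U"
  shows "avg (\<lambda>U. f (K * U)) = avg f"
proof -
  obtain \<pi> where p: "bij_betw \<pi> G G" "\<forall>U\<in>G. \<exists>c. cmod c = 1 \<and> K * U = c \<cdot>\<^sub>m \<pi> U" using shift[OF K] by blast
  have "f (K * U) = f (\<pi> U)" if "U \<in> G" for U
  proof -
    from bspec[OF p(2) that] obtain c where "cmod c = 1" "K * U = c \<cdot>\<^sub>m \<pi> U" by (elim exE conjE)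
    moreover have "\<pi> U \<in> Cl" using p(1) that G_Cl unfolding bij_betw_def by blast
    ultimately show ?thesis using f by simp
  qed
  then have "(\<Sum>U\<in>G. f (K * U)) = (\<Sum>U\<in>G. f (\<pi> U))" by simp
  also have "\<dots> = (\<Sum>U\<in>G. f U)" by (rule sum.reindex_bij_betw[OF p(1)])
  finally show ?thesis by (simp add: avg_def)
qed

context
  fixes A B C E assumes M: "A \<in> M" "B \<in> M" "C \<in> M" "E \<in> M"
begin

text \<open>The word is read backwards: \<open>R * Q * P\<close> is the adjoint of
  \<open>P * Q * R\<close>, and its phase cancels the one of the kernel factor
  \<open>tr (P * (Q * (R * W)))\<close>.\<close>

definition ghat :: "complex mat \<Rightarrow> complex mat \<Rightarrow> complex mat \<Rightarrow> complex" where
  "ghat P Q R = avg (\<lambda>U. Gam (cj U C) (cj U B) (cj U A) (cj U E) R Q P)"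

lemma ghat_invariant: "Cl_invariant ghat"
  unfolding Cl_invariant_def
proof (intro ballI impI)
  fix K P P' Q Q' R R' assume K: "K \<in> Cl" and s: "P \<in> S" "P' \<in> S" "Q \<in> S" "Q' \<in> S" "R \<in> S" "R' \<in> S"
    and m: "maps_to K P P'" "maps_to K Q Q'" "maps_to K R R'"
  have "ghat P' Q' R' = avg (\<lambda>U. Gam (cj (K * U) C) (cj (K * U) B) (cj (K * U) A) (cj (K * U) E) R' Q' P')"
    unfolding ghat_def by (rule avg_shift[OF K, symmetric]) (use M in \<open>simp add: cj_phase\<close>)
  also have "\<dots> = ghat P Q R"
    unfolding ghat_def
  proof (rule avg_cong)
    fix U assume U: "U \<in> Cl"
    then have c: "cj U A \<in> M" "cj U B \<in> M" "cj U C \<in> M" "cj U E \<in> M" using M by simp_all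
    show "Gam (cj (K * U) C) (cj (K * U) B) (cj (K * U) A) (cj (K * U) E) R' Q' P' = Gam (cj U C) (cj U B) (cj U A) (cj U E) R Q P"
      unfolding cj_mult[OF Cl_M[OF K] Cl_M[OF U] M(1)] cj_mult[OF Cl_M[OF K] Cl_M[OF U] M(2)]
        cj_mult[OF Cl_M[OF K] Cl_M[OF U] M(3)] cj_mult[OF Cl_M[OF K] Cl_M[OF U] M(4)]
      by (rule Gam_cj[OF K s(5,6) m(3) s(3,4) m(2) s(1,2) m(1) c(3,2,1,4)])
  qed
  finally show "ghat P' Q' R' = ghat P Q R" .
qed

definition F4 :: "complex mat \<Rightarrow> complex mat \<Rightarrow> complex mat \<Rightarrow> complex mat \<Rightarrow> complex" where
  "F4 P Q R T = avg (\<lambda>U. tr (P * cj U A) * (tr (Q * cj U B) * (tr (R * cj U C) * tr (T * cj U E))))"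

lemma tr_S_cj: "X \<in> S \<Longrightarrow> P \<in> S \<Longrightarrow> Y \<in> M \<Longrightarrow> tr (P * cj X Y) = chi P X * tr (P * Y)"
proof -
  assume a: "X \<in> S" "P \<in> S" "Y \<in> M"
  have m: "P * (X * Y) \<in> M" using a by simp
  have "tr (P * cj X Y) = tr (P * (X * (Y * X)))" unfolding cj_def S_adj[OF a(1)] ..
  also have "\<dots> = chi P X * tr (X * (P * (Y * X)))" 
    unfolding chi_sym[of P X] by (rule chi_tr[OF a(1,2), symmetric]) (use a in simp)
  also have "tr (X * (P * (Y * X))) = tr ((P * (Y * X)) * X)" by (rule tr_cyc) (use a in simp_all)
  also have "(P * (Y * X)) * X = P * Y" using a by simp
  finally show ?thesis .
qed

text \<open>If every Pauli operator \<open>X\<close> had product of signs 1 with the four arguments,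
  \<open>sum_chi_word\<close> would make the trace of the word nonzero. For an \<open>X\<close> with
  another sign, replacing \<open>U\<close> by \<open>X * U\<close> multiplies the average by that
  sign without changing it.\<close>

lemma F4_zero:
  assumes s: "P \<in> S" "Q \<in> S" "R \<in> S" "T \<in> S" and t: "tr (P * (Q * (R * T))) = 0"
  shows "F4 P Q R T = 0"
proof -
  have w: "word [P, Q, R, T] = P * (Q * (R * T))" using s by simp
  have "\<exists>X\<in>S. chi P X * (chi Q X * (chi R X * chi T X)) \<noteq> 1"
  proof (rule ccontr)
    assume "\<not> ?thesis"
    then have "(\<Sum>X\<in>S. \<Prod>Y\<leftarrow>[P, Q, R, T]. chi Y X) = (\<Sum>X\<in>S. 1)" by (intro sum.cong refl) simp
    moreover have "(\<Sum>X\<in>S. \<Prod>Y\<leftarrow>[P, Q, R, T]. chi Y X) = 0"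
      using sum_chi_word[of "[P, Q, R, T]"] s t unfolding w by simp
    moreover have "(\<Sum>X\<in>S. 1) \<noteq> (0::complex)" using finite_S one_S by auto
    ultimately show False by simp
  qed
  then obtain X where X: "X \<in> S" "chi P X * (chi Q X * (chi R X * chi T X)) \<noteq> 1" by blast
  have "F4 P Q R T = avg (\<lambda>U. tr (P * cj (X * U) A) * (tr (Q * cj (X * U) B) * (tr (R * cj (X * U) C) * tr (T * cj (X * U) E))))"
    unfolding F4_def by (rule avg_shift[OF S_Cl[OF X(1)], symmetric]) (use M in \<open>simp add: cj_phase\<close>)
  also have "\<dots> = avg (\<lambda>U. chi P X * (chi Q X * (chi R X * chi T X)) *
      (tr (P * cj U A) * (tr (Q * cj U B) * (tr (R * cj U C) * tr (T * cj U E)))))"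
  proof (rule avg_cong)
    fix U assume U: "U \<in> Cl"
    have c: "cj U A \<in> M" "cj U B \<in> M" "cj U C \<in> M" "cj U E \<in> M" using M U by simp_all
    have e: "cj (X * U) Y = cj X (cj U Y)" if "Y \<in> M" for Y by (rule cj_mult[OF S_carrier[OF X(1)] Cl_M[OF U] that])
    show "tr (P * cj (X * U) A) * (tr (Q * cj (X * U) B) * (tr (R * cj (X * U) C) * tr (T * cj (X * U) E))) =
      chi P X * (chi Q X * (chi R X * chi T X)) * (tr (P * cj U A) * (tr (Q * cj U B) * (tr (R * cj U C) * tr (T * cj U E))))"
      unfolding e[OF M(1)] e[OF M(2)] e[OF M(3)] e[OF M(4)] tr_S_cj[OF X(1) s(1) c(1)] tr_S_cj[OF X(1) s(2) c(2)]
        tr_S_cj[OF X(1) s(3) c(3)] tr_S_cj[OF X(1) s(4) c(4)] by (simp only: mult_ac)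
  qed
  also have "\<dots> = chi P X * (chi Q X * (chi R X * chi T X)) * F4 P Q R T" unfolding F4_def by (rule avg_cmult)
  finally show ?thesis using X(2) by simp
qed

text \<open>By \<open>F4_zero\<close> only the operator \<open>Z\<close> proportional to
  \<open>P * Q * R\<close> contributes. The phase \<open>c * e\<close> enters once directly and once
  conjugated through \<open>ghat\<close>.\<close>

lemma sum_F4:
  assumes s: "P \<in> S" "Q \<in> S" "R \<in> S" and W: "W \<in> M"
  shows "(\<Sum>T\<in>S. tr (T * W) * F4 P Q R T) = tr (P * (Q * (R * W))) * ghat P Q R"
proof -
  obtain X c where X: "X \<in> S" "cmod c = 1" "Q * R = c \<cdot>\<^sub>m X" using S_mult[OF s(2,3)] by blast
  obtain Z e where Z: "Z \<in> S" "cmod e = 1" "P * X = e \<cdot>\<^sub>m Z" using S_mult[OF s(1) X(1)] by blast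
  have pqr: "P * (Q * R) = (c * e) \<cdot>\<^sub>m Z" unfolding X(3) smult_right_M[OF S_carrier[OF s(1)] S_carrier[OF X(1)]] Z(3) smult_smult ..
  have e1: "P * (Q * (R * Y)) = (c * e) \<cdot>\<^sub>m (Z * Y)" if Y: "Y \<in> M" for Y
  proof -
    have "P * (Q * (R * Y)) = (P * (Q * R)) * Y" using s Y by (simp only: mult_assoc_M mult_M S_carrier)
    then show ?thesis unfolding pqr smult_left_M[OF S_carrier[OF Z(1)] Y] .
  qed
  have "adj (P * (Q * R)) = R * (Q * P)" using s by simp
  then have rqp: "R * (Q * P) = cnj (c * e) \<cdot>\<^sub>m Z" unfolding pqr adj_smult S_adj[OF Z(1)] ..
  have e2: "R * (Q * (P * Y)) = cnj (c * e) \<cdot>\<^sub>m (Z * Y)" if Y: "Y \<in> M" for Y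
  proof -
    have "R * (Q * (P * Y)) = (R * (Q * P)) * Y" using s Y by (simp only: mult_assoc_M mult_M S_carrier)
    then show ?thesis unfolding rqp smult_left_M[OF S_carrier[OF Z(1)] Y] .
  qed
  have un: "(c * e) * cnj (c * e) = 1" using complex_norm_square[of "c * e"] X(2) Z(2) by (simp add: norm_mult)
  have z: "F4 P Q R T = 0" if "T \<in> S" "T \<noteq> Z" for T
  proof (rule F4_zero[OF s that(1)])
    have "tr (Z * T) = 0" by (rule S_orth[OF Z(1) that(1)]) (use that(2) in blast)
    then show "tr (P * (Q * (R * T))) = 0"
      unfolding e1[OF S_carrier[OF that(1)]] tr_M_smult[OF mult_M[OF S_carrier[OF Z(1)] S_carrier[OF that(1)]]] by simp
  qed
  have "(\<Sum>T\<in>S. tr (T * W) * F4 P Q R T) = (\<Sum>T\<in>S. if T = Z then tr (Z * W) * F4 P Q R Z else 0)"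
    by (intro sum.cong refl) (auto simp: z)
  also have "\<dots> = tr (Z * W) * F4 P Q R Z" using finite_S Z(1) by simp
  also have "ghat P Q R = cnj (c * e) * F4 P Q R Z"
    unfolding ghat_def F4_def avg_cmult[symmetric]
  proof (rule avg_cong)
    fix U assume U: "U \<in> Cl"
    then have m: "cj U E \<in> M" using M by simp
    show "Gam (cj U C) (cj U B) (cj U A) (cj U E) R Q P =
       cnj (c * e) * (tr (P * cj U A) * (tr (Q * cj U B) * (tr (R * cj U C) * tr (Z * cj U E))))"
      unfolding Gam_def e2[OF m] tr_M_smult[OF mult_M[OF S_carrier[OF Z(1)] m]] by (simp only: mult_ac)
  qed
  moreover have "tr (P * (Q * (R * W))) = (c * e) * tr (Z * W)"
    unfolding e1[OF W] tr_M_smult[OF mult_M[OF S_carrier[OF Z(1)] W]] ..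
  ultimately show ?thesis using un by (simp add: mult_ac)
qed

lemma expand_form:
  assumes W: "W \<in> M" and X: "X \<in> M" "Y \<in> M" "Z \<in> M"
  shows "sum3 (\<lambda>P Q R. (2 * tr (P * W) * tr (Q * W) * tr (R * W) + tr (P * (W * (Q * W))) * tr (R * W) +
       tr (Q * (W * (R * W))) * tr (P * W)) * (tr (P * X) * (tr (Q * Y) * tr (R * Z)))) =
     of_nat d ^ 3 * (2 * tr (W * X) * tr (W * Y) * tr (W * Z) + tr (W * (X * (W * Y))) * tr (W * Z) + tr (W * (Y * (W * Z))) * tr (W * X))"
proof -
  have one: "(\<Sum>P\<in>S. tr (P * W) * tr (P * V)) = of_nat d * tr (W * V)" if "V \<in> M" for V
    by (rule completeness'[OF W that])
  have two: "(\<Sum>P\<in>S. \<Sum>Q\<in>S. tr (P * (W * (Q * W))) * (tr (P * U) * tr (Q * V))) = of_nat d ^ 2 * tr (W * (U * (W * V)))"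
    if U: "U \<in> M" and V: "V \<in> M" for U V
  proof -
    have "(\<Sum>Q\<in>S. tr (P * (W * (Q * W))) * (tr (P * U) * tr (Q * V))) = tr (P * U) * (of_nat d * tr (P * (W * (V * W))))"
      if P: "P \<in> S" for P
    proof -
      have "(\<Sum>Q\<in>S. tr (P * (W * (Q * W))) * (tr (P * U) * tr (Q * V))) = tr (P * U) * (\<Sum>Q\<in>S. tr (Q * V) * tr ((P * W) * (Q * W)))"
        unfolding sum_distrib_left using P W by (intro sum.cong refl) simp
      also have "\<dots> = tr (P * U) * (of_nat d * tr ((P * W) * (V * W)))"
        by (subst sum_insert) (use P W V in simp_all)
      finally show ?thesis using P W V by simp
    qed
    then have "(\<Sum>P\<in>S. \<Sum>Q\<in>S. tr (P * (W * (Q * W))) * (tr (P * U) * tr (Q * V))) =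
        of_nat d * (\<Sum>P\<in>S. tr (P * U) * tr (P * (W * (V * W))))" by (simp add: sum_distrib_left mult_ac)
    also have "\<dots> = of_nat d * (of_nat d * tr (U * (W * (V * W))))"
      by (subst completeness') (use U V W in simp_all)
    also have "tr (U * (W * (V * W))) = tr ((U * (W * V)) * W)" using U V W by simp
    also have "\<dots> = tr (W * (U * (W * V)))" by (rule tr_cyc) (use U V W in simp_all)
    finally show ?thesis by (simp add: power2_eq_square)
  qed
  let ?f = "\<lambda>P. tr (P * W) * tr (P * X)" and ?g = "\<lambda>P. tr (P * W) * tr (P * Y)" and ?h = "\<lambda>P. tr (P * W) * tr (P * Z)"
  let ?u = "\<lambda>P Q. tr (P * (W * (Q * W))) * (tr (P * X) * tr (Q * Y))" and ?v = "\<lambda>Q R. tr (Q * (W * (R * W))) * (tr (Q * Y) * tr (R * Z))"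
  have uh: "sum3 (\<lambda>P Q R. u P Q * h R) = (\<Sum>P\<in>S. \<Sum>Q\<in>S. u P Q) * (\<Sum>R\<in>S. h R)" for u h
    by (simp only: sum_distrib_right) (simp only: sum_distrib_left)
  have fv: "sum3 (\<lambda>P Q R. f P * v Q R) = (\<Sum>P\<in>S. f P) * (\<Sum>Q\<in>S. \<Sum>R\<in>S. v Q R)" for f v
    by (simp only: sum_distrib_right) (simp only: sum_distrib_left)
  have fg: "(\<Sum>P\<in>S. \<Sum>Q\<in>S. f P * g Q) = (\<Sum>P\<in>S. f P) * (\<Sum>Q\<in>S. g Q)" for f g :: "complex mat \<Rightarrow> complex"
    by (rule sum_product[symmetric])
  have "sum3 (\<lambda>P Q R. (2 * tr (P * W) * tr (Q * W) * tr (R * W) + tr (P * (W * (Q * W))) * tr (R * W) +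
       tr (Q * (W * (R * W))) * tr (P * W)) * (tr (P * X) * (tr (Q * Y) * tr (R * Z)))) =
     sum3 (\<lambda>P Q R. (2 * ?f P * ?g Q) * ?h R + ?u P Q * ?h R + ?f P * ?v Q R)"
    by (intro sum.cong refl) (simp add: algebra_simps)
  also have "\<dots> = 2 * (\<Sum>P\<in>S. ?f P) * (\<Sum>Q\<in>S. ?g Q) * (\<Sum>R\<in>S. ?h R) +
     (\<Sum>P\<in>S. \<Sum>Q\<in>S. ?u P Q) * (\<Sum>R\<in>S. ?h R) + (\<Sum>P\<in>S. ?f P) * (\<Sum>Q\<in>S. \<Sum>R\<in>S. ?v Q R)"
    unfolding sum.distrib uh fv fg sum_distrib_left ..
  also have "\<dots> = of_nat d ^ 3 * (2 * tr (W * X) * tr (W * Y) * tr (W * Z) + tr (W * (X * (W * Y))) * tr (W * Z) + tr (W * (Y * (W * Z))) * tr (W * X))"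
    unfolding one[OF X(1)] one[OF X(2)] one[OF X(3)] two[OF X(1,2)] two[OF X(2,3)]
    by (simp add: algebra_simps power2_eq_square power3_eq_cube)
  finally show ?thesis .
qed

end

end

context pauli_system
begin

text \<open>Summed over all Pauli operators \<open>W\<close> this gives \<open>m\<close> at
  \<open>A\<close> and \<open>B\<close>. It is kept for a general \<open>W\<close> because a gate
  \<open>T\<close> acts on it by replacing \<open>W\<close> with
  \<open>adj T * (W * T)\<close>.\<close>

definition Th :: "complex mat \<Rightarrow> complex mat \<Rightarrow> complex mat \<Rightarrow> complex" where
  "Th W A B = tr (W * A) * tr (W * A) * (tr (W * B) * tr (W * B)) + tr (W * (A * (W * B))) * (tr (W * A) * tr (W * B))"

lemma sum3_reverse: "sum3 f = sum3 (\<lambda>P Q R. f R Q P)"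
proof -
  have "sum3 f = (\<Sum>Q\<in>S. \<Sum>R\<in>S. \<Sum>P\<in>S. f P Q R)" by (rule sum_rotate)
  also have "\<dots> = (\<Sum>R\<in>S. \<Sum>Q\<in>S. \<Sum>P\<in>S. f P Q R)" by (rule sum.swap)
  finally show ?thesis .
qed

lemma sum3_delta:
  "sum3 (\<lambda>P Q R. if P = Q then h P R else 0) = (\<Sum>P\<in>S. \<Sum>R\<in>S. h P R)"
  "sum3 (\<lambda>P Q R. if Q = R then h P Q else 0) = (\<Sum>P\<in>S. \<Sum>Q\<in>S. h P Q)"
  "sum3 (\<lambda>P Q R. if P = R then h P Q else 0) = (\<Sum>P\<in>S. \<Sum>Q\<in>S. h P Q)"
  "sum3 (\<lambda>P Q R. if P = Q \<and> Q = R then k P else 0) = (\<Sum>P\<in>S. k P)"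
  "sum3 (\<lambda>P Q R. if P = 1\<^sub>m d then h Q R else 0) = (\<Sum>Q\<in>S. \<Sum>R\<in>S. h Q R)"
  "sum3 (\<lambda>P Q R. if R = 1\<^sub>m d then h P Q else 0) = (\<Sum>P\<in>S. \<Sum>Q\<in>S. h P Q)"
  "sum3 (\<lambda>P Q R. if P = 1\<^sub>m d \<and> R = 1\<^sub>m d then k Q else 0) = (\<Sum>Q\<in>S. k Q)"
proof -
  have pq: "sum3 (\<lambda>P Q R. if P = Q then h P R else 0) = (\<Sum>P\<in>S. \<Sum>R\<in>S. h P R)" for h
  proof -
    have "sum3 (\<lambda>P Q R. if P = Q then h P R else 0) = (\<Sum>P\<in>S. \<Sum>Q\<in>S. if P = Q then (\<Sum>R\<in>S. h P R) else 0)"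
      by (intro sum.cong refl) auto
    then show ?thesis using finite_S by simp
  qed
  show "sum3 (\<lambda>P Q R. if P = Q then h P R else 0) = (\<Sum>P\<in>S. \<Sum>R\<in>S. h P R)" by (rule pq)
  show "sum3 (\<lambda>P Q R. if Q = R then h P Q else 0) = (\<Sum>P\<in>S. \<Sum>Q\<in>S. h P Q)" using finite_S by simp
  show "sum3 (\<lambda>P Q R. if P = R then h P Q else 0) = (\<Sum>P\<in>S. \<Sum>Q\<in>S. h P Q)" using finite_S by simp
  show "sum3 (\<lambda>P Q R. if P = Q \<and> Q = R then k P else 0) = (\<Sum>P\<in>S. k P)"
  proof -
    have "sum3 (\<lambda>P Q R. if P = Q \<and> Q = R then k P else 0) = sum3 (\<lambda>P Q R. if P = Q then (if P = R then k P else 0) else 0)"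
      by (intro sum.cong refl) auto
    then show ?thesis unfolding pq using finite_S by simp
  qed
  have p1: "sum3 (\<lambda>P Q R. if P = 1\<^sub>m d then h Q R else 0) = (\<Sum>Q\<in>S. \<Sum>R\<in>S. h Q R)" for h
  proof -
    have "sum3 (\<lambda>P Q R. if P = 1\<^sub>m d then h Q R else 0) = (\<Sum>P\<in>S. if P = 1\<^sub>m d then (\<Sum>Q\<in>S. \<Sum>R\<in>S. h Q R) else 0)"
      by (intro sum.cong refl) auto
    then show ?thesis using finite_S one_S by simp
  qed
  show "sum3 (\<lambda>P Q R. if P = 1\<^sub>m d then h Q R else 0) = (\<Sum>Q\<in>S. \<Sum>R\<in>S. h Q R)" by (rule p1)
  show "sum3 (\<lambda>P Q R. if R = 1\<^sub>m d then h P Q else 0) = (\<Sum>P\<in>S. \<Sum>Q\<in>S. h P Q)" using finite_S one_S by simp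
  show "sum3 (\<lambda>P Q R. if P = 1\<^sub>m d \<and> R = 1\<^sub>m d then k Q else 0) = (\<Sum>Q\<in>S. k Q)"
  proof -
    have "sum3 (\<lambda>P Q R. if P = 1\<^sub>m d \<and> R = 1\<^sub>m d then k Q else 0) = sum3 (\<lambda>P Q R. if P = 1\<^sub>m d then (if R = 1\<^sub>m d then k Q else 0) else 0)"
      by (intro sum.cong refl) auto
    then show ?thesis unfolding p1 using finite_S one_S by simp
  qed
qed

lemma lam_reverse: "lam c1 c2 c3 al be ga de ep ze et R Q P = lam c1 c2 c3 al be ga de ep ze et P Q R"
proof -
  have s: "chi R Q = chi Q R" "chi R P = chi P R" "chi Q P = chi P Q" by (rule chi_sym)+
  have "(if R = Q then al + be * chi P R else 0) = (if Q = R then al + be * chi P Q else 0)"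
    "(if Q = P then al + be * chi Q R else 0) = (if P = Q then al + be * chi P R else 0)"
    "(if R = P then ga + de * chi Q R else 0) = (if P = R then ga + de * chi P Q else 0)"
    using chi_sym[of Q R] by auto
  then show ?thesis unfolding lam_def s by (auto simp: algebra_simps)
qed

text \<open>Every summand of \<open>lam\<close> picks out one of the sums of \<open>Gam\<close>
  evaluated before. The reversed order of arguments is removed by \<open>lam_reverse\<close>, the
  symmetry of \<open>lam\<close> under exchange of \<open>P\<close> and \<open>R\<close>.\<close>

lemma lam_Gam_sum:
  assumes A: "A \<in> M" and B: "B \<in> M" and A1: "tr A = 1"
  shows "sum3 (\<lambda>P Q R. lam c1 c2 c3 al be ga de ep ze et P Q R * Gam A B A B R Q P) =
     of_nat d ^ 3 * (2 * c1 * tr (A * (B * (A * B))) + 4 * c2 * tr (A * (A * (B * B))))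
     + c3 * (of_nat d ^ 2 * ((\<Sum>P\<in>S. tr (P * A) * tr (P * (B * (P * (A * (P * B)))))) + (\<Sum>P\<in>S. tr (P * A) * tr (P * (A * (P * (B * (P * B))))))))
     + 2 * (al * (of_nat d ^ 2 * (tr (A * B) * tr (A * B))) + be * (of_nat d * (\<Sum>P\<in>S. tr (P * A) * tr (P * B) * tr (P * (A * (P * B))))))
     + ga * (of_nat d * (\<Sum>P\<in>S. tr (P * A) * tr (P * A) * tr (P * (B * (P * B))))) + de * (of_nat d ^ 2 * (tr (A * A) * tr (B * B)))
     + ep * (\<Sum>P\<in>S. tr (P * A) * tr (P * B) * (tr (P * A) * tr (P * B)))
     + ze * (4 * of_nat d ^ 2 * tr (A * (B * B))) + et * (of_nat d * tr (B * B))"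
proof -
  let ?G = "Gam A B A B"
  have "sum3 (\<lambda>P Q R. lam c1 c2 c3 al be ga de ep ze et P Q R * Gam A B A B R Q P) =
     sum3 (\<lambda>P Q R. lam c1 c2 c3 al be ga de ep ze et P Q R * Gam A B A B P Q R)"
    by (subst sum3_reverse) (simp only: lam_reverse)
  also have "\<dots> = sum3 (\<lambda>P Q R. c1 * ?G P Q R + c1 * (chi P Q * (chi P R * (chi Q R * ?G P Q R)))
     + c2 * (chi P Q * ?G P Q R) + c2 * (chi Q R * ?G P Q R) + c2 * (chi P Q * (chi P R * ?G P Q R)) + c2 * (chi P R * (chi Q R * ?G P Q R))
     + c3 * (chi P R * ?G P Q R) + c3 * (chi P Q * (chi Q R * ?G P Q R))
     + (if P = Q then al * ?G P P R + be * (chi P R * ?G P P R) else 0)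
     + (if Q = R then al * ?G P Q Q + be * (chi P Q * ?G P Q Q) else 0)
     + (if P = R then ga * ?G P Q P + de * (chi P Q * ?G P Q P) else 0)
     + (if P = Q \<and> Q = R then ep * ?G P P P else 0)
     + (if P = 1\<^sub>m d then ze * ?G (1\<^sub>m d) Q R + ze * (chi Q R * ?G (1\<^sub>m d) Q R) else 0)
     + (if R = 1\<^sub>m d then ze * ?G P Q (1\<^sub>m d) + ze * (chi P Q * ?G P Q (1\<^sub>m d)) else 0)
     + (if P = 1\<^sub>m d \<and> R = 1\<^sub>m d then et * ?G (1\<^sub>m d) Q (1\<^sub>m d) else 0))"
  proof (intro sum.cong refl)
    fix P Q R
    have d: "(if b then x else 0) * y = (if b then x * y else (0::complex))" for b x y by simp
    have i: "(if P = Q then (al + be * chi P R) * ?G P Q R else 0) = (if P = Q then al * ?G P P R + be * (chi P R * ?G P P R) else 0)"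
      "(if Q = R then (al + be * chi P Q) * ?G P Q R else 0) = (if Q = R then al * ?G P Q Q + be * (chi P Q * ?G P Q Q) else 0)"
      "(if P = R then (ga + de * chi P Q) * ?G P Q R else 0) = (if P = R then ga * ?G P Q P + de * (chi P Q * ?G P Q P) else 0)"
      "(if P = Q \<and> Q = R then ep * ?G P Q R else 0) = (if P = Q \<and> Q = R then ep * ?G P P P else 0)"
      "(if P = 1\<^sub>m d then ze * (1 + chi Q R) * ?G P Q R else 0) = (if P = 1\<^sub>m d then ze * ?G (1\<^sub>m d) Q R + ze * (chi Q R * ?G (1\<^sub>m d) Q R) else 0)"
      "(if R = 1\<^sub>m d then ze * (1 + chi P Q) * ?G P Q R else 0) = (if R = 1\<^sub>m d then ze * ?G P Q (1\<^sub>m d) + ze * (chi P Q * ?G P Q (1\<^sub>m d)) else 0)"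
      "(if P = 1\<^sub>m d \<and> R = 1\<^sub>m d then et * ?G P Q R else 0) = (if P = 1\<^sub>m d \<and> R = 1\<^sub>m d then et * ?G (1\<^sub>m d) Q (1\<^sub>m d) else 0)"
      by (simp_all only: distrib_left distrib_right mult.assoc mult_1_right mult_1_left split: if_split) auto
    show "lam c1 c2 c3 al be ga de ep ze et P Q R * ?G P Q R = c1 * ?G P Q R + c1 * (chi P Q * (chi P R * (chi Q R * ?G P Q R)))
     + c2 * (chi P Q * ?G P Q R) + c2 * (chi Q R * ?G P Q R) + c2 * (chi P Q * (chi P R * ?G P Q R)) + c2 * (chi P R * (chi Q R * ?G P Q R))
     + c3 * (chi P R * ?G P Q R) + c3 * (chi P Q * (chi Q R * ?G P Q R))
     + (if P = Q then al * ?G P P R + be * (chi P R * ?G P P R) else 0)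
     + (if Q = R then al * ?G P Q Q + be * (chi P Q * ?G P Q Q) else 0)
     + (if P = R then ga * ?G P Q P + de * (chi P Q * ?G P Q P) else 0)
     + (if P = Q \<and> Q = R then ep * ?G P P P else 0)
     + (if P = 1\<^sub>m d then ze * ?G (1\<^sub>m d) Q R + ze * (chi Q R * ?G (1\<^sub>m d) Q R) else 0)
     + (if R = 1\<^sub>m d then ze * ?G P Q (1\<^sub>m d) + ze * (chi P Q * ?G P Q (1\<^sub>m d)) else 0)
     + (if P = 1\<^sub>m d \<and> R = 1\<^sub>m d then et * ?G (1\<^sub>m d) Q (1\<^sub>m d) else 0)"
      unfolding i[symmetric] unfolding lam_def by (simp only: distrib_right d) (simp only: distrib_left distrib_right mult_1_right mult_1_left mult.assoc add.assoc)
  qed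
  also have "\<dots> = of_nat d ^ 3 * (2 * c1 * tr (A * (B * (A * B))) + 4 * c2 * tr (A * (A * (B * B))))
     + c3 * (of_nat d ^ 2 * ((\<Sum>P\<in>S. tr (P * A) * tr (P * (B * (P * (A * (P * B)))))) + (\<Sum>P\<in>S. tr (P * A) * tr (P * (A * (P * (B * (P * B))))))))
     + 2 * (al * (of_nat d ^ 2 * (tr (A * B) * tr (A * B))) + be * (of_nat d * (\<Sum>P\<in>S. tr (P * A) * tr (P * B) * tr (P * (A * (P * B))))))
     + ga * (of_nat d * (\<Sum>P\<in>S. tr (P * A) * tr (P * A) * tr (P * (B * (P * B))))) + de * (of_nat d ^ 2 * (tr (A * A) * tr (B * B)))
     + ep * (\<Sum>P\<in>S. tr (P * A) * tr (P * B) * (tr (P * A) * tr (P * B)))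
     + ze * (4 * of_nat d ^ 2 * tr (A * (B * B))) + et * (of_nat d * tr (B * B))"
  proof -
    have rot: "tr (B * (A * (A * B))) = tr (A * (A * (B * B)))"
    proof -
      have "tr (B * (A * (A * B))) = tr ((A * (A * B)) * B)" by (rule tr_cyc) (use A B in simp_all)
      then show ?thesis using A B by simp
    qed
    have rot2: "tr (B * (A * B)) = tr (A * (B * B))"
    proof -
      have "tr (B * (A * B)) = tr ((A * B) * B)" by (rule tr_cyc) (use A B in simp_all)
      then show ?thesis using A B by simp
    qed
    have ba: "tr (B * A) = tr (A * B)" by (rule tr_cyc[OF B A])
    have pb: "(\<Sum>Q\<in>S. tr (Q * B) * tr (Q * A) * tr (Q * (A * (Q * B)))) = (\<Sum>P\<in>S. tr (P * A) * tr (P * B) * tr (P * (A * (P * B))))"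
      by (simp only: mult.commute)
    have k3: "sum3 (\<lambda>P Q R. c * f P Q R) = c * sum3 f" for c f by (simp only: sum_distrib_left)
    have k2: "(\<Sum>P\<in>S. \<Sum>Q\<in>S. c * h P Q) = c * (\<Sum>P\<in>S. \<Sum>Q\<in>S. h P Q)" for c :: complex and h by (simp only: sum_distrib_left)
    have k1: "(\<Sum>P\<in>S. c * h P) = c * (\<Sum>P\<in>S. h P)" for c :: complex and h by (simp only: sum_distrib_left)
    show ?thesis
      unfolding sum.distrib sum3_delta k3
      unfolding sum3_Gam[OF A B A B] sum3_x[OF A B A B] sum3_z[OF A B A B] sum3_xy[OF A B A B] sum3_yz[OF A B A B] sum3_xyz[OF A B A B]
        sum3_y[OF A B A B] sum3_xz[OF A B A B]
      unfolding k2
      unfolding sum2_PQ[OF A B A B] sum2_PQ_chi[OF A B A B] sum2_QR[OF A B A B] sum2_QR_chi[OF A B A B]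
        sum2_PR[OF A B A B] sum2_PR_chi[OF A B A B] sum2_P1[OF A B A B] sum2_P1_chi[OF A B A B]
        sum2_R1[OF A B A B] sum2_R1_chi[OF A B A B]
      unfolding k1 sum1_PPP[OF A B A B] sum1_P1R1[OF A B A B] rot rot2 ba pb A1
      by (simp add: algebra_simps)
  qed
  finally show ?thesis .
qed

lemma tr3_scalar:
  assumes s: "P \<in> S" "Q \<in> S" "R \<in> S" and t: "tr (P * (Q * R)) \<noteq> 0"
  shows "\<exists>c. R * (Q * P) = c \<cdot>\<^sub>m 1\<^sub>m d"
proof -
  obtain X c where X: "X \<in> S" "cmod c = 1" "Q * R = c \<cdot>\<^sub>m X" using S_mult[OF s(2,3)] by blast
  have "P * (Q * R) = c \<cdot>\<^sub>m (P * X)" unfolding X(3) using smult_right_M[OF S_carrier[OF s(1)] S_carrier[OF X(1)]] .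
  moreover from this have "P = X" using t S_orth[OF s(1) X(1)] tr_M_smult[OF mult_M[OF S_carrier[OF s(1)] S_carrier[OF X(1)]]] by auto
  ultimately have "P * (Q * R) = c \<cdot>\<^sub>m 1\<^sub>m d" using S_sq[OF X(1)] by simp
  then have "adj (P * (Q * R)) = cnj c \<cdot>\<^sub>m 1\<^sub>m d" by simp
  moreover have "adj (P * (Q * R)) = R * (Q * P)" using s by simp
  ultimately show ?thesis by metis
qed

end

context clifford_sample
begin

text \<open>All four operators are expanded in Pauli strings, so that \<open>F4\<close> carries the
  average. Summing out the fourth variable by \<open>sum_F4\<close> supplies the missing factor of
  \<open>kap_eq\<close>.\<close>

lemma kap_expect:
  assumes W: "W \<in> M" "W * W = 1\<^sub>m d" "tr W = 0" and M: "A \<in> M" "B \<in> M" "C \<in> M" "E \<in> M"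
  shows "of_nat d ^ 5 * avg (\<lambda>U. (2 * tr (W * cj U A) * tr (W * cj U B) * tr (W * cj U C)
      + tr (W * (cj U A * (W * cj U B))) * tr (W * cj U C) + tr (W * (cj U B * (W * cj U C))) * tr (W * cj U A)) * tr (W * cj U E))
    = sum3 (\<lambda>P Q R. kap W P Q R * ghat A B C E P Q R)"
proof -
  let ?\<phi> = "\<lambda>P Q R. 2 * tr (P * W) * tr (Q * W) * tr (R * W) + tr (P * (W * (Q * W))) * tr (R * W) + tr (Q * (W * (R * W))) * tr (P * W)"
  let ?\<Psi> = "\<lambda>U. 2 * tr (W * cj U A) * tr (W * cj U B) * tr (W * cj U C)
      + tr (W * (cj U A * (W * cj U B))) * tr (W * cj U C) + tr (W * (cj U B * (W * cj U C))) * tr (W * cj U A)"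
  have "of_nat d ^ 4 * avg (\<lambda>U. ?\<Psi> U * tr (W * cj U E)) = avg (\<lambda>U. (of_nat d ^ 3 * ?\<Psi> U) * (of_nat d * tr (W * cj U E)))"
    unfolding avg_cmult[symmetric] by (rule avg_cong) (simp add: power_numeral_reduce mult_ac)
  also have "\<dots> = avg (\<lambda>U. sum3 (\<lambda>P Q R. \<Sum>T\<in>S. ?\<phi> P Q R * (tr (T * W) *
      (tr (P * cj U A) * (tr (Q * cj U B) * (tr (R * cj U C) * tr (T * cj U E)))))))"
  proof (rule avg_cong)
    fix U assume U: "U \<in> Cl"
    have c: "cj U A \<in> M" "cj U B \<in> M" "cj U C \<in> M" "cj U E \<in> M" using M U by simp_all
    show "(of_nat d ^ 3 * ?\<Psi> U) * (of_nat d * tr (W * cj U E)) = sum3 (\<lambda>P Q R. \<Sum>T\<in>S. ?\<phi> P Q R * (tr (T * W) *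
      (tr (P * cj U A) * (tr (Q * cj U B) * (tr (R * cj U C) * tr (T * cj U E))))))"
      unfolding expand_form[OF c W(1) c(1-3), symmetric] completeness'[OF W(1) c(4), symmetric]
      unfolding sum_distrib_right by (intro sum.cong refl, subst sum_distrib_left, intro sum.cong refl) (simp only: mult_ac)
  qed
  also have "\<dots> = sum3 (\<lambda>P Q R. ?\<phi> P Q R * (\<Sum>T\<in>S. tr (T * W) * F4 A B C E P Q R T))"
    unfolding avg_sum F4_def[OF M] avg_cmult sum_distrib_left ..
  also have "\<dots> = sum3 (\<lambda>P Q R. ?\<phi> P Q R * (tr (P * (Q * (R * W))) * ghat A B C E P Q R))"
    by (intro sum.cong refl arg_cong2[where f="(*)"] sum_F4[OF M _ _ _ W(1)])
  finally have "of_nat d * (of_nat d ^ 4 * avg (\<lambda>U. ?\<Psi> U * tr (W * cj U E))) =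
      sum3 (\<lambda>P Q R. of_nat d * (?\<phi> P Q R * (tr (P * (Q * (R * W))) * ghat A B C E P Q R)))"
    by (simp only: sum_distrib_left)
  also have "\<dots> = sum3 (\<lambda>P Q R. kap W P Q R * ghat A B C E P Q R)"
    by (intro sum.cong refl) (simp only: kap_eq[OF W] mult_ac)
  finally have e: "of_nat d * (of_nat d ^ 4 * avg (\<lambda>U. ?\<Psi> U * tr (W * cj U E))) = sum3 (\<lambda>P Q R. kap W P Q R * ghat A B C E P Q R)" .
  have "(of_nat d :: complex) ^ 5 = of_nat d * of_nat d ^ 4" using power_Suc[of "of_nat d :: complex" 4] by simp
  then show ?thesis using e by (simp only: mult.assoc)
qed

text \<open>With the alternating arguments A, B, A, B the two symmetrized terms of the 4-linear form
  coincide by cyclicity of the trace, so the form equals twice \<open>Th\<close>.\<close>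

lemma Th_expect:
  assumes W: "W \<in> M" "W * W = 1\<^sub>m d" "tr W = 0" and M: "A \<in> M" "B \<in> M"
  shows "2 * of_nat d ^ 5 * avg (\<lambda>U. Th W (cj U A) (cj U B)) = sum3 (\<lambda>P Q R. kap W P Q R * ghat A B A B P Q R)"
proof -
  have "2 * of_nat d ^ 5 * avg (\<lambda>U. Th W (cj U A) (cj U B)) = of_nat d ^ 5 * avg (\<lambda>U. 2 * Th W (cj U A) (cj U B))"
    by (simp add: avg_cmult)
  also have "avg (\<lambda>U. 2 * Th W (cj U A) (cj U B)) = avg (\<lambda>U. (2 * tr (W * cj U A) * tr (W * cj U B) * tr (W * cj U A)
      + tr (W * (cj U A * (W * cj U B))) * tr (W * cj U A) + tr (W * (cj U B * (W * cj U A))) * tr (W * cj U A)) * tr (W * cj U B))"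
  proof (rule avg_cong)
    fix U assume U: "U \<in> Cl"
    have c: "cj U A \<in> M" "cj U B \<in> M" using M U by simp_all
    have "tr ((W * cj U B) * (W * cj U A)) = tr ((W * cj U A) * (W * cj U B))" by (rule tr_cyc) (use c W in simp_all)
    then have "tr (W * (cj U B * (W * cj U A))) = tr (W * (cj U A * (W * cj U B)))" using c W(1) by simp
    then show "2 * Th W (cj U A) (cj U B) = (2 * tr (W * cj U A) * tr (W * cj U B) * tr (W * cj U A)
      + tr (W * (cj U A * (W * cj U B))) * tr (W * cj U A) + tr (W * (cj U B * (W * cj U A))) * tr (W * cj U A)) * tr (W * cj U B)"
      by (simp add: Th_def algebra_simps)
  qed
  also have "of_nat d ^ 5 * \<dots> = sum3 (\<lambda>P Q R. kap W P Q R * ghat A B A B P Q R)"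
    by (rule kap_expect[OF W M M])
  finally show ?thesis .
qed

text \<open>For \<open>Q = 1\<close> the factor at \<open>Q\<close> is \<open>tr B\<close>. If
  \<open>P * Q * R\<close> has nonzero trace, then \<open>R * Q * P\<close> is a scalar and the last
  factor is a multiple of \<open>tr B\<close>.\<close>

lemma ghat_zero:
  assumes M: "A \<in> M" "B \<in> M" and B0: "tr B = 0" and s: "P \<in> S" "Q \<in> S" "R \<in> S" and z: "Q = 1\<^sub>m d \<or> tr (P * (Q * R)) \<noteq> 0"
  shows "ghat A B A B P Q R = 0"
proof -
  have "ghat A B A B P Q R = avg (\<lambda>U. 0)"
    unfolding ghat_def[OF M M]
  proof (rule avg_cong)
    fix U assume U: "U \<in> Cl"
    have c: "cj U A \<in> M" "cj U B \<in> M" using M U by simp_all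
    have t: "tr (cj U B) = 0" using cj_tr[OF U M(2)] B0 by simp
    show "Gam (cj U A) (cj U B) (cj U A) (cj U B) R Q P = 0"
    proof (cases "Q = 1\<^sub>m d")
      case True
      then show ?thesis unfolding Gam_def True one_left_M[OF c(2)] t by simp
    next
      case False
      then obtain e where e: "R * (Q * P) = e \<cdot>\<^sub>m 1\<^sub>m d" using tr3_scalar[OF s] z by blast
      have "R * (Q * (P * cj U B)) = (R * (Q * P)) * cj U B" using s c by (simp only: mult_assoc_M mult_M S_carrier)
      also have "\<dots> = e \<cdot>\<^sub>m cj U B" unfolding e smult_left_M[OF one_M c(2)] one_left_M[OF c(2)] ..
      finally have "R * (Q * (P * cj U B)) = e \<cdot>\<^sub>m cj U B" .
      then show ?thesis unfolding Gam_def by (simp add: tr_M_smult[OF c(2)] t)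
    qed
  qed
  then show ?thesis by (simp add: avg_const)
qed

text \<open>The kernels are summed over the family before the replacement, since only the total has
  to agree with \<open>lam'\<close>. Once the kernel is \<open>lam\<close>, the sum against
  \<open>Gam\<close> is Clifford invariant and the average disappears.\<close>

lemma family_expect:
  assumes W: "\<And>i. i \<in> J \<Longrightarrow> W i \<in> M" "\<And>i. i \<in> J \<Longrightarrow> W i * W i = 1\<^sub>m d" "\<And>i. i \<in> J \<Longrightarrow> tr (W i) = 0"
    and M: "A \<in> M" "B \<in> M" and A1: "tr A = 1" and B0: "tr B = 0"
    and st: "same_stats (\<lambda>P Q R. \<Sum>i\<in>J. kap1 (W i) P Q R) (lam' c1 c2 c3 al be ga de ep ze et)"
    and E1: "c1 + 2 * c2 + c3 + ze = 0" and E2: "2 * c1 + 4 * c2 + 2 * c3 + ga + de + 4 * ze + et = 0"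
  shows "2 * of_nat d ^ 5 * (\<Sum>i\<in>J. avg (\<lambda>U. Th (W i) (cj U A) (cj U B))) =
    sum3 (\<lambda>P Q R. lam c1 c2 c3 al be ga de ep ze et P Q R * Gam A B A B R Q P)"
proof -
  let ?g = "ghat A B A B"
  let ?lam = "lam c1 c2 c3 al be ga de ep ze et"
  have "2 * of_nat d ^ 5 * (\<Sum>i\<in>J. avg (\<lambda>U. Th (W i) (cj U A) (cj U B))) = (\<Sum>i\<in>J. sum3 (\<lambda>P Q R. kap (W i) P Q R * ?g P Q R))"
    unfolding sum_distrib_left by (intro sum.cong refl Th_expect W M)
  also have "\<dots> = (\<Sum>i\<in>J. sum3 (\<lambda>P Q R. kap1 (W i) P Q R * ?g P Q R))"
    by (intro sum.cong refl) (simp add: kap1_def ghat_zero[OF M B0 _ one_S])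
  also have "\<dots> = sum3 (\<lambda>P Q R. (\<Sum>i\<in>J. kap1 (W i) P Q R) * ?g P Q R)"
  proof -
    have "(\<Sum>i\<in>J. sum3 (\<lambda>P Q R. f i P Q R)) = sum3 (\<lambda>P Q R. \<Sum>i\<in>J. f i P Q R)" for f :: "_ \<Rightarrow> _ \<Rightarrow> _ \<Rightarrow> _ \<Rightarrow> complex"
      by (subst sum.swap, intro sum.cong refl, subst sum.swap, intro sum.cong refl, rule sum.swap)
    then show ?thesis unfolding sum_distrib_right .
  qed
  also have "\<dots> = sum3 (\<lambda>P Q R. ?lam P Q R * ?g P Q R)"
  proof (rule dual_sum[OF class_fun_of_invariant[OF ghat_invariant[OF M M]] st _ _ E1 E2])
    fix P Q R assume s: "P \<in> S" "Q \<in> S" "R \<in> S"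
    show "(\<Sum>i\<in>J. kap1 (W i) P Q R) = 0" if "\<not> supp P Q R"
      by (rule sum.neutral) (use kap1_supp[OF W s that] in blast)
    show "?g P Q R = 0" if "Q = 1\<^sub>m d \<or> tr (P * (Q * R)) \<noteq> 0" by (rule ghat_zero[OF M B0 s that])
  qed
  also have "\<dots> = avg (\<lambda>U. sum3 (\<lambda>P Q R. ?lam P Q R * Gam (cj U A) (cj U B) (cj U A) (cj U B) R Q P))"
    unfolding ghat_def[OF M M] avg_sum avg_cmult ..
  also have "\<dots> = avg (\<lambda>U. sum3 (\<lambda>P Q R. ?lam P Q R * Gam A B A B R Q P))"
    by (rule avg_cong) (rule sum3_lam_Gam[OF _ M M])
  also have "\<dots> = sum3 (\<lambda>P Q R. ?lam P Q R * Gam A B A B R Q P)" by (rule avg_const)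
  finally show ?thesis .
qed

end

section \<open>The coefficients for one layer and the exact formula for its average\<close>

context pauli_system
begin

lemma isum_sum: "isum (\<lambda>P Q R. \<Sum>i\<in>J. f i P Q R) = (\<Sum>i\<in>J. isum (f i))"
proof -
  have "isum (\<lambda>P Q R. \<Sum>i\<in>J. f i P Q R) = sum3 (\<lambda>P Q R. \<Sum>i\<in>J. if ind P Q R then f i P Q R else 0)"
    unfolding isum_def by (intro sum.cong refl) simp
  also have "\<dots> = (\<Sum>i\<in>J. isum (f i))"
    unfolding isum_def
    by (subst (2) sum.swap, intro sum.cong refl, subst (2) sum.swap, intro sum.cong refl, rule sum.swap)
  finally show ?thesis .
qed

lemma psum_sum: "psum (\<lambda>P Q. \<Sum>i\<in>J. f i P Q) = (\<Sum>i\<in>J. psum (f i))"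
proof -
  have "psum (\<lambda>P Q. \<Sum>i\<in>J. f i P Q) = (\<Sum>P\<in>S. \<Sum>Q\<in>S. \<Sum>i\<in>J. if P \<noteq> 1\<^sub>m d \<and> Q \<noteq> 1\<^sub>m d \<and> P \<noteq> Q then f i P Q else 0)"
    unfolding psum_def by (intro sum.cong refl) simp
  also have "\<dots> = (\<Sum>i\<in>J. psum (f i))"
    unfolding psum_def by (subst (2) sum.swap, intro sum.cong refl, rule sum.swap)
  finally show ?thesis .
qed

lemma usum_sum: "usum (\<lambda>P. \<Sum>i\<in>J. f i P) = (\<Sum>i\<in>J. usum (f i))"
proof -
  have "usum (\<lambda>P. \<Sum>i\<in>J. f i P) = (\<Sum>P\<in>S. \<Sum>i\<in>J. if P \<noteq> 1\<^sub>m d then f i P else 0)"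
    unfolding usum_def by (intro sum.cong refl) simp
  then show ?thesis unfolding usum_def by (simp add: sum.swap[of _ J])
qed

end

text \<open>A certificate that an equation follows from two others: \<open>al\<close> and
  \<open>be\<close> are the multipliers, and the 3 clears the denominators in the coefficients of
  \<open>lam\<close>.\<close>

lemma lin_rel:
  fixes a b :: complex
  assumes "a = 0" "b = 0" "3 * (l - r) = al * a + be * b"
  shows "l = r"
  using assms by simp

context pauli_system
begin

text \<open>The coefficients of \<open>lam\<close> are those for which \<open>lam\<close> and the summed \<open>kap1\<close> have equal class sums. They are linear in
  \<open>u = 1 - \<mu>\<^sub>2\<close> and \<open>v = (1 - \<mu>\<^sub>1) d / (d + 3)\<close>, where \<open>\<mu>\<^sub>1\<close> and \<open>\<mu>\<^sub>2\<close> are the eigenvalues of one layer on the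
  symmetric and on the \<open>[2,2]\<close> sector; each condition is an explicit combination of the two equations defining \<open>u\<close> and \<open>v\<close>.\<close>
lemma same_stats_family:
  fixes J :: "'i set" and g h u v x :: complex
  defines "x \<equiv> of_nat d"
  assumes W: "\<And>i. i \<in> J \<Longrightarrow> W i \<in> M" "\<And>i. i \<in> J \<Longrightarrow> W i * W i = 1\<^sub>m d" "\<And>i. i \<in> J \<Longrightarrow> tr (W i) = 0"
    and card: "of_nat (card J) = x\<^sup>2 - 1"
    and q4: "(\<Sum>i\<in>J. q4 (W i)) = x ^ 4 * (x\<^sup>2 * g - 1)"
    and q2: "(\<Sum>i\<in>J. q2 (W i)) = x ^ 3 * (x\<^sup>2 * h - 1)"
    and q3: "(\<Sum>i\<in>J. q3 (W i)) = - x\<^sup>2"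
    and u: "u * ((x\<^sup>2 - 1) * (x\<^sup>2 - 4)) = x\<^sup>2 * (x\<^sup>2 * (1 - g) - 1)"
    and v: "v * ((x + 1) * (x + 2) * (x + 4) * (x - 1)) = x\<^sup>2 * ((x + 1) * (x + 2) - x\<^sup>2 * g - 3 * x * h)"
    and y: "y = v * (x + 3) - u * x"
  shows "same_stats (\<lambda>P Q R. \<Sum>i\<in>J. kap1 (W i) P Q R)
     (lam' (2 * x ^ 2 * (v - u) / 3) (x ^ 2 * (u + 2 * v) / 3) (- 2 * x ^ 2 * y / 3) (2 * x ^ 3 * (2 * u + v) / 3)
        (x ^ 4 * (1 - u) - 2 * x ^ 3 * y / 3) (- 2 * x ^ 3 * y / 3) (2 * x ^ 3 * (2 * u + v) / 3) (2 * x ^ 5 * (1 - u) - 2 * x ^ 4 * y / 3)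
        (2 * x ^ 3 * (v - u) / 3) (2 * x ^ 4 * (v - u) / 3))"
    (is "same_stats ?K (lam' ?c1 ?c2 ?c3 ?al ?be ?ga ?de ?ep ?ze ?et)")
proof -
  have U: "u * ((x\<^sup>2 - 1) * (x\<^sup>2 - 4)) - x\<^sup>2 * (x\<^sup>2 * (1 - g) - 1) = 0" using u by simp
  have V: "v * ((x + 1) * (x + 2) * (x + 4) * (x - 1)) - x\<^sup>2 * ((x + 1) * (x + 2) - x\<^sup>2 * g - 3 * x * h) = 0" using v by simp
  define Q4 where "Q4 = x ^ 4 * (x\<^sup>2 * g - 1)"
  define Q2 where "Q2 = x ^ 3 * (x\<^sup>2 * h - 1)"
  define cc where "cc = 2 * x * (Q4 + Q2)"
  define p1 where "p1 = x\<^sup>2 * (2 * Q2 + Q4 - x\<^sup>2) - (x\<^sup>2 - 1) * x ^ 4"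
  define r0 where "r0 = 2 * x\<^sup>2 * (Q2 - x\<^sup>2)"
  note red = isum_sum psum_sum usum_sum sum_distrib_left[of _ _ J]
  let ?L = "lam' ?c1 ?c2 ?c3 ?al ?be ?ga ?de ?ep ?ze ?et"
  note L = lam_isum[of ?c1 ?c2 ?c3 ?al ?be ?ga ?de ?ep ?ze ?et] lam_usum[of ?c1 ?c2 ?c3 ?al ?be ?ga ?de ?ep ?ze ?et]
  have LP: "psum (\<lambda>P Q. ?L P P Q) = (of_nat d ^ 2 - 1) * ((of_nat d ^ 2 - 2) * (2 * ?c1 + 2 * ?c2 + ?al) - 2 * (2 * ?c2 + 2 * ?c3 + ?be))"
    "psum (\<lambda>P Q. chi P Q * ?L P P Q) = (of_nat d ^ 2 - 1) * ((of_nat d ^ 2 - 2) * (2 * ?c2 + 2 * ?c3 + ?be) - 2 * (2 * ?c1 + 2 * ?c2 + ?al))"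
    by (rule psum_affine, rule lam_pairs(1), assumption+)+
  have LQ: "psum (\<lambda>P Q. ?L P Q Q) = (of_nat d ^ 2 - 1) * ((of_nat d ^ 2 - 2) * (2 * ?c1 + 2 * ?c2 + ?al) - 2 * (2 * ?c2 + 2 * ?c3 + ?be))"
    "psum (\<lambda>P Q. chi P Q * ?L P Q Q) = (of_nat d ^ 2 - 1) * ((of_nat d ^ 2 - 2) * (2 * ?c2 + 2 * ?c3 + ?be) - 2 * (2 * ?c1 + 2 * ?c2 + ?al))"
    by (rule psum_affine, rule lam_pairs(2), assumption+)+
  have LR: "psum (\<lambda>P Q. ?L P Q P) = (of_nat d ^ 2 - 1) * ((of_nat d ^ 2 - 2) * (2 * ?c1 + 2 * ?c3 + ?ga) - 2 * (4 * ?c2 + ?de))"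
    "psum (\<lambda>P Q. chi P Q * ?L P Q P) = (of_nat d ^ 2 - 1) * ((of_nat d ^ 2 - 2) * (4 * ?c2 + ?de) - 2 * (2 * ?c1 + 2 * ?c3 + ?ga))"
    by (rule psum_affine, rule lam_pairs(3), assumption+)+
  \<comment> \<open>The sum of \<open>q3\<close> over the family is \<open>- x\<^sup>2\<close>,
    which accounts for the last summand.\<close>
  have lin: "(\<Sum>i\<in>J. f i) = (x\<^sup>2 - 1) * a + b * Q4 + c * Q2 - e * x\<^sup>2"
    if "\<And>i. i \<in> J \<Longrightarrow> f i = a + b * q4 (W i) + c * q2 (W i) + e * q3 (W i)" for f a b c e
    using q4 q2 q3 card that by (simp add: sum.distrib sum_distrib_left[symmetric] Q4_def Q2_def)
  have KA1: "(\<Sum>i\<in>J. isum (kap1 (W i))) = 2 * cc - (x\<^sup>2 - 1) * (2 * x ^ 5 + 2 * x ^ 4) - r0"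
    by (rule trans[OF lin[of _ "- 2 * x ^ 5 - 2 * x ^ 4" "4 * x" "4 * x - 2 * x ^ 2" "- 2 * x ^ 2"]]) (simp_all add: kap1_isum[OF W] x_def[symmetric] cc_def r0_def p1_def algebra_simps power_numeral_reduce)
  have KA2: "(\<Sum>i\<in>J. isum (\<lambda>P Q R. chi P Q * (chi P R * (chi Q R * kap1 (W i) P Q R)))) = 2 * cc - (x\<^sup>2 - 1) * (2 * x ^ 5 + 2 * x ^ 4) - r0"
    by (rule trans[OF lin[of _ "- 2 * x ^ 5 - 2 * x ^ 4" "4 * x" "4 * x - 2 * x ^ 2" "- 2 * x ^ 2"]]) (simp_all add: kap1_isum[OF W] x_def[symmetric] cc_def r0_def p1_def algebra_simps power_numeral_reduce)
  have KB1: "(\<Sum>i\<in>J. isum (\<lambda>P Q R. chi P Q * kap1 (W i) P Q R)) = 2 * cc + (x\<^sup>2 - 1) * (x ^ 6 - 2 * x ^ 5 - 4 * x ^ 4) - p1"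
    by (rule trans[OF lin[of _ "x ^ 6 - 2 * x ^ 5 - 3 * x ^ 4" "4 * x - x ^ 2" "4 * x - 2 * x ^ 2" "- (x ^ 2)"]]) (simp_all add: kap1_isum[OF W] x_def[symmetric] cc_def r0_def p1_def algebra_simps power_numeral_reduce)
  have KB2: "(\<Sum>i\<in>J. isum (\<lambda>P Q R. chi Q R * kap1 (W i) P Q R)) = 2 * cc + (x\<^sup>2 - 1) * (x ^ 6 - 2 * x ^ 5 - 4 * x ^ 4) - p1"
    by (rule trans[OF lin[of _ "x ^ 6 - 2 * x ^ 5 - 3 * x ^ 4" "4 * x - x ^ 2" "4 * x - 2 * x ^ 2" "- (x ^ 2)"]]) (simp_all add: kap1_isum[OF W] x_def[symmetric] cc_def r0_def p1_def algebra_simps power_numeral_reduce)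
  have KB3: "(\<Sum>i\<in>J. isum (\<lambda>P Q R. chi P Q * (chi P R * kap1 (W i) P Q R))) = 2 * cc + (x\<^sup>2 - 1) * (x ^ 6 - 2 * x ^ 5 - 4 * x ^ 4) - p1"
    by (rule trans[OF lin[of _ "x ^ 6 - 2 * x ^ 5 - 3 * x ^ 4" "4 * x - x ^ 2" "4 * x - 2 * x ^ 2" "- (x ^ 2)"]]) (simp_all add: kap1_isum[OF W] x_def[symmetric] cc_def r0_def p1_def algebra_simps power_numeral_reduce)
  have KB4: "(\<Sum>i\<in>J. isum (\<lambda>P Q R. chi P R * (chi Q R * kap1 (W i) P Q R))) = 2 * cc + (x\<^sup>2 - 1) * (x ^ 6 - 2 * x ^ 5 - 4 * x ^ 4) - p1"
    by (rule trans[OF lin[of _ "x ^ 6 - 2 * x ^ 5 - 3 * x ^ 4" "4 * x - x ^ 2" "4 * x - 2 * x ^ 2" "- (x ^ 2)"]]) (simp_all add: kap1_isum[OF W] x_def[symmetric] cc_def r0_def p1_def algebra_simps power_numeral_reduce)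
  have KC1: "(\<Sum>i\<in>J. isum (\<lambda>P Q R. chi P R * kap1 (W i) P Q R)) = 2 * cc + x * r0 - 2 * (x\<^sup>2 - 1) * x ^ 4 - 2 * p1 - r0"
    by (rule trans[OF lin[of _ "0" "4 * x - 2 * x ^ 2" "4 * x + 2 * x ^ 3 - 6 * x ^ 2" "2 * x ^ 3 - 4 * x ^ 2"]]) (simp_all add: kap1_isum[OF W] x_def[symmetric] cc_def r0_def p1_def algebra_simps power_numeral_reduce)
  have KC2: "(\<Sum>i\<in>J. isum (\<lambda>P Q R. chi P Q * (chi Q R * kap1 (W i) P Q R))) = 2 * cc + x * r0 - 2 * (x\<^sup>2 - 1) * x ^ 4 - 2 * p1 - r0"
    by (rule trans[OF lin[of _ "0" "4 * x - 2 * x ^ 2" "4 * x + 2 * x ^ 3 - 6 * x ^ 2" "2 * x ^ 3 - 4 * x ^ 2"]]) (simp_all add: kap1_isum[OF W] x_def[symmetric] cc_def r0_def p1_def algebra_simps power_numeral_reduce)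
  have KP1: "(\<Sum>i\<in>J. psum (\<lambda>P R. kap1 (W i) P P R)) = 2 * (x\<^sup>2 - 1) * x ^ 5 - cc"
    by (rule trans[OF lin[of _ "2 * x ^ 5" "- 2 * x" "- 2 * x" "0"]]) (simp_all add: kap1_psum[OF W] x_def[symmetric] cc_def r0_def p1_def algebra_simps power_numeral_reduce)
  have KP2: "(\<Sum>i\<in>J. psum (\<lambda>P R. kap1 (W i) P R R)) = 2 * (x\<^sup>2 - 1) * x ^ 5 - cc"
    by (rule trans[OF lin[of _ "2 * x ^ 5" "- 2 * x" "- 2 * x" "0"]]) (simp_all add: kap1_psum[OF W] x_def[symmetric] cc_def r0_def p1_def algebra_simps power_numeral_reduce)
  have KX1: "(\<Sum>i\<in>J. psum (\<lambda>P R. chi P R * kap1 (W i) P P R)) = p1 - cc"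
    by (rule trans[OF lin[of _ "- (x ^ 4)" "x ^ 2 - 2 * x" "2 * x ^ 2 - 2 * x" "x ^ 2"]]) (simp_all add: kap1_psum[OF W] x_def[symmetric] cc_def r0_def p1_def algebra_simps power_numeral_reduce)
  have KX2: "(\<Sum>i\<in>J. psum (\<lambda>P R. chi P R * kap1 (W i) P R R)) = p1 - cc"
    by (rule trans[OF lin[of _ "- (x ^ 4)" "x ^ 2 - 2 * x" "2 * x ^ 2 - 2 * x" "x ^ 2"]]) (simp_all add: kap1_psum[OF W] x_def[symmetric] cc_def r0_def p1_def algebra_simps power_numeral_reduce)
  have KR1: "(\<Sum>i\<in>J. psum (\<lambda>P R. kap1 (W i) P R P)) = r0 - cc"
    by (rule trans[OF lin[of _ "0" "- 2 * x" "2 * x ^ 2 - 2 * x" "2 * x ^ 2"]]) (simp_all add: kap1_psum[OF W] x_def[symmetric] cc_def r0_def p1_def algebra_simps power_numeral_reduce)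
  have KS1: "(\<Sum>i\<in>J. psum (\<lambda>P R. chi P R * kap1 (W i) P R P)) = (x\<^sup>2 - 1) * (2 * x ^ 5 + 2 * x ^ 4) - cc"
    by (rule trans[OF lin[of _ "2 * x ^ 5 + 2 * x ^ 4" "- 2 * x" "- 2 * x" "0"]]) (simp_all add: kap1_psum[OF W] x_def[symmetric] cc_def r0_def p1_def algebra_simps power_numeral_reduce)
  have KU1: "(\<Sum>i\<in>J. usum (\<lambda>P. kap1 (W i) P P P)) = cc"
    by (rule trans[OF lin[of _ "0" "2 * x" "2 * x" "0"]]) (simp_all add: kap1_psum[OF W] x_def[symmetric] cc_def r0_def p1_def algebra_simps power_numeral_reduce)
  note defs = Q4_def Q2_def cc_def p1_def r0_def y N1_def N0_def x_def[symmetric]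
  \<comment> \<open>In each of the following certificates the variable \<open>h\<close> occurs only
    on the left and in \<open>V\<close>, so its coefficient fixes the second multiplier; the
    coefficient of \<open>g\<close> then fixes the first.\<close>
  have EA: "2 * cc - (x\<^sup>2 - 1) * (2 * x ^ 5 + 2 * x ^ 4) - r0 = ?c1 * N1 + (?c1 + 4 * ?c2 + 2 * ?c3) * N0"
    by (rule lin_rel[OF U V, of _ _ "8 * x ^ 3 + 2 * x ^ 4" "4 * x ^ 3 - 2 * x ^ 4"]) (simp add: defs field_simps power_numeral_reduce)
  have EB: "2 * cc + (x\<^sup>2 - 1) * (x ^ 6 - 2 * x ^ 5 - 4 * x ^ 4) - p1 = ?c2 * N1 + (2 * ?c1 + 3 * ?c2 + 2 * ?c3) * N0"
    by (rule lin_rel[OF U V, of _ _ "8 * x ^ 3 - x ^ 4" "4 * x ^ 3 - 2 * x ^ 4"]) (simp add: defs field_simps power_numeral_reduce)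
  have EC: "2 * cc + x * r0 - 2 * (x\<^sup>2 - 1) * x ^ 4 - 2 * p1 - r0 = ?c3 * N1 + (2 * ?c1 + 4 * ?c2 + ?c3) * N0"
    by (rule lin_rel[OF U V, of _ _ "8 * x ^ 3 - 2 * x ^ 5" "4 * x ^ 3 - 6 * x ^ 4 + 2 * x ^ 5"]) (simp add: defs field_simps power_numeral_reduce)
  have EP: "2 * (x\<^sup>2 - 1) * x ^ 5 - cc = (x\<^sup>2 - 1) * ((x\<^sup>2 - 2) * (2 * ?c1 + 2 * ?c2 + ?al) - 2 * (2 * ?c2 + 2 * ?c3 + ?be))"
    by (rule lin_rel[OF U V, of _ _ "- 4 * x ^ 3" "- 2 * x ^ 3"]) (simp add: defs field_simps power_numeral_reduce)
  have EP': "p1 - cc = (x\<^sup>2 - 1) * ((x\<^sup>2 - 2) * (2 * ?c2 + 2 * ?c3 + ?be) - 2 * (2 * ?c1 + 2 * ?c2 + ?al))"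
    by (rule lin_rel[OF U V, of _ _ "- 4 * x ^ 3 + x ^ 4" "- 2 * x ^ 3 + 2 * x ^ 4"]) (simp add: defs field_simps power_numeral_reduce)
  have ER: "r0 - cc = (x\<^sup>2 - 1) * ((x\<^sup>2 - 2) * (2 * ?c1 + 2 * ?c3 + ?ga) - 2 * (4 * ?c2 + ?de))"
    by (rule lin_rel[OF U V, of _ _ "- 4 * x ^ 3 - 2 * x ^ 4" "- 2 * x ^ 3 + 2 * x ^ 4"]) (simp add: defs field_simps power_numeral_reduce)
  have ER': "(x\<^sup>2 - 1) * (2 * x ^ 5 + 2 * x ^ 4) - cc = (x\<^sup>2 - 1) * ((x\<^sup>2 - 2) * (4 * ?c2 + ?de) - 2 * (2 * ?c1 + 2 * ?c3 + ?ga))"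
    by (rule lin_rel[OF U V, of _ _ "- 4 * x ^ 3" "- 2 * x ^ 3"]) (simp add: defs field_simps power_numeral_reduce)
  have EU: "cc = (x\<^sup>2 - 1) * (2 * ?c1 + 4 * ?c2 + 2 * ?c3 + 2 * (?al + ?be) + ?ga + ?de + ?ep)"
    by (rule lin_rel[OF U V, of _ _ "4 * x ^ 3" "2 * x ^ 3"]) (simp add: defs field_simps power_numeral_reduce)
  show ?thesis
    unfolding same_stats_def red KA1 KA2 KB1 KB2 KB3 KB4 KC1 KC2 KP1 KP2 KX1 KX2 KR1 KS1 KU1 L LP LQ LR x_def[symmetric]
    using EA EB EC EP EP' ER ER' EU by (intro conjI)
qed

text \<open>\<open>aT\<close> and \<open>bT\<close> are the two parts of \<open>m\<close>.
  \<open>cT\<close> stems from coinciding outer factors, \<open>eT\<close> and \<open>eT'\<close>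
  from the two products of signs that no permutation realizes.\<close>

definition aT where "aT A B = (\<Sum>P\<in>S. tr (P * A) * tr (P * A) * (tr (P * B) * tr (P * B)))"
definition bT where "bT A B = (\<Sum>P\<in>S. tr (P * (A * (P * B))) * (tr (P * A) * tr (P * B)))"
definition cT where "cT A B = (\<Sum>P\<in>S. tr (P * A) * tr (P * A) * tr (P * (B * (P * B))))"
definition eT where "eT A B = (\<Sum>P\<in>S. tr (P * A) * tr (P * (B * (P * (A * (P * B))))))"
definition eT' where "eT' A B = (\<Sum>P\<in>S. tr (P * A) * tr (P * (A * (P * (B * (P * B))))))"

lemma sum_Th: "(\<Sum>P\<in>S. Th P A B) = aT A B + bT A B"
  by (simp add: Th_def aT_def bT_def sum.distrib)

lemma tr_PAPB_maps:
  assumes U: "U \<in> Cl" and P: "P \<in> S" "P' \<in> S" "maps_to U P P'" and A: "A \<in> M" "B \<in> M"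
  shows "tr (P' * (cj U A * (P' * cj U B))) = tr (P * (A * (P * B)))"
proof -
  obtain s where s: "s \<in> {1,-1}" "cj U P = s \<cdot>\<^sub>m P'" using P(3) unfolding maps_to_def by blast
  have m: "cj U A \<in> M" "cj U B \<in> M" "P * A \<in> M" "P * B \<in> M" "cj U (P * A) \<in> M" "cj U (P * B) \<in> M" using U A P by simp_all
  have "P' * (cj U A * (P' * cj U B)) = (P' * cj U A) * (P' * cj U B)"
    using m P by (simp only: mult_assoc_M mult_M S_carrier)
  also have "\<dots> = (s * s) \<cdot>\<^sub>m (cj U (P * A) * cj U (P * B))"
    unfolding mult_maps[OF U P(1,2) s(2,1) A(1)] mult_maps[OF U P(1,2) s(2,1) A(2)]
      smult_left_M[OF m(5) smult_M[OF m(6)]] smult_right_M[OF m(5,6)] smult_smult ..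
  also have "s * s = 1" using s(1) by auto
  also have "1 \<cdot>\<^sub>m (cj U (P * A) * cj U (P * B)) = cj U ((P * A) * (P * B))"
    unfolding cj_prod[OF U m(3,4)] by simp
  finally have "tr (P' * (cj U A * (P' * cj U B))) = tr (cj U ((P * A) * (P * B)))" by (rule arg_cong)
  also have "\<dots> = tr ((P * A) * (P * B))" by (rule cj_tr[OF U mult_M[OF m(3,4)]])
  finally show ?thesis using A P(1) by (simp only: mult_assoc_M mult_M S_carrier)
qed

lemma xi_maps:
  assumes U: "U \<in> Cl" and P: "P \<in> S" "P' \<in> S" "maps_to U P P'" and A: "A \<in> M" "B \<in> M"
  shows "tr (P' * cj U A) * tr (P' * cj U B) = tr (P * A) * tr (P * B)"
proof -
  obtain s where s: "s \<in> {1,-1}" "\<forall>A\<in>M. tr (P' * cj U A) = s * tr (P * A)" using tr_maps1[OF U P] by blast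
  have "tr (P' * cj U A) = s * tr (P * A)" "tr (P' * cj U B) = s * tr (P * B)" using s(2) A by blast+
  then show ?thesis using s(1) by auto
qed

lemma Th_maps:
  assumes U: "U \<in> Cl" and P: "P \<in> S" "P' \<in> S" "maps_to U P P'" and A: "A \<in> M" "B \<in> M"
  shows "Th P' (cj U A) (cj U B) = Th P A B"
  unfolding Th_def xi_maps[OF U P A] xi_maps[OF U P A(1,1)] xi_maps[OF U P A(2,2)] tr_PAPB_maps[OF U P A] ..

lemma sum_act: "U \<in> Cl \<Longrightarrow> (\<Sum>P\<in>S. h (act U P)) = (\<Sum>P\<in>S. h P)"
  by (rule sum.reindex_bij_betw[OF act_bij])

lemma sum_Th_cj:
  assumes U: "U \<in> Cl" and A: "A \<in> M" "B \<in> M"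
  shows "(\<Sum>P\<in>S. Th P (cj U A) (cj U B)) = (\<Sum>P\<in>S. Th P A B)"
proof -
  have "(\<Sum>P\<in>S. Th P (cj U A) (cj U B)) = (\<Sum>P\<in>S. Th (act U P) (cj U A) (cj U B))" by (rule sum_act[OF U, symmetric])
  also have "\<dots> = (\<Sum>P\<in>S. Th P A B)" by (intro sum.cong refl Th_maps[OF U _ act(1)[OF U] act(2)[OF U] A])
  finally show ?thesis .
qed

end

context clifford_sample
begin

text \<open>\<open>lam_Gam_sum\<close> with the coefficients of \<open>same_stats_family\<close>,
  after division by the common factor \<open>2 * x ^ 4 / 3\<close>.\<close>

lemma one_step_formula:
  fixes J :: "'i set" and g h u v x y :: complex
  defines "x \<equiv> of_nat d"
  assumes W: "\<And>i. i \<in> J \<Longrightarrow> W i \<in> M" "\<And>i. i \<in> J \<Longrightarrow> W i * W i = 1\<^sub>m d" "\<And>i. i \<in> J \<Longrightarrow> tr (W i) = 0"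
    and card: "of_nat (card J) = x\<^sup>2 - 1"
    and q4: "(\<Sum>i\<in>J. q4 (W i)) = x ^ 4 * (x\<^sup>2 * g - 1)"
    and q2: "(\<Sum>i\<in>J. q2 (W i)) = x ^ 3 * (x\<^sup>2 * h - 1)"
    and q3: "(\<Sum>i\<in>J. q3 (W i)) = - x\<^sup>2"
    and u: "u * ((x\<^sup>2 - 1) * (x\<^sup>2 - 4)) = x\<^sup>2 * (x\<^sup>2 * (1 - g) - 1)"
    and v: "v * ((x + 1) * (x + 2) * (x + 4) * (x - 1)) = x\<^sup>2 * ((x + 1) * (x + 2) - x\<^sup>2 * g - 3 * x * h)"
    and y: "y = v * (x + 3) - u * x"
    and A: "A \<in> M" and B: "B \<in> M" and A1: "tr A = 1" and B0: "tr B = 0"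
  shows "3 * x * (\<Sum>i\<in>J. avg (\<lambda>U. Th (W i) (cj U A) (cj U B))) =
     2 * x * (v - u) * tr (A * (B * (A * B))) + 2 * x * (u + 2 * v) * tr (A * (A * (B * B)))
     + 2 * x * (2 * u + v) * (tr (A * B) * tr (A * B)) + x * (2 * u + v) * (tr (A * A) * tr (B * B))
     + 4 * x * (v - u) * tr (A * (B * B)) + x * (v - u) * tr (B * B)
     + 3 * x * (1 - u) * (aT A B + bT A B) - y * (aT A B + 2 * bT A B + cT A B + eT A B + eT' A B)"
proof -
  have x0: "x \<noteq> 0" using d_pos by (simp add: x_def)
  note st = same_stats_family[where J=J and W=W, OF W card[unfolded x_def] q4[unfolded x_def] q2[unfolded x_def] q3[unfolded x_def]
      u[unfolded x_def] v[unfolded x_def] y[unfolded x_def], folded x_def]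
  note f = family_expect[where J=J and W=W, OF W A B A1 B0 st, folded x_def]
  note l = lam_Gam_sum[OF A B A1, folded x_def]
  have b: "(\<Sum>P\<in>S. tr (P * A) * tr (P * B) * tr (P * (A * (P * B)))) = bT A B"
    unfolding bT_def by (intro sum.cong refl) (simp only: mult_ac)
  have a: "(\<Sum>P\<in>S. tr (P * A) * tr (P * B) * (tr (P * A) * tr (P * B))) = aT A B"
    unfolding aT_def by (intro sum.cong refl) (simp only: mult_ac)
  have "2 * x ^ 5 * (\<Sum>i\<in>J. avg (\<lambda>U. Th (W i) (cj U A) (cj U B))) =
     x ^ 3 * (2 * (2 * x ^ 2 * (v - u) / 3) * tr (A * (B * (A * B))) + 4 * (x ^ 2 * (u + 2 * v) / 3) * tr (A * (A * (B * B))))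
     + (- 2 * x ^ 2 * y / 3) * (x ^ 2 * (eT A B + eT' A B))
     + 2 * ((2 * x ^ 3 * (2 * u + v) / 3) * (x ^ 2 * (tr (A * B) * tr (A * B))) + (x ^ 4 * (1 - u) - 2 * x ^ 3 * y / 3) * (x * bT A B))
     + (- 2 * x ^ 3 * y / 3) * (x * cT A B) + (2 * x ^ 3 * (2 * u + v) / 3) * (x ^ 2 * (tr (A * A) * tr (B * B)))
     + (2 * x ^ 5 * (1 - u) - 2 * x ^ 4 * y / 3) * aT A B
     + (2 * x ^ 3 * (v - u) / 3) * (4 * x ^ 2 * tr (A * (B * B))) + (2 * x ^ 4 * (v - u) / 3) * (x * tr (B * B))"
    unfolding f[OF _ _] eT_def eT'_def cT_def a[symmetric] b[symmetric]
    by (subst f) (simp_all only: l, simp_all add: y field_simps power_numeral_reduce)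
  also have "\<dots> = (2 * x ^ 4 / 3) * (2 * x * (v - u) * tr (A * (B * (A * B))) + 2 * x * (u + 2 * v) * tr (A * (A * (B * B)))
     + 2 * x * (2 * u + v) * (tr (A * B) * tr (A * B)) + x * (2 * u + v) * (tr (A * A) * tr (B * B))
     + 4 * x * (v - u) * tr (A * (B * B)) + x * (v - u) * tr (B * B)
     + 3 * x * (1 - u) * (aT A B + bT A B) - y * (aT A B + 2 * bT A B + cT A B + eT A B + eT' A B))"
    by (simp add: field_simps power_numeral_reduce)
  finally have "(2 * x ^ 4 / 3) * (3 * x * (\<Sum>i\<in>J. avg (\<lambda>U. Th (W i) (cj U A) (cj U B)))) = (2 * x ^ 4 / 3) * (2 * x * (v - u) * tr (A * (B * (A * B))) + 2 * x * (u + 2 * v) * tr (A * (A * (B * B)))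
     + 2 * x * (2 * u + v) * (tr (A * B) * tr (A * B)) + x * (2 * u + v) * (tr (A * A) * tr (B * B))
     + 4 * x * (v - u) * tr (A * (B * B)) + x * (v - u) * tr (B * B)
     + 3 * x * (1 - u) * (aT A B + bT A B) - y * (aT A B + 2 * bT A B + cT A B + eT A B + eT' A B))"
    by (simp add: power_numeral_reduce)
  then show ?thesis using x0 by (simp only: mult_cancel_left) simp
qed

section \<open>The second moment over commuting Pauli operators\<close>

context
  fixes A B assumes A: "A \<in> M" and B: "B \<in> M" and B0: "tr B = 0"
begin

definition xi where "xi U P = tr (P * cj U A) * tr (P * cj U B)"
definition kpair where "kpair P Q = avg (\<lambda>U. xi U P * xi U Q)"

lemma xi_one: "U \<in> Cl \<Longrightarrow> xi U (1\<^sub>m d) = 0"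
  unfolding xi_def using one_left_M[OF cj_M[OF Cl_M B]] cj_tr[OF _ B] B0 by simp

lemma kpair_one: "kpair (1\<^sub>m d) Q = 0" "kpair P (1\<^sub>m d) = 0"
proof -
  have "kpair (1\<^sub>m d) Q = avg (\<lambda>U. 0)" "kpair P (1\<^sub>m d) = avg (\<lambda>U. 0)"
    unfolding kpair_def by (rule avg_cong, simp add: xi_one)+
  then show "kpair (1\<^sub>m d) Q = 0" "kpair P (1\<^sub>m d) = 0" by (simp_all add: avg_const)
qed

text \<open>A function of pairs is treated as one of triples that ignores the middle argument. Its
  values at \<open>(P, P, Q)\<close> then turn the classification of triples into one of
  pairs.\<close>

lemma kpair_invariant: "Cl_invariant (\<lambda>P Q R. kpair P R)"
  unfolding Cl_invariant_def
proof (intro ballI impI)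
  fix K P P' R R' assume K: "K \<in> Cl" and s: "P \<in> S" "P' \<in> S" "R \<in> S" "R' \<in> S" and m: "maps_to K P P'" "maps_to K R R'"
  have "kpair P' R' = avg (\<lambda>U. xi (K * U) P' * xi (K * U) R')"
    unfolding kpair_def by (rule avg_shift[OF K, symmetric]) (use A B in \<open>simp add: cj_phase xi_def\<close>)
  also have "\<dots> = kpair P R" unfolding kpair_def
  proof (rule avg_cong)
    fix U assume U: "U \<in> Cl"
    then have c: "cj U A \<in> M" "cj U B \<in> M" using A B by simp_all
    show "xi (K * U) P' * xi (K * U) R' = xi U P * xi U R"
      unfolding xi_def cj_mult[OF Cl_M[OF K] Cl_M[OF U] A] cj_mult[OF Cl_M[OF K] Cl_M[OF U] B]
        xi_maps[OF K s(1,2) m(1) c] xi_maps[OF K s(3,4) m(2) c] ..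
  qed
  finally show "kpair P' R' = kpair P R" .
qed

lemma sum_xi: "U \<in> Cl \<Longrightarrow> (\<Sum>P\<in>S. xi U P) = of_nat d * tr (A * B)"
proof -
  assume U: "U \<in> Cl"
  have "(\<Sum>P\<in>S. xi U P) = of_nat d * tr (cj U A * cj U B)"
    unfolding xi_def by (rule completeness') (use U A B in simp_all)
  also have "cj U A * cj U B = cj U (A * B)" by (rule cj_prod[OF U A B, symmetric])
  finally show ?thesis unfolding cj_tr[OF U mult_M[OF A B]] .
qed

lemma sum_xi_chi: "U \<in> Cl \<Longrightarrow> (\<Sum>P\<in>S. \<Sum>Q\<in>S. chi P Q * (xi U P * xi U Q)) = of_nat d * bT A B"
proof -
  assume U: "U \<in> Cl"
  have c: "cj U A \<in> M" "cj U B \<in> M" using U A B by simp_all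
  have "(\<Sum>P\<in>S. \<Sum>Q\<in>S. chi P Q * (xi U P * xi U Q)) = (\<Sum>P\<in>S. xi U P * (\<Sum>Q\<in>S. chi P Q * (tr (Q * cj U A) * tr (Q * cj U B))))"
    unfolding sum_distrib_left xi_def by (intro sum.cong refl) (simp only: mult_ac)
  also have "\<dots> = (\<Sum>P\<in>S. xi U P * (of_nat d * tr (P * (cj U A * (P * cj U B)))))"
    by (intro sum.cong refl arg_cong2[where f="(*)"] completeness_chi[OF c])
  also have "\<dots> = of_nat d * (\<Sum>P\<in>S. tr (P * (cj U A * (P * cj U B))) * (tr (P * cj U A) * tr (P * cj U B)))"
    unfolding sum_distrib_left xi_def by (intro sum.cong refl) (simp only: mult_ac)
  also have "(\<Sum>P\<in>S. tr (P * (cj U A * (P * cj U B))) * (tr (P * cj U A) * tr (P * cj U B))) = bT A B"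
  proof -
    have "(\<Sum>P\<in>S. tr (P * (cj U A * (P * cj U B))) * (tr (P * cj U A) * tr (P * cj U B))) =
       (\<Sum>P\<in>S. tr (act U P * (cj U A * (act U P * cj U B))) * (tr (act U P * cj U A) * tr (act U P * cj U B)))"
      by (rule sum_act[OF U, symmetric])
    also have "\<dots> = bT A B"
      unfolding bT_def by (intro sum.cong refl arg_cong2[where f="(*)"] tr_PAPB_maps[OF U _ act(1)[OF U] act(2)[OF U] A B]
          xi_maps[OF U _ act(1)[OF U] act(2)[OF U] A B])
    finally show ?thesis .
  qed
  finally show ?thesis .
qed

lemma sum_xi_sq: "U \<in> Cl \<Longrightarrow> (\<Sum>P\<in>S. xi U P * xi U P) = aT A B"
proof -
  assume U: "U \<in> Cl"
  have "(\<Sum>P\<in>S. xi U P * xi U P) = (\<Sum>P\<in>S. xi U (act U P) * xi U (act U P))" by (rule sum_act[OF U, symmetric])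
  also have "\<dots> = (\<Sum>P\<in>S. (tr (P * A) * tr (P * B)) * (tr (P * A) * tr (P * B)))"
  proof (rule sum.cong[OF refl])
    fix P assume P: "P \<in> S"
    show "xi U (act U P) * xi U (act U P) = (tr (P * A) * tr (P * B)) * (tr (P * A) * tr (P * B))"
      unfolding xi_def xi_maps[OF U P act(1)[OF U P] act(2)[OF U P] A B] ..
  qed
  also have "\<dots> = aT A B" unfolding aT_def by (intro sum.cong refl) (simp only: mult_ac)
  finally show ?thesis .
qed

text \<open>A second moment over a family of commuting Pauli operators only needs transitivity on commuting pairs. For \<open>d = 2\<close> there are
  no such pairs, but the formula persists because the corresponding sum over pairs is then empty.\<close>
lemma commuting_second_moment:
  assumes Z: "Z \<subseteq> S" "1\<^sub>m d \<in> Z" "card Z = d" and com: "\<And>P Q. P \<in> Z \<Longrightarrow> Q \<in> Z \<Longrightarrow> chi P Q = 1" and d2: "d \<ge> 2"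
  shows "(of_nat d + 1) * (of_nat d + 2) * (\<Sum>P\<in>Z. \<Sum>Q\<in>Z. kpair P Q) =
     of_nat d * (aT A B + bT A B + of_nat d * (tr (A * B) * tr (A * B)))"
proof -
  let ?x = "of_nat d :: complex"
  note cf = class_fun_of_invariant[OF kpair_invariant, unfolded class_fun_def]
  obtain \<Gamma> where G: "\<And>P Q. P \<in> S \<Longrightarrow> Q \<in> S \<Longrightarrow> P \<noteq> 1\<^sub>m d \<Longrightarrow> Q \<noteq> 1\<^sub>m d \<Longrightarrow> P \<noteq> Q \<Longrightarrow> kpair P Q = \<Gamma> (chi P Q)"
    using cf[THEN conjunct2, THEN conjunct1] by blast
  obtain c where c: "\<And>P. P \<in> S \<Longrightarrow> P \<noteq> 1\<^sub>m d \<Longrightarrow> kpair P P = c"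
    using cf[THEN conjunct2, THEN conjunct2, THEN conjunct2, THEN conjunct2] by blast
  have diag: "(\<Sum>P\<in>S. kpair P P) = aT A B"
  proof -
    have "(\<Sum>P\<in>S. kpair P P) = avg (\<lambda>U. \<Sum>P\<in>S. xi U P * xi U P)" unfolding kpair_def avg_sum ..
    also have "\<dots> = avg (\<lambda>U. aT A B)" by (rule avg_cong[OF sum_xi_sq])
    finally show ?thesis unfolding avg_const .
  qed
  have kc: "(?x ^ 2 - 1) * c = aT A B"
  proof -
    have "(\<Sum>P\<in>S. kpair P P) = usum (\<lambda>P. c * 1)"
      unfolding usum_def by (intro sum.cong refl) (auto simp: c kpair_one)
    then show ?thesis unfolding usum_cmult usum_1 diag by (simp add: mult.commute)
  qed
  \<comment> \<open>The weight \<open>1 + chi P Q\<close> vanishes on anticommuting pairs and is 2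
    on commuting ones, so this sum isolates the value \<open>\<Gamma> 1\<close>.\<close>
  have all: "(\<Sum>P\<in>S. \<Sum>Q\<in>S. (1 + chi P Q) * kpair P Q) = ?x ^ 2 * (tr (A * B) * tr (A * B)) + ?x * bT A B"
  proof -
    have "(\<Sum>P\<in>S. \<Sum>Q\<in>S. (1 + chi P Q) * kpair P Q) = avg (\<lambda>U. \<Sum>P\<in>S. \<Sum>Q\<in>S. (1 + chi P Q) * (xi U P * xi U Q))"
      unfolding kpair_def avg_sum avg_cmult ..
    also have "\<dots> = avg (\<lambda>U. ?x ^ 2 * (tr (A * B) * tr (A * B)) + ?x * bT A B)"
    proof (rule avg_cong)
      fix U assume U: "U \<in> Cl"
      have "(\<Sum>P\<in>S. \<Sum>Q\<in>S. (1 + chi P Q) * (xi U P * xi U Q)) = (\<Sum>P\<in>S. xi U P) * (\<Sum>P\<in>S. xi U P) + (\<Sum>P\<in>S. \<Sum>Q\<in>S. chi P Q * (xi U P * xi U Q))"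
        unfolding sum_product by (simp add: sum.distrib distrib_right)
      then show "(\<Sum>P\<in>S. \<Sum>Q\<in>S. (1 + chi P Q) * (xi U P * xi U Q)) = ?x ^ 2 * (tr (A * B) * tr (A * B)) + ?x * bT A B"
        unfolding sum_xi[OF U] sum_xi_chi[OF U] by (simp add: power2_eq_square mult_ac)
    qed
    finally show ?thesis unfolding avg_const .
  qed
  have off: "(?x ^ 2 - 1) * (?x ^ 2 - 4) * \<Gamma> 1 = ?x ^ 2 * (tr (A * B) * tr (A * B)) + ?x * bT A B - 2 * aT A B"
  proof -
    have "(\<Sum>P\<in>S. \<Sum>Q\<in>S. (1 + chi P Q) * kpair P Q) = psum (\<lambda>P Q. (1 + chi P Q) * kpair P Q) + (\<Sum>P\<in>S. 2 * kpair P P)"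
    proof -
      have "(\<Sum>P\<in>S. \<Sum>Q\<in>S. (1 + chi P Q) * kpair P Q) = (\<Sum>P\<in>S. \<Sum>Q\<in>S. (if P \<noteq> 1\<^sub>m d \<and> Q \<noteq> 1\<^sub>m d \<and> P \<noteq> Q then (1 + chi P Q) * kpair P Q else 0)
           + (if Q = P then 2 * kpair P P else 0))"
        by (intro sum.cong refl) (auto simp: kpair_one)
      then show ?thesis unfolding psum_def using finite_S by (simp add: sum.distrib)
    qed
    moreover have "psum (\<lambda>P Q. (1 + chi P Q) * kpair P Q) = psum (\<lambda>P Q. \<Gamma> 1 * 1 + \<Gamma> 1 * chi P Q)"
    proof (rule psum_cong)
      fix P Q assume a: "P \<in> S" "Q \<in> S" "P \<noteq> 1\<^sub>m d" "Q \<noteq> 1\<^sub>m d" "P \<noteq> Q"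
      show "(1 + chi P Q) * kpair P Q = \<Gamma> 1 * 1 + \<Gamma> 1 * chi P Q"
        using G[OF a] chi_cases[of P Q] by (auto simp: algebra_simps)
    qed
    moreover have "psum (\<lambda>P Q. \<Gamma> 1 * 1 + \<Gamma> 1 * chi P Q) = (?x ^ 2 - 1) * (?x ^ 2 - 4) * \<Gamma> 1"
      unfolding psum_add psum_cmult psum_1 psum_chi by (simp add: algebra_simps)
    ultimately show ?thesis using all diag by (simp add: sum_distrib_left[symmetric])
  qed
  have fZ: "finite Z" using Z(1) finite_S finite_subset by blast
  have Zs: "(\<Sum>P\<in>Z. \<Sum>Q\<in>Z. kpair P Q) = (?x - 1) * c + (?x - 1) * (?x - 2) * \<Gamma> 1"
  proof -
    have one: "(\<Sum>P\<in>Z. if P = 1\<^sub>m d then 0 else k) = (?x - 1) * k" for k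
    proof -
      have "(\<Sum>P\<in>Z. if P = 1\<^sub>m d then 0 else k) = (\<Sum>P\<in>Z. k - (if P = 1\<^sub>m d then k else 0))" by (intro sum.cong refl) auto
      then show ?thesis using fZ Z by (simp add: sum_subtractf algebra_simps)
    qed
    have "(\<Sum>Q\<in>Z. kpair P Q) = (if P = 1\<^sub>m d then 0 else c + (?x - 2) * \<Gamma> 1)" if P: "P \<in> Z" for P
    proof (cases "P = 1\<^sub>m d")
      case False
      have "(\<Sum>Q\<in>Z. kpair P Q) = (\<Sum>Q\<in>Z. (if Q = P then c - \<Gamma> 1 else 0) + (if Q = 1\<^sub>m d then 0 else \<Gamma> 1))"
      proof (intro sum.cong refl)
        fix Q assume Q: "Q \<in> Z"
        show "kpair P Q = (if Q = P then c - \<Gamma> 1 else 0) + (if Q = 1\<^sub>m d then 0 else \<Gamma> 1)"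
          using G[of P Q] c[of P] com[OF P Q] P Q Z(1) False by (cases "Q = P"; cases "Q = 1\<^sub>m d") (auto simp: kpair_one)
      qed
      also have "\<dots> = c - \<Gamma> 1 + (?x - 1) * \<Gamma> 1" using fZ P one by (simp add: sum.distrib)
      finally show ?thesis using False by (simp add: algebra_simps)
    qed (simp add: kpair_one)
    then have "(\<Sum>P\<in>Z. \<Sum>Q\<in>Z. kpair P Q) = (\<Sum>P\<in>Z. if P = 1\<^sub>m d then 0 else c + (?x - 2) * \<Gamma> 1)" by (intro sum.cong refl)
    then show ?thesis unfolding one by (simp add: algebra_simps)
  qed
  have "(?x + 1) * (?x + 2) * (\<Sum>P\<in>Z. \<Sum>Q\<in>Z. kpair P Q) = (?x + 2) * ((?x ^ 2 - 1) * c) + (?x ^ 2 - 1) * (?x ^ 2 - 4) * \<Gamma> 1"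
    unfolding Zs by (simp add: algebra_simps power2_eq_square)
  then show ?thesis unfolding kc off by (simp add: algebra_simps power2_eq_square)
qed

end

end

section \<open>Pauli strings as product matrices\<close>

lemma bit_of_less: "bit_of i a < 2"
  by (simp add: bit_of_def)

lemma bit_of_top: "a < 2 ^ n \<Longrightarrow> bit_of n a = 0" "a < 2 ^ n \<Longrightarrow> bit_of n (a + 2 ^ n) = 1"
  by (simp_all add: bit_of_def)

lemma bit_of_add: assumes "i < n" shows "bit_of i (a + 2 ^ n) = bit_of i a"
proof -
  obtain m where m: "n = i + Suc m" using assms less_iff_Suc_add by auto
  have "(a + 2 ^ n) div 2 ^ i = (a + 2 ^ Suc m * 2 ^ i) div 2 ^ i" by (simp only: m power_add mult.commute)
  also have "\<dots> = 2 ^ Suc m + a div 2 ^ i" by (rule div_mult_self1) simp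
  finally show ?thesis by (simp add: bit_of_def)
qed

lemma bits_eqI: "a < 2 ^ n \<Longrightarrow> b < 2 ^ n \<Longrightarrow> (\<And>i. i < n \<Longrightarrow> bit_of i a = bit_of i b) \<Longrightarrow> a = b"
proof (induction n arbitrary: a b)
  case (Suc n)
  have s: "bit_of (Suc i) c = bit_of i (c div 2)" for i c by (simp add: bit_of_def div_mult2_eq)
  have "a div 2 = b div 2"
    by (rule Suc.IH) (use Suc.prems in \<open>auto simp: s[symmetric]\<close>)
  moreover have "a mod 2 = b mod 2" using Suc.prems(3)[of 0] by (simp add: bit_of_def)
  ultimately show ?case by (metis div_mult_mod_eq)
qed simp

lemma sum_lessThan_add: "(\<Sum>a<m + m'. f a) = (\<Sum>a<m. f a) + (\<Sum>a<m'. f (a + m) :: complex)" for m m' :: nat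
  by (induction m') (simp_all add: add_ac)

lemma sum_bits: "(\<Sum>a<2 ^ n. \<Prod>i<n. F i (bit_of i a)) = (\<Prod>i<n. F i 0 + F i 1 :: complex)"
proof (induction n)
  case (Suc n)
  have "(\<Sum>a<2 ^ Suc n. \<Prod>i<Suc n. F i (bit_of i a)) =
     (\<Sum>a<2 ^ n. (\<Prod>i<n. F i (bit_of i a)) * F n 0) + (\<Sum>a<2 ^ n. (\<Prod>i<n. F i (bit_of i a)) * F n 1)"
    unfolding power_Suc mult_2 sum_lessThan_add prod.lessThan_Suc
    by (intro arg_cong2[where f="(+)"] sum.cong refl) (simp_all add: bit_of_top bit_of_add)
  then show ?case by (simp add: sum_distrib_right[symmetric] Suc distrib_left)
qed simp

lemma prod_delta_bits:
  assumes "a < 2 ^ n" "b < 2 ^ n" "c < 2 ^ n" "e < 2 ^ n"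
  shows "(\<Prod>i<n. if bit_of i a = bit_of i b \<and> bit_of i c = bit_of i e then z else 0) = (if a = b \<and> c = e then z ^ n else 0 :: complex)"
proof (cases "a = b \<and> c = e")
  case False
  then obtain i where "i < n" "\<not> (bit_of i a = bit_of i b \<and> bit_of i c = bit_of i e)" using bits_eqI assms by metis
  then have "(\<Prod>i<n. if bit_of i a = bit_of i b \<and> bit_of i c = bit_of i e then z else 0) = 0" by (intro prod_zero) auto
  then show ?thesis using False by simp
qed simp

text \<open>A tensor product of matrices indexed by bit positions. Bit positions run opposite to the
  tensor factors of \<open>pauli_string\<close>, hence the reversal of indices in
  \<open>pauli_string_pz\<close>.\<close>

definition pm :: "nat \<Rightarrow> (nat \<Rightarrow> nat \<Rightarrow> nat \<Rightarrow> complex) \<Rightarrow> complex mat" where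
  "pm n f = mat (2 ^ n) (2 ^ n) (\<lambda>(a, b). \<Prod>i<n. f i (bit_of i a) (bit_of i b))"

definition mm :: "(nat \<Rightarrow> nat \<Rightarrow> complex) \<Rightarrow> (nat \<Rightarrow> nat \<Rightarrow> complex) \<Rightarrow> nat \<Rightarrow> nat \<Rightarrow> complex" where
  "mm f g a b = f a 0 * g 0 b + f a 1 * g 1 b"

lemma pm_carrier: "pm n f \<in> carrier_mat (2 ^ n) (2 ^ n)"
  by (simp add: pm_def)

lemma pm_index: "a < 2 ^ n \<Longrightarrow> b < 2 ^ n \<Longrightarrow> pm n f $$ (a,b) = (\<Prod>i<n. f i (bit_of i a) (bit_of i b))"
  by (simp add: pm_def)

lemma pm_eqI:
  assumes "A \<in> carrier_mat (2 ^ n) (2 ^ n)" "\<And>a b. a < 2 ^ n \<Longrightarrow> b < 2 ^ n \<Longrightarrow> A $$ (a,b) = (\<Prod>i<n. f i (bit_of i a) (bit_of i b))"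
  shows "A = pm n f"
  using assms by (intro eq_matI) (auto simp: pm_def)

lemma pm_cong: "(\<And>i a b. i < n \<Longrightarrow> a < 2 \<Longrightarrow> b < 2 \<Longrightarrow> f i a b = g i a b) \<Longrightarrow> pm n f = pm n g"
  by (rule pm_eqI[OF pm_carrier]) (simp add: pm_index bit_of_less)

lemma pm_mult: "pm n f * pm n g = pm n (\<lambda>i. mm (f i) (g i))"
proof (rule pm_eqI)
  show "pm n f * pm n g \<in> carrier_mat (2 ^ n) (2 ^ n)" by (rule mult_carrier_mat[OF pm_carrier pm_carrier])
  fix a b :: nat assume ab: "a < 2 ^ n" "b < 2 ^ n"
  have "(pm n f * pm n g) $$ (a,b) = (\<Sum>k<2 ^ n. pm n f $$ (a,k) * pm n g $$ (k,b))"
    by (rule mat_mult_index[OF pm_carrier pm_carrier ab])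
  also have "\<dots> = (\<Sum>k<2 ^ n. \<Prod>i<n. f i (bit_of i a) (bit_of i k) * g i (bit_of i k) (bit_of i b))"
    using ab by (intro sum.cong refl) (simp add: pm_index prod.distrib)
  also have "\<dots> = (\<Prod>i<n. mm (f i) (g i) (bit_of i a) (bit_of i b))"
    unfolding mm_def by (rule sum_bits)
  finally show "(pm n f * pm n g) $$ (a,b) = (\<Prod>i<n. mm (f i) (g i) (bit_of i a) (bit_of i b))" .
qed

lemma pm_adj: "adj (pm n f) = pm n (\<lambda>i a b. cnj (f i b a))"
  by (rule pm_eqI[OF adj_carrier[OF pm_carrier]]) (simp_all add: pm_index carrier_matD[OF pm_carrier])

lemma pm_smult: "pm n (\<lambda>i a b. c i * f i a b) = (\<Prod>i<n. c i) \<cdot>\<^sub>m pm n f"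
  by (rule pm_eqI[symmetric, OF smult_carrier_mat[OF pm_carrier]])
    (simp add: pm_index carrier_matD[OF pm_carrier] prod.distrib)

lemma pm_one: "pm n (\<lambda>i a b. if a = b then 1 else 0) = 1\<^sub>m (2 ^ n)"
  by (rule pm_eqI[symmetric, OF one_carrier_mat]) (use prod_delta_bits[of _ n _ 0 0 1] in \<open>simp\<close>)

lemma pm_tr: "tr (pm n f) = (\<Prod>i<n. f i 0 0 + f i 1 1)"
proof -
  have "tr (pm n f) = (\<Sum>a<2 ^ n. \<Prod>i<n. (\<lambda>i c. f i c c) i (bit_of i a))"
    unfolding tr_def carrier_matD(1)[OF pm_carrier] by (intro sum.cong refl) (simp add: pm_index)
  then show ?thesis using sum_bits[where n=n and F="\<lambda>i c. f i c c"] by simp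
qed

definition pz :: "nat \<Rightarrow> (nat \<Rightarrow> nat) \<Rightarrow> complex mat" where
  "pz n q = pm n (\<lambda>i. pauli1 (q i))"

text \<open>Labels are extensional functions, so that different labels give different strings, and
  sums of products over them factor into a product of sums over the sites.\<close>

definition QI :: "nat \<Rightarrow> (nat \<Rightarrow> nat) set" where
  "QI n = PiE {..<n} (\<lambda>_. {..<4})"

lemma sum_QI: "(\<Sum>q\<in>QI n. \<Prod>i<n. F i (q i)) = (\<Prod>i<n. \<Sum>p<4. F i p :: complex)"
  unfolding QI_def by (rule prod_sum_PiE[symmetric]) simp_all

lemma sum4: "(\<Sum>p<4. f p :: complex) = f 0 + f 1 + f 2 + f (3::nat)"
  by (simp add: eval_nat_numeral)

lemma less4_cases: "(p::nat) < 4 \<Longrightarrow> p = 0 \<or> p = 1 \<or> p = 2 \<or> p = 3"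
  by auto

lemma less2_cases: "(p::nat) < 2 \<Longrightarrow> p = 0 \<or> p = 1"
  by auto

lemma pauli1_mult:
  assumes "p < 4" "q < 4"
  shows "\<exists>r<4. \<exists>c. cmod c = 1 \<and> (\<forall>a<2. \<forall>b<2. mm (pauli1 p) (pauli1 q) a b = c * pauli1 r a b)"
proof -
  \<comment> \<open>The labels of X, Y, Z add up to 6, so two different ones leave
    \<open>6 - p - q\<close> for their product.\<close>
  define r where "r = (if p = 0 then q else if q = 0 then p else if p = q then 0 else 6 - p - q)"
  define c where "c = (if p = 0 \<or> q = 0 \<or> p = q then 1 else if p = 1 \<and> q = 2 \<or> p = 2 \<and> q = 3 \<or> p = 3 \<and> q = 1 then \<i> else - \<i>)"
  have "r < 4 \<and> cmod c = 1 \<and> (\<forall>a<2. \<forall>b<2. mm (pauli1 p) (pauli1 q) a b = c * pauli1 r a b)"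
    using less4_cases[OF assms(1)] less4_cases[OF assms(2)]
    by (elim disjE) (simp_all add: r_def c_def mm_def pauli1_def All_less_Suc numeral_2_eq_2)
  then show ?thesis by blast
qed

lemma pauli1_comm:
  assumes "p < 4" "q < 4"
  shows "\<exists>s\<in>{1,-1}. \<forall>a<2. \<forall>b<2. mm (pauli1 p) (pauli1 q) a b = s * mm (pauli1 q) (pauli1 p) a b"
proof -
  define s :: complex where "s = (if p = 0 \<or> q = 0 \<or> p = q then 1 else -1)"
  have "s \<in> {1,-1} \<and> (\<forall>a<2. \<forall>b<2. mm (pauli1 p) (pauli1 q) a b = s * mm (pauli1 q) (pauli1 p) a b)"
    using less4_cases[OF assms(1)] less4_cases[OF assms(2)]
    by (elim disjE) (simp_all add: s_def mm_def pauli1_def All_less_Suc numeral_2_eq_2)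
  then show ?thesis by blast
qed

lemma pauli1_adj: "p < 4 \<Longrightarrow> cnj (pauli1 p b a) = pauli1 p a b"
  using less4_cases[of p] by (auto simp: pauli1_def)

lemma pauli1_sq: "p < 4 \<Longrightarrow> a < 2 \<Longrightarrow> b < 2 \<Longrightarrow> mm (pauli1 p) (pauli1 p) a b = (if a = b then 1 else 0)"
  by (drule less4_cases, drule less2_cases, drule less2_cases, elim disjE) (simp_all add: pauli1_def mm_def)

lemma pauli1_tr: "p < 4 \<Longrightarrow> q < 4 \<Longrightarrow> mm (pauli1 p) (pauli1 q) 0 0 + mm (pauli1 p) (pauli1 q) 1 1 = (if p = q then 2 else 0)"
  by (drule less4_cases, drule less4_cases, elim disjE) (simp_all add: pauli1_def mm_def)

lemma pauli1_complete: "a < 2 \<Longrightarrow> b < 2 \<Longrightarrow> i < 2 \<Longrightarrow> j < 2 \<Longrightarrow>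
    (\<Sum>p<4. pauli1 p a b * pauli1 p i j) = (if a = j \<and> b = i then 2 else 0)"
  unfolding sum4 by (drule less2_cases, drule less2_cases, drule less2_cases, drule less2_cases, elim disjE) (simp_all add: pauli1_def)

lemma pauli1_zero: "pauli1 0 = (\<lambda>a b. if a = b then 1 else 0)"
  by (rule ext)+ (simp add: pauli1_def)

lemma pauli_string_pz: "pauli_string n ps = pz n (\<lambda>i. ps ! (n - 1 - i))"
  unfolding pz_def
proof (rule pm_eqI)
  show "pauli_string n ps \<in> carrier_mat (2 ^ n) (2 ^ n)" by (simp add: pauli_string_def)
  fix a b :: nat assume "a < 2 ^ n" "b < 2 ^ n"
  then have "pauli_string n ps $$ (a,b) = (\<Prod>j<n. pauli1 (ps ! j) (bit_of (n - 1 - j) a) (bit_of (n - 1 - j) b))"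
    by (simp add: pauli_string_def)
  also have "\<dots> = (\<Prod>i<n. pauli1 (ps ! (n - 1 - i)) (bit_of i a) (bit_of i b))"
    by (rule prod.reindex_bij_witness[where i="\<lambda>i. n - 1 - i" and j="\<lambda>i. n - 1 - i"]) auto
  finally show "pauli_string n ps $$ (a,b) = (\<Prod>i<n. pauli1 (ps ! (n - 1 - i)) (bit_of i a) (bit_of i b))" .
qed

lemma pz_cong: "(\<And>i. i < n \<Longrightarrow> q i = q' i) \<Longrightarrow> pz n q = pz n q'"
  unfolding pz_def by (rule pm_cong) simp

lemma paulis_pz: "paulis n = pz n ` QI n"
proof
  show "paulis n \<subseteq> pz n ` QI n"
  proof
    fix P assume "P \<in> paulis n"
    then obtain ps where ps: "length ps = n" "set ps \<subseteq> {0..<4}" "P = pz n (\<lambda>i. ps ! (n - 1 - i))"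
      by (auto simp: paulis_def pauli_idx_def pauli_string_pz)
    have "P = pz n (restrict (\<lambda>i. ps ! (n - 1 - i)) {..<n})" unfolding ps(3) by (rule pz_cong) simp
    moreover have "restrict (\<lambda>i. ps ! (n - 1 - i)) {..<n} \<in> QI n"
      using ps(1,2) by (auto simp: QI_def subset_iff)
    ultimately show "P \<in> pz n ` QI n" by blast
  qed
  show "pz n ` QI n \<subseteq> paulis n"
  proof
    fix P assume "P \<in> pz n ` QI n"
    then obtain q where q: "q \<in> QI n" "P = pz n q" by blast
    define ps where "ps = map (\<lambda>j. q (n - 1 - j)) [0..<n]"
    have "ps \<in> pauli_idx n" using q(1) by (auto simp: pauli_idx_def ps_def QI_def PiE_def Pi_def)
    moreover have "P = pauli_string n ps"
      unfolding q(2) pauli_string_pz ps_def by (rule pz_cong) simp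
    ultimately show "P \<in> paulis n" by (simp add: paulis_def)
  qed
qed

lemma QI_less: "q \<in> QI n \<Longrightarrow> i < n \<Longrightarrow> q i < 4"
  by (auto simp: QI_def PiE_def Pi_def)

lemma finite_QI: "finite (QI n)"
  unfolding QI_def by (intro finite_PiE) simp_all

lemma tr_pz_mult: "q \<in> QI n \<Longrightarrow> q' \<in> QI n \<Longrightarrow> tr (pz n q * pz n q') = (\<Prod>i<n. if q i = q' i then 2 else 0)"
  unfolding pz_def pm_mult pm_tr by (intro prod.cong refl pauli1_tr QI_less) auto

lemma pz_orth: assumes "q \<in> QI n" "q' \<in> QI n" "q \<noteq> q'" shows "tr (pz n q * pz n q') = 0"
proof -
  obtain i where "i < n" "q i \<noteq> q' i" using assms PiE_ext[of q "{..<n}" "\<lambda>_. {..<4}" q'] unfolding QI_def by blast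
  then show ?thesis unfolding tr_pz_mult[OF assms(1,2)] by (intro prod_zero) auto
qed

lemma inj_pz: "inj_on (pz n) (QI n)"
proof (rule inj_onI, rule ccontr)
  fix q q' assume q: "q \<in> QI n" "q' \<in> QI n" "pz n q = pz n q'" "q \<noteq> q'"
  have "tr (pz n q * pz n q) = 0" using pz_orth[OF q(1,2,4)] q(3) by simp
  then show False unfolding tr_pz_mult[OF q(1,1)] by simp
qed

lemma sum_paulis: "(\<Sum>P\<in>paulis n. f P) = (\<Sum>q\<in>QI n. f (pz n q))"
  unfolding paulis_pz by (subst sum.reindex[OF inj_pz]) simp

lemma inj_pauli_string: "inj_on (pauli_string n) (pauli_idx n)"
proof (rule inj_onI)
  fix ps qs assume a: "ps \<in> pauli_idx n" "qs \<in> pauli_idx n" "pauli_string n ps = pauli_string n qs"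
  let ?r = "\<lambda>ps. restrict (\<lambda>i. ps ! (n - 1 - i)) {..<n}"
  have r: "?r x \<in> QI n" "pauli_string n x = pz n (?r x)" if "x \<in> pauli_idx n" for x
    using that unfolding pauli_string_pz by (auto simp: QI_def pauli_idx_def subset_iff intro: pz_cong)
  have e: "?r ps = ?r qs" using inj_onD[OF inj_pz] r a by metis
  show "ps = qs"
  proof (rule nth_equalityI)
    show "length ps = length qs" using a by (simp add: pauli_idx_def)
    fix j assume "j < length ps"
    then have "j < n" using a by (simp add: pauli_idx_def)
    then show "ps ! j = qs ! j" using fun_cong[OF e, of "n - 1 - j"] by simp
  qed
qed

lemma sum_pauli_idx: "(\<Sum>ps\<in>pauli_idx n. f (pauli_string n ps)) = (\<Sum>P\<in>paulis n. f P)"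
  unfolding paulis_def by (subst sum.reindex[OF inj_pauli_string]) simp

lemma pauli_system_paulis: "pauli_system (2 ^ n) (paulis n)"
proof
  show "finite (paulis n)" unfolding paulis_pz by (rule finite_imageI[OF finite_QI])
  have "pz n (restrict (\<lambda>_. 0) {..<n}) = pz n (\<lambda>_. 0)" by (rule pz_cong) simp
  then have "pz n (restrict (\<lambda>_. 0) {..<n}) = 1\<^sub>m (2 ^ n)" unfolding pz_def pauli1_zero pm_one .
  moreover have "restrict (\<lambda>_. 0) {..<n} \<in> QI n" by (auto simp: QI_def)
  ultimately show "1\<^sub>m (2 ^ n) \<in> paulis n" unfolding paulis_pz by (metis imageI)
  fix P assume "P \<in> paulis n"
  then obtain q where q: "q \<in> QI n" "P = pz n q" unfolding paulis_pz by blast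
  show "P \<in> carrier_mat (2 ^ n) (2 ^ n)" unfolding q(2) pz_def by (rule pm_carrier)
  show "adj P = P" unfolding q(2) pz_def pm_adj by (rule pm_cong) (rule pauli1_adj[OF QI_less[OF q(1)]])
  show "P * P = 1\<^sub>m (2 ^ n)"
    unfolding q(2) pz_def pm_mult pm_one[symmetric] by (rule pm_cong) (rule pauli1_sq[OF QI_less[OF q(1)]])
  fix Q assume "Q \<in> paulis n"
  then obtain q' where q': "q' \<in> QI n" "Q = pz n q'" unfolding paulis_pz by blast
  show "P \<noteq> Q \<Longrightarrow> tr (P * Q) = 0" unfolding q(2) q'(2) by (rule pz_orth[OF q(1) q'(1)]) auto
  have "\<exists>r c. \<forall>i<n. r i < 4 \<and> cmod (c i) = 1 \<and> (\<forall>a<2. \<forall>b<2. mm (pauli1 (q i)) (pauli1 (q' i)) a b = c i * pauli1 (r i) a b)"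
  proof -
    have "\<forall>i<n. \<exists>r c. r < 4 \<and> cmod c = 1 \<and> (\<forall>a<2. \<forall>b<2. mm (pauli1 (q i)) (pauli1 (q' i)) a b = c * pauli1 r a b)"
      using pauli1_mult[OF QI_less[OF q(1)] QI_less[OF q'(1)]] by blast
    then show ?thesis by metis
  qed
  then obtain r c where rc: "\<And>i. i < n \<Longrightarrow> r i < 4" "\<And>i. i < n \<Longrightarrow> cmod (c i) = 1"
    "\<And>i a b. i < n \<Longrightarrow> a < 2 \<Longrightarrow> b < 2 \<Longrightarrow> mm (pauli1 (q i)) (pauli1 (q' i)) a b = c i * pauli1 (r i) a b" by blast
  have "P * Q = (\<Prod>i<n. c i) \<cdot>\<^sub>m pz n r"
    unfolding q(2) q'(2) pz_def pm_mult pm_smult[symmetric] by (rule pm_cong) (rule rc(3))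
  also have "pz n r = pz n (restrict r {..<n})" by (rule pz_cong) simp
  finally have "P * Q = (\<Prod>i<n. c i) \<cdot>\<^sub>m pz n (restrict r {..<n})" .
  moreover have "restrict r {..<n} \<in> QI n" using rc(1) by (auto simp: QI_def)
  moreover have "cmod (\<Prod>i<n. c i) = 1" unfolding prod_norm[symmetric] using rc(2) by simp
  ultimately show "\<exists>R\<in>paulis n. \<exists>c. cmod c = 1 \<and> P * Q = c \<cdot>\<^sub>m R" unfolding paulis_pz by blast
  have "\<exists>s. \<forall>i<n. s i \<in> {1,-1} \<and> (\<forall>a<2. \<forall>b<2. mm (pauli1 (q i)) (pauli1 (q' i)) a b = s i * mm (pauli1 (q' i)) (pauli1 (q i)) a b)"
  proof -
    have "\<forall>i<n. \<exists>s. s \<in> {1,-1} \<and> (\<forall>a<2. \<forall>b<2. mm (pauli1 (q i)) (pauli1 (q' i)) a b = s * mm (pauli1 (q' i)) (pauli1 (q i)) a b)"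
      using pauli1_comm[OF QI_less[OF q(1)] QI_less[OF q'(1)]] by blast
    then show ?thesis by metis
  qed
  then obtain s where s: "\<And>i. i < n \<Longrightarrow> s i \<in> {1,-1}"
    "\<And>i a b. i < n \<Longrightarrow> a < 2 \<Longrightarrow> b < 2 \<Longrightarrow> mm (pauli1 (q i)) (pauli1 (q' i)) a b = s i * mm (pauli1 (q' i)) (pauli1 (q i)) a b" by blast
  have pq: "P * Q = (\<Prod>i<n. s i) \<cdot>\<^sub>m (Q * P)"
    unfolding q(2) q'(2) pz_def pm_mult pm_smult[symmetric] by (rule pm_cong) (rule s(2))
  have "(\<Prod>i<m. s i) \<in> {1,-1}" if "m \<le> n" for m
    using that
  proof (induction m)
    case (Suc m)
    then have "s m \<in> {1,-1}" "(\<Prod>i<m. s i) \<in> {1,-1}" using s(1)[of m] by simp_all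
    then show ?case by auto
  qed simp
  from this[of n] have "(\<Prod>i<n. s i) = 1 \<or> (\<Prod>i<n. s i) = -1" by simp
  moreover have "1 \<cdot>\<^sub>m (Q * P) = Q * P" by (rule eq_matI) simp_all
  ultimately show "P * Q = Q * P \<or> P * Q = (-1) \<cdot>\<^sub>m (Q * P)" using pq by metis
next
  fix a b i j :: nat assume l: "a < 2 ^ n" "b < 2 ^ n" "i < 2 ^ n" "j < 2 ^ n"
  have "(\<Sum>P\<in>paulis n. P $$ (a,b) * P $$ (i,j)) =
      (\<Sum>q\<in>QI n. \<Prod>k<n. pauli1 (q k) (bit_of k a) (bit_of k b) * pauli1 (q k) (bit_of k i) (bit_of k j))"
    unfolding sum_paulis pz_def using l by (simp add: pm_index prod.distrib)
  also have "\<dots> = (\<Prod>k<n. \<Sum>p<4. pauli1 p (bit_of k a) (bit_of k b) * pauli1 p (bit_of k i) (bit_of k j))"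
    by (rule sum_QI)
  also have "\<dots> = (\<Prod>k<n. if bit_of k a = bit_of k j \<and> bit_of k b = bit_of k i then 2 else 0)"
    by (intro prod.cong refl pauli1_complete bit_of_less)
  also have "\<dots> = (if a = j \<and> b = i then of_nat (2 ^ n) else 0)" unfolding prod_delta_bits[OF l(1,4,2,3)] by simp
  finally show "(\<Sum>P\<in>paulis n. P $$ (a,b) * P $$ (i,j)) = (if a = j \<and> b = i then of_nat (2 ^ n) else 0)" .
qed simp

text \<open>The strings of I and Z, that is, the Pauli operators diagonal in the computational
  basis.\<close>

definition zset :: "nat \<Rightarrow> complex mat set" where
  "zset n = pz n ` PiE {..<n} (\<lambda>_. {0,3})"

lemma zset_QI: "PiE {..<n} (\<lambda>_. {0,3}) \<subseteq> QI n"
  unfolding QI_def by (intro PiE_mono) auto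

lemma zset_paulis: "zset n \<subseteq> paulis n"
  unfolding zset_def paulis_pz by (intro image_mono zset_QI)

lemma card_zset: "card (zset n) = 2 ^ n"
proof -
  have "card (zset n) = card (PiE {..<n} (\<lambda>_. {0,3::nat}))"
    unfolding zset_def by (rule card_image[OF inj_on_subset[OF inj_pz zset_QI]])
  then show ?thesis by (simp add: card_PiE numeral_2_eq_2)
qed

lemma one_zset: "1\<^sub>m (2 ^ n) \<in> zset n"
proof -
  have "pz n (restrict (\<lambda>_. 0) {..<n}) = pz n (\<lambda>_. 0)" by (rule pz_cong) simp
  then have "pz n (restrict (\<lambda>_. 0) {..<n}) = 1\<^sub>m (2 ^ n)" unfolding pz_def pauli1_zero pm_one .
  moreover have "restrict (\<lambda>_. 0) {..<n} \<in> PiE {..<n} (\<lambda>_. {0,3})" by auto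
  ultimately show ?thesis unfolding zset_def by (metis imageI)
qed

lemma zset_comm: assumes "P \<in> zset n" "Q \<in> zset n" shows "P * Q = Q * P"
proof -
  obtain q q' where q: "P = pz n q" "Q = pz n q'" "q \<in> PiE {..<n} (\<lambda>_. {0,3})" "q' \<in> PiE {..<n} (\<lambda>_. {0,3})"
    using assms unfolding zset_def by blast
  have "q i \<in> {0,3}" "q' i \<in> {0,3}" if "i < n" for i using q(3,4) that by auto
  then have "mm (pauli1 (q i)) (pauli1 (q' i)) a b = mm (pauli1 (q' i)) (pauli1 (q i)) a b" if "i < n" for i a b
    using that by (cases "q i = 0"; cases "q' i = 0") (force simp: mm_def pauli1_def)+
  then show ?thesis unfolding q(1,2) pz_def pm_mult by (intro pm_cong)
qed

lemma zset_diag: assumes "P \<in> zset n" "a < 2 ^ n" "b < 2 ^ n" "a \<noteq> b" shows "P $$ (a,b) = 0"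
proof -
  obtain q where q: "P = pz n q" "q \<in> PiE {..<n} (\<lambda>_. {0,3})" using assms unfolding zset_def by blast
  obtain i where i: "i < n" "bit_of i a \<noteq> bit_of i b" using bits_eqI assms by metis
  have "q i \<in> {0,3}" using q(2) i(1) by auto
  then have "pauli1 (q i) (bit_of i a) (bit_of i b) = 0" using i(2) by (auto simp: pauli1_def)
  then show ?thesis unfolding q(1) pz_def pm_index[OF assms(2,3)] using i(1) by (intro prod_zero) auto
qed

lemma zset_complete:
  assumes "a < 2 ^ n" "b < 2 ^ n" shows "(\<Sum>P\<in>zset n. P $$ (a,a) * P $$ (b,b)) = (if a = b then 2 ^ n else 0)"
proof -
  have "(\<Sum>P\<in>zset n. P $$ (a,a) * P $$ (b,b)) = (\<Sum>q\<in>PiE {..<n} (\<lambda>_. {0,3}). pz n q $$ (a,a) * pz n q $$ (b,b))"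
    unfolding zset_def by (subst sum.reindex[OF inj_on_subset[OF inj_pz zset_QI]]) simp
  also have "\<dots> = (\<Sum>q\<in>PiE {..<n} (\<lambda>_. {0,3}). \<Prod>k<n. pauli1 (q k) (bit_of k a) (bit_of k a) * pauli1 (q k) (bit_of k b) (bit_of k b))"
    unfolding pz_def using assms by (simp add: pm_index prod.distrib)
  also have "\<dots> = (\<Prod>k<n. \<Sum>p\<in>{0,3}. pauli1 p (bit_of k a) (bit_of k a) * pauli1 p (bit_of k b) (bit_of k b))"
    by (rule prod_sum_PiE[symmetric]) simp_all
  also have "\<dots> = (\<Prod>k<n. if bit_of k a = bit_of k b \<and> bit_of k a = bit_of k b then 2 else 0)"
  proof (intro prod.cong refl)
    fix k show "(\<Sum>p\<in>{0,3}. pauli1 p (bit_of k a) (bit_of k a) * pauli1 p (bit_of k b) (bit_of k b)) =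
        (if bit_of k a = bit_of k b \<and> bit_of k a = bit_of k b then 2 else 0)"
      using less2_cases[OF bit_of_less, of k a] less2_cases[OF bit_of_less, of k b]
      by (elim disjE) (simp_all add: pauli1_def)
  qed
  also have "\<dots> = (if a = b then 2 ^ n else 0)" unfolding prod_delta_bits[OF assms assms] by simp
  finally show ?thesis .
qed

lemma tr_zset: assumes "P \<in> zset n" "A \<in> carrier_mat (2 ^ n) (2 ^ n)" shows "tr (P * A) = (\<Sum>a<2 ^ n. P $$ (a,a) * A $$ (a,a))"
proof -
  have P: "P \<in> carrier_mat (2 ^ n) (2 ^ n)"
    by (rule pauli_system.S_carrier[OF pauli_system_paulis subsetD[OF zset_paulis assms(1)]])
  have "tr (P * A) = (\<Sum>a<2 ^ n. \<Sum>b<2 ^ n. if b = a then P $$ (a,a) * A $$ (a,a) else 0)"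
    unfolding tr_mult[OF P assms(2)] by (intro sum.cong refl) (use zset_diag[OF assms(1)] in auto)
  then show ?thesis by simp
qed

text \<open>Parseval's identity on diagonal matrices. It translates a measurement in the
  computational basis into Pauli coefficients.\<close>

lemma diagonal_zset:
  assumes "A \<in> carrier_mat (2 ^ n) (2 ^ n)" "B \<in> carrier_mat (2 ^ n) (2 ^ n)"
  shows "2 ^ n * (\<Sum>b<2 ^ n. A $$ (b,b) * B $$ (b,b)) = (\<Sum>P\<in>zset n. tr (P * A) * tr (P * B))"
proof -
  have "(\<Sum>P\<in>zset n. tr (P * A) * tr (P * B)) =
      (\<Sum>P\<in>zset n. \<Sum>a<2 ^ n. \<Sum>b<2 ^ n. A $$ (a,a) * B $$ (b,b) * (P $$ (a,a) * P $$ (b,b)))"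
    by (intro sum.cong refl) (simp add: tr_zset assms sum_product mult_ac)
  also have "\<dots> = (\<Sum>a<2 ^ n. \<Sum>b<2 ^ n. A $$ (a,a) * B $$ (b,b) * (\<Sum>P\<in>zset n. P $$ (a,a) * P $$ (b,b)))"
    unfolding sum_distrib_left by (subst sum.swap, intro sum.cong refl, subst sum.swap, intro sum.cong refl)
  also have "\<dots> = (\<Sum>a<2 ^ n. \<Sum>b<2 ^ n. if b = a then 2 ^ n * (A $$ (a,a) * B $$ (a,a)) else 0)"
    by (intro sum.cong refl) (auto simp: zset_complete)
  also have "\<dots> = 2 ^ n * (\<Sum>b<2 ^ n. A $$ (b,b) * B $$ (b,b))" by (simp add: sum_distrib_left)
  finally show ?thesis by simp
qed

section \<open>The gate T\<close>

definition \<omega> :: complex where "\<omega> = exp (\<i> * of_real (pi / 4))"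

definition tf :: "nat \<Rightarrow> nat \<Rightarrow> nat \<Rightarrow> nat \<Rightarrow> complex" where
  "tf k i a b = (if a = b then (if i < k \<and> a = 1 then \<omega> else 1) else 0)"

lemma cnj_omega_mult: "cnj \<omega> * \<omega> = 1" "\<omega> * cnj \<omega> = 1"
  by (simp_all only: \<omega>_def cis_conv_exp[symmetric] cis_cnj cis_mult) simp_all

lemma omega_sq: "\<omega> * \<omega> = \<i>"
proof -
  have "\<omega> * \<omega> = cis (pi / 4 + pi / 4)" by (simp only: \<omega>_def cis_conv_exp[symmetric] cis_mult)
  then show ?thesis by simp
qed

text \<open>This removes complex conjugation in favour of powers of \<open>\<omega>\<close>, which
  \<open>omega_sq\<close> reduces further, so that the single-qubit sums can be evaluated by ring
  arithmetic.\<close>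

lemma cnj_omega: "cnj \<omega> = - (\<omega> * \<omega> * \<omega>)"
proof -
  note cnj_omega_mult(1)
  moreover have "(- (\<omega> * \<omega> * \<omega>)) * \<omega> = - (\<i> * \<i>)" using omega_sq by (metis mult.assoc mult_minus_left)
  ultimately have "cnj \<omega> * \<omega> = (- (\<omega> * \<omega> * \<omega>)) * \<omega>" by simp
  moreover have "\<omega> \<noteq> 0" by (simp add: \<omega>_def)
  ultimately show ?thesis by (metis mult_right_cancel)
qed

lemma prod_prefix: "k \<le> n \<Longrightarrow> (\<Prod>i<n. if i < k then f i else 1) = (\<Prod>i<k. f i :: complex)" for n k :: nat
  by (rule prod.mono_neutral_cong_right) auto

lemma T_hat_pm: assumes "k \<le> n" shows "T_hat n k = pm n (tf k)"
proof (rule pm_eqI)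
  show "T_hat n k \<in> carrier_mat (2 ^ n) (2 ^ n)" by (simp add: T_hat_def)
  fix a b :: nat assume ab: "a < 2 ^ n" "b < 2 ^ n"
  show "T_hat n k $$ (a,b) = (\<Prod>i<n. tf k i (bit_of i a) (bit_of i b))"
  proof (cases "a = b")
    case True
    have e: "\<omega> ^ c = (if c = 1 then \<omega> else 1)" if "c < 2" for c using less2_cases[OF that] by auto
    have "exp (\<i> * of_real (pi / 4) * of_nat (\<Sum>i<k. bit_of i a)) = \<omega> ^ (\<Sum>i<k. bit_of i a)"
      unfolding \<omega>_def by (simp add: exp_of_nat_mult[symmetric] mult.commute)
    also have "\<dots> = (\<Prod>i<k. \<omega> ^ bit_of i a)" by (rule power_sum)
    also have "\<dots> = (\<Prod>i<n. if i < k then \<omega> ^ bit_of i a else 1)" by (rule prod_prefix[OF assms, symmetric])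
    also have "\<dots> = (\<Prod>i<n. tf k i (bit_of i a) (bit_of i a))"
      by (intro prod.cong refl) (simp add: tf_def e[OF bit_of_less])
    finally show ?thesis using ab True by (simp add: T_hat_def)
  next
    case False
    obtain i where "i < n" "bit_of i a \<noteq> bit_of i b" using bits_eqI ab False by metis
    then have "i < n" "tf k i (bit_of i a) (bit_of i b) = 0" by (simp_all add: tf_def)
    then have "(\<Prod>i<n. tf k i (bit_of i a) (bit_of i b)) = 0" by (intro prod_zero) auto
    then show ?thesis using ab False by (simp add: T_hat_def)
  qed
qed

lemma unitary_T_hat: assumes "k \<le> n" shows "unitary (2 ^ n) (T_hat n k)"
proof -
  note w = cnj_omega_mult(1)
  have t: "mm (\<lambda>a b. cnj (tf k i b a)) (tf k i) a b = (if a = b then 1 else 0)" "mm (tf k i) (\<lambda>a b. cnj (tf k i b a)) a b = (if a = b then 1 else 0)"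
    if "a < 2" "b < 2" for i a b
    using less2_cases[OF that(1)] less2_cases[OF that(2)] w by (auto simp: mm_def tf_def mult.commute)
  show ?thesis unfolding unitary_def T_hat_pm[OF assms] pm_adj pm_mult pm_one[symmetric]
    by (intro conjI pm_carrier pm_cong t)
qed

definition wf :: "nat \<Rightarrow> nat \<Rightarrow> nat \<Rightarrow> nat \<Rightarrow> nat \<Rightarrow> complex" where
  "wf k i q = mm (\<lambda>a b. cnj (tf k i b a)) (mm (pauli1 q) (tf k i))"

lemma T_conj_pz: "k \<le> n \<Longrightarrow> adj (T_hat n k) * (pz n q * T_hat n k) = pm n (\<lambda>i. wf k i (q i))"
  unfolding T_hat_pm pm_adj pz_def pm_mult wf_def ..

definition tr2 :: "(nat \<Rightarrow> nat \<Rightarrow> complex) \<Rightarrow> complex" where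
  "tr2 f = f 0 0 + f 1 1"

text \<open>Each summand is a product over sites, hence so is the double sum: every site contributes
  \<open>c\<close>, and the \<open>k\<close> sites that carry a gate contribute \<open>z\<close> in
  addition.\<close>

lemma double_sum_paulis:
  fixes F :: "nat \<Rightarrow> nat \<Rightarrow> nat \<Rightarrow> complex"
  assumes f: "\<And>q p. f (pz n q) (pz n p) = (\<Prod>i<n. F i (q i) (p i))"
    and F: "\<And>i. (\<Sum>q<4. \<Sum>p<4. F i q p) = c * (if i < k then z else 1)" and k: "k \<le> n"
  shows "(\<Sum>V\<in>paulis n. \<Sum>P\<in>paulis n. f V P) = c ^ n * z ^ k"
proof -
  have "(\<Sum>V\<in>paulis n. \<Sum>P\<in>paulis n. f V P) = (\<Sum>q\<in>QI n. \<Prod>i<n. \<Sum>p<4. F i (q i) p)"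
  proof (unfold sum_paulis f, rule sum.cong[OF refl])
    fix q show "(\<Sum>p\<in>QI n. \<Prod>i<n. F i (q i) (p i)) = (\<Prod>i<n. \<Sum>p<4. F i (q i) p)"
      by (rule sum_QI[where F="\<lambda>i. F i (q i)"])
  qed
  also have "\<dots> = (\<Prod>i<n. \<Sum>q<4. \<Sum>p<4. F i q p)" by (rule sum_QI[where F="\<lambda>i q. \<Sum>p<4. F i q p"])
  also have "\<dots> = c ^ n * z ^ k" unfolding F by (simp add: prod.distrib prod_prefix[OF k])
  finally show ?thesis .
qed

lemma tr_word: "tr (pz n p * pm n w) = (\<Prod>i<n. tr2 (mm (pauli1 (p i)) (w i)))"
  unfolding pz_def pm_mult pm_tr tr2_def ..

lemma tr_word2: "tr (pz n p * (pm n w * (pz n p * pm n w))) = (\<Prod>i<n. tr2 (mm (pauli1 (p i)) (mm (w i) (mm (pauli1 (p i)) (w i)))))"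
  unfolding pz_def pm_mult pm_tr tr2_def ..

lemma tr_word3: "tr (pz n p * (pm n w * (pz n p * (pm n w * (pz n p * pm n w))))) =
   (\<Prod>i<n. tr2 (mm (pauli1 (p i)) (mm (w i) (mm (pauli1 (p i)) (mm (w i) (mm (pauli1 (p i)) (w i)))))))"
  unfolding pz_def pm_mult pm_tr tr2_def ..

lemma wf_entries:
  "wf k i 0 0 0 = 1" "wf k i 0 0 1 = 0" "wf k i 0 1 0 = 0" "wf k i 0 1 1 = 1"
  "wf k i 3 0 0 = 1" "wf k i 3 0 1 = 0" "wf k i 3 1 0 = 0" "wf k i 3 1 1 = -1"
  "wf k i 1 0 0 = 0" "wf k i 1 0 1 = (if i < k then \<omega> else 1)" "wf k i 1 1 0 = (if i < k then cnj \<omega> else 1)" "wf k i 1 1 1 = 0"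
  "wf k i 2 0 0 = 0" "wf k i 2 0 1 = - \<i> * (if i < k then \<omega> else 1)" "wf k i 2 1 0 = \<i> * (if i < k then cnj \<omega> else 1)" "wf k i 2 1 1 = 0"
  using cnj_omega_mult by (simp_all add: wf_def mm_def tf_def pauli1_def)

text \<open>On a site with a gate I and Z are fixed and contribute 16 each. X and Y are spread
  evenly, up to sign, over two Pauli matrices with traces of modulus sqrt 2, and contribute 8 each.
  The ratio 48 / 64 is the origin of 3/4.\<close>

lemma qubit_q4: "(\<Sum>q<4. \<Sum>p<4. tr2 (mm (pauli1 p) (wf k i q)) ^ 4) = 64 * (if i < k then 3/4 else 1)"
  by (cases "i < k") (simp_all add: sum4 tr2_def mm_def wf_entries[unfolded One_nat_def] pauli1_def cnj_omega omega_sq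
      power_numeral_reduce algebra_simps)

text \<open>I and Z contribute 8 each. On a site with a gate X and Y contribute nothing: conjugating
  the rotated matrix by X or Y gives a matrix orthogonal to it, while its traces against I and Z
  vanish. This halves the sum.\<close>

lemma qubit_q2: "(\<Sum>q<4. \<Sum>p<4. tr2 (mm (pauli1 p) (wf k i q)) ^ 2 * tr2 (mm (pauli1 p) (mm (wf k i q) (mm (pauli1 p) (wf k i q))))) = 32 * (if i < k then 1/2 else 1)"
  by (cases "i < k") (simp_all add: sum4 tr2_def mm_def wf_entries[unfolded One_nat_def] pauli1_def cnj_omega omega_sq
      power_numeral_reduce algebra_simps)

text \<open>I and Z contribute 4 each. On a site with a gate the product of X or Y with a rotated X
  or Y is, up to sign, a rotation with eigenvalues exp (+- i pi / 4), so its trace times the trace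
  of its cube is -2. The four such terms cancel the contribution of I and Z.\<close>

lemma qubit_q3: "(\<Sum>q<4. \<Sum>p<4. tr2 (mm (pauli1 p) (wf k i q)) * tr2 (mm (pauli1 p) (mm (wf k i q) (mm (pauli1 p) (mm (wf k i q) (mm (pauli1 p) (wf k i q))))))) = 16 * (if i < k then 0 else 1)"
  by (cases "i < k") (simp_all add: sum4 tr2_def mm_def wf_entries[unfolded One_nat_def] pauli1_def cnj_omega omega_sq
      power_numeral_reduce algebra_simps)

lemma T_sums:
  assumes k: "k \<le> n"
  defines "W \<equiv> \<lambda>V. adj (T_hat n k) * (V * T_hat n k)"
  shows "(\<Sum>V\<in>paulis n. \<Sum>P\<in>paulis n. tr (P * W V) ^ 4) = 64 ^ n * (3/4) ^ k"
    and "(\<Sum>V\<in>paulis n. \<Sum>P\<in>paulis n. tr (P * W V) ^ 2 * tr (P * (W V * (P * W V)))) = 32 ^ n * (1/2) ^ k"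
    and "(\<Sum>V\<in>paulis n. \<Sum>P\<in>paulis n. tr (P * W V) * tr (P * (W V * (P * (W V * (P * W V)))))) = 16 ^ n * 0 ^ k"
proof -
  show "(\<Sum>V\<in>paulis n. \<Sum>P\<in>paulis n. tr (P * W V) ^ 4) = 64 ^ n * (3/4) ^ k"
    by (rule double_sum_paulis[OF _ qubit_q4 k]) (unfold W_def T_conj_pz[OF k] tr_word prod_power_distrib, rule refl)
  show "(\<Sum>V\<in>paulis n. \<Sum>P\<in>paulis n. tr (P * W V) ^ 2 * tr (P * (W V * (P * W V)))) = 32 ^ n * (1/2) ^ k"
    by (rule double_sum_paulis[OF _ qubit_q2 k]) (unfold W_def T_conj_pz[OF k] tr_word tr_word2 prod_power_distrib prod.distrib, rule refl)
  show "(\<Sum>V\<in>paulis n. \<Sum>P\<in>paulis n. tr (P * W V) * tr (P * (W V * (P * (W V * (P * W V)))))) = 16 ^ n * 0 ^ k"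
    by (rule double_sum_paulis[OF _ qubit_q3 k]) (unfold W_def T_conj_pz[OF k] tr_word tr_word3 prod.distrib, rule refl)
qed

section \<open>Clifford classes and circuits\<close>

context pauli_system
begin

lemma Cl_phase_norm:
  assumes U: "U \<in> Cl" and V: "V \<in> Cl" and c: "V = c \<cdot>\<^sub>m U" shows "cmod c = 1"
proof -
  have "1\<^sub>m d = V * adj V" by (rule Cl_unitary(2)[OF V, symmetric])
  also have "\<dots> = (c * cnj c) \<cdot>\<^sub>m (U * adj U)" unfolding c using U by (simp add: mult.commute)
  also have "U * adj U = 1\<^sub>m d" by (rule Cl_unitary(2)[OF U])
  finally have "1\<^sub>m d $$ (0,0) = ((c * cnj c) \<cdot>\<^sub>m 1\<^sub>m d) $$ (0,0)" by (rule arg_cong)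
  then have "c * cnj c = 1" using d_pos by simp
  then have "of_real ((cmod c)\<^sup>2) = (1 :: complex)" by (simp only: complex_norm_square)
  then have "(cmod c)\<^sup>2 = 1" by (simp only: of_real_eq_1_iff)
  then show ?thesis using power2_eq_1_iff[of "cmod c"] norm_ge_zero[of c] by linarith
qed

lemma tr_nondegenerate:
  assumes A: "A \<in> M" and B: "B \<in> M" and e: "\<And>X. X \<in> M \<Longrightarrow> tr (A * X) = tr (B * X)" shows "A = B"
proof (rule eq_matI)
  fix i j assume "i < dim_row B" "j < dim_col B"
  then have ij: "i < d" "j < d" using B by auto
  define X where "X = mat d d (\<lambda>(a,b). if a = j then (if b = i then 1 else 0) else (0::complex))"
  have X: "X \<in> M" unfolding X_def by (rule mat_carrier)
  have t: "tr (C * X) = C $$ (i,j)" if C: "C \<in> M" for C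
  proof -
    have "tr (C * X) = (\<Sum>a<d. \<Sum>b<d. if b = j then (if a = i then C $$ (a,b) else 0) else 0)"
      unfolding tr_mult[OF C X] by (intro sum.cong refl) (simp add: X_def)
    then show ?thesis using ij by simp
  qed
  show "A $$ (i,j) = B $$ (i,j)" using e[OF X] unfolding t[OF A] t[OF B] .
qed (use A B in auto)

text \<open>Schur's lemma for the Pauli operators: on such a \<open>W\<close> the twirl is
  multiplication by \<open>d ^ 2\<close>, while \<open>completeness_split\<close> evaluates it as
  \<open>d * tr W\<close> times the identity.\<close>

lemma commutant_scalar:
  assumes W: "W \<in> M" and c: "\<And>P. P \<in> S \<Longrightarrow> P * W = W * P"
  shows "W = (tr W / of_nat d) \<cdot>\<^sub>m 1\<^sub>m d"
proof (rule tr_nondegenerate[OF W smult_M[OF one_M]])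
  fix X assume X: "X \<in> M"
  have "(\<Sum>P\<in>S. tr (P * W * (P * X))) = (\<Sum>P\<in>S. tr (W * X))"
  proof (intro sum.cong refl)
    fix P assume P: "P \<in> S"
    have "P * W * (P * X) = W * (P * (P * X))" unfolding c[OF P] using W P X by (simp only: mult_assoc_M mult_M S_carrier)
    then show "tr (P * W * (P * X)) = tr (W * X)" unfolding S_sq_left[OF P X] by simp
  qed
  then have "of_nat d * tr W * tr X = of_nat d ^ 2 * tr (W * X)" unfolding completeness_split[OF W X] by (simp add: card_S)
  moreover have "of_nat d \<noteq> (0::complex)" using d_pos by simp
  ultimately have "tr (W * X) = tr W / of_nat d * tr X" by (simp add: field_simps power2_eq_square)
  moreover have "(tr W / of_nat d) \<cdot>\<^sub>m 1\<^sub>m d * X = (tr W / of_nat d) \<cdot>\<^sub>m X"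
    unfolding smult_left_M[OF one_M X] one_left_M[OF X] ..
  ultimately show "tr (W * X) = tr ((tr W / of_nat d) \<cdot>\<^sub>m 1\<^sub>m d * X)" by (metis tr_M_smult[OF X])
qed

lemma Cl_eq_up_to_phase:
  assumes U: "U \<in> Cl" and V: "V \<in> Cl" and e: "\<And>P. P \<in> S \<Longrightarrow> cj U P = cj V P"
  shows "\<exists>c. V = c \<cdot>\<^sub>m U"
proof -
  let ?W = "adj U * V"
  have m: "U \<in> M" "V \<in> M" "adj U \<in> M" "adj V \<in> M" "?W \<in> M" using U V by simp_all
  have "P * ?W = ?W * P" if P: "P \<in> S" for P
  proof -
    have "cj U P * V = cj V P * V" unfolding e[OF P] ..
    moreover have "cj V P * V = V * (P * (adj V * V))" unfolding cj_def using m P by (simp only: mult_assoc_M mult_M S_carrier)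
    moreover have "cj U P * V = U * (P * (adj U * V))" unfolding cj_def using m P by (simp only: mult_assoc_M mult_M S_carrier)
    ultimately have "adj U * (U * (P * (adj U * V))) = adj U * (V * P)"
      unfolding Cl_unitary(1)[OF V] one_right_M[OF S_carrier[OF P]] by simp
    moreover have "adj U * (U * (P * (adj U * V))) = P * (adj U * V)" by (rule Cl_cancel(1)[OF U]) (use m P in simp)
    ultimately show ?thesis using m P by (simp only: mult_assoc_M mult_M S_carrier)
  qed
  then have "?W = (tr ?W / of_nat d) \<cdot>\<^sub>m 1\<^sub>m d" by (rule commutant_scalar[OF m(5)])
  then have "U * ?W = U * ((tr ?W / of_nat d) \<cdot>\<^sub>m 1\<^sub>m d)" by (rule arg_cong)
  moreover have "U * ?W = V" by (rule Cl_cancel(2)[OF U m(2)])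
  moreover have "U * ((tr ?W / of_nat d) \<cdot>\<^sub>m 1\<^sub>m d) = (tr ?W / of_nat d) \<cdot>\<^sub>m U"
    unfolding smult_right_M[OF m(1) one_M] one_right_M[OF m(1)] ..
  ultimately show ?thesis by metis
qed

end

locale qubits = fixes n :: nat

sublocale qubits \<subseteq> pauli_system "2 ^ n" "paulis n"
  by (rule pauli_system_paulis)

context qubits
begin

lemma Cl_clifford: "Cl = clifford n"
  unfolding Cl_def clifford_def ..

abbreviation CC where "CC \<equiv> clifford_classes n"

lemma phase_relI: "U \<in> Cl \<Longrightarrow> V \<in> Cl \<Longrightarrow> V = c \<cdot>\<^sub>m U \<Longrightarrow> (U, V) \<in> phase_rel n"
  unfolding phase_rel_def Cl_clifford by blast

lemma phase_relE: assumes "(U, V) \<in> phase_rel n" obtains c where "U \<in> Cl" "V \<in> Cl" "V = c \<cdot>\<^sub>m U" "cmod c = 1"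
  using assms Cl_phase_norm unfolding phase_rel_def Cl_clifford by blast

lemma phase_sym: "(U, V) \<in> phase_rel n \<Longrightarrow> (V, U) \<in> phase_rel n"
proof (elim phase_relE)
  fix c assume a: "U \<in> Cl" "V \<in> Cl" "V = c \<cdot>\<^sub>m U" "cmod c = 1"
  have "c \<noteq> 0" using a(4) by auto
  then have "U = (1 / c) \<cdot>\<^sub>m V" unfolding a(3) by (metis smult_smult smult_one_mat nonzero_eq_divide_eq)
  then show ?thesis by (rule phase_relI[OF a(2,1)])
qed

lemma phase_equiv: "equiv (clifford n) (phase_rel n)"
proof (rule equivI)
  show "phase_rel n \<subseteq> clifford n \<times> clifford n" unfolding phase_rel_def by blast
  show "refl_on (clifford n) (phase_rel n)"
    unfolding refl_on_def using phase_relI[of _ _ 1] by (simp add: Cl_clifford)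
  show "sym (phase_rel n)" by (rule symI) (rule phase_sym)
  show "trans (phase_rel n)"
  proof (rule transI)
    fix U V W assume "(U, V) \<in> phase_rel n" "(V, W) \<in> phase_rel n"
    then show "(U, W) \<in> phase_rel n"
      by (elim phase_relE) (rule phase_relI, auto)
  qed
qed

lemma rep_class: "X \<in> CC \<Longrightarrow> rep X \<in> X"
  unfolding clifford_classes_def rep_def using in_quotient_imp_non_empty[OF phase_equiv] by (metis ex_in_conv someI_ex)

lemma rep_Cl: "X \<in> CC \<Longrightarrow> rep X \<in> Cl"
  using rep_class[of X] in_quotient_imp_subset[OF phase_equiv] unfolding clifford_classes_def Cl_clifford by blast

lemma rep_unique: "X \<in> CC \<Longrightarrow> Y \<in> CC \<Longrightarrow> (rep X, rep Y) \<in> phase_rel n \<Longrightarrow> X = Y"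
  using quotient_eqI[OF phase_equiv] rep_class unfolding clifford_classes_def by blast

lemma inj_rep: "inj_on rep CC"
proof (rule inj_onI)
  fix X Y assume a: "X \<in> CC" "Y \<in> CC" "rep X = rep Y"
  show "X = Y" by (rule rep_unique[OF a(1,2)]) (rule phase_relI[OF rep_Cl[OF a(1)] rep_Cl[OF a(2)], of 1], simp add: a(3))
qed

definition cls where "cls U = phase_rel n `` {U}"

lemma cls: "U \<in> Cl \<Longrightarrow> cls U \<in> CC"
  unfolding cls_def clifford_classes_def Cl_clifford by (rule quotientI)

lemma rep_cls: "U \<in> Cl \<Longrightarrow> (U, rep (cls U)) \<in> phase_rel n"
  using rep_class[OF cls] unfolding cls_def by blast

text \<open>A class is determined by the conjugates of the finitely many Pauli operators, by
  \<open>Cl_eq_up_to_phase\<close>, and each conjugate is one of finitely many signed Pauli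
  operators.\<close>

lemma finite_CC: "finite CC"
proof -
  let ?T = "(\<lambda>(s, Q). s \<cdot>\<^sub>m Q) ` ({1,-1} \<times> paulis n)"
  let ?f = "\<lambda>X. restrict (\<lambda>P. cj (rep X) P) (paulis n)"
  have "inj_on ?f CC"
  proof (rule inj_onI)
    fix X Y assume a: "X \<in> CC" "Y \<in> CC" "?f X = ?f Y"
    have "cj (rep X) P = cj (rep Y) P" if P: "P \<in> paulis n" for P using fun_cong[OF a(3), of P] P by (simp only: restrict_apply' if_True)
    then obtain c where "rep Y = c \<cdot>\<^sub>m rep X" using Cl_eq_up_to_phase[OF rep_Cl[OF a(1)] rep_Cl[OF a(2)]] by blast
    then have "(rep X, rep Y) \<in> phase_rel n" by (rule phase_relI[OF rep_Cl[OF a(1)] rep_Cl[OF a(2)]])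
    then show "X = Y" by (rule rep_unique[OF a(1,2)])
  qed
  moreover have "?f ` CC \<subseteq> PiE (paulis n) (\<lambda>_. ?T)"
  proof (rule image_subsetI, rule restrict_PiE_iff[THEN iffD2], rule ballI)
    fix X P assume X: "X \<in> CC" and P: "P \<in> paulis n"
    obtain Q where "Q \<in> paulis n" "maps_to (rep X) P Q" using Cl_maps[OF rep_Cl[OF X] P] by blast
    then obtain s where "s \<in> {1,-1}" "cj (rep X) P = s \<cdot>\<^sub>m Q" unfolding maps_to_def by blast
    then show "cj (rep X) P \<in> ?T" using \<open>Q \<in> paulis n\<close> by (intro image_eqI[where x="(s,Q)"]) simp_all
  qed
  moreover have "finite (PiE (paulis n) (\<lambda>_. ?T))" by (intro finite_PiE finite_imageI finite_cartesian_product finite_S) simp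
  ultimately show ?thesis using inj_on_finite by blast
qed

lemma CC_ne: "CC \<noteq> {}"
  using cls[OF one_Cl] by blast

definition GG where "GG = rep ` CC"

text \<open>The permutation sends \<open>U\<close> to the chosen representative of the class of
  \<open>K * U\<close>. It is injective because left multiplication by \<open>K\<close> can be
  undone, hence bijective on a finite set.\<close>

lemma GG_shift:
  assumes K: "K \<in> Cl" shows "\<exists>\<pi>. bij_betw \<pi> GG GG \<and> (\<forall>U\<in>GG. \<exists>c. cmod c = 1 \<and> K * U = c \<cdot>\<^sub>m \<pi> U)"
proof -
  define \<pi> where "\<pi> U = rep (cls (K * U))" for U
  have G: "U \<in> Cl" if "U \<in> GG" for U using that rep_Cl unfolding GG_def by blast
  have KU: "(K * U, \<pi> U) \<in> phase_rel n" if "U \<in> GG" for U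
    unfolding \<pi>_def by (rule rep_cls[OF Cl_mult[OF K G[OF that]]])
  have sub: "\<pi> ` GG \<subseteq> GG" unfolding \<pi>_def using cls Cl_mult[OF K G] by (auto simp: GG_def)
  have "inj_on \<pi> GG"
  proof (rule inj_onI)
    fix U V assume a: "U \<in> GG" "V \<in> GG" "\<pi> U = \<pi> V"
    have "(K * U, \<pi> U) \<in> phase_rel n" "(\<pi> U, K * V) \<in> phase_rel n" using KU[OF a(1)] phase_sym[OF KU[OF a(2)]] unfolding a(3) .
    then have "(K * U, K * V) \<in> phase_rel n" using phase_equiv unfolding equiv_def by (meson transE)
    then obtain c where c: "K * V = c \<cdot>\<^sub>m (K * U)" by (elim phase_relE)
    have m: "U \<in> M" "V \<in> M" "K \<in> M" using G[OF a(1)] G[OF a(2)] K by simp_all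
    have "adj K * (K * V) = c \<cdot>\<^sub>m (adj K * (K * U))" unfolding c by (rule smult_right_M[OF adj_M[OF m(3)] mult_M[OF m(3,1)]])
    then have "V = c \<cdot>\<^sub>m U" unfolding Cl_cancel(1)[OF K m(1)] Cl_cancel(1)[OF K m(2)] .
    then have "(U, V) \<in> phase_rel n" by (rule phase_relI[OF G[OF a(1)] G[OF a(2)]])
    then show "U = V" using a(1,2) rep_unique unfolding GG_def by blast
  qed
  moreover have "\<pi> ` GG = GG" by (rule endo_inj_surj[OF _ sub calculation]) (simp add: GG_def finite_CC)
  ultimately have "bij_betw \<pi> GG GG" unfolding bij_betw_def by blast
  moreover have "\<exists>c. cmod c = 1 \<and> K * U = c \<cdot>\<^sub>m \<pi> U" if "U \<in> GG" for U
    using phase_sym[OF KU[OF that]] by (elim phase_relE) blast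
  ultimately show ?thesis by blast
qed

end

sublocale qubits \<subseteq> clifford_sample "2 ^ n" "paulis n" GG
proof
  show "finite GG" "GG \<noteq> {}" using finite_CC CC_ne by (simp_all add: GG_def)
  show "GG \<subseteq> Cl" using rep_Cl unfolding GG_def by blast
qed (rule GG_shift)

context qubits
begin

definition mean :: "(complex mat \<Rightarrow> real) \<Rightarrow> real" where
  "mean f = (\<Sum>X\<in>CC. f (rep X)) / real (card CC)"

lemma of_real_mean: "of_real (mean f) = avg (\<lambda>U. of_real (f U))"
proof -
  have "avg (\<lambda>U. of_real (f U)) = (\<Sum>U\<in>GG. of_real (f U)) / of_nat (card GG)" by (rule avg_def)
  then show ?thesis unfolding mean_def GG_def card_image[OF inj_rep] sum.reindex[OF inj_rep] by simp
qed

lemma mean_cong: "(\<And>U. U \<in> Cl \<Longrightarrow> f U = g U) \<Longrightarrow> mean f = mean g"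
  unfolding mean_def by (intro arg_cong2[where f="(/)"] sum.cong refl) (auto intro: rep_Cl)

lemma circuit_snoc: "cs \<noteq> [] \<Longrightarrow> circuit T (cs @ [c]) = c * T * circuit T cs"
  by (cases cs) simp_all

abbreviation seqs where "seqs l \<equiv> {cs. set cs \<subseteq> CC \<and> length cs = Suc l}"

lemma ens_0: "ens_expect n k 0 f = mean f"
proof -
  have "seqs 0 = (\<lambda>c. [c]) ` CC" by (auto simp: length_Suc_conv)
  then have "(\<Sum>cs\<in>seqs 0. f (circuit (T_hat n k) (map rep cs))) = (\<Sum>c\<in>CC. f (rep c))"
    by (simp only:) (subst sum.reindex, auto simp: inj_on_def)
  then show ?thesis unfolding ens_expect_def mean_def by simp
qed

text \<open>The Clifford unitary applied last is split off. The circuit before it then acts as a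
  fixed unitary on state and observable, to which a bound for one average can be applied.\<close>

lemma ens_Suc: "ens_expect n k (Suc l) f = ens_expect n k l (\<lambda>A. mean (\<lambda>C. f (C * T_hat n k * A)))"
proof -
  have "(\<Sum>cs\<in>seqs (Suc l). f (circuit (T_hat n k) (map rep cs))) =
     (\<Sum>(cs,c)\<in>seqs l \<times> CC. f (circuit (T_hat n k) (map rep (cs @ [c]))))"
  proof (rule sum.reindex_bij_witness[where i="\<lambda>(cs,c). cs @ [c]" and j="\<lambda>cs. (butlast cs, last cs)"])
    fix cs assume "cs \<in> seqs (Suc l)"
    then have a: "cs \<noteq> []" "set cs \<subseteq> CC" "length cs = Suc (Suc l)" by auto
    show "(case (butlast cs, last cs) of (cs, c) \<Rightarrow> cs @ [c]) = cs" using a(1) by simp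
    show "(butlast cs, last cs) \<in> seqs l \<times> CC" using a last_in_set[OF a(1)] in_set_butlastD[of _ cs] by auto
    show "(case (butlast cs, last cs) of (cs, c) \<Rightarrow> f (circuit (T_hat n k) (map rep (cs @ [c])))) = f (circuit (T_hat n k) (map rep cs))"
      by (simp only: prod.case append_butlast_last_id[OF a(1)])
  qed auto
  also have "\<dots> = (\<Sum>cs\<in>seqs l. \<Sum>c\<in>CC. f (circuit (T_hat n k) (map rep (cs @ [c]))))"
    by (rule sum.cartesian_product[symmetric])
  also have "\<dots> = (\<Sum>cs\<in>seqs l. \<Sum>c\<in>CC. f (rep c * T_hat n k * circuit (T_hat n k) (map rep cs)))"
  proof (intro sum.cong refl)
    fix cs c assume "cs \<in> seqs l"
    then have "map rep cs \<noteq> []" by auto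
    then show "f (circuit (T_hat n k) (map rep (cs @ [c]))) = f (rep c * T_hat n k * circuit (T_hat n k) (map rep cs))"
      using circuit_snoc[of "map rep cs"] by simp
  qed
  finally show ?thesis unfolding ens_expect_def mean_def
    by (simp add: sum_divide_distrib[symmetric])
qed

lemma unitary_mult: "unitary (2 ^ n) U \<Longrightarrow> unitary (2 ^ n) V \<Longrightarrow> unitary (2 ^ n) (U * V)"
proof -
  assume a: "unitary (2 ^ n) U" "unitary (2 ^ n) V"
  then have m: "U \<in> M" "V \<in> M" and i: "adj U * U = 1\<^sub>m (2 ^ n)" "U * adj U = 1\<^sub>m (2 ^ n)" "adj V * V = 1\<^sub>m (2 ^ n)" "V * adj V = 1\<^sub>m (2 ^ n)"
    unfolding unitary_def by blast+
  have "adj (U * V) * (U * V) = adj V * ((adj U * U) * V)" "(U * V) * adj (U * V) = U * ((V * adj V) * adj U)"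
    unfolding adj_mult_M[OF m] using m by (simp_all only: mult_assoc_M mult_M adj_M)
  then show ?thesis unfolding unitary_def i one_left_M[OF m(2)] one_left_M[OF adj_M[OF m(1)]] i using m by simp
qed

lemma Cl_unitary': "U \<in> Cl \<Longrightarrow> unitary (2 ^ n) U"
  unfolding Cl_def by blast

lemma circuit_unitary:
  assumes k: "k \<le> n" shows "set cs \<subseteq> CC \<Longrightarrow> cs \<noteq> [] \<Longrightarrow> unitary (2 ^ n) (circuit (T_hat n k) (map rep cs))"
proof (induction cs rule: rev_induct)
  case (snoc c cs)
  have c: "unitary (2 ^ n) (rep c)" using snoc.prems(1) by (intro Cl_unitary' rep_Cl) simp
  show ?case
  proof (cases "cs = []")
    case False
    then have "unitary (2 ^ n) (circuit (T_hat n k) (map rep cs))" using snoc by simp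
    then show ?thesis using False circuit_snoc[of "map rep cs"] unitary_mult[OF unitary_mult[OF c unitary_T_hat[OF k]]] by simp
  qed (use c in simp)
qed simp

lemma card_seqs: "card (seqs l) = card CC ^ Suc l"
  by (rule card_lists_length_eq[OF finite_CC])

lemma card_CC_pos: "card CC > 0"
  using finite_CC CC_ne by (simp add: card_gt_0_iff)

lemma ens_mono:
  assumes k: "k \<le> n" and f: "\<And>A. unitary (2 ^ n) A \<Longrightarrow> f A \<le> g A" shows "ens_expect n k l f \<le> ens_expect n k l g"
  unfolding ens_expect_def by (intro divide_right_mono sum_mono f circuit_unitary[OF k]) auto

lemma ens_cong:
  assumes k: "k \<le> n" and f: "\<And>A. unitary (2 ^ n) A \<Longrightarrow> f A = g A" shows "ens_expect n k l f = ens_expect n k l g"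
  by (intro antisym ens_mono[OF k]) (simp_all add: f)

lemma ens_affine: "ens_expect n k l (\<lambda>A. c * f A + e) = c * ens_expect n k l f + e"
proof -
  have "card CC \<noteq> 0" using card_CC_pos by simp
  then show ?thesis unfolding ens_expect_def sum.distrib sum_distrib_left[symmetric]
    by (simp add: card_seqs add_divide_distrib)
qed

end

section \<open>Positive semidefinite matrices\<close>

text \<open>The Cauchy-Schwarz inequality, read off from Lagrange's identity.\<close>

lemma sum_mult_square_le: "(\<Sum>i<m. f i * g i)\<^sup>2 \<le> (\<Sum>i<m. (f i)\<^sup>2) * (\<Sum>i<m. (g i)\<^sup>2 :: real)" for m :: nat
proof -
  have "0 \<le> (\<Sum>i<m. \<Sum>j<m. (f i * g j - f j * g i)\<^sup>2)" by (intro sum_nonneg) simp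
  also have "\<dots> = (\<Sum>i<m. \<Sum>j<m. (f i)\<^sup>2 * (g j)\<^sup>2) + (\<Sum>i<m. \<Sum>j<m. (g i)\<^sup>2 * (f j)\<^sup>2) - 2 * (\<Sum>i<m. \<Sum>j<m. (f i * g i) * (f j * g j))"
    unfolding sum_distrib_left sum.distrib[symmetric] sum_subtractf[symmetric]
    by (intro sum.cong refl) (simp add: power2_eq_square algebra_simps)
  finally show ?thesis unfolding sum_product[symmetric] by (simp add: power2_eq_square mult.commute)
qed

definition qform :: "nat \<Rightarrow> (nat \<Rightarrow> nat \<Rightarrow> complex) \<Rightarrow> (nat \<Rightarrow> complex) \<Rightarrow> complex" where
  "qform m f v = (\<Sum>a<m. \<Sum>b<m. cnj (v a) * f a b * v b)"

lemma qform_Suc: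
  "qform (Suc m) f v = qform m f v + (\<Sum>a<m. cnj (v a) * f a m) * v m + cnj (v m) * (\<Sum>b<m. f m b * v b) + cnj (v m) * f m m * v m"
  by (simp add: qform_def sum.distrib sum_distrib_left sum_distrib_right mult_ac)

lemma qform_restrict: "qform (Suc m) f (v(m := 0)) = qform m f v"
  unfolding qform_Suc by (simp add: qform_def)

definition psdf :: "nat \<Rightarrow> (nat \<Rightarrow> nat \<Rightarrow> complex) \<Rightarrow> bool" where
  "psdf m f \<longleftrightarrow> (\<forall>a<m. \<forall>b<m. f b a = cnj (f a b)) \<and> (\<forall>v. 0 \<le> Re (qform m f v))"

lemma psdf_Suc: "psdf (Suc m) f \<Longrightarrow> psdf m f"
  unfolding psdf_def by (metis qform_restrict less_Suc_eq)

lemma psdf_zero_diag: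
  assumes f: "psdf (Suc m) f" and z: "f m m = 0" and a: "a < m" shows "f m a = 0"
proof (rule ccontr)
  assume n: "f m a \<noteq> 0"
  define r where "r = (cmod (f m a))\<^sup>2"
  have r: "r > 0" using n by (simp add: r_def)
  \<comment> \<open>Chosen so that the cross terms add up to \<open>- 2 * (Re (f a a) + 1)\<close>.
    The form then has real part \<open>- Re (f a a) - 2\<close>, which is negative.\<close>
  define s :: complex where "s = - of_real ((Re (f a a) + 1) / r) * f m a"
  define v where "v = (\<lambda>c. if c = m then s else if c = a then 1 else 0)"
  have one: "(\<Sum>c<m. g c * v c) = g a" "(\<Sum>c<m. cnj (v c) * g c) = g a" for g
  proof -
    have "(\<Sum>c<m. g c * v c) = (\<Sum>c<m. if c = a then g a else 0)" "(\<Sum>c<m. cnj (v c) * g c) = (\<Sum>c<m. if c = a then g a else 0)"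
      by (intro sum.cong refl; simp add: v_def)+
    then show "(\<Sum>c<m. g c * v c) = g a" "(\<Sum>c<m. cnj (v c) * g c) = g a" using a by simp_all
  qed
  have "qform m f v = (\<Sum>c<m. cnj (v c) * (\<Sum>b<m. f c b * v b))"
    unfolding qform_def by (simp add: sum_distrib_left mult_ac)
  then have "qform (Suc m) f v = f a a + f a m * s + cnj s * f m a"
    unfolding qform_Suc one by (simp add: z v_def)
  also have "f a m = cnj (f m a)" using f a unfolding psdf_def by (metis less_Suc_eq)
  finally have "Re (qform (Suc m) f v) = Re (f a a) + 2 * Re (cnj (f m a) * s)" by simp
  also have "cnj (f m a) * s = of_real (- (Re (f a a) + 1) / r * r)"
  proof -
    have "cnj (f m a) * f m a = of_real r" unfolding r_def complex_norm_square by (rule mult.commute)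
    moreover have "cnj (f m a) * s = - of_real ((Re (f a a) + 1) / r) * (cnj (f m a) * f m a)" unfolding s_def by (simp only: mult_ac)
    ultimately show ?thesis by (simp only: of_real_mult[symmetric] of_real_minus[symmetric] minus_divide_left)
  qed
  also have "- (Re (f a a) + 1) / r * r = - (Re (f a a) + 1)" using r by simp
  finally have e: "Re (qform (Suc m) f v) = - Re (f a a) - 2" by simp
  have "qform (Suc m) f (\<lambda>c. if c = a then 1 else 0) = f a a"
  proof -
    have "qform (Suc m) f (\<lambda>c. if c = a then 1 else 0) = (\<Sum>c<Suc m. \<Sum>b<Suc m. if b = a then if c = a then f a a else 0 else 0)"
      unfolding qform_def by (intro sum.cong refl) auto
    then show ?thesis using a by simp
  qed
  then have "0 \<le> Re (f a a)" using f unfolding psdf_def by metis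
  moreover have "0 \<le> Re (qform (Suc m) f v)" using f unfolding psdf_def by blast
  ultimately show False using e by linarith
qed

text \<open>Gaussian elimination of the last index splits off a rank one summand of \<open>f\<close>, whose contribution is a value of the quadratic form of \<open>g\<close>.\<close>
lemma psdf_trace:
  "psdf m f \<Longrightarrow> psdf m g \<Longrightarrow> 0 \<le> Re (\<Sum>a<m. \<Sum>b<m. f a b * g b a)"
proof (induction m arbitrary: f)
  case (Suc m)
  note g = psdf_Suc[OF Suc.prems(2)]
  have herm: "f b a = cnj (f a b)" if "a < Suc m" "b < Suc m" for a b using Suc.prems(1) that unfolding psdf_def by blast
  show ?case
  proof (cases "f m m = 0")
    case True
    have "f m a = 0" if "a < m" for a by (rule psdf_zero_diag[OF Suc.prems(1) True that])
    moreover from this have "f a m = 0" if "a < m" for a using herm[of m a] that by simp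
    ultimately have "(\<Sum>a<Suc m. \<Sum>b<Suc m. f a b * g b a) = (\<Sum>a<m. \<Sum>b<m. f a b * g b a)" using True by simp
    then show ?thesis using Suc.IH[OF psdf_Suc[OF Suc.prems(1)] g] by simp
  next
    case False
    define r where "r = Re (f m m)"
    have fr: "f m m = of_real r" using herm[of m m] by (simp add: r_def complex_eq_iff)
    have q0: "qform m f (\<lambda>c. 0) = 0" by (simp add: qform_def)
    have "qform (Suc m) f (\<lambda>c. if c = m then 1 else 0) = f m m"
    proof -
      have "qform m f (\<lambda>c. if c = m then 1 else 0) = 0" unfolding qform_def by (intro sum.neutral ballI) auto
      moreover have "(\<Sum>a<m. cnj (if a = m then 1 else 0) * f a m) = 0" "(\<Sum>b<m. f m b * (if b = m then 1 else 0)) = 0"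
        by (intro sum.neutral ballI; auto)+
      ultimately show ?thesis unfolding qform_Suc by simp
    qed
    then have "r \<ge> 0" using Suc.prems(1) unfolding psdf_def r_def by metis
    then have r: "r > 0" using False fr by auto
    define h where "h a b = f a b - f a m * f m b / f m m" for a b
    have h: "psdf m h"
      unfolding psdf_def
    proof (intro conjI allI impI)
      fix a b assume "a < m" "b < m"
      then show "h b a = cnj (h a b)" unfolding h_def using herm[of a b] herm[of a m] herm[of m b] herm[of m m] by (simp add: mult.commute)
    next
      fix v
      define S where "S = (\<Sum>b<m. f m b * v b)"
      have S': "(\<Sum>a<m. cnj (v a) * f a m) = cnj S"
        unfolding S_def cnj_sum by (intro sum.cong refl) (use herm[of m] in \<open>simp add: mult.commute\<close>)
      \<comment> \<open>The last coordinate completes the square: the form of \<open>f\<close> at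
        \<open>w\<close> equals the form of the Schur complement \<open>h\<close> at
        \<open>v\<close>.\<close>
      define w where "w = v(m := - S / f m m)"
      have "qform m f w = qform m f v" "(\<Sum>a<m. cnj (w a) * f a m) = (\<Sum>a<m. cnj (v a) * f a m)" "(\<Sum>b<m. f m b * w b) = S" "w m = - S / f m m"
        unfolding qform_def S_def w_def by simp_all
      then have "qform (Suc m) f w = qform m f v - cnj S * S / f m m"
        unfolding qform_Suc by (simp only: S') (use r in \<open>simp add: fr field_simps\<close>)
      moreover have "qform m h v = qform m f v - cnj S * S / f m m"
      proof -
        have "qform m h v = qform m f v - (\<Sum>a<m. \<Sum>b<m. (cnj (v a) * f a m) * (f m b * v b)) / f m m"
          unfolding qform_def h_def by (simp add: sum_subtractf right_diff_distrib left_diff_distrib sum_divide_distrib mult_ac)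
        then show ?thesis unfolding sum_product[symmetric] S' S_def .
      qed
      ultimately show "0 \<le> Re (qform m h v)" using Suc.prems(1) unfolding psdf_def by metis
    qed
    have hm: "h a m = 0" "h m a = 0" for a using False by (simp_all add: h_def)
    have "(\<Sum>a<Suc m. \<Sum>b<Suc m. f a b * g b a) = (\<Sum>a<Suc m. \<Sum>b<Suc m. h a b * g b a) + (\<Sum>a<Suc m. \<Sum>b<Suc m. f m b * g b a * f a m) / f m m"
      unfolding h_def by (simp only: left_diff_distrib sum_subtractf sum_divide_distrib) (simp add: mult_ac)
    also have "(\<Sum>a<Suc m. \<Sum>b<Suc m. h a b * g b a) = (\<Sum>a<m. \<Sum>b<m. h a b * g b a)" by (simp add: hm)
    also have "(\<Sum>a<Suc m. \<Sum>b<Suc m. f m b * g b a * f a m) = qform (Suc m) g (\<lambda>a. f a m)"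
      unfolding qform_def by (subst sum.swap, intro sum.cong refl) (use herm[of _ m] in simp)
    finally have "Re (\<Sum>a<Suc m. \<Sum>b<Suc m. f a b * g b a) = Re (\<Sum>a<m. \<Sum>b<m. h a b * g b a) + Re (qform (Suc m) g (\<lambda>a. f a m)) / r"
      unfolding fr by simp
    moreover have "0 \<le> Re (qform (Suc m) g (\<lambda>a. f a m)) / r" using Suc.prems(2) r unfolding psdf_def by simp
    ultimately show ?thesis using Suc.IH[OF h g] by linarith
  qed
qed simp

context pauli_system
begin

definition psd where "psd A \<longleftrightarrow> A \<in> M \<and> psdf d (\<lambda>a b. A $$ (a,b))"

lemma psd_M: "psd A \<Longrightarrow> A \<in> M"
  unfolding psd_def by blast

lemma psd_adj: assumes "psd A" shows "adj A = A"
proof (rule eq_matI)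
  have A: "A \<in> M" and h: "\<forall>a<d. \<forall>b<d. A $$ (b,a) = cnj (A $$ (a,b))" using assms unfolding psd_def psdf_def by blast+
  show "dim_row (adj A) = dim_row A" "dim_col (adj A) = dim_col A" using A by simp_all
  fix i j assume "i < dim_row A" "j < dim_col A"
  then have ij: "i < d" "j < d" "i < dim_col A" "j < dim_row A" using A by simp_all
  show "adj A $$ (i,j) = A $$ (i,j)" unfolding adj_index[OF ij(3,4)] using h ij(1,2) by metis
qed

lemma psd_trace: "psd A \<Longrightarrow> psd B \<Longrightarrow> 0 \<le> Re (tr (A * B))"
  unfolding psd_def using psdf_trace by (elim conjE) (simp add: tr_mult)

lemma psdI: assumes A: "A \<in> M" "adj A = A" and q: "\<And>v. 0 \<le> Re (qform d (\<lambda>a b. A $$ (a,b)) v)" shows "psd A"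
proof -
  have "A $$ (b,a) = cnj (A $$ (a,b))" if "a < d" "b < d" for a b
    using adj_index[of b A a] A that by simp
  then show ?thesis using A(1) q unfolding psd_def psdf_def by blast
qed

lemma psd_conj: assumes A: "psd A" and K: "K \<in> M" shows "psd (adj K * (A * K))"
proof (rule psdI)
  note m = psd_M[OF A]
  show "adj K * (A * K) \<in> M" by (intro mult_M adj_M m K)
  show "adj (adj K * (A * K)) = adj K * (A * K)"
    unfolding adj_mult_M[OF adj_M[OF K] mult_M[OF m K]] adj_mult_M[OF m K] psd_adj[OF A] adj_adj by (rule mult_assoc_M[OF adj_M[OF K] m K])
  fix v
  define w where "w i = (\<Sum>b<d. K $$ (i,b) * v b)" for i
  have "(adj K * (A * K)) $$ (a,b) = (\<Sum>i<d. \<Sum>j<d. cnj (K $$ (i,a)) * A $$ (i,j) * K $$ (j,b))" if "a < d" "b < d" for a b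
    using that K m by (simp add: mat_mult_index[where r=d and m=d and c=d] sum_distrib_left mult_ac del: index_mult_mat(1))
  then have "qform d (\<lambda>a b. (adj K * (A * K)) $$ (a,b)) v =
     (\<Sum>a<d. \<Sum>b<d. \<Sum>i<d. \<Sum>j<d. (cnj (K $$ (i,a)) * cnj (v a)) * A $$ (i,j) * (K $$ (j,b) * v b))"
    unfolding qform_def by (intro sum.cong refl) (simp add: sum_distrib_left sum_distrib_right mult_ac)
  also have "\<dots> = (\<Sum>i<d. \<Sum>j<d. \<Sum>a<d. \<Sum>b<d. (cnj (K $$ (i,a)) * cnj (v a)) * A $$ (i,j) * (K $$ (j,b) * v b))"
  proof -
    have "(\<Sum>a<d. \<Sum>b<d. \<Sum>i<d. \<Sum>j<d. f a b i j) = (\<Sum>i<d. \<Sum>j<d. \<Sum>a<d. \<Sum>b<d. f a b i j)" for f :: "nat \<Rightarrow> nat \<Rightarrow> nat \<Rightarrow> nat \<Rightarrow> complex"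
    proof -
      have "(\<Sum>a<d. \<Sum>b<d. \<Sum>i<d. \<Sum>j<d. f a b i j) = (\<Sum>a<d. \<Sum>i<d. \<Sum>j<d. \<Sum>b<d. f a b i j)"
        by (intro sum.cong refl sum_rotate)
      also have "\<dots> = (\<Sum>i<d. \<Sum>j<d. \<Sum>a<d. \<Sum>b<d. f a b i j)" by (rule sum_rotate)
      finally show ?thesis .
    qed
    then show ?thesis .
  qed
  also have "\<dots> = qform d (\<lambda>i j. A $$ (i,j)) w"
    unfolding qform_def w_def by (intro sum.cong refl) (simp add: cnj_sum sum_product sum_distrib_left sum_distrib_right mult_ac)
  finally show "0 \<le> Re (qform d (\<lambda>a b. (adj K * (A * K)) $$ (a,b)) v)" using A unfolding psd_def psdf_def by simp
qed

lemma qform_one: "qform d (\<lambda>a b. 1\<^sub>m d $$ (a,b)) v = of_real (\<Sum>a<d. (cmod (v a))\<^sup>2)"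
proof -
  have "qform d (\<lambda>a b. 1\<^sub>m d $$ (a,b)) v = (\<Sum>a<d. \<Sum>b<d. if b = a then cnj (v a) * v a else 0)"
    unfolding qform_def by (intro sum.cong refl) auto
  then show ?thesis unfolding of_real_sum complex_norm_square by (simp add: mult.commute)
qed

lemma psd_one: "psd (1\<^sub>m d)"
  by (rule psdI[OF one_M adj_one]) (simp add: qform_one sum_nonneg)

lemma psd_gram: "K \<in> M \<Longrightarrow> psd (adj K * K)"
  using psd_conj[OF psd_one] by simp

lemma psd_sq: assumes "K \<in> M" "adj K = K" shows "psd (K * K)"
  using psd_gram[OF assms(1)] unfolding assms(2) .

lemma minus_M: "A \<in> M \<Longrightarrow> B \<in> M \<Longrightarrow> A - B \<in> M"
  by (rule minus_carrier_mat)

lemma qform_diff: "A \<in> M \<Longrightarrow> B \<in> M \<Longrightarrow> qform d (\<lambda>a b. (z \<cdot>\<^sub>m A - B) $$ (a,b)) v =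
    z * qform d (\<lambda>a b. A $$ (a,b)) v - qform d (\<lambda>a b. B $$ (a,b)) v"
  unfolding qform_def sum_distrib_left sum_subtractf[symmetric] by (intro sum.cong refl) (auto simp: algebra_simps)

lemma adj_minus: "A \<in> M \<Longrightarrow> B \<in> M \<Longrightarrow> adj (A - B) = adj A - adj B"
  by (rule eq_matI) auto

lemma tr_minus: "A \<in> M \<Longrightarrow> B \<in> M \<Longrightarrow> tr (A - B) = tr A - tr B"
  by (auto simp: tr_def sum_subtractf)

lemma herm_tr_real: "A \<in> M \<Longrightarrow> adj A = A \<Longrightarrow> B \<in> M \<Longrightarrow> adj B = B \<Longrightarrow> tr (A * B) = of_real (Re (tr (A * B)))"
proof -
  assume a: "A \<in> M" "adj A = A" "B \<in> M" "adj B = B"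
  have "cnj (tr (A * B)) = tr (adj (A * B))" by (rule tr_adj[symmetric, OF mult_M[OF a(1,3)]])
  also have "\<dots> = tr (B * A)" unfolding adj_mult_M[OF a(1,3)] a(2,4) ..
  also have "\<dots> = tr (A * B)" by (rule tr_cyc[OF a(3,1)])
  finally show ?thesis by (simp add: complex_eq_iff)
qed

text \<open>The operator bound of \<open>A\<close> by its trace, obtained without eigenvalues. For a
  vector \<open>v\<close> the matrix with entries \<open>v a * cnj (v b)\<close> is at most the
  squared norm of \<open>v\<close> times the identity by Cauchy-Schwarz; pairing the difference with
  \<open>A\<close> in \<open>psd_trace\<close> gives the form inequality at
  \<open>v\<close>.\<close>

lemma psd_tr_minus: assumes A: "psd A" shows "psd (of_real (Re (tr A)) \<cdot>\<^sub>m 1\<^sub>m d - A)"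
proof (rule psdI)
  note m = psd_M[OF A]
  show "of_real (Re (tr A)) \<cdot>\<^sub>m 1\<^sub>m d - A \<in> M" by (intro minus_M smult_M one_M m)
  show "adj (of_real (Re (tr A)) \<cdot>\<^sub>m 1\<^sub>m d - A) = of_real (Re (tr A)) \<cdot>\<^sub>m 1\<^sub>m d - A"
    unfolding adj_minus[OF smult_M[OF one_M] m] psd_adj[OF A] adj_smult adj_one by simp
  fix v
  define s where "s = (\<Sum>a<d. (cmod (v a))\<^sup>2)"
  define Y where "Y = mat d d (\<lambda>(a,b). v a * cnj (v b))"
  have Y: "Y \<in> M" unfolding Y_def by (rule mat_carrier)
  have "psd (of_real s \<cdot>\<^sub>m 1\<^sub>m d - Y)"
  proof (rule psdI)
    show "of_real s \<cdot>\<^sub>m 1\<^sub>m d - Y \<in> M" by (intro minus_M smult_M one_M Y)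
    have "adj Y = Y" by (rule eq_matI) (auto simp: Y_def)
    then show "adj (of_real s \<cdot>\<^sub>m 1\<^sub>m d - Y) = of_real s \<cdot>\<^sub>m 1\<^sub>m d - Y"
      unfolding adj_minus[OF smult_M[OF one_M] Y] adj_smult adj_one by simp
    fix u
    have "qform d (\<lambda>a b. Y $$ (a,b)) u = (\<Sum>a<d. \<Sum>b<d. (cnj (u a) * v a) * (cnj (v b) * u b))"
      unfolding qform_def by (intro sum.cong refl) (simp add: Y_def)
    also have "\<dots> = (\<Sum>a<d. cnj (u a) * v a) * cnj (\<Sum>a<d. cnj (u a) * v a)" unfolding sum_product[symmetric] by (simp add: cnj_sum mult.commute)
    finally have "Re (qform d (\<lambda>a b. Y $$ (a,b)) u) = (cmod (\<Sum>a<d. cnj (u a) * v a))\<^sup>2"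
      unfolding complex_norm_square[symmetric] by simp
    also have "\<dots> \<le> (\<Sum>a<d. cmod (u a) * cmod (v a))\<^sup>2"
      by (intro power_mono norm_ge_zero order_trans[OF norm_sum]) (simp add: norm_mult)
    also have "\<dots> \<le> (\<Sum>a<d. (cmod (u a))\<^sup>2) * (\<Sum>a<d. (cmod (v a))\<^sup>2)" by (rule sum_mult_square_le)
    finally show "0 \<le> Re (qform d (\<lambda>a b. (of_real s \<cdot>\<^sub>m 1\<^sub>m d - Y) $$ (a,b)) u)"
      unfolding qform_diff[OF one_M Y] qform_one s_def[symmetric] by (simp add: mult.commute)
  qed
  from psd_trace[OF A this] have "0 \<le> Re (tr (of_real s \<cdot>\<^sub>m A - A * Y))"
    unfolding mult_minus_distrib_mat[OF m smult_M[OF one_M] Y] smult_right_M[OF m one_M] one_right_M[OF m] .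
  moreover have "tr (A * Y) = qform d (\<lambda>a b. A $$ (a,b)) v"
    unfolding tr_mult[OF m Y] qform_def by (intro sum.cong refl) (simp add: Y_def)
  ultimately show "0 \<le> Re (qform d (\<lambda>a b. (of_real (Re (tr A)) \<cdot>\<^sub>m 1\<^sub>m d - A) $$ (a,b)) v)"
    unfolding tr_minus[OF smult_M[OF m] mult_M[OF m Y]] tr_M_smult[OF m] qform_diff[OF one_M m] qform_one s_def[symmetric]
    by (simp add: mult.commute)
qed

text \<open>Cauchy-Schwarz for the Hilbert-Schmidt inner product of \<open>adj Z\<close> and
  \<open>Z\<close>, which have equal norms; it is carried out entry by entry.\<close>

lemma tr_sq_le: assumes Z: "Z \<in> M" shows "\<bar>Re (tr (Z * Z))\<bar> \<le> Re (tr (adj Z * Z))"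
proof -
  have e: "Re (tr (adj Z * Z)) = (\<Sum>i<d. \<Sum>j<d. (cmod (Z $$ (j,i)))\<^sup>2)"
    unfolding tr_mult[OF adj_M[OF Z] Z] Re_sum
    by (intro sum.cong refl) (use Z in \<open>simp add: complex_norm_square[symmetric] mult.commute cmod_power2 power2_eq_square\<close>)
  have e': "Re (tr (adj Z * Z)) = (\<Sum>i<d. \<Sum>j<d. (cmod (Z $$ (i,j)))\<^sup>2)" unfolding e by (rule sum.swap)
  have b: "\<bar>Re (x * y)\<bar> \<le> ((cmod x)\<^sup>2 + (cmod y)\<^sup>2) / 2" for x y
  proof -
    have "\<bar>Re (x * y)\<bar> \<le> cmod x * cmod y" using abs_Re_le_cmod[of "x * y"] by (simp add: norm_mult)
    then show ?thesis using sum_squares_bound[of "cmod x" "cmod y"] by simp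
  qed
  have "\<bar>Re (tr (Z * Z))\<bar> \<le> (\<Sum>i<d. \<Sum>j<d. \<bar>Re (Z $$ (i,j) * Z $$ (j,i))\<bar>)"
    unfolding tr_mult[OF Z Z] Re_sum by (rule order_trans[OF sum_abs sum_mono[OF sum_abs]])
  also have "\<dots> \<le> (\<Sum>i<d. \<Sum>j<d. ((cmod (Z $$ (i,j)))\<^sup>2 + (cmod (Z $$ (j,i)))\<^sup>2) / 2)" by (intro sum_mono b)
  also have "\<dots> = Re (tr (adj Z * Z))"
    unfolding sum_divide_distrib[symmetric] sum.distrib e[symmetric] e'[symmetric] by simp
  finally show ?thesis .
qed

text \<open>Expanding the conjugated factor gives a double sum over \<open>P\<close> and
  \<open>Q\<close> with the symmetric weight \<open>chi P Q\<close>. Exchanging the two variables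
  exchanges \<open>A\<close> with \<open>X\<close> and \<open>Y\<close> with
  \<open>Z\<close>.\<close>

lemma e_swap:
  assumes A: "A \<in> M" and X: "X \<in> M" and Y: "Y \<in> M" and Z: "Z \<in> M"
  shows "(\<Sum>P\<in>S. tr (P * A) * tr (P * (X * (P * (Y * (P * Z)))))) = (\<Sum>P\<in>S. tr (P * X) * tr (P * (A * (P * (Z * (P * Y))))))"
proof -
  have ex: "of_nat d * (\<Sum>P\<in>S. tr (P * A) * tr (P * (X * (P * (Y * (P * Z)))))) =
      (\<Sum>P\<in>S. \<Sum>Q\<in>S. chi P Q * (tr (P * A) * tr (Q * X) * tr (Q * (Y * (P * Z)))))"
    if "A \<in> M" "X \<in> M" "Y \<in> M" "Z \<in> M" for A X Y Z
  proof -
    have "of_nat d * (\<Sum>P\<in>S. tr (P * A) * tr (P * (X * (P * (Y * (P * Z)))))) =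
       (\<Sum>P\<in>S. tr (P * A) * (of_nat d * tr (P * (X * (P * (Y * (P * Z)))))))"
      by (simp add: sum_distrib_left mult_ac)
    also have "\<dots> = (\<Sum>P\<in>S. tr (P * A) * (\<Sum>Q\<in>S. chi P Q * (tr (Q * X) * tr (Q * (Y * (P * Z))))))"
      by (intro sum.cong refl arg_cong2[where f="(*)"] split_expand) (use that in simp_all)
    finally show ?thesis by (simp add: sum_distrib_left mult_ac)
  qed
  have "of_nat d * (\<Sum>P\<in>S. tr (P * A) * tr (P * (X * (P * (Y * (P * Z)))))) =
      (\<Sum>P\<in>S. \<Sum>Q\<in>S. chi P Q * (tr (P * X) * tr (Q * A) * tr (Q * (Z * (P * Y)))))"
    unfolding ex[OF A X Y Z]
  proof (subst sum.swap, intro sum.cong refl)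
    fix P Q assume PQ: "P \<in> S" "Q \<in> S"
    have "tr (P * (Y * (Q * Z))) = tr ((P * Y) * (Q * Z))" using PQ Y Z by (simp only: mult_assoc_M mult_M S_carrier)
    also have "\<dots> = tr ((Q * Z) * (P * Y))" by (rule tr_cyc) (use PQ Y Z in simp_all)
    also have "\<dots> = tr (Q * (Z * (P * Y)))" using PQ Y Z by (simp only: mult_assoc_M mult_M S_carrier)
    finally show "chi Q P * (tr (Q * A) * tr (P * X) * tr (P * (Y * (Q * Z)))) = chi P Q * (tr (P * X) * tr (Q * A) * tr (Q * (Z * (P * Y))))"
      by (simp add: chi_sym mult_ac)
  qed
  then show ?thesis unfolding ex[OF X A Z Y, symmetric] using d_pos by simp
qed

section \<open>Inequalities between the invariants of a state and an observable\<close>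

context
  fixes A B assumes A: "psd A" "tr A = 1" and B: "B \<in> M" "adj B = B"
begin

lemmas mA = psd_M[OF A(1)]
lemmas hA = psd_adj[OF A(1)]

definition al where "al P = Re (tr (P * A))"
definition be where "be P = Re (tr (P * B))"

lemma al: "P \<in> S \<Longrightarrow> tr (P * A) = of_real (al P)"
  unfolding al_def by (rule herm_tr_real) (simp_all add: mA hA)

lemma be: "P \<in> S \<Longrightarrow> tr (P * B) = of_real (be P)"
  unfolding be_def by (rule herm_tr_real) (simp_all add: B)

text \<open>The matrices \<open>1 + P\<close> and \<open>1 - P\<close> have positive semidefinite
  squares, and the traces of these against \<open>A\<close> are \<open>2 + 2 * al P\<close> and
  \<open>2 - 2 * al P\<close>.\<close>

lemma al_le: assumes P: "P \<in> S" shows "(al P)\<^sup>2 \<le> 1"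
proof -
  have "0 \<le> 2 + 2 * s * al P" if s: "s = 1 \<or> s = -1" for s :: real
  proof -
    let ?K = "1\<^sub>m d + of_real s \<cdot>\<^sub>m P"
    have K: "?K \<in> M" "adj ?K = ?K" using P by (simp_all add: adj_add[of _ d d])
    have "?K * ?K = 1\<^sub>m d + of_real s \<cdot>\<^sub>m P + (of_real s \<cdot>\<^sub>m P + (of_real s * of_real s) \<cdot>\<^sub>m 1\<^sub>m d)"
      using P by (simp add: add_mult_distrib_mat[of _ d d _ _ d] mult_add_distrib_mat[of _ d d _ d] add_smult_distrib_left_mat[of _ d d])
    then have "A * (?K * ?K) = A + of_real s \<cdot>\<^sub>m (A * P) + (of_real s \<cdot>\<^sub>m (A * P) + (of_real s * of_real s) \<cdot>\<^sub>m A)"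
      using P mA by (simp add: mult_add_distrib_mat[of _ d d _ d])
    then have "tr (A * (?K * ?K)) = 2 + 2 * of_real s * tr (A * P)"
      using P mA s A(2) by (auto simp: tr_add[of _ d] algebra_simps)
    moreover have "tr (A * P) = of_real (al P)" unfolding al[OF P, symmetric] by (rule tr_cyc[OF mA S_carrier[OF P]])
    moreover have "0 \<le> Re (tr (A * (?K * ?K)))" by (rule psd_trace[OF A(1) psd_sq[OF K]])
    ultimately show ?thesis by simp
  qed
  from this[of 1] this[of "-1"] have "\<bar>al P\<bar> \<le> 1" by auto
  then show ?thesis by (simp add: abs_square_le_1)
qed

definition "NN = Re (tr (B * B))"
definition "ww = Re (tr (A * A))"
definition "tt = Re (tr (A * B))"
definition "pp = Re (tr (A * (B * B)))"
definition "qq = Re (tr (A * (A * (B * B))))"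
definition "mr = Re (tr (A * (B * (A * B))))"
definition "aa = Re (aT A B)"
definition "bb = Re (bT A B)"
definition "cc = Re (cT A B)"
definition "ee = Re (eT A B)"

lemma sum_be: "(\<Sum>P\<in>S. (be P)\<^sup>2) = real d * NN"
proof -
  have "of_real (\<Sum>P\<in>S. (be P)\<^sup>2) = (\<Sum>P\<in>S. tr (P * B) * tr (P * B))"
    unfolding of_real_sum by (intro sum.cong refl) (simp add: be power2_eq_square)
  also have "\<dots> = of_nat d * tr (B * B)" by (rule completeness'[OF B(1) B(1)])
  finally have "Re (of_real (\<Sum>P\<in>S. (be P)\<^sup>2)) = Re (of_nat d * tr (B * B))" by (rule arg_cong)
  then show ?thesis by (simp add: NN_def)
qed

lemma aa_eq: "aa = (\<Sum>P\<in>S. (al P)\<^sup>2 * (be P)\<^sup>2)"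
  unfolding aa_def aT_def Re_sum by (intro sum.cong refl) (simp add: al be power2_eq_square)

lemma aa_bounds: "0 \<le> aa" "aa \<le> real d * NN"
proof -
  show "0 \<le> aa" unfolding aa_eq by (intro sum_nonneg) simp
  have "aa \<le> (\<Sum>P\<in>S. 1 * (be P)\<^sup>2)" unfolding aa_eq by (intro sum_mono mult_right_mono al_le) simp_all
  then show "aa \<le> real d * NN" by (simp add: sum_be)
qed

lemma tr_conj_real: "P \<in> S \<Longrightarrow> tr (P * (A * (P * B))) = of_real (Re (tr (P * (A * (P * B)))))"
proof -
  assume P: "P \<in> S"
  have m: "P * (A * P) \<in> M" using P mA by simp
  have e: "P * (A * (P * B)) = (P * (A * P)) * B" using P mA B(1) by (simp only: mult_assoc_M mult_M S_carrier)
  have h: "adj (P * (A * P)) = P * (A * P)"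
    unfolding adj_mult_M[OF S_carrier[OF P] mult_M[OF mA S_carrier[OF P]]] adj_mult_M[OF mA S_carrier[OF P]] hA S_adj[OF P]
    by (rule mult_assoc_M[OF S_carrier[OF P] mA S_carrier[OF P]])
  show ?thesis unfolding e by (rule herm_tr_real[OF m h B])
qed

text \<open>\<open>bb\<close> is the inner product of \<open>al P * be P\<close> with its symplectic
  Fourier transform. Both have squared norm \<open>aa\<close> by
  \<open>fourier_isometry\<close>.\<close>

lemma bb_bounds: "\<bar>bb\<bar> \<le> aa"
proof -
  define x where "x P = Re (tr (P * (A * (P * B))))" for P
  have b: "bb = (\<Sum>P\<in>S. x P * (al P * be P))"
    unfolding bb_def bT_def Re_sum by (intro sum.cong refl) (subst tr_conj_real, simp_all add: al be x_def)
  have "(\<Sum>P\<in>S. (x P)\<^sup>2) = aa"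
  proof -
    have "of_real (\<Sum>P\<in>S. (x P)\<^sup>2) = (\<Sum>P\<in>S. tr (P * (A * (P * B))) * tr (P * (A * (P * B))))"
      unfolding of_real_sum x_def 
    proof (intro sum.cong refl)
      fix P assume "P \<in> S"
      from tr_conj_real[OF this] obtain r where "tr (P * (A * (P * B))) = of_real r" by blast
      then show "of_real ((Re (tr (P * (A * (P * B)))))\<^sup>2) = tr (P * (A * (P * B))) * tr (P * (A * (P * B)))"
        by (simp add: power2_eq_square)
    qed
    also have "\<dots> = (\<Sum>P\<in>S. tr (P * A) * tr (P * B) * (tr (P * A) * tr (P * B)))" by (rule fourier_isometry[OF mA B(1) mA B(1)])
    also have "\<dots> = aT A B" unfolding aT_def by (intro sum.cong refl) (simp only: mult_ac)
    finally have "Re (of_real (\<Sum>P\<in>S. (x P)\<^sup>2)) = aa" unfolding aa_def by (rule arg_cong)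
    then show ?thesis by simp
  qed
  moreover have "\<bar>x P * (al P * be P)\<bar> \<le> ((x P)\<^sup>2 + (al P)\<^sup>2 * (be P)\<^sup>2) / 2" for P
    using sum_squares_bound[of "\<bar>x P\<bar>" "\<bar>al P * be P\<bar>"] by (simp add: abs_mult power_mult_distrib)
  then have "\<bar>bb\<bar> \<le> (\<Sum>P\<in>S. ((x P)\<^sup>2 + (al P)\<^sup>2 * (be P)\<^sup>2) / 2)"
    unfolding b by (intro order_trans[OF sum_abs] sum_mono)
  ultimately show ?thesis unfolding sum_divide_distrib[symmetric] sum.distrib aa_eq[symmetric] by simp
qed

text \<open>By \<open>four_cycle_sum\<close> each summand may be taken as \<open>tr (Z * Z)\<close>
  with \<open>Z = P * A * P * B\<close>. This is at most \<open>tr (adj Z * Z)\<close>, and the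
  latter sums to a twirl.\<close>

lemma cc_le: "cc \<le> real d * ww * NN"
proof -
  have "cT A B = (\<Sum>P\<in>S. tr (P * (A * (P * (B * (P * (A * (P * B))))))))"
    unfolding cT_def four_cycle_sum[OF mA B(1) mA B(1)] ..
  then have "cc = (\<Sum>P\<in>S. Re (tr (P * (A * (P * (B * (P * (A * (P * B)))))))))" unfolding cc_def Re_sum[symmetric] by simp
  also have "\<dots> \<le> (\<Sum>P\<in>S. Re (tr (P * (A * A) * (P * (B * B)))))"
  proof (intro sum_mono)
    fix P assume P: "P \<in> S"
    let ?Z = "P * (A * (P * B))"
    have Z: "?Z \<in> M" using P mA B by simp
    have "adj ?Z = B * (P * (A * P))"
      using P mA B(1) by (simp only: adj_mult_M mult_M S_carrier hA B(2) S_adj mult_assoc_M)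
    moreover have "B * (P * (A * P)) * ?Z = B * (P * (A * (P * (P * (A * (P * B))))))" using P mA B(1) by (simp only: mult_assoc_M mult_M S_carrier)
    moreover have "P * (P * (A * (P * B))) = A * (P * B)" using P mA B by simp
    moreover have "B * (P * (A * (A * (P * B)))) = B * ((P * (A * A)) * (P * B))" using P mA B(1) by (simp only: mult_assoc_M mult_M S_carrier)
    ultimately have "tr (adj ?Z * ?Z) = tr (B * ((P * (A * A)) * (P * B)))" by (simp only:)
    also have "\<dots> = tr (((P * (A * A)) * (P * B)) * B)" by (rule tr_cyc) (use P mA B(1) in simp_all)
    also have "((P * (A * A)) * (P * B)) * B = P * (A * A) * (P * (B * B))" using P mA B(1) by (simp only: mult_assoc_M mult_M S_carrier)
    finally have "Re (tr (?Z * ?Z)) \<le> Re (tr (P * (A * A) * (P * (B * B))))" using tr_sq_le[OF Z] by (simp only: abs_le_iff)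
    moreover have "?Z * ?Z = P * (A * (P * (B * (P * (A * (P * B))))))" using P mA B(1) by (simp only: mult_assoc_M mult_M S_carrier)
    ultimately show "Re (tr (P * (A * (P * (B * (P * (A * (P * B)))))))) \<le> Re (tr (P * (A * A) * (P * (B * B))))" by (simp only:)
  qed
  also have "\<dots> = Re (of_nat d * tr (A * A) * tr (B * B))"
    unfolding Re_sum[symmetric] completeness_split[OF mult_M[OF mA mA] mult_M[OF B(1) B(1)]] ..
  also have "tr (A * A) = of_real ww" unfolding ww_def by (rule herm_tr_real[OF mA hA mA hA])
  also have "tr (B * B) = of_real NN" unfolding NN_def by (rule herm_tr_real[OF B B])
  finally show ?thesis by simp
qed

lemma eT_sym: "eT' A B = eT A B"
  unfolding eT_def eT'_def
proof (intro sum.cong refl arg_cong2[where f="(*)"])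
  fix P assume P: "P \<in> S"
  have "tr (P * (B * (P * (A * (P * B))))) = tr ((P * B) * (P * (A * (P * B))))" using P mA B(1) by (simp only: mult_assoc_M mult_M S_carrier)
  also have "\<dots> = tr ((P * (A * (P * B))) * (P * B))" by (rule tr_cyc) (use P mA B(1) in simp_all)
  also have "\<dots> = tr (P * (A * (P * (B * (P * B)))))" using P mA B(1) by (simp only: mult_assoc_M mult_M S_carrier)
  finally show "tr (P * (A * (P * (B * (P * B))))) = tr (P * (B * (P * (A * (P * B)))))" ..
qed

text \<open>With the Hermitian matrix \<open>G = be P * P + s * P * B * P\<close> and
  \<open>s\<close> a sign, \<open>tr (A * G * A * G)\<close> is nonnegative because \<open>A\<close>
  and \<open>G * A * G\<close> are positive. Its two square terms sum to \<open>cc\<close> each, by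
  two representations of \<open>cT\<close>, and its mixed terms to \<open>2 * s * ee\<close> by
  \<open>e_swap\<close>.\<close>

lemma ee_bounds: "\<bar>ee\<bar> \<le> cc"
proof -
  have e: "eT A B = (\<Sum>P\<in>S. tr (P * B) * tr (P * (A * (P * (B * (P * A))))))"
    unfolding eT_def by (rule e_swap[OF mA B(1) mA B(1)])
  have c1: "cT A B = (\<Sum>P\<in>S. tr (P * (A * (P * (B * (P * (A * (P * B))))))))"
    unfolding cT_def four_cycle_sum[OF mA B(1) mA B(1)] ..
  have c2: "cT A B = (\<Sum>P\<in>S. tr (P * B) * tr (P * B) * tr (P * (A * (P * A))))"
    unfolding c1 four_cycle_sum[OF B(1) mA B(1) mA, symmetric]
  proof (intro sum.cong refl)
    fix P assume P: "P \<in> S"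
    have "P * (A * (P * (B * (P * (A * (P * B)))))) = (P * A) * (P * (B * (P * (A * (P * B)))))" using P mA B(1) by (simp only: mult_assoc_M mult_M S_carrier)
    moreover have "P * (B * (P * (A * (P * (B * (P * A)))))) = (P * (B * (P * (A * (P * B))))) * (P * A)" using P mA B(1) by (simp only: mult_assoc_M mult_M S_carrier)
    moreover have "tr ((P * A) * (P * (B * (P * (A * (P * B)))))) = tr ((P * (B * (P * (A * (P * B))))) * (P * A))"
      by (rule tr_cyc) (use P mA B(1) in simp_all)
    ultimately show "tr (P * (A * (P * (B * (P * (A * (P * B))))))) = tr (P * (B * (P * (A * (P * (B * (P * A)))))))" by (simp only:)
  qed
  have "0 \<le> 2 * cc + 2 * s * ee" if s: "s = 1 \<or> s = -1" for s :: real
  proof -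
    let ?s = "of_real s :: complex"
    have "0 \<le> (\<Sum>P\<in>S. Re (tr (P * B) * tr (P * B) * tr (P * (A * (P * A))) + 2 * ?s * (tr (P * B) * tr (P * (A * (P * (B * (P * A))))))
        + tr (P * (A * (P * (B * (P * (A * (P * B)))))))))"
    proof (intro sum_nonneg)
      fix P assume P: "P \<in> S"
      let ?X = "of_real (be P) \<cdot>\<^sub>m P" and ?Y = "?s \<cdot>\<^sub>m (P * (B * P))" and ?b = "of_real (be P) :: complex"
      let ?G = "?X + ?Y"
      have XY: "?X \<in> M" "?Y \<in> M" "?G \<in> M" "P * (B * P) \<in> M" using P B by simp_all
      have hG: "adj ?G = ?G"
        unfolding adj_add[OF XY(1,2)] adj_smult adj_mult_M[OF S_carrier[OF P] mult_M[OF B(1) S_carrier[OF P]]] adj_mult_M[OF B(1) S_carrier[OF P]] S_adj[OF P] B(2)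
          mult_assoc_M[OF S_carrier[OF P] B(1) S_carrier[OF P]] by simp
      have "0 \<le> Re (tr (A * (adj ?G * (A * ?G))))" by (rule psd_trace[OF A(1) psd_conj[OF A(1) XY(3)]])
      also have "A * (adj ?G * (A * ?G)) = A * (?X * (A * ?X)) + A * (?Y * (A * ?X)) + (A * (?X * (A * ?Y)) + A * (?Y * (A * ?Y)))"
        unfolding hG mult_add_distrib_mat[OF mA XY(1,2)] mult_add_distrib_mat[OF XY(3) mult_M[OF mA XY(1)] mult_M[OF mA XY(2)]]
          add_mult_distrib_mat[OF XY(1,2) mult_M[OF mA XY(1)]] add_mult_distrib_mat[OF XY(1,2) mult_M[OF mA XY(2)]]
        unfolding mult_add_distrib_mat[OF mA add_carrier_mat[OF mult_M[OF XY(2) mult_M[OF mA XY(1)]]] add_carrier_mat[OF mult_M[OF XY(2) mult_M[OF mA XY(2)]]]]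
          mult_add_distrib_mat[OF mA mult_M[OF XY(1) mult_M[OF mA XY(1)]] mult_M[OF XY(2) mult_M[OF mA XY(1)]]]
          mult_add_distrib_mat[OF mA mult_M[OF XY(1) mult_M[OF mA XY(2)]] mult_M[OF XY(2) mult_M[OF mA XY(2)]]] ..
      also have "tr (A * (?X * (A * ?X)) + A * (?Y * (A * ?X)) + (A * (?X * (A * ?Y)) + A * (?Y * (A * ?Y)))) =
          ?b * ?b * tr (A * (P * (A * P))) + ?s * ?b * tr (A * (P * (B * (P * (A * P))))) + (?s * ?b * tr (A * (P * (A * (P * (B * P)))))
           + ?s * ?s * tr (A * (P * (B * (P * (A * (P * (B * P))))))))"
      proof -
        have m: "A * (?X * (A * ?X)) \<in> M" "A * (?Y * (A * ?X)) \<in> M" "A * (?X * (A * ?Y)) \<in> M" "A * (?Y * (A * ?Y)) \<in> M"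
          by (intro mult_M mA XY)+
        have w: "P * (A * P) \<in> M" "P * (A * (P * (B * P))) \<in> M" "P * (B * (P * (A * P))) \<in> M" "P * (B * (P * (A * (P * (B * P))))) \<in> M"
          by (intro mult_M mA B(1) S_carrier P)+
        have 1: "A * (?X * (A * ?X)) = (?b * ?b) \<cdot>\<^sub>m (A * (P * (A * P)))" using P mA by simp
        have 2: "A * (?Y * (A * ?X)) = (?s * ?b) \<cdot>\<^sub>m (A * (P * (B * (P * (A * P)))))" using P mA B(1) by (simp add: mult.commute)
        have 3: "A * (?X * (A * ?Y)) = (?s * ?b) \<cdot>\<^sub>m (A * (P * (A * (P * (B * P)))))" using P mA B(1) by (simp add: mult.commute)
        have 4: "A * (?Y * (A * ?Y)) = (?s * ?s) \<cdot>\<^sub>m (A * (P * (B * (P * (A * (P * (B * P)))))))" using P mA B(1) by simp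
        show ?thesis
          unfolding tr_add[OF add_carrier_mat[OF m(2)] add_carrier_mat[OF m(4)]] tr_add[OF m(1,2)] tr_add[OF m(3,4)]
          unfolding 1 2 3 4 tr_M_smult[OF mult_M[OF mA w(1)]] tr_M_smult[OF mult_M[OF mA w(2)]] tr_M_smult[OF mult_M[OF mA w(3)]]
            tr_M_smult[OF mult_M[OF mA w(4)]] ..
      qed
      also have "?s * ?s = 1" using s by auto
      also have "tr (A * (P * (A * P))) = tr (P * (A * (P * A)))"
      proof -
        have e: "A * (P * (A * P)) = (A * (P * A)) * P" using P mA B(1) by (simp only: mult_assoc_M mult_M S_carrier)
        show ?thesis unfolding e by (rule tr_cyc) (use P mA in simp_all)
      qed
      also have "tr (A * (P * (B * (P * (A * P))))) = tr (P * (A * (P * (B * (P * A)))))"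
      proof -
        have e: "A * (P * (B * (P * (A * P)))) = (A * (P * (B * (P * A)))) * P" using P mA B(1) by (simp only: mult_assoc_M mult_M S_carrier)
        show ?thesis unfolding e by (rule tr_cyc) (use P mA B(1) in simp_all)
      qed
      also have "tr (A * (P * (A * (P * (B * P))))) = tr (P * (A * (P * (B * (P * A)))))"
      proof -
        have e: "A * (P * (A * (P * (B * P)))) = (A * P) * (A * (P * (B * P)))" using P mA B(1) by (simp only: mult_assoc_M mult_M S_carrier)
        have e': "(A * (P * (B * P))) * (A * P) = (A * (P * (B * (P * A)))) * P" using P mA B(1) by (simp only: mult_assoc_M mult_M S_carrier)
        have "tr (A * (P * (A * (P * (B * P))))) = tr ((A * (P * (B * P))) * (A * P))"
          unfolding e by (rule tr_cyc) (use P mA B(1) in simp_all)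
        also have "\<dots> = tr (P * (A * (P * (B * (P * A)))))" unfolding e' by (rule tr_cyc) (use P mA B(1) in simp_all)
        finally show ?thesis .
      qed
      also have "tr (A * (P * (B * (P * (A * (P * (B * P))))))) = tr (P * (A * (P * (B * (P * (A * (P * B)))))))"
      proof -
        have e: "A * (P * (B * (P * (A * (P * (B * P)))))) = (A * (P * (B * (P * (A * (P * B)))))) * P" using P mA B(1) by (simp only: mult_assoc_M mult_M S_carrier)
        show ?thesis unfolding e by (rule tr_cyc) (use P mA B(1) in simp_all)
      qed
      finally show "0 \<le> Re (tr (P * B) * tr (P * B) * tr (P * (A * (P * A))) + 2 * ?s * (tr (P * B) * tr (P * (A * (P * (B * (P * A))))))
        + tr (P * (A * (P * (B * (P * (A * (P * B))))))))"
        unfolding be[OF P] by (simp add: algebra_simps)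
    qed
    also have "\<dots> = Re (cT A B + 2 * ?s * eT A B + cT A B)"
      unfolding Re_sum[symmetric] sum.distrib sum_distrib_left[symmetric] c2[symmetric] e[symmetric] c1[symmetric] ..
    finally show ?thesis unfolding cc_def ee_def by simp
  qed
  from this[of 1] this[of "-1"] show ?thesis by auto
qed

lemma w_bounds: "0 \<le> ww" "ww \<le> 1"
proof -
  show "0 \<le> ww" unfolding ww_def by (rule psd_trace[OF A(1) A(1)])
  have "psd (1\<^sub>m d - A)" using psd_tr_minus[OF A(1)] unfolding A(2) by simp
  from psd_trace[OF A(1) this] have "0 \<le> Re (tr (A - A * A))"
    unfolding mult_minus_distrib_mat[OF mA one_M mA] one_right_M[OF mA] .
  then show "ww \<le> 1" unfolding tr_minus[OF mA mult_M[OF mA mA]] A(2) ww_def by simp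
qed

lemma psd_BB: "psd (of_real NN \<cdot>\<^sub>m 1\<^sub>m d - B * B)"
  unfolding NN_def by (rule psd_tr_minus[OF psd_sq[OF B]])

lemma p_le: "pp \<le> NN"
proof -
  have "0 \<le> Re (tr (of_real NN \<cdot>\<^sub>m A - A * (B * B)))"
    using psd_trace[OF A(1) psd_BB]
    unfolding mult_minus_distrib_mat[OF mA smult_M[OF one_M] mult_M[OF B(1) B(1)]] smult_right_M[OF mA one_M] one_right_M[OF mA] .
  then show ?thesis unfolding tr_minus[OF smult_M[OF mA] mult_M[OF mA mult_M[OF B(1) B(1)]]] tr_M_smult[OF mA] A(2) pp_def by simp
qed

lemma q_bounds: "0 \<le> qq" "qq \<le> ww * NN"
proof -
  have e: "A * A * (B * B) = A * (A * (B * B))" using mA B by simp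
  show "0 \<le> qq" unfolding qq_def e[symmetric] by (rule psd_trace[OF psd_sq[OF mA hA] psd_sq[OF B]])
  have AA: "A * A \<in> M" using mA by simp
  have "0 \<le> Re (tr (of_real NN \<cdot>\<^sub>m (A * A) - A * A * (B * B)))"
    using psd_trace[OF psd_sq[OF mA hA] psd_BB]
    unfolding mult_minus_distrib_mat[OF AA smult_M[OF one_M] mult_M[OF B(1) B(1)]] smult_right_M[OF AA one_M] one_right_M[OF AA] .
  then show "qq \<le> ww * NN"
    unfolding tr_minus[OF smult_M[OF AA] mult_M[OF AA mult_M[OF B(1) B(1)]]] tr_M_smult[OF AA]
    unfolding e qq_def ww_def by (simp add: mult.commute)
qed

lemma m_bounds: "\<bar>mr\<bar> \<le> qq"
proof -
  have Z: "A * B \<in> M" using mA B by simp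
  have "A * B * (A * B) = A * (B * (A * B))" using mA B by simp
  moreover have "tr (adj (A * B) * (A * B)) = tr (A * (A * (B * B)))"
  proof -
    have "adj (A * B) * (A * B) = B * (A * (A * B))"
      unfolding adj_mult_M[OF mA B(1)] hA B(2) by (rule mult_assoc_M[OF B(1) mA mult_M[OF mA B(1)]])
    moreover have "tr (B * (A * (A * B))) = tr ((A * (A * B)) * B)" by (rule tr_cyc) (use mA B(1) in simp_all)
    moreover have "(A * (A * B)) * B = A * (A * (B * B))" using mA B by (simp only: mult_assoc_M mult_M)
    ultimately show ?thesis by (simp only:)
  qed
  ultimately show ?thesis using tr_sq_le[OF Z] unfolding mr_def qq_def by (simp only:)
qed

lemma t_real: "tr (A * B) = of_real tt"
  unfolding tt_def by (rule herm_tr_real[OF mA hA B])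

text \<open>The variance of \<open>B\<close> in the state \<open>A\<close> is nonnegative.\<close>

lemma t_le: "tt\<^sup>2 \<le> pp"
proof -
  let ?K = "B - of_real tt \<cdot>\<^sub>m 1\<^sub>m d"
  have K: "?K \<in> M" "adj ?K = ?K" using B by (simp_all add: minus_M adj_minus)
  have tb: "of_real tt \<cdot>\<^sub>m B \<in> M" "of_real tt \<cdot>\<^sub>m 1\<^sub>m d \<in> M" using B by simp_all
  have "?K * ?K = ?K * B - of_real tt \<cdot>\<^sub>m ?K"
    unfolding mult_minus_distrib_mat[OF K(1) B(1) tb(2)] smult_right_M[OF K(1) one_M] one_right_M[OF K(1)] ..
  also have "?K * B = B * B - of_real tt \<cdot>\<^sub>m B"
    unfolding minus_mult_distrib_mat[OF B(1) tb(2) B(1)] smult_left_M[OF one_M B(1)] one_left_M[OF B(1)] ..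
  finally have KK: "?K * ?K = B * B - of_real tt \<cdot>\<^sub>m B - of_real tt \<cdot>\<^sub>m ?K" .
  have BB: "B * B \<in> M" "B * B - of_real tt \<cdot>\<^sub>m B \<in> M" using B by (simp_all add: minus_M)
  have "A * (?K * ?K) = A * (B * B) - of_real tt \<cdot>\<^sub>m (A * B) - of_real tt \<cdot>\<^sub>m (A * B - of_real tt \<cdot>\<^sub>m A)"
    unfolding KK mult_minus_distrib_mat[OF mA BB(2) smult_M[OF K(1)]] mult_minus_distrib_mat[OF mA BB(1) tb(1)]
      smult_right_M[OF mA B(1)] smult_right_M[OF mA K(1)] mult_minus_distrib_mat[OF mA B(1) tb(2)] smult_right_M[OF mA one_M] one_right_M[OF mA] ..
  then have "tr (A * (?K * ?K)) = tr (A * (B * B)) - of_real tt * of_real tt - of_real tt * (of_real tt - of_real tt * 1)"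
    using mA B by (simp add: tr_minus minus_M t_real A(2))
  moreover have "0 \<le> Re (tr (A * (?K * ?K)))" by (rule psd_trace[OF A(1) psd_sq[OF K]])
  ultimately show ?thesis unfolding pp_def by (simp add: power2_eq_square)
qed

end

end

section \<open>Estimate for one layer\<close>

text \<open>\<open>ucoef\<close> and \<open>vcoef\<close> are the numerators of \<open>u\<close> and
  \<open>v\<close> from \<open>same_stats_family\<close> over the common denominator
  \<open>(x\<^sup>2 - 1) * (x\<^sup>2 - 4) * (x + 4)\<close>.\<close>

definition ucoef :: "real \<Rightarrow> real \<Rightarrow> real" where
  "ucoef x g = x\<^sup>2 * (x\<^sup>2 * (1 - g) - 1) * (x + 4)"

definition vcoef :: "real \<Rightarrow> real \<Rightarrow> real \<Rightarrow> real" where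
  "vcoef x g h = x\<^sup>2 * ((x + 1) * (x + 2) - x\<^sup>2 * g - 3 * x * h) * (x - 2)"

text \<open>A positive multiple of the claimed bound minus \<open>\<sigma> * (E - g * (a + b))\<close>, where \<open>E\<close> is the average of \<open>a + b\<close> after one layer. The
  arguments \<open>w\<close>, \<open>s\<close>, \<open>f\<close> stand for \<open>tr A\<^sup>2 tr B\<^sup>2\<close>, \<open>(tr (AB))\<^sup>2\<close> and \<open>c + 2 e\<close>.\<close>
definition gap :: "real \<Rightarrow> real \<Rightarrow> real \<Rightarrow> real \<Rightarrow> real \<Rightarrow> real \<Rightarrow> real \<Rightarrow> real \<Rightarrow> real \<Rightarrow> real \<Rightarrow> real \<Rightarrow> real \<Rightarrow> real \<Rightarrow> real" where
  "gap \<sigma> x g h N w s p q m a b f = 3 * x * (1 - g) * ((x - 1) * (x\<^sup>2 - 4) * (x + 4)) * (6 * (x + 2) * N + \<sigma> * x * s)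
    - \<sigma> * (2 * x * (vcoef x g h - ucoef x g) * m + 2 * x * (ucoef x g + 2 * vcoef x g h) * q + 2 * x * (2 * ucoef x g + vcoef x g h) * s
       + x * (2 * ucoef x g + vcoef x g h) * w + 4 * x * (vcoef x g h - ucoef x g) * p + x * (vcoef x g h - ucoef x g) * N
       + 3 * x * ((x\<^sup>2 - 1) * (x\<^sup>2 - 4) * (x + 4) - ucoef x g) * (a + b)
       - (vcoef x g h * (x + 3) - ucoef x g * x) * (a + 2 * b + f) - 3 * x * g * ((x\<^sup>2 - 1) * (x\<^sup>2 - 4) * (x + 4)) * (a + b))"

text \<open>The weights are the barycentric coordinates of \<open>(g, h)\<close> with respect to the
  points (3/4, 1/2), (1/2, 0) and (0, 0).\<close>

lemma gap_affine:
  "gap \<sigma> x g h N w s p q m a b f = 2 * h * gap \<sigma> x (3/4) (1/2) N w s p q m a b f + (2 * g - 3 * h) * gap \<sigma> x (1/2) 0 N w s p q m a b f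
     + (1 - 2 * g + h) * gap \<sigma> x 0 0 N w s p q m a b f"
proof -
  have u: "ucoef x g = 2 * h * ucoef x (3/4) + (2 * g - 3 * h) * ucoef x (1/2) + (1 - 2 * g + h) * ucoef x 0"
    by (simp add: ucoef_def field_simps power_numeral_reduce)
  have v: "vcoef x g h = 2 * h * vcoef x (3/4) (1/2) + (2 * g - 3 * h) * vcoef x (1/2) 0 + (1 - 2 * g + h) * vcoef x 0 0"
    by (simp add: vcoef_def field_simps power_numeral_reduce)
  define D where "D = (x\<^sup>2 - 1) * (x\<^sup>2 - 4) * (x + 4)"
  define K where "K = 3 * x * ((x - 1) * (x\<^sup>2 - 4) * (x + 4)) * (6 * (x + 2) * N + \<sigma> * x * s)"
  define c1 where "c1 = - (\<sigma> * (2 * x * q - 2 * x * m + 4 * x * s + 2 * x * w - 4 * x * p - x * N - 3 * x * (a + b) + x * (a + 2 * b + f)))"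
  define c2 where "c2 = - (\<sigma> * (2 * x * m + 4 * x * q + 2 * x * s + x * w + 4 * x * p + x * N - (x + 3) * (a + 2 * b + f)))"
  define L where "L = \<sigma> * 3 * x * D * (a + b)"
  have form: "gap \<sigma> x g h N w s p q m a b f = K * (1 - g) + c1 * ucoef x g + c2 * vcoef x g h - L * (1 - g)" for g h
    unfolding gap_def D_def[symmetric] L_def c1_def c2_def K_def by (simp add: algebra_simps)
  show ?thesis unfolding form u v by (simp add: algebra_simps)
qed

text \<open>The three vertices span the region containing all \<open>((3/4) ^ k, (1/2) ^ k)\<close> with \<open>k \<ge> 1\<close>. At each of them the gap is a combination
  of the constraints whose coefficients are polynomials in \<open>z = x - 4\<close> with nonnegative coefficients.\<close>

context
  fixes N w s p q m a b f z :: real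
  assumes z: "0 \<le> z" and con: "0 \<le> w" "w \<le> N" "0 \<le> s" "s \<le> p" "p \<le> N" "0 \<le> q" "q \<le> w" "\<bar>m\<bar> \<le> q"
    "0 \<le> a" "a \<le> (z + 4) * N" "\<bar>b\<bar> \<le> a" "- ((z + 4) * w) \<le> f" "f \<le> 3 * (z + 4) * w"
begin

lemma con_nonneg:
  "0 \<le> f + (z + 4) * w" "0 \<le> 3 * (z + 4) * w - f" "0 \<le> m + q" "0 \<le> q - m" "0 \<le> q" "0 \<le> w - q" "0 \<le> a + b" "0 \<le> a - b" "0 \<le> a"
  "0 \<le> (z + 4) * N - a" "0 \<le> s" "0 \<le> p - s" "0 \<le> N - p" "0 \<le> w" "0 \<le> N - w" "0 \<le> N"
  using con by (auto simp: abs_le_iff)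

lemma gap_vertex1: "0 \<le> gap 1 (z + 4) (3/4) (1/2) N w s p q m a b f"
proof -
  have "4 * gap 1 (z + 4) (3/4) (1/2) N w s p q m a b f =
      (4608 + 5952 * z + 2880 * z ^ 2 + 660 * z ^ 3 + 72 * z ^ 4 + 3 * z ^ 5) * (f + (z + 4) * w)
      + (36864 + 56832 * z + 34944 * z ^ 2 + 11040 * z ^ 3 + 1896 * z ^ 4 + 168 * z ^ 5 + 6 * z ^ 6) * (w - q)
      + (10368 + 13104 * z + 6180 * z ^ 2 + 1380 * z ^ 3 + 147 * z ^ 4 + 6 * z ^ 5) * (a + b)
      + (4608 + 5952 * z + 2880 * z ^ 2 + 660 * z ^ 3 + 72 * z ^ 4 + 3 * z ^ 5) * ((z + 4) * N - a)
      + (23040 + 34368 * z + 20352 * z ^ 2 + 6180 * z ^ 3 + 1020 * z ^ 4 + 87 * z ^ 5 + 3 * z ^ 6) * (p - s)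
      + (23040 + 34368 * z + 20352 * z ^ 2 + 6180 * z ^ 3 + 1020 * z ^ 4 + 87 * z ^ 5 + 3 * z ^ 6) * (N - p)
      + (73728 + 113664 * z + 69888 * z ^ 2 + 22080 * z ^ 3 + 3792 * z ^ 4 + 336 * z ^ 5 + 12 * z ^ 6) * (N - w)
      + (9216 + 15360 * z + 9360 * z ^ 2 + 2580 * z ^ 3 + 324 * z ^ 4 + 15 * z ^ 5) * N"
    unfolding gap_def ucoef_def vcoef_def by (simp add: field_simps power_numeral_reduce)
  also have "\<dots> \<ge> 0" by (intro add_nonneg_nonneg con_nonneg[THEN mult_nonneg_nonneg[rotated]]) (use z in simp_all)
  finally show ?thesis by simp
qed

lemma gap_vertex2: "0 \<le> gap 1 (z + 4) (1/2) 0 N w s p q m a b f"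
proof -
  have "2 * gap 1 (z + 4) (1/2) 0 N w s p q m a b f =
      (2688 + 4032 * z + 2184 * z ^ 2 + 552 * z ^ 3 + 66 * z ^ 4 + 3 * z ^ 5) * (f + (z + 4) * w)
      + (3072 + 3072 * z + 1152 * z ^ 2 + 192 * z ^ 3 + 12 * z ^ 4) * (m + q)
      + (39936 + 59136 * z + 35520 * z ^ 2 + 11088 * z ^ 3 + 1896 * z ^ 4 + 168 * z ^ 5 + 6 * z ^ 6) * (w - q)
      + (9600 + 11952 * z + 5652 * z ^ 2 + 1284 * z ^ 3 + 141 * z ^ 4 + 6 * z ^ 5) * (a + b)
      + (2688 + 4032 * z + 2184 * z ^ 2 + 552 * z ^ 3 + 66 * z ^ 4 + 3 * z ^ 5) * ((z + 4) * N - a)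
      + (26112 + 36672 * z + 20928 * z ^ 2 + 6228 * z ^ 3 + 1020 * z ^ 4 + 87 * z ^ 5 + 3 * z ^ 6) * (p - s)
      + (19968 + 30528 * z + 18624 * z ^ 2 + 5844 * z ^ 3 + 996 * z ^ 4 + 87 * z ^ 5 + 3 * z ^ 6) * (N - p)
      + (70656 + 107520 * z + 66048 * z ^ 2 + 21024 * z ^ 3 + 3660 * z ^ 4 + 330 * z ^ 5 + 12 * z ^ 6) * (N - w)
      + (24576 + 36480 * z + 20208 * z ^ 2 + 5196 * z ^ 3 + 618 * z ^ 4 + 27 * z ^ 5) * N"
    unfolding gap_def ucoef_def vcoef_def by (simp add: field_simps power_numeral_reduce)
  also have "\<dots> \<ge> 0" by (intro add_nonneg_nonneg con_nonneg[THEN mult_nonneg_nonneg[rotated]]) (use z in simp_all)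
  finally show ?thesis by simp
qed

lemma gap_vertex3: "0 \<le> gap 1 (z + 4) 0 0 N w s p q m a b f"
proof -
  have "1 * gap 1 (z + 4) 0 0 N w s p q m a b f =
      (960 + 672 * z + 156 * z ^ 2 + 12 * z ^ 3) * (3 * (z + 4) * w - f)
      + (7680 + 9216 * z + 4416 * z ^ 2 + 1056 * z ^ 3 + 126 * z ^ 4 + 6 * z ^ 5) * (m + q)
      + (38400 + 55680 * z + 33120 * z ^ 2 + 10344 * z ^ 3 + 1788 * z ^ 4 + 162 * z ^ 5 + 6 * z ^ 6) * (w - q)
      + (3840 + 3888 * z + 1404 * z ^ 2 + 216 * z ^ 3 + 12 * z ^ 4) * (a + b)
      + (960 + 672 * z + 156 * z ^ 2 + 12 * z ^ 3) * a
      + (24576 + 33216 * z + 18528 * z ^ 2 + 5484 * z ^ 3 + 912 * z ^ 4 + 81 * z ^ 5 + 3 * z ^ 6) * (p - s)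
      + (9216 + 14784 * z + 9696 * z ^ 2 + 3372 * z ^ 3 + 660 * z ^ 4 + 69 * z ^ 5 + 3 * z ^ 6) * (N - p)
      + (69120 + 94464 * z + 53568 * z ^ 2 + 16128 * z ^ 3 + 2718 * z ^ 4 + 243 * z ^ 5 + 9 * z ^ 6) * (N - w)
      + (49920 + 87168 * z + 56016 * z ^ 2 + 17388 * z ^ 3 + 2769 * z ^ 4 + 213 * z ^ 5 + 6 * z ^ 6) * N"
    unfolding gap_def ucoef_def vcoef_def by (simp add: field_simps power_numeral_reduce)
  also have "\<dots> \<ge> 0" by (intro add_nonneg_nonneg con_nonneg[THEN mult_nonneg_nonneg[rotated]]) (use z in simp_all)
  finally show ?thesis by simp
qed

lemma gap_vertex4: "0 \<le> gap (-1) (z + 4) (3/4) (1/2) N w s p q m a b f"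
proof -
  have "4 * gap (-1) (z + 4) (3/4) (1/2) N w s p q m a b f =
      (4608 + 5952 * z + 2880 * z ^ 2 + 660 * z ^ 3 + 72 * z ^ 4 + 3 * z ^ 5) * (3 * (z + 4) * w - f)
      + (36864 + 56832 * z + 34944 * z ^ 2 + 11040 * z ^ 3 + 1896 * z ^ 4 + 168 * z ^ 5 + 6 * z ^ 6) * q
      + (10368 + 13104 * z + 6180 * z ^ 2 + 1380 * z ^ 3 + 147 * z ^ 4 + 6 * z ^ 5) * (a - b)
      + (16128 + 20256 * z + 9480 * z ^ 2 + 2100 * z ^ 3 + 222 * z ^ 4 + 9 * z ^ 5) * ((z + 4) * N - a)
      + (23040 + 34368 * z + 20352 * z ^ 2 + 6180 * z ^ 3 + 1020 * z ^ 4 + 87 * z ^ 5 + 3 * z ^ 6) * s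
      + (36864 + 56832 * z + 34944 * z ^ 2 + 11040 * z ^ 3 + 1896 * z ^ 4 + 168 * z ^ 5 + 6 * z ^ 6) * (N - w)
      + (23040 + 37824 * z + 23952 * z ^ 2 + 7440 * z ^ 3 + 1200 * z ^ 4 + 96 * z ^ 5 + 3 * z ^ 6) * N"
    unfolding gap_def ucoef_def vcoef_def by (simp add: field_simps power_numeral_reduce)
  also have "\<dots> \<ge> 0" by (intro add_nonneg_nonneg con_nonneg[THEN mult_nonneg_nonneg[rotated]]) (use z in simp_all)
  finally show ?thesis by simp
qed

lemma gap_vertex5: "0 \<le> gap (-1) (z + 4) (1/2) 0 N w s p q m a b f"
proof -
  have "2 * gap (-1) (z + 4) (1/2) 0 N w s p q m a b f =
      (2688 + 4032 * z + 2184 * z ^ 2 + 552 * z ^ 3 + 66 * z ^ 4 + 3 * z ^ 5) * (3 * (z + 4) * w - f)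
      + (3072 + 3072 * z + 1152 * z ^ 2 + 192 * z ^ 3 + 12 * z ^ 4) * (q - m)
      + (33792 + 52992 * z + 33216 * z ^ 2 + 10704 * z ^ 3 + 1872 * z ^ 4 + 168 * z ^ 5 + 6 * z ^ 6) * q
      + (9600 + 11952 * z + 5652 * z ^ 2 + 1284 * z ^ 3 + 141 * z ^ 4 + 6 * z ^ 5) * (a - b)
      + (16512 + 19872 * z + 9120 * z ^ 2 + 2016 * z ^ 3 + 216 * z ^ 4 + 9 * z ^ 5) * ((z + 4) * N - a)
      + (26112 + 36672 * z + 20928 * z ^ 2 + 6228 * z ^ 3 + 1020 * z ^ 4 + 87 * z ^ 5 + 3 * z ^ 6) * s
      + (6144 + 6144 * z + 2304 * z ^ 2 + 384 * z ^ 3 + 24 * z ^ 4) * (N - p)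
      + (12288 + 26880 * z + 20544 * z ^ 2 + 7632 * z ^ 3 + 1500 * z ^ 4 + 150 * z ^ 5 + 6 * z ^ 6) * (N - w)
      + (38400 + 61248 * z + 37296 * z ^ 2 + 11064 * z ^ 3 + 1674 * z ^ 4 + 120 * z ^ 5 + 3 * z ^ 6) * N"
    unfolding gap_def ucoef_def vcoef_def by (simp add: field_simps power_numeral_reduce)
  also have "\<dots> \<ge> 0" by (intro add_nonneg_nonneg con_nonneg[THEN mult_nonneg_nonneg[rotated]]) (use z in simp_all)
  finally show ?thesis by simp
qed

lemma gap_vertex6: "0 \<le> gap (-1) (z + 4) 0 0 N w s p q m a b f"
proof -
  have "1 * gap (-1) (z + 4) 0 0 N w s p q m a b f =
      (960 + 672 * z + 156 * z ^ 2 + 12 * z ^ 3) * (f + (z + 4) * w)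
      + (7680 + 9216 * z + 4416 * z ^ 2 + 1056 * z ^ 3 + 126 * z ^ 4 + 6 * z ^ 5) * (q - m)
      + (23040 + 37248 * z + 24288 * z ^ 2 + 8232 * z ^ 3 + 1536 * z ^ 4 + 150 * z ^ 5 + 6 * z ^ 6) * q
      + (3840 + 3888 * z + 1404 * z ^ 2 + 216 * z ^ 3 + 12 * z ^ 4) * (a - b)
      + (8640 + 8448 * z + 2964 * z ^ 2 + 444 * z ^ 3 + 24 * z ^ 4) * ((z + 4) * N - a)
      + (24576 + 33216 * z + 18528 * z ^ 2 + 5484 * z ^ 3 + 912 * z ^ 4 + 81 * z ^ 5 + 3 * z ^ 6) * s
      + (15360 + 18432 * z + 8832 * z ^ 2 + 2112 * z ^ 3 + 252 * z ^ 4 + 12 * z ^ 5) * (N - p)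
      + (15360 + 24192 * z + 15264 * z ^ 2 + 4968 * z ^ 3 + 882 * z ^ 4 + 81 * z ^ 5 + 3 * z ^ 6) * w
      + (70656 + 126336 * z + 85728 * z ^ 2 + 28980 * z ^ 3 + 5229 * z ^ 4 + 483 * z ^ 5 + 18 * z ^ 6) * N"
    unfolding gap_def ucoef_def vcoef_def by (simp add: field_simps power_numeral_reduce)
  also have "\<dots> \<ge> 0" by (intro add_nonneg_nonneg con_nonneg[THEN mult_nonneg_nonneg[rotated]]) (use z in simp_all)
  finally show ?thesis by simp
qed

lemma gap_nonneg:
  assumes "0 \<le> h" "3 * h \<le> 2 * g" "2 * g - h \<le> 1" "\<sigma> = 1 \<or> \<sigma> = -1"
  shows "0 \<le> gap \<sigma> (z + 4) g h N w s p q m a b f"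
proof -
  have c: "0 \<le> 2 * h" "0 \<le> 2 * g - 3 * h" "0 \<le> 1 - 2 * g + h" using assms(1-3) by simp_all
  have v: "0 \<le> gap \<sigma> (z + 4) (3/4) (1/2) N w s p q m a b f" "0 \<le> gap \<sigma> (z + 4) (1/2) 0 N w s p q m a b f"
    "0 \<le> gap \<sigma> (z + 4) 0 0 N w s p q m a b f"
    using assms(4) gap_vertex1 gap_vertex2 gap_vertex3 gap_vertex4 gap_vertex5 gap_vertex6 by blast+
  show ?thesis unfolding gap_affine[of \<sigma> _ g h]
    by (rule add_nonneg_nonneg[OF add_nonneg_nonneg[OF mult_nonneg_nonneg[OF c(1) v(1)] mult_nonneg_nonneg[OF c(2) v(2)]] mult_nonneg_nonneg[OF c(3) v(3)]])
qed

end

text \<open>Both inequalities are equalities at \<open>k = 1\<close>, which is the vertex (3/4,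
  1/2). The point (1, 1) of \<open>k = 0\<close> violates the first one.\<close>

lemma powers_in_region:
  assumes "k \<ge> (1::nat)" shows "3 * (1/2) ^ k \<le> 2 * (3/4 :: real) ^ k" "2 * (3/4 :: real) ^ k - (1/2) ^ k \<le> 1"
proof -
  have "3 * (1/2) ^ k \<le> 2 * (3/4 :: real) ^ k \<and> 2 * (3/4 :: real) ^ k - (1/2) ^ k \<le> 1"
    using assms by (induction k rule: dec_induct) auto
  then show "3 * (1/2) ^ k \<le> 2 * (3/4 :: real) ^ k" "2 * (3/4 :: real) ^ k - (1/2) ^ k \<le> 1" by blast+
qed

section \<open>Circuits with several layers\<close>

lemma Re_mult_real: "Re (of_real c * z) = c * Re z"
  by simp

lemma Re_two_mult: "Re (2 * z) = 2 * Re z"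
  by simp

context pauli_system
begin

lemma unitary_M: "unitary d U \<Longrightarrow> U \<in> M"
  unfolding unitary_def by (elim conjE)

lemma unitary_cancel:
  assumes U: "unitary d U" and A: "A \<in> M" shows "adj U * (U * A) = A" "U * (adj U * A) = A"
proof -
  have "adj U * U = 1\<^sub>m d" "U * adj U = 1\<^sub>m d" using U unfolding unitary_def by blast+
  then show "adj U * (U * A) = A" "U * (adj U * A) = A"
    using mult_assoc_M[of "adj U" U A] mult_assoc_M[of U "adj U" A] A unitary_M[OF U] by simp_all
qed

lemma unitary_cj_prod:
  assumes U: "unitary d U" and A: "A \<in> M" "B \<in> M" shows "cj U (A * B) = cj U A * cj U B"
  using unitary_M[OF U] A by (simp add: cj_def unitary_cancel[OF U])

lemma unitary_cj_tr: assumes U: "unitary d U" and A: "A \<in> M" shows "tr (cj U A) = tr A"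
proof -
  note m = unitary_M[OF U]
  have "tr (U * (A * adj U)) = tr ((A * adj U) * U)" by (rule tr_cyc) (use m A in simp_all)
  also have "(A * adj U) * U = A * (adj U * U)" by (rule mult_assoc_M) (use m A in simp_all)
  also have "adj U * U = 1\<^sub>m d" using U unfolding unitary_def by blast
  finally show ?thesis unfolding cj_def one_right_M[OF A] .
qed

lemma adj_cj: "U \<in> M \<Longrightarrow> A \<in> M \<Longrightarrow> adj (cj U A) = cj U (adj A)"
  by (simp add: cj_def)

lemma psd_cj: assumes "psd A" "U \<in> M" shows "psd (cj U A)"
  using psd_conj[OF assms(1) adj_M[OF assms(2)]] unfolding adj_adj cj_def .

definition state_observable :: "complex mat \<Rightarrow> complex mat \<Rightarrow> bool" where
  "state_observable A B \<longleftrightarrow> psd A \<and> tr A = 1 \<and> B \<in> M \<and> adj B = B \<and> tr B = 0"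

lemma state_observableD:
  assumes "state_observable A B" shows "psd A" "tr A = 1" "B \<in> M" "adj B = B" "tr B = 0" "A \<in> M"
  using assms psd_M unfolding state_observable_def by blast+

lemma state_observable_cj:
  assumes U: "unitary d U" and s: "state_observable A B" shows "state_observable (cj U A) (cj U B)"
  using psd_cj[OF _ unitary_M[OF U]] state_observableD[OF s] unitary_M[OF U]
  unfolding state_observable_def by (simp add: unitary_cj_tr[OF U] adj_cj)

lemmas NN_state = NN_def[OF state_observableD(1-4)]
lemmas tt_state = tt_def[OF state_observableD(1-4)]

lemma state_cj_invariants:
  assumes U: "unitary d U" and s: "state_observable A B"
  shows "NN (cj U B) = NN B" "tt (cj U A) (cj U B) = tt A B"
proof -
  note o = state_observableD[OF s] and t = state_observable_cj[OF U s]
  show "NN (cj U B) = NN B" unfolding NN_state[OF s s s s] NN_state[OF t t t t] unitary_cj_prod[OF U o(3,3), symmetric] unitary_cj_tr[OF U mult_M[OF o(3,3)]] ..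
  show "tt (cj U A) (cj U B) = tt A B" unfolding tt_state[OF s s s s] tt_state[OF t t t t] unitary_cj_prod[OF U o(6,3), symmetric] unitary_cj_tr[OF U mult_M[OF o(6,3)]] ..
qed

definition moment :: "complex mat \<Rightarrow> complex mat \<Rightarrow> real" where
  "moment A B = Re (\<Sum>P\<in>S. Th P A B)"

lemma moment_eq: assumes s: "state_observable A B" shows "moment A B = aa A B + bb A B"
  unfolding sum_Th moment_def aa_def[OF state_observableD(1-4)[OF s]] bb_def[OF state_observableD(1-4)[OF s]] by simp

lemma moment_bounds: assumes s: "state_observable A B" shows "0 \<le> moment A B" "moment A B \<le> 2 * real d * NN B"
  using aa_bounds[OF state_observableD(1-4)[OF s]] bb_bounds[OF state_observableD(1-4)[OF s]]
  unfolding moment_eq[OF s] by auto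

lemma tt_le_NN: assumes s: "state_observable A B" shows "(tt A B)\<^sup>2 \<le> NN B"
  using t_le[OF state_observableD(1-4)[OF s]] p_le[OF state_observableD(1-4)[OF s]] by simp

text \<open>Passage to the Heisenberg picture: the gate is moved from state and observable to the
  Pauli operator.\<close>

lemma Th_pull:
  assumes T: "unitary d T" and P: "P \<in> S" and A: "A \<in> M" "B \<in> M"
  shows "Th P (cj T A) (cj T B) = Th (adj T * (P * T)) A B"
proof -
  note m = unitary_M[OF T]
  let ?W = "adj T * (P * T)"
  have W: "?W \<in> M" using m P by simp
  have mv: "P * cj T X = cj T (?W * X)" if X: "X \<in> M" for X
    using m P X by (simp add: cj_def unitary_cancel[OF T])
  have t: "tr (P * cj T X) = tr (?W * X)" if X: "X \<in> M" for X
    unfolding mv[OF X] by (rule unitary_cj_tr[OF T mult_M[OF W X]])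
  have "P * (cj T A * (P * cj T B)) = (P * cj T A) * (P * cj T B)"
    using m P A by (simp only: mult_assoc_M mult_M S_carrier cj_M)
  also have "\<dots> = cj T ((?W * A) * (?W * B))"
    unfolding mv[OF A(1)] mv[OF A(2)] by (rule unitary_cj_prod[OF T mult_M[OF W A(1)] mult_M[OF W A(2)], symmetric])
  also have "(?W * A) * (?W * B) = ?W * (A * (?W * B))" by (rule mult_assoc_M[OF W A(1) mult_M[OF W A(2)]])
  finally have "tr (P * (cj T A * (P * cj T B))) = tr (?W * (A * (?W * B)))"
    using unitary_cj_tr[OF T mult_M[OF W mult_M[OF A(1) mult_M[OF W A(2)]]]] by simp
  then show ?thesis unfolding Th_def t[OF A(1)] t[OF A(2)] by simp
qed

lemma pulled_one: assumes T: "unitary d T" shows "adj T * (1\<^sub>m d * T) = 1\<^sub>m d"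
proof -
  have "adj T * T = 1\<^sub>m d" using T unfolding unitary_def by blast
  then show ?thesis unfolding one_left_M[OF unitary_M[OF T]] .
qed

text \<open>The identity contributes nothing for traceless \<open>B\<close>. It is removed so that
  every remaining \<open>adj T * (V * T)\<close> is a traceless involution, as the kernel
  computations require.\<close>

lemma moment_pull:
  assumes T: "unitary d T" and A: "A \<in> M" and B: "B \<in> M" "tr B = 0"
  shows "moment (cj T A) (cj T B) = Re (\<Sum>V\<in>S - {1\<^sub>m d}. Th (adj T * (V * T)) A B)"
proof -
  have one: "Th (adj T * (1\<^sub>m d * T)) A B = 0"
    unfolding pulled_one[OF T] Th_def one_left_M[OF B(1)] B(2) by simp
  have "(\<Sum>P\<in>S. Th P (cj T A) (cj T B)) = (\<Sum>V\<in>S. Th (adj T * (V * T)) A B)"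
    by (intro sum.cong refl Th_pull[OF T _ A B(1)])
  also have "\<dots> = (\<Sum>V\<in>S - {1\<^sub>m d}. Th (adj T * (V * T)) A B)"
    using one by (simp add: sum.remove[OF finite_S one_S])
  finally show ?thesis unfolding moment_def by simp
qed

text \<open>The contributions of the identity, to be subtracted from the sums over all Pauli
  operators in \<open>T_sums\<close>.\<close>

lemma q_one: "q4 (1\<^sub>m d) = of_nat d ^ 4" "q2 (1\<^sub>m d) = of_nat d ^ 3" "q3 (1\<^sub>m d) = of_nat d ^ 2"
proof -
  have delta: "(\<Sum>P\<in>S. f P) = c" if "\<And>P. P \<in> S \<Longrightarrow> f P = (if P = 1\<^sub>m d then c else 0)" for f and c :: complex
  proof -
    have "(\<Sum>P\<in>S. f P) = (\<Sum>P\<in>S. if P = 1\<^sub>m d then c else 0)" by (intro sum.cong refl that)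
    then show ?thesis using finite_S one_S by simp
  qed
  show "q4 (1\<^sub>m d) = of_nat d ^ 4" unfolding q4_def by (rule delta) (simp add: tr_S)
  show "q2 (1\<^sub>m d) = of_nat d ^ 3" unfolding q2_def by (rule delta) (simp add: tr_S power_numeral_reduce)
  show "q3 (1\<^sub>m d) = of_nat d ^ 2" unfolding q3_def by (rule delta) (simp add: tr_S power_numeral_reduce)
qed

lemma pulled_involution:
  assumes T: "unitary d T" and V: "V \<in> S" defines "W \<equiv> adj T * (V * T)"
  shows "W \<in> M" "W * W = 1\<^sub>m d" "tr W = tr V"
proof -
  note m = unitary_M[OF T]
  show W: "W \<in> M" unfolding W_def using m V by simp
  have "W * W = adj T * T" unfolding W_def using m V by (simp add: unitary_cancel[OF T])
  then show "W * W = 1\<^sub>m d" using T unfolding unitary_def by simp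
  have "tr W = tr ((V * T) * adj T)" unfolding W_def by (rule tr_cyc) (use m V in simp_all)
  also have "(V * T) * adj T = V * (T * adj T)" by (rule mult_assoc_M) (use m V in simp_all)
  also have "T * adj T = 1\<^sub>m d" using T unfolding unitary_def by blast
  finally show "tr W = tr V" using V by simp
qed

end

text \<open>The denominator \<open>D\<close> exceeds the factor in \<open>gap\<close> by
  \<open>x + 1\<close>, which becomes the denominator of the bound. The positive factor that is
  cancelled contains \<open>x\<^sup>2 - 4\<close>.\<close>

lemma slack_of_gap:
  fixes x g h N w s p q m a b f \<sigma> E :: real
  defines "D \<equiv> (x\<^sup>2 - 1) * (x\<^sup>2 - 4) * (x + 4)"
  assumes x: "4 \<le> x" and gap: "0 \<le> gap \<sigma> x g h N w s p q m a b f"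
    and E: "3 * x * D * E = 2 * x * (vcoef x g h - ucoef x g) * m + 2 * x * (ucoef x g + 2 * vcoef x g h) * q + 2 * x * (2 * ucoef x g + vcoef x g h) * s
       + x * (2 * ucoef x g + vcoef x g h) * w + 4 * x * (vcoef x g h - ucoef x g) * p + x * (vcoef x g h - ucoef x g) * N
       + 3 * x * (D - ucoef x g) * (a + b) - (vcoef x g h * (x + 3) - ucoef x g * x) * (a + 2 * b + f)"
  shows "\<sigma> * (E - g * (a + b)) \<le> (1 - g) * ((6 * (x + 2) * N + \<sigma> * x * s) / (x + 1))"
proof -
  define D' where "D' = (x - 1) * (x\<^sup>2 - 4) * (x + 4)"
  have "0 < x\<^sup>2 - 4" using power_mono[of 4 x 2] x by simp
  then have D': "0 < D'" unfolding D'_def using x by simp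
  have DD: "D = (x + 1) * D'" unfolding D_def D'_def by (simp add: algebra_simps power2_eq_square)
  have "gap \<sigma> x g h N w s p q m a b f = 3 * x * (1 - g) * D' * (6 * (x + 2) * N + \<sigma> * x * s) - \<sigma> * (3 * x * D * E - 3 * x * g * D * (a + b))"
    unfolding gap_def D_def[symmetric] D'_def[symmetric] E ..
  also have "\<dots> = 3 * x * D' * ((1 - g) * (6 * (x + 2) * N + \<sigma> * x * s) - (x + 1) * (\<sigma> * (E - g * (a + b))))"
    unfolding DD by (simp add: algebra_simps)
  finally have "0 \<le> 3 * x * D' * ((1 - g) * (6 * (x + 2) * N + \<sigma> * x * s) - (x + 1) * (\<sigma> * (E - g * (a + b))))"
    using gap by simp
  moreover have "0 < 3 * x * D'" using x D' by simp
  ultimately have "0 \<le> (1 - g) * (6 * (x + 2) * N + \<sigma> * x * s) - (x + 1) * (\<sigma> * (E - g * (a + b)))"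
    by (simp only: zero_le_mult_iff) linarith
  then show ?thesis using x by (simp add: field_simps)
qed

context qubits
begin

lemma Re_avg: "Re (avg f) = mean (\<lambda>U. Re (f U))"
proof -
  have "Re (avg f) = (\<Sum>U\<in>GG. Re (f U)) / real (card GG)" unfolding avg_def by (simp add: Re_sum)
  then show ?thesis unfolding mean_def GG_def card_image[OF inj_rep] sum.reindex[OF inj_rep] by simp
qed

definition layer :: "complex mat \<Rightarrow> complex mat \<Rightarrow> complex mat \<Rightarrow> real" where
  "layer T A B = mean (\<lambda>C. moment (cj T (cj C A)) (cj T (cj C B)))"

lemma layer_sum:
  assumes T: "unitary (2 ^ n) T" and A: "A \<in> M" and B: "B \<in> M" "tr B = 0"
  shows "layer T A B = Re (\<Sum>V\<in>paulis n - {1\<^sub>m (2 ^ n)}. avg (\<lambda>U. Th (adj T * (V * T)) (cj U A) (cj U B)))"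
proof -
  have "layer T A B = mean (\<lambda>C. Re (\<Sum>V\<in>paulis n - {1\<^sub>m (2 ^ n)}. Th (adj T * (V * T)) (cj C A) (cj C B)))"
    unfolding layer_def
  proof (rule mean_cong)
    fix C assume C: "C \<in> Cl"
    show "moment (cj T (cj C A)) (cj T (cj C B)) = Re (\<Sum>V\<in>paulis n - {1\<^sub>m (2 ^ n)}. Th (adj T * (V * T)) (cj C A) (cj C B))"
      by (rule moment_pull[OF T]) (use C A B in \<open>simp_all add: cj_tr\<close>)
  qed
  then show ?thesis unfolding Re_avg[symmetric] avg_sum .
qed

lemma layer_zero:
  assumes "state_observable A B" shows "layer (1\<^sub>m (2 ^ n)) A B = moment A B"
proof -
  note s = state_observableD[OF assms]
  have "layer (1\<^sub>m (2 ^ n)) A B = mean (\<lambda>C. moment A B)"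
    unfolding layer_def
  proof (rule mean_cong)
    fix C assume C: "C \<in> Cl"
    then have c: "cj C A \<in> M" "cj C B \<in> M" using s by simp_all
    show "moment (cj (1\<^sub>m (2 ^ n)) (cj C A)) (cj (1\<^sub>m (2 ^ n)) (cj C B)) = moment A B"
      unfolding cj_one[OF c(1)] cj_one[OF c(2)] moment_def sum_Th_cj[OF C s(6,3)] ..
  qed
  then show ?thesis using card_CC_pos by (simp add: mean_def)
qed

text \<open>The bound on the error of one layer, up to the factor \<open>1 - (3/4) ^ k\<close>. It is a unitary invariant, so the errors of successive layers add up to a
  geometric sum.\<close>
definition slack :: "real \<Rightarrow> complex mat \<Rightarrow> complex mat \<Rightarrow> real" where
  "slack \<sigma> A B = (6 * (2 ^ n + 2) * NN B + \<sigma> * 2 ^ n * (tt A B)\<^sup>2) / (2 ^ n + 1)"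

lemma T_hat_0: "T_hat n 0 = 1\<^sub>m (2 ^ n)"
  unfolding T_hat_def by (rule eq_matI) auto

lemma layer_T_identity:
  assumes k: "1 \<le> k" "k \<le> n" and n: "2 \<le> n" and s: "state_observable A B"
  defines "x \<equiv> 2 ^ n :: real" and "g \<equiv> (3/4 :: real) ^ k" and "h \<equiv> (1/2 :: real) ^ k"
  shows "3 * x * ((x\<^sup>2 - 1) * (x\<^sup>2 - 4) * (x + 4)) * layer (T_hat n k) A B =
     2 * x * (vcoef x g h - ucoef x g) * mr A B + 2 * x * (ucoef x g + 2 * vcoef x g h) * qq A B
       + 2 * x * (2 * ucoef x g + vcoef x g h) * (tt A B)\<^sup>2
       + x * (2 * ucoef x g + vcoef x g h) * (ww A * NN B) + 4 * x * (vcoef x g h - ucoef x g) * pp A B + x * (vcoef x g h - ucoef x g) * NN B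
       + 3 * x * ((x\<^sup>2 - 1) * (x\<^sup>2 - 4) * (x + 4) - ucoef x g) * (aa A B + bb A B)
       - (vcoef x g h * (x + 3) - ucoef x g * x) * (aa A B + 2 * bb A B + (cc A B + 2 * ee A B))"
proof -
  let ?T = "T_hat n k" and ?J = "paulis n - {1\<^sub>m (2 ^ n)}"
  note o = state_observableD[OF s]
  define W where "W V = adj ?T * (V * ?T)" for V
  note T = unitary_T_hat[OF k(2)]
  have W1: "W (1\<^sub>m (2 ^ n)) = 1\<^sub>m (2 ^ n)" unfolding W_def by (rule pulled_one[OF T])
  have W: "W V \<in> M" "W V * W V = 1\<^sub>m (2 ^ n)" "tr (W V) = 0" if V: "V \<in> ?J" for V
  proof -
    have v: "V \<in> paulis n" "V \<noteq> 1\<^sub>m (2 ^ n)" using V by blast+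
    note p = pulled_involution[OF T v(1), folded W_def]
    show "W V \<in> M" "W V * W V = 1\<^sub>m (2 ^ n)" by (rule p)+
    show "tr (W V) = 0" unfolding p(3) tr_S[OF v(1)] using v(2) by simp
  qed
  define X where "X = (of_nat (2 ^ n) :: complex)"
  have Xr: "X = of_real x" unfolding X_def x_def by simp
  have X2: "X = 2 ^ n" unfolding X_def by simp
  have pw: "(64 :: complex) ^ n = X ^ 6" "(32 :: complex) ^ n = X ^ 5" "(16 :: complex) ^ n = X ^ 4"
    unfolding X2 power_mult[symmetric] mult.commute[of n] unfolding power_mult by simp_all
  note Ts = T_sums[OF k(2), folded W_def q4_def q2_def q3_def, unfolded pw]
  \<comment> \<open>This is where \<open>1 \<le> k\<close> matters: a single gate makes the
    \<open>q3\<close>-sum over all Pauli operators vanish, so that only the subtracted identity is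
    left.\<close>
  have k0: "(0 :: complex) ^ k = 0" using k(1) by simp
  have rm: "(\<Sum>V\<in>?J. f V) = (\<Sum>V\<in>paulis n. f V) - f (1\<^sub>m (2 ^ n))" for f :: "complex mat \<Rightarrow> complex"
    using sum.remove[OF finite_S one_S, of f] by (simp only: add_diff_cancel_left')
  have q4: "(\<Sum>V\<in>?J. q4 (W V)) = X ^ 4 * (X\<^sup>2 * of_real g - 1)"
    unfolding rm W1 q_one Ts X_def[symmetric] g_def by (simp add: algebra_simps power_numeral_reduce)
  have q2: "(\<Sum>V\<in>?J. q2 (W V)) = X ^ 3 * (X\<^sup>2 * of_real h - 1)"
    unfolding rm W1 q_one Ts X_def[symmetric] h_def by (simp add: algebra_simps power_numeral_reduce)
  have q3: "(\<Sum>V\<in>?J. q3 (W V)) = - X\<^sup>2"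
    unfolding rm W1 q_one Ts X_def[symmetric] k0 by simp
  have card: "of_nat (card ?J) = X\<^sup>2 - 1"
  proof -
    have "card (paulis n) = Suc (card ?J)" by (rule card.remove[OF finite_S one_S])
    then have "of_nat (card (paulis n)) = 1 + (of_nat (card ?J) :: complex)" by (simp only: of_nat_Suc)
    then show ?thesis unfolding card_S X_def by (simp only: add_diff_cancel_left')
  qed
  define D where "D = (x\<^sup>2 - 1) * (x\<^sup>2 - 4) * (x + 4)"
  define u where "u = ucoef x g / D"
  define v where "v = vcoef x g h / D"
  have x4: "4 \<le> x" using power_increasing[OF n, of "2 :: real"] unfolding x_def by simp
  then have x16: "16 \<le> x\<^sup>2" using power_mono[of 4 x 2] by simp
  have D0: "D \<noteq> 0" unfolding D_def using x4 x16 by simp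
  have uD: "u * D = ucoef x g" and vD: "v * D = vcoef x g h" unfolding u_def v_def using D0 by simp_all
  have "u * ((x\<^sup>2 - 1) * (x\<^sup>2 - 4)) * (x + 4) = x\<^sup>2 * (x\<^sup>2 * (1 - g) - 1) * (x + 4)"
    using uD unfolding D_def ucoef_def by (simp only: mult.assoc)
  then have u: "u * ((x\<^sup>2 - 1) * (x\<^sup>2 - 4)) = x\<^sup>2 * (x\<^sup>2 * (1 - g) - 1)" using x4 by simp
  have "v * ((x + 1) * (x + 2) * (x + 4) * (x - 1)) * (x - 2) = v * D"
    unfolding D_def by (simp add: algebra_simps power_numeral_reduce)
  then have "v * ((x + 1) * (x + 2) * (x + 4) * (x - 1)) * (x - 2) = x\<^sup>2 * ((x + 1) * (x + 2) - x\<^sup>2 * g - 3 * x * h) * (x - 2)"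
    unfolding vD vcoef_def .
  then have v: "v * ((x + 1) * (x + 2) * (x + 4) * (x - 1)) = x\<^sup>2 * ((x + 1) * (x + 2) - x\<^sup>2 * g - 3 * x * h)" using x4 by simp
  have uc: "of_real u * ((X\<^sup>2 - 1) * (X\<^sup>2 - 4)) = X\<^sup>2 * (X\<^sup>2 * (1 - of_real g) - 1)"
    unfolding Xr using arg_cong[OF u, of complex_of_real] by simp
  have vc: "of_real v * ((X + 1) * (X + 2) * (X + 4) * (X - 1)) = X\<^sup>2 * ((X + 1) * (X + 2) - X\<^sup>2 * of_real g - 3 * X * of_real h)"
    unfolding Xr using arg_cong[OF v, of complex_of_real] by simp
  define Z where "Z = (\<Sum>V\<in>?J. avg (\<lambda>U. Th (W V) (cj U A) (cj U B)))"
  define y where "y = v * (x + 3) - u * x"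
  have yc: "of_real y = of_real v * (X + 3) - of_real u * X" unfolding y_def Xr by simp
  have tr_AB: "tr (A * B) = of_real (tt A B)" by (rule t_real[OF o(1-4)])
  have tr_AA: "tr (A * A) = of_real (ww A)"
    unfolding ww_def[OF o(1-4)] by (rule herm_tr_real[OF o(6) psd_adj[OF o(1)] o(6) psd_adj[OF o(1)]])
  have tr_BB: "tr (B * B) = of_real (NN B)"
    unfolding NN_def[OF o(1-4)] by (rule herm_tr_real[OF o(3,4) o(3,4)])
  have "3 * X * Z = 2 * X * (of_real v - of_real u) * tr (A * (B * (A * B))) + 2 * X * (of_real u + 2 * of_real v) * tr (A * (A * (B * B)))
     + 2 * X * (2 * of_real u + of_real v) * (tr (A * B) * tr (A * B)) + X * (2 * of_real u + of_real v) * (tr (A * A) * tr (B * B))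
     + 4 * X * (of_real v - of_real u) * tr (A * (B * B)) + X * (of_real v - of_real u) * tr (B * B)
     + 3 * X * (1 - of_real u) * (aT A B + bT A B) - of_real y * (aT A B + 2 * bT A B + cT A B + eT A B + eT' A B)"
    unfolding Z_def X_def
    by (rule one_step_formula[where J="?J" and W=W, OF W card[unfolded X_def] q4[unfolded X_def] q2[unfolded X_def] q3[unfolded X_def]
        uc[unfolded X_def] vc[unfolded X_def] yc[unfolded X_def] o(6,3,2,5)])
  also have "\<dots> = of_real (2 * x * (v - u)) * tr (A * (B * (A * B))) + of_real (2 * x * (u + 2 * v)) * tr (A * (A * (B * B)))
     + of_real (2 * x * (2 * u + v) * (tt A B)\<^sup>2) + of_real (x * (2 * u + v) * (ww A * NN B))
     + of_real (4 * x * (v - u)) * tr (A * (B * B)) + of_real (x * (v - u) * NN B)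
     + of_real (3 * x * (1 - u)) * (aT A B + bT A B) - of_real y * (aT A B + 2 * bT A B + cT A B + eT A B + eT A B)"
    unfolding tr_AB tr_AA tr_BB Xr eT_sym[OF o(1-4)] by (simp add: power2_eq_square)
  finally have "of_real (3 * x) * Z = of_real (2 * x * (v - u)) * tr (A * (B * (A * B))) + of_real (2 * x * (u + 2 * v)) * tr (A * (A * (B * B)))
     + of_real (2 * x * (2 * u + v) * (tt A B)\<^sup>2) + of_real (x * (2 * u + v) * (ww A * NN B))
     + of_real (4 * x * (v - u)) * tr (A * (B * B)) + of_real (x * (v - u) * NN B)
     + of_real (3 * x * (1 - u)) * (aT A B + bT A B) - of_real y * (aT A B + 2 * bT A B + cT A B + eT A B + eT A B)"
    unfolding Xr by simp
  then have "Re (of_real (3 * x) * Z) = Re (of_real (2 * x * (v - u)) * tr (A * (B * (A * B))) + of_real (2 * x * (u + 2 * v)) * tr (A * (A * (B * B)))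
     + of_real (2 * x * (2 * u + v) * (tt A B)\<^sup>2) + of_real (x * (2 * u + v) * (ww A * NN B))
     + of_real (4 * x * (v - u)) * tr (A * (B * B)) + of_real (x * (v - u) * NN B)
     + of_real (3 * x * (1 - u)) * (aT A B + bT A B) - of_real y * (aT A B + 2 * bT A B + cT A B + eT A B + eT A B))"
    by (rule arg_cong)
  then have real: "3 * x * Re Z = 2 * x * (v - u) * mr A B + 2 * x * (u + 2 * v) * qq A B + 2 * x * (2 * u + v) * (tt A B)\<^sup>2
     + x * (2 * u + v) * (ww A * NN B) + 4 * x * (v - u) * pp A B + x * (v - u) * NN B
     + 3 * x * (1 - u) * (aa A B + bb A B) - y * (aa A B + 2 * bb A B + cc A B + ee A B + ee A B)"
    unfolding mr_def[OF o(1-4)] qq_def[OF o(1-4)] pp_def[OF o(1-4)] aa_def[OF o(1-4)] bb_def[OF o(1-4)] cc_def[OF o(1-4)] ee_def[OF o(1-4)]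
    by (simp only: plus_complex.sel minus_complex.sel Re_complex_of_real Re_mult_real Re_two_mult)
  have "layer ?T A B = Re Z" unfolding Z_def W_def by (rule layer_sum[OF T o(6,3,5)])
  then have "3 * x * D * layer ?T A B = D * (3 * x * Re Z)" by simp
  also have "\<dots> = 2 * x * (v * D - u * D) * mr A B + 2 * x * (u * D + 2 * (v * D)) * qq A B + 2 * x * (2 * (u * D) + v * D) * (tt A B)\<^sup>2
     + x * (2 * (u * D) + v * D) * (ww A * NN B) + 4 * x * (v * D - u * D) * pp A B + x * (v * D - u * D) * NN B
     + 3 * x * (D - u * D) * (aa A B + bb A B) - (v * D * (x + 3) - u * D * x) * (aa A B + 2 * bb A B + (cc A B + 2 * ee A B))"
    unfolding real y_def by (simp add: algebra_simps)
  finally show ?thesis unfolding uD vD unfolding D_def .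
qed

text \<open>For \<open>k = 0\<close> the parameters lie outside the triangle, but then a layer is a
  Clifford unitary, which preserves the moment, and both sides are 0. For positive \<open>k\<close>
  the bound is \<open>gap_nonneg\<close> with \<open>z = 2 ^ n - 4\<close>.\<close>

lemma layer_bound:
  assumes k: "k \<le> n" and n: "2 \<le> n" and s: "state_observable A B" and \<sigma>: "\<sigma> = 1 \<or> \<sigma> = -1"
  shows "\<sigma> * (layer (T_hat n k) A B - (3/4) ^ k * moment A B) \<le> (1 - (3/4) ^ k) * slack \<sigma> A B"
proof (cases "k = 0")
  case True
  then show ?thesis by (simp add: T_hat_0 layer_zero[OF s])
next
  case False
  note o = state_observableD[OF s]
  let ?x = "2 ^ n :: real"
  have x: "4 \<le> ?x" using power_increasing[OF n, of "2 :: real"] by simp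
  have N: "0 \<le> NN B" using zero_le_power2 tt_le_NN[OF s] by (rule order_trans)
  note wb = w_bounds[OF o(1-4)]
  have wN: "0 \<le> ww A * NN B" "ww A * NN B \<le> NN B"
    using mult_nonneg_nonneg[OF wb(1) N] mult_right_mono[OF wb(2) N] by simp_all
  have real_x: "real (2 ^ n) = ?x" by simp
  note ab = aa_bounds[OF o(1-4), unfolded real_x] and cw = cc_le[OF o(1-4), unfolded real_x mult.assoc] and e = ee_bounds[OF o(1-4)]
  \<comment> \<open>From \<open>\<bar>ee\<bar> \<le> cc\<close> the sum lies between
    \<open>- cc\<close> and \<open>3 * cc\<close>, and \<open>cc\<close> is at most
    \<open>2 ^ n * ww * NN\<close>.\<close>
  have f: "- (?x * (ww A * NN B)) \<le> cc A B + 2 * ee A B" "cc A B + 2 * ee A B \<le> 3 * ?x * (ww A * NN B)"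
    using e cw by (auto simp: abs_le_iff)
  have "0 \<le> gap \<sigma> (?x - 4 + 4) ((3/4) ^ k) ((1/2) ^ k) (NN B) (ww A * NN B) ((tt A B)\<^sup>2) (pp A B) (qq A B) (mr A B) (aa A B) (bb A B) (cc A B + 2 * ee A B)"
  proof (rule gap_nonneg)
    show "0 \<le> ?x - 4" using x by simp
    show "3 * (1/2) ^ k \<le> 2 * (3/4 :: real) ^ k" "2 * (3/4 :: real) ^ k - (1/2) ^ k \<le> 1"
      using powers_in_region[of k] False by simp_all
    show "- ((?x - 4 + 4) * (ww A * NN B)) \<le> cc A B + 2 * ee A B" "cc A B + 2 * ee A B \<le> 3 * (?x - 4 + 4) * (ww A * NN B)"
      "aa A B \<le> (?x - 4 + 4) * NN B"
      using f ab by simp_all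
  qed (use wN t_le[OF o(1-4)] p_le[OF o(1-4)] q_bounds[OF o(1-4)] m_bounds[OF o(1-4)] ab(1) bb_bounds[OF o(1-4)] \<sigma> in simp_all)
  then have "0 \<le> gap \<sigma> ?x ((3/4) ^ k) ((1/2) ^ k) (NN B) (ww A * NN B) ((tt A B)\<^sup>2) (pp A B) (qq A B) (mr A B) (aa A B) (bb A B) (cc A B + 2 * ee A B)"
    by simp
  then show ?thesis unfolding slack_def moment_eq[OF s]
    by (rule slack_of_gap[OF x _ layer_T_identity[OF _ k n s]]) (use False in simp)
qed

lemma slack_cj: "unitary (2 ^ n) U \<Longrightarrow> state_observable A B \<Longrightarrow> slack \<sigma> (cj U A) (cj U B) = slack \<sigma> A B"
  unfolding slack_def by (simp only: state_cj_invariants)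

lemma mean_cmult: "mean (\<lambda>U. c * f U) = c * mean f"
  unfolding mean_def by (simp add: sum_distrib_left)

section \<open>The measurement and the passage to several layers\<close>

definition readout :: "complex mat \<Rightarrow> complex mat \<Rightarrow> complex mat \<Rightarrow> real" where
  "readout U A B = (\<Sum>b<2 ^ n. Re (cj U A $$ (b,b)) * Re (cj U B $$ (b,b)))"

lemma readout_zset:
  assumes A: "A \<in> M" "adj A = A" and B: "B \<in> M" "adj B = B" and U: "U \<in> M"
  shows "of_real (2 ^ n * readout U A B) = (\<Sum>P\<in>zset n. tr (P * cj U A) * tr (P * cj U B))"
proof -
  have diag: "X $$ (b,b) = of_real (Re (X $$ (b,b)))" if "X \<in> M" "adj X = X" "b < 2 ^ n" for X b
    using adj_index[of b X b] that by (simp add: complex_eq_iff)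
  have m: "cj U A \<in> M" "cj U B \<in> M" using U A B by simp_all
  have h: "adj (cj U A) = cj U A" "adj (cj U B) = cj U B" unfolding adj_cj[OF U A(1)] adj_cj[OF U B(1)] A(2) B(2) by (rule refl)+
  have "(\<Sum>P\<in>zset n. tr (P * cj U A) * tr (P * cj U B)) = 2 ^ n * (\<Sum>b<2 ^ n. cj U A $$ (b,b) * cj U B $$ (b,b))"
    by (rule diagonal_zset[OF m, symmetric])
  also have "(\<Sum>b<2 ^ n. cj U A $$ (b,b) * cj U B $$ (b,b)) = of_real (readout U A B)"
    unfolding readout_def of_real_sum of_real_mult by (intro sum.cong refl arg_cong2[where f="(*)"] diag m h) simp_all
  finally show ?thesis by simp
qed

text \<open>By \<open>readout_zset\<close> the squared readout is a double sum over diagonal Pauli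
  operators, which commute, so its mean is given by \<open>commuting_second_moment\<close>.\<close>

lemma mean_readout:
  assumes n: "1 \<le> n" and s: "state_observable A B"
  shows "(2 ^ n + 1) * (2 ^ n + 2) * (2 ^ n * mean (\<lambda>U. (readout U A B)\<^sup>2)) = moment A B + 2 ^ n * (tt A B)\<^sup>2"
proof -
  note o = state_observableD[OF s]
  note xi = xi_def[OF o(6,3,5)] and kp = kpair_def[OF o(6,3,5)]
  let ?x = "2 ^ n :: real"
  have "of_real (mean (\<lambda>U. (?x * readout U A B)\<^sup>2)) = avg (\<lambda>U. (of_real (?x * readout U A B))\<^sup>2)"
    unfolding of_real_mean by simp
  also have "\<dots> = avg (\<lambda>U. \<Sum>P\<in>zset n. \<Sum>Q\<in>zset n. xi A B U P * xi A B U Q)"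
  proof (rule avg_cong)
    fix U assume "U \<in> Cl"
    then have U: "U \<in> M" by simp
    show "(of_real (?x * readout U A B))\<^sup>2 = (\<Sum>P\<in>zset n. \<Sum>Q\<in>zset n. xi A B U P * xi A B U Q)"
      unfolding readout_zset[OF o(6) psd_adj[OF o(1)] o(3,4) U] xi power2_eq_square sum_product ..
  qed
  also have "\<dots> = (\<Sum>P\<in>zset n. \<Sum>Q\<in>zset n. kpair A B P Q)" unfolding avg_sum kp ..
  finally have k: "(\<Sum>P\<in>zset n. \<Sum>Q\<in>zset n. kpair A B P Q) = of_real (?x\<^sup>2 * mean (\<lambda>U. (readout U A B)\<^sup>2))"
    unfolding power_mult_distrib mean_cmult by (rule sym)
  have com: "chi P Q = 1" if "P \<in> zset n" "Q \<in> zset n" for P Q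
    unfolding chi_def using zset_comm[OF that] by simp
  have two: "2 \<le> (2 :: nat) ^ n" using power_increasing[OF n, of "2 :: nat"] by simp
  have "(of_nat (2 ^ n) + 1) * (of_nat (2 ^ n) + 2) * (\<Sum>P\<in>zset n. \<Sum>Q\<in>zset n. kpair A B P Q) =
      of_nat (2 ^ n) * (aT A B + bT A B + of_nat (2 ^ n) * (tr (A * B) * tr (A * B)))"
    by (rule commuting_second_moment[OF o(6,3,5) zset_paulis one_zset card_zset]) (erule (1) com, rule two)
  then have "of_real ((?x + 1) * (?x + 2) * (?x\<^sup>2 * mean (\<lambda>U. (readout U A B)\<^sup>2))) =
      of_real ?x * (aT A B + bT A B) + of_real (?x\<^sup>2 * (tt A B)\<^sup>2)"
    unfolding k t_real[OF o(1-4)] by (simp add: power2_eq_square algebra_simps)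
  then have "Re (of_real ((?x + 1) * (?x + 2) * (?x\<^sup>2 * mean (\<lambda>U. (readout U A B)\<^sup>2)))) =
      Re (of_real ?x * (aT A B + bT A B) + of_real (?x\<^sup>2 * (tt A B)\<^sup>2))"
    by (rule arg_cong)
  then have "(?x + 1) * (?x + 2) * (?x\<^sup>2 * mean (\<lambda>U. (readout U A B)\<^sup>2)) = ?x * moment A B + ?x\<^sup>2 * (tt A B)\<^sup>2"
    unfolding plus_complex.sel(1) Re_mult_real Re_complex_of_real moment_def sum_Th .
  then have "?x * ((?x + 1) * (?x + 2) * (?x * mean (\<lambda>U. (readout U A B)\<^sup>2))) = ?x * (moment A B + ?x * (tt A B)\<^sup>2)"
    by (simp add: power2_eq_square algebra_simps)
  then show ?thesis by simp
qed

lemma readout_cj: "C \<in> M \<Longrightarrow> Y \<in> M \<Longrightarrow> A \<in> M \<Longrightarrow> B \<in> M \<Longrightarrow> readout (C * Y) A B = readout C (cj Y A) (cj Y B)"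
  unfolding readout_def by (simp only: cj_mult)

text \<open>For a traceless observable the inverse measurement channel is multiplication by
  \<open>2 ^ n + 1\<close>.\<close>

lemma integrand_readout:
  assumes U: "U \<in> M" and A: "A \<in> M" and B: "B \<in> M" "tr B = 0"
  shows "(\<Sum>b<2 ^ n. Re ((U * A * adj U) $$ (b,b)) * Re ((U * Minv n B * adj U) $$ (b,b)))\<^sup>2 = (2 ^ n + 1)\<^sup>2 * (readout U A B)\<^sup>2"
proof -
  have M': "Minv n B = of_real (2 ^ n + 1) \<cdot>\<^sub>m B"
    unfolding Minv_def B(2) using B(1) by (intro eq_matI) auto
  have a: "U * A * adj U = cj U A" unfolding cj_def using U A by (simp only: mult_assoc_M adj_M)
  have "U * Minv n B * adj U = U * (Minv n B * adj U)"
    by (rule mult_assoc_M[OF U _ adj_M[OF U]]) (unfold M', rule smult_M[OF B(1)])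
  also have "\<dots> = of_real (2 ^ n + 1) \<cdot>\<^sub>m cj U B"
    unfolding M' cj_def smult_left_M[OF B(1) adj_M[OF U]] by (rule smult_right_M[OF U mult_M[OF B(1) adj_M[OF U]]])
  finally have b: "U * Minv n B * adj U = of_real (2 ^ n + 1) \<cdot>\<^sub>m cj U B" .
  have c: "cj U B \<in> M" using U B by simp
  have "(\<Sum>b<2 ^ n. Re ((U * A * adj U) $$ (b,b)) * Re ((U * Minv n B * adj U) $$ (b,b))) = (2 ^ n + 1) * readout U A B"
    unfolding readout_def sum_distrib_left
  proof (intro sum.cong refl)
    fix i :: nat assume "i \<in> {..<2 ^ n}"
    then have "(of_real (2 ^ n + 1) \<cdot>\<^sub>m cj U B) $$ (i,i) = of_real (2 ^ n + 1) * cj U B $$ (i,i)" using c by (subst index_smult_mat) auto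
    then show "Re ((U * A * adj U) $$ (i,i)) * Re ((U * Minv n B * adj U) $$ (i,i)) = (2 ^ n + 1) * (Re (cj U A $$ (i,i)) * Re (cj U B $$ (i,i)))"
      unfolding a b by (simp only: Re_mult_real mult.left_commute)
  qed
  then show ?thesis by (simp only: power_mult_distrib)
qed

text \<open>The mean of \<open>moment\<close> before the last Clifford unitary is applied. For \<open>l = 0\<close> no layer precedes it.\<close>
definition layered :: "nat \<Rightarrow> nat \<Rightarrow> complex mat \<Rightarrow> complex mat \<Rightarrow> real" where
  "layered k l A B = (case l of 0 \<Rightarrow> moment A B
     | Suc l' \<Rightarrow> ens_expect n k l' (\<lambda>U. moment (cj (T_hat n k * U) A) (cj (T_hat n k * U) B)))"

lemma mean_integrand:
  assumes n: "1 \<le> n" and Y: "unitary (2 ^ n) Y" and s: "state_observable A B"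
  shows "mean (\<lambda>C. (\<Sum>b<2 ^ n. Re ((C * Y * A * adj (C * Y)) $$ (b,b)) * Re ((C * Y * Minv n B * adj (C * Y)) $$ (b,b)))\<^sup>2) =
     (2 ^ n + 1) / (2 ^ n * (2 ^ n + 2)) * moment (cj Y A) (cj Y B) + (2 ^ n + 1) / (2 ^ n + 2) * (tt A B)\<^sup>2"
proof -
  note o = state_observableD[OF s]
  let ?x = "2 ^ n :: real" and ?m = "mean (\<lambda>C. (readout C (cj Y A) (cj Y B))\<^sup>2)"
  have "mean (\<lambda>C. (\<Sum>b<2 ^ n. Re ((C * Y * A * adj (C * Y)) $$ (b,b)) * Re ((C * Y * Minv n B * adj (C * Y)) $$ (b,b)))\<^sup>2) =
      mean (\<lambda>C. (?x + 1)\<^sup>2 * (readout C (cj Y A) (cj Y B))\<^sup>2)"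
  proof (rule mean_cong)
    fix C assume "C \<in> Cl"
    then have C: "C \<in> M" by simp
    show "(\<Sum>b<2 ^ n. Re ((C * Y * A * adj (C * Y)) $$ (b,b)) * Re ((C * Y * Minv n B * adj (C * Y)) $$ (b,b)))\<^sup>2 =
        (?x + 1)\<^sup>2 * (readout C (cj Y A) (cj Y B))\<^sup>2"
      unfolding integrand_readout[OF mult_M[OF C unitary_M[OF Y]] o(6,3,5)] readout_cj[OF C unitary_M[OF Y] o(6,3)] ..
  qed
  also have "\<dots> = (?x + 1)\<^sup>2 * ?m" by (rule mean_cmult)
  also have "\<dots> = (?x + 1) / (?x * (?x + 2)) * ((?x + 1) * (?x + 2) * (?x * ?m))"
  proof -
    have "?x * (?x + 2) \<noteq> 0" by (simp add: add_pos_pos[THEN less_imp_neq, symmetric])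
    then show ?thesis unfolding times_divide_eq_left by (intro nonzero_eq_divide_eq[THEN iffD2]) (simp_all add: algebra_simps power2_eq_square)
  qed
  also have "\<dots> = (?x + 1) / (?x * (?x + 2)) * (moment (cj Y A) (cj Y B) + ?x * (tt A B)\<^sup>2)"
    unfolding mean_readout[OF n state_observable_cj[OF Y s]] state_cj_invariants[OF Y s] ..
  also have "\<dots> = (?x + 1) / (?x * (?x + 2)) * moment (cj Y A) (cj Y B) + (?x + 1) / (?x + 2) * (tt A B)\<^sup>2"
    unfolding distrib_left[of "(?x + 1) / (?x * (?x + 2))"] by simp
  finally show ?thesis .
qed

text \<open>The second moment contains \<open>(tt A B)\<^sup>2\<close> with weight
  \<open>(2 ^ n + 1) / (2 ^ n + 2)\<close>, slightly less than the squared mean that is subtracted;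
  the difference is the last term.\<close>

lemma V_star_layered:
  assumes n: "1 \<le> n" and k: "k \<le> n" and s: "state_observable A B"
  shows "V_star n k l B A = (2 ^ n + 1) / (2 ^ n * (2 ^ n + 2)) * layered k l A B - (tt A B)\<^sup>2 / (2 ^ n + 2)"
proof -
  note o = state_observableD[OF s]
  let ?x = "2 ^ n :: real" and ?\<kappa> = "(2 ^ n + 1) / (2 ^ n * (2 ^ n + 2)) :: real" and ?t = "(tt A B)\<^sup>2"
  define F where "F U = (\<Sum>b<2 ^ n. Re ((U * A * adj U) $$ (b,b)) * Re ((U * Minv n B * adj U) $$ (b,b)))\<^sup>2" for U
  note mi = mean_integrand[OF n _ s, folded F_def]
  have one: "unitary (2 ^ n) (1\<^sub>m (2 ^ n))" by (rule Cl_unitary'[OF one_Cl])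
  have "ens_expect n k l F = ?\<kappa> * layered k l A B + (?x + 1) / (?x + 2) * ?t"
  proof (cases l)
    case 0
    have "mean F = mean (\<lambda>C. F (C * 1\<^sub>m (2 ^ n)))" by (rule mean_cong) (simp only: one_right_M Cl_M)
    then show ?thesis unfolding 0 ens_0 layered_def mi[OF one] cj_one[OF o(6)] cj_one[OF o(3)] by simp
  next
    case (Suc l')
    have "ens_expect n k l F = ens_expect n k l' (\<lambda>U. ?\<kappa> * moment (cj (T_hat n k * U) A) (cj (T_hat n k * U) B) + (?x + 1) / (?x + 2) * ?t)"
      unfolding Suc ens_Suc
    proof (rule ens_cong[OF k])
      fix U assume U: "unitary (2 ^ n) U"
      have "mean (\<lambda>C. F (C * T_hat n k * U)) = mean (\<lambda>C. F (C * (T_hat n k * U)))"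
        by (rule mean_cong) (simp only: mult_assoc_M Cl_M unitary_M[OF U] unitary_M[OF unitary_T_hat[OF k]])
      then show "mean (\<lambda>C. F (C * T_hat n k * U)) = ?\<kappa> * moment (cj (T_hat n k * U) A) (cj (T_hat n k * U) B) + (?x + 1) / (?x + 2) * ?t"
        unfolding mi[OF unitary_mult[OF unitary_T_hat[OF k] U]] .
    qed
    then show ?thesis unfolding ens_affine layered_def Suc by simp
  qed
  moreover have "Re (tr (B * A)) = tt A B" unfolding tr_cyc[OF o(3,6)] t_real[OF o(1-4)] by simp
  moreover have "(?x + 1) / (?x + 2) * ?t - ?t = - (?t / (?x + 2))"
  proof -
    have "0 < ?x + 2" by (simp add: add_pos_pos)
    then show ?thesis by (simp add: field_simps)
  qed
  ultimately show ?thesis unfolding V_star_def F_def[symmetric] by simp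
qed

lemma layered_Suc:
  assumes k: "k \<le> n" and s: "state_observable A B"
  shows "layered k (Suc 0) A B = layer (T_hat n k) A B"
    and "layered k (Suc (Suc l)) A B = ens_expect n k l (\<lambda>U. layer (T_hat n k) (cj (T_hat n k * U) A) (cj (T_hat n k * U) B))"
proof -
  note o = state_observableD[OF s]
  let ?T = "T_hat n k"
  note T = unitary_M[OF unitary_T_hat[OF k]]
  show "layered k (Suc 0) A B = layer ?T A B"
    unfolding layered_def layer_def by (simp only: nat.case ens_0) (rule mean_cong, simp only: cj_mult T Cl_M o)
  have "ens_expect n k (Suc l) (\<lambda>U. moment (cj (?T * U) A) (cj (?T * U) B)) =
      ens_expect n k l (\<lambda>U. layer ?T (cj (?T * U) A) (cj (?T * U) B))"
    unfolding ens_Suc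
  proof (rule ens_cong[OF k])
    fix U assume "unitary (2 ^ n) U"
    then have U: "U \<in> M" by (rule unitary_M)
    show "mean (\<lambda>C. moment (cj (?T * (C * ?T * U)) A) (cj (?T * (C * ?T * U)) B)) = layer ?T (cj (?T * U) A) (cj (?T * U) B)"
      unfolding layer_def by (rule mean_cong) (simp only: cj_mult T U Cl_M o mult_M mult_assoc_M cj_M)
  qed
  then show "layered k (Suc (Suc l)) A B = ens_expect n k l (\<lambda>U. layer ?T (cj (?T * U) A) (cj (?T * U) B))"
    unfolding layered_def by simp
qed

text \<open>\<open>layer_bound\<close> is averaged over the part of the circuit that precedes the
  layer. Unitary invariance keeps \<open>slack\<close> constant in this average.\<close>

lemma layered_step:
  assumes k: "k \<le> n" and n: "2 \<le> n" and s: "state_observable A B" and \<sigma>: "\<sigma> = 1 \<or> \<sigma> = -1"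
  shows "\<sigma> * (layered k (Suc l) A B - (3/4) ^ k * layered k l A B) \<le> (1 - (3/4) ^ k) * slack \<sigma> A B"
proof (cases l)
  case 0
  have "layered k 0 A B = moment A B" unfolding layered_def by simp
  then show ?thesis using layer_bound[OF k n s \<sigma>] unfolding 0 layered_Suc[OF k s] by simp
next
  case (Suc l')
  let ?T = "T_hat n k" and ?g = "(3/4 :: real) ^ k"
  have "ens_expect n k l' (\<lambda>U. \<sigma> * layer ?T (cj (?T * U) A) (cj (?T * U) B) + 0) \<le>
      ens_expect n k l' (\<lambda>U. (\<sigma> * ?g) * moment (cj (?T * U) A) (cj (?T * U) B) + (1 - ?g) * slack \<sigma> A B)"
  proof (rule ens_mono[OF k])
    fix U assume "unitary (2 ^ n) U"
    then have u: "unitary (2 ^ n) (?T * U)" by (rule unitary_mult[OF unitary_T_hat[OF k]])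
    show "\<sigma> * layer ?T (cj (?T * U) A) (cj (?T * U) B) + 0 \<le> (\<sigma> * ?g) * moment (cj (?T * U) A) (cj (?T * U) B) + (1 - ?g) * slack \<sigma> A B"
      using layer_bound[OF k n state_observable_cj[OF u s] \<sigma>] unfolding slack_cj[OF u s] by (simp add: algebra_simps)
  qed
  then have "\<sigma> * layered k (Suc l) A B \<le> (\<sigma> * ?g) * layered k l A B + (1 - ?g) * slack \<sigma> A B"
    unfolding ens_affine Suc layered_Suc(2)[OF k s] unfolding layered_def by simp
  then show ?thesis by (simp add: algebra_simps)
qed

text \<open>The errors accumulate as \<open>(1 - g) + g * (1 - G) = 1 - g * G\<close>, so the bound
  never exceeds \<open>slack\<close>, whatever the number of layers.\<close>

lemma layered_bound:
  assumes k: "k \<le> n" and n: "2 \<le> n" and s: "state_observable A B" and \<sigma>: "\<sigma> = 1 \<or> \<sigma> = -1"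
  shows "\<sigma> * (layered k l A B - (3/4) ^ (k * l) * moment A B) \<le> (1 - (3/4) ^ (k * l)) * slack \<sigma> A B"
proof (induction l)
  case 0
  then show ?case by (simp add: layered_def)
next
  case (Suc l)
  define g where "g = (3/4 :: real) ^ k"
  define G where "G = (3/4 :: real) ^ (k * l)"
  have g: "0 \<le> g" unfolding g_def by simp
  have p: "(3/4 :: real) ^ (k * Suc l) = g * G" unfolding g_def G_def by (simp add: power_add)
  have "\<sigma> * (layered k (Suc l) A B - g * G * moment A B) = \<sigma> * (layered k (Suc l) A B - g * layered k l A B) + g * (\<sigma> * (layered k l A B - G * moment A B))"
    by (simp add: algebra_simps)
  also have "\<dots> \<le> (1 - g) * slack \<sigma> A B + g * ((1 - G) * slack \<sigma> A B)"
    by (rule add_mono[OF layered_step[OF k n s \<sigma>, folded g_def] mult_left_mono[OF Suc.IH[folded G_def] g]])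
  also have "\<dots> = (1 - g * G) * slack \<sigma> A B" by (simp add: algebra_simps)
  finally show ?case unfolding p .
qed

lemma layered_trivial_bounds:
  assumes k: "k \<le> n" and s: "state_observable A B"
  shows "0 \<le> layered k l A B" "layered k l A B \<le> 2 * 2 ^ n * NN B"
proof -
  have m: "0 \<le> moment (cj U A) (cj U B)" "moment (cj U A) (cj U B) \<le> 2 * 2 ^ n * NN B" if U: "unitary (2 ^ n) U" for U
    using moment_bounds[OF state_observable_cj[OF U s]] unfolding state_cj_invariants[OF U s] by simp_all
  have const: "ens_expect n k l' (\<lambda>U. e) = e" for l' e using ens_affine[of k l' 0 "\<lambda>_. 0" e] by simp
  show "0 \<le> layered k l A B"
  proof (cases l)
    case (Suc l')
    have "ens_expect n k l' (\<lambda>U. 0) \<le> ens_expect n k l' (\<lambda>U. moment (cj (T_hat n k * U) A) (cj (T_hat n k * U) B))"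
      by (rule ens_mono[OF k m(1)[OF unitary_mult[OF unitary_T_hat[OF k]]]])
    then show ?thesis unfolding const layered_def Suc by simp
  qed (use moment_bounds[OF s] in \<open>simp add: layered_def\<close>)
  show "layered k l A B \<le> 2 * 2 ^ n * NN B"
  proof (cases l)
    case (Suc l')
    have "ens_expect n k l' (\<lambda>U. moment (cj (T_hat n k * U) A) (cj (T_hat n k * U) B)) \<le> ens_expect n k l' (\<lambda>U. 2 * 2 ^ n * NN B)"
      by (rule ens_mono[OF k m(2)[OF unitary_mult[OF unitary_T_hat[OF k]]]])
    then show ?thesis unfolding const layered_def Suc by simp
  qed (use moment_bounds[OF s] in \<open>simp add: layered_def\<close>)
qed

lemma V_tri_moment:
  assumes s: "state_observable A B"
  shows "V_tri n B A = (2 ^ n + 1) / (2 ^ n * (2 ^ n + 2)) * moment A B"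
proof -
  note o = state_observableD[OF s]
  note al = al[OF o(1-4)] and be = be[OF o(1-4)]
  have sw: "tr (X * P) = tr (P * X)" if "X \<in> M" "P \<in> paulis n" for X P by (rule tr_cyc[OF that(1) S_carrier[OF that(2)]])
  have Xi: "Re (tr (A * P) * tr (B * P)) = al A P * be B P" if P: "P \<in> paulis n" for P
    unfolding sw[OF o(6) P] sw[OF o(3) P] al[OF P] be[OF P] by simp
  have Xt: "tr (A * P * B * P) = tr (P * (A * (P * B)))" if P: "P \<in> paulis n" for P
  proof -
    note p = S_carrier[OF P]
    have e: "A * P * B = A * (P * B)" by (rule mult_assoc_M[OF o(6) p o(3)])
    show ?thesis unfolding e by (rule tr_cyc[OF mult_M[OF o(6) mult_M[OF p o(3)]] p])
  qed
  have "(\<Sum>ps\<in>pauli_idx n. (Xi n A B ps)\<^sup>2) = (\<Sum>P\<in>paulis n. (Re (tr (A * P) * tr (B * P)))\<^sup>2)"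
    unfolding Xi_def by (rule sum_pauli_idx)
  also have "\<dots> = aa A B" unfolding aa_eq[OF o(1-4)] by (intro sum.cong refl) (simp only: Xi power_mult_distrib)
  finally have 1: "(\<Sum>ps\<in>pauli_idx n. (Xi n A B ps)\<^sup>2) = aa A B" .
  have "(\<Sum>ps\<in>pauli_idx n. Xi_tilde n A B ps * Xi n A B ps) =
      (\<Sum>P\<in>paulis n. Re (tr (A * P * B * P)) * Re (tr (A * P) * tr (B * P)))"
    unfolding Xi_tilde_def Xi_def by (rule sum_pauli_idx)
  also have "\<dots> = bb A B" unfolding bb_def[OF o(1-4)] bT_def Re_sum
  proof (intro sum.cong refl)
    fix P assume P: "P \<in> paulis n"
    have e: "tr (P * A) * tr (P * B) = of_real (al A P * be B P)" unfolding al[OF P] be[OF P] by simp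
    show "Re (tr (A * P * B * P)) * Re (tr (A * P) * tr (B * P)) = Re (tr (P * (A * (P * B))) * (tr (P * A) * tr (P * B)))"
      unfolding e Xi[OF P] Xt[OF P] mult.commute[of _ "of_real _"] Re_mult_real by (rule mult.commute)
  qed
  finally have 2: "(\<Sum>ps\<in>pauli_idx n. Xi_tilde n A B ps * Xi n A B ps) = bb A B" .
  show ?thesis unfolding V_tri_def Let_def 1 2 moment_eq[OF s] by simp
qed

lemma state_observable_density:
  assumes A: "density_op (2 ^ n) A" and B: "hermitian (2 ^ n) B" "tr B = 0" shows "state_observable A B"
proof -
  have m: "A \<in> M" "adj A = A" and q: "\<And>v. v \<in> carrier_vec (2 ^ n) \<Longrightarrow> 0 \<le> Re (\<Sum>i<2 ^ n. cnj (v $ i) * (A *\<^sub>v v) $ i)" and t: "tr A = 1"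
    using A unfolding density_op_def hermitian_def by blast+
  have "psd A"
  proof (rule psdI[OF m])
    fix v :: "nat \<Rightarrow> complex"
    let ?v = "vec (2 ^ n) v"
    have "qform (2 ^ n) (\<lambda>a b. A $$ (a,b)) v = (\<Sum>i<2 ^ n. cnj (?v $ i) * (A *\<^sub>v ?v) $ i)"
      unfolding qform_def
    proof (intro sum.cong refl)
      fix a :: nat assume "a \<in> {..<2 ^ n}"
      then have a: "a < 2 ^ n" by simp
      have "(A *\<^sub>v ?v) $ a = (\<Sum>b<2 ^ n. A $$ (a,b) * v b)"
        using a m(1) by (simp add: scalar_prod_def atLeast0LessThan)
      then show "(\<Sum>b<2 ^ n. cnj (v a) * A $$ (a,b) * v b) = cnj (?v $ a) * (A *\<^sub>v ?v) $ a"
        using a by (simp add: sum_distrib_left mult.assoc)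
    qed
    then show "0 \<le> Re (qform (2 ^ n) (\<lambda>a b. A $$ (a,b)) v)" using q[OF vec_carrier] by simp
  qed
  then show ?thesis using B t unfolding state_observable_def hermitian_def by blast
qed

lemma NN_hs_norm: assumes s: "state_observable A B" shows "hs_norm_sq B = NN B"
proof -
  note o = state_observableD[OF s]
  have "NN B = Re (\<Sum>i<2 ^ n. \<Sum>j<2 ^ n. B $$ (i,j) * B $$ (j,i))"
    unfolding NN_state[OF s s s s] tr_mult[OF o(3,3)] ..
  also have "\<dots> = (\<Sum>i<2 ^ n. \<Sum>j<2 ^ n. (cmod (B $$ (i,j)))\<^sup>2)"
    unfolding Re_sum
  proof (intro sum.cong refl)
    fix i j :: nat assume "i \<in> {..<2 ^ n}" "j \<in> {..<2 ^ n}"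
    then have "B $$ (j,i) = cnj (B $$ (i,j))" using adj_index[of j B i] o(3,4) by simp
    then show "Re (B $$ (i,j) * B $$ (j,i)) = (cmod (B $$ (i,j)))\<^sup>2"
      unfolding cmod_power2 by (simp add: power2_eq_square)
  qed
  finally show ?thesis using o(3) unfolding hs_norm_sq_def by simp
qed

text \<open>The term \<open>- t / (x + 2)\<close> of \<open>V_star_layered\<close> shifts the
  difference downwards. The two versions of \<open>slack\<close> allow
  \<open>6 / x * N + t / (x + 2)\<close> above and \<open>6 / x * N - t / (x + 2)\<close> below, so
  after the shift the bound is \<open>6 / x * N\<close> on both sides.\<close>

lemma V_star_bound:
  assumes n: "1 \<le> n" and k: "k \<le> n" and s: "state_observable A B"
  shows "\<bar>V_star n k l B A - (3/4) ^ (k * l) * V_tri n B A\<bar> \<le> 6 / 2 ^ n * NN B"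
proof -
  define x where "x = (2 :: real) ^ n"
  define G where "G = (3/4 :: real) ^ (k * l)"
  define t where "t = (tt A B)\<^sup>2"
  define N where "N = NN B"
  define m where "m = moment A B"
  define L where "L = layered k l A B"
  define \<kappa> where "\<kappa> = (x + 1) / (x * (x + 2))"
  have G: "0 \<le> G" "G \<le> 1" unfolding G_def by (simp_all add: power_le_one)
  have x: "2 \<le> x" using power_increasing[OF n, of "2 :: real"] unfolding x_def by simp
  have t: "0 \<le> t" "t \<le> N" unfolding t_def N_def using tt_le_NN[OF s] by simp_all
  have tx: "0 \<le> t / (x + 2)" "t / (x + 2) \<le> 6 / x * N"
  proof -
    show "0 \<le> t / (x + 2)" using t x by simp
    have "t / (x + 2) \<le> N / x" by (rule frac_le) (use t x in simp_all)
    also have "\<dots> \<le> 6 / x * N" using t x by (simp add: divide_right_mono)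
    finally show "t / (x + 2) \<le> 6 / x * N" .
  qed
  have diff: "V_star n k l B A - G * V_tri n B A = \<kappa> * (L - G * m) - t / (x + 2)"
    unfolding V_star_layered[OF n k s, of l, folded x_def, folded L_def t_def \<kappa>_def] V_tri_moment[OF s, folded x_def, folded m_def \<kappa>_def]
    by (simp add: algebra_simps)
  have \<kappa>: "0 \<le> \<kappa>" unfolding \<kappa>_def using x by simp
  have "\<kappa> * (L - G * m) \<le> 6 / x * N + t / (x + 2) \<and> - (6 / x * N - t / (x + 2)) \<le> \<kappa> * (L - G * m)"
  proof (cases "n = 1")
    \<comment> \<open>Here \<open>\<kappa>\<close> is 3/8 and both \<open>L\<close> and
      \<open>G * m\<close> lie between 0 and \<open>4 * N\<close>, so their difference contributes
      at most half of the permitted \<open>3 * N\<close>; this leaves room for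
      \<open>t / 4\<close>.\<close>
    case True
    then have x2: "x = 2" unfolding x_def by simp
    have L: "0 \<le> L" "L \<le> 4 * N" unfolding L_def N_def using layered_trivial_bounds[OF k s, of l] True by simp_all
    have m: "0 \<le> m" "m \<le> 4 * N" unfolding m_def N_def using moment_bounds[OF s] True by simp_all
    have "0 \<le> G * m" "G * m \<le> 4 * N" using mult_nonneg_nonneg[OF G(1) m(1)] mult_right_mono[OF G(2) m(1)] m(2) by simp_all
    then show ?thesis unfolding \<kappa>_def x2 using L t by simp
  next
    case False
    then have n2: "2 \<le> n" using n by simp
    have sl: "\<kappa> * slack \<sigma> A B = 6 / x * N + \<sigma> * (t / (x + 2))" for \<sigma>
    proof -
      have "\<kappa> * slack \<sigma> A B = (6 * (x + 2) * N + \<sigma> * x * t) / (x * (x + 2))"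
        unfolding \<kappa>_def slack_def x_def[symmetric] N_def[symmetric] t_def[symmetric] using x by simp
      also have "\<dots> = 6 * (x + 2) * N / (x * (x + 2)) + \<sigma> * x * t / (x * (x + 2))" by (rule add_divide_distrib)
      also have "6 * (x + 2) * N / (x * (x + 2)) = 6 / x * N" using x by (simp add: divide_simps)
      also have "\<sigma> * x * t / (x * (x + 2)) = \<sigma> * (t / (x + 2))" using x by (simp add: divide_simps)
      finally show ?thesis .
    qed
    have "\<kappa> * (1 * (L - G * m)) \<le> \<kappa> * ((1 - G) * slack 1 A B)" "\<kappa> * (- 1 * (L - G * m)) \<le> \<kappa> * ((1 - G) * slack (- 1) A B)"
      unfolding L_def G_def m_def by (intro mult_left_mono layered_bound[OF k n2 s] \<kappa>, simp)+
    then have b: "\<kappa> * (L - G * m) \<le> (1 - G) * (6 / x * N + t / (x + 2))" "- (\<kappa> * (L - G * m)) \<le> (1 - G) * (6 / x * N - t / (x + 2))"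
      unfolding mult.left_commute[of \<kappa> "1 - G"] sl by (simp_all add: right_diff_distrib)
    \<comment> \<open>The factor \<open>1 - G\<close> may be replaced by 1 because both brackets are
      nonnegative; for the second one this is the bound on \<open>t / (x + 2)\<close> in
      \<open>tx\<close>.\<close>
    have "(1 - G) * (6 / x * N + t / (x + 2)) \<le> 1 * (6 / x * N + t / (x + 2))" "(1 - G) * (6 / x * N - t / (x + 2)) \<le> 1 * (6 / x * N - t / (x + 2))"
      by (rule mult_right_mono; use G tx in linarith)+
    then show ?thesis unfolding mult_1 using b by (intro conjI) (erule order_trans[rotated], assumption, linarith)
  qed
  then show ?thesis using tx unfolding G_def[symmetric] diff x_def[symmetric] N_def[symmetric] abs_le_iff by linarith
qed

end

theorem theorem5:
  fixes n k l :: nat and \<rho> Ob :: "complex mat"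
  assumes "n \<ge> 1" and "k \<le> n"
    and "density_op (2^n) \<rho>"
    and "hermitian (2^n) Ob" and "tr Ob = 0"
  shows "\<bar>V_star n k l Ob \<rho> - (3/4) ^ (k * l) * V_tri n Ob \<rho>\<bar>
           \<le> 6 / real (2^n) * hs_norm_sq Ob"
proof -
  note s = qubits.state_observable_density[OF assms(3-5)]
  show ?thesis using qubits.V_star_bound[OF assms(1,2) s] unfolding qubits.NN_hs_norm[OF s] by simp
qed

end
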